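(* Let $n\ge 4$ and consider type $D_n$. For every dominant integral weight $\lambda=\sum_{k=1}^n\lambda_k\Lambda_k$ ($\lambda_k\in\mathbb{Z}_{\ge0}$) there exists an isomorphism of crystals $$B_{f_B,\Theta^-_{\mathbf{i}_0}}[\lambda]\;\cong\;\Sigma_{\iota_0}[\lambda],$$ where $B_{f_B,\Theta^-_{\mathbf{i}_0}}[\lambda]$ is the crystal obtained by ultra-discretization of the decorated geometric crystal $TB^-_{w_0}$ with decoration $f_B$, and $\Sigma_{\iota_0}[\lambda]$ is the polyhedral realization, both defined in the context.
   Context: **Root data.** $I=\{1,\dots,n\}$, Cartan matrix $a_{i,j}=\langle h_i,\alpha_j\rangle$ of type $D_n$: $a_{i,i}=2$; $a_{i,j}=-1$ if $|i-j|=1$ and $\{i,j\}\neq\{n-1,n\}$, or if $\{i,j\}=\{n-2,n\}$; $a_{i,j}=0$ otherwise. $\Lambda_i$ are the fundamental weights. $N=n(n-1)$ is the length of the longest Weyl group element $w_0$. The word $\mathbf{i}_0=i_1i_2\cdots i_N=(1\,2\cdots n)^{n-1}$ is a reduced word of $w_0$, and $\iota_0=\mathbf{i}_0^{-1}=(i_N,\dots,i_2,i_1)=(n\cdots 2\,1)^{n-1}$. An element $x\in\mathbb{Z}^N$ is written $(x_1,\dots,x_N)$ or doubly indexed $(x_i^{(j)})$, $1\le j\le n-1$, $1\le i\le n$, via $x_{(j-1)n+i}=x_i^{(j)}$ (so $x_i^{(j)}$ belongs to the $j$-th occurrence of the letter $i$ in $\mathbf{i}_0$); the same convention is used for $c=(c_i^{(j)})\in(\mathbb{C}^\times)^N$.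 Put $x_i^{(j)}=0$ if $(j,i)\notin[1,n-1]\times[1,n]$. **Crystals.** A crystal is meant in Kashiwara's sense (maps $\mathrm{wt},\varepsilon_i,\varphi_i,\tilde e_i,\tilde f_i$, with $\mathrm{wt}_i=\langle h_i,\mathrm{wt}\rangle$ and $\varphi_i=\varepsilon_i+\mathrm{wt}_i$); an isomorphism is a bijection preserving $\mathrm{wt},\varepsilon_i,\varphi_i$ and commuting with all $\tilde e_i,\tilde f_i$. **Polyhedral realization $\Sigma_{\iota_0}[\lambda]$.** Define sets of linear forms on $\mathbb{Z}^N$. For $1\le k\le n-2$: $$\Xi_k=\{x_i^{(k)}-x_{i-1}^{(k+1)}\mid 1\le i\le n-2\}\cup\{x_{n-1}^{(k)}+x_n^{(k)}-x_{n-2}^{(k+1)},\ x_{n-2}^{(k+1)}-x_{n-1}^{(k+1)}-x_n^{(k+1)}\}\cup\{x_n^{(k)}-x_{n-1}^{(k+1)},\ x_{n-1}^{(k)}-x_n^{(k+1)}\}\cup\{x_{n+k-j-1}^{(j)}-x_{n+k-j}^{(j)}\mid k+2\le j\le n-1\},$$ $\Xi_{n-1}=\{x_{n-1}^{(n-1)}\}$, $\Xi_n=\{x_n^{(n-1)}\}$, and for $1\le k\le n-2$, $\Xi'_k=\{x_{k-j}^{(j)}-x_{k-j+1}^{(j)}\mid 1\le j\le k\}$. Let $M_n$ be the set of all nonempty sequences of integers $\mu=(\mu_1,\dots,\mu_l)$ with $0<\mu_l<\dots<\mu_1<n$. Let $X_i^{(j)}=x_n^{(j)}$ if $j$ even and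 $i=n-1$; $x_{n-1}^{(j)}$ if $j$ even and $i=n$; $x_i^{(j)}$ otherwise. Let ${X'}_i^{(j)}=x_n^{(j)}$ if $j$ odd and $i=n-1$; $x_{n-1}^{(j)}$ if $j$ odd and $i=n$; $x_i^{(j)}$ otherwise. For $\mu\in M_n$ put $$\varphi_\mu(x)=\sum_{k=1}^l\bigl(X_{n-\mu_k-1}^{(\mu_k+k-1)}-X_{n-\mu_k}^{(\mu_k+k-1)}\bigr)+\epsilon_\mu X_n^{(l)},\qquad \varphi'_\mu(x)=\sum_{k=1}^l\bigl({X'}_{n-\mu_k-1}^{(\mu_k+k-1)}-{X'}_{n-\mu_k}^{(\mu_k+k-1)}\bigr)+\epsilon_\mu {X'}_n^{(l)},$$ with $\epsilon_\mu=0$ if $\mu_l=1$ and $\epsilon_\mu=1$ if $\mu_l\ge2$. Put $\Xi'_{n-1}=\{\varphi_\mu\mid\mu\in M_n\}$, $\Xi'_n=\{\varphi'_\mu\mid\mu\in M_n\}$ and $\Xi_{\iota_0}=\bigcup_{k=1}^n\Xi_k$. Then $$\Sigma_{\iota_0}[\lambda]=\{x\in\mathbb{Z}^N\mid f(x)\ge0\ \forall f\in\Xi_{\iota_0},\ \ \lambda_k+g(x)\ge0\ \forall g\in\Xi'_k,\ k=1,\dots,n\}.$$ Known (Hoshino): this set is the image of the Kashiwara-type embedding $B(\lambda)\hookrightarrow\mathbb{Z}^N\otimes R_\lambda$, where $R_\lambda=\{r_\lambda\}$ is the one-element crystal with $\mathrm{wt}(r_\lambda)=\lambda$, $\varepsilon_i(r_\lambda)=-\langle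 h_i,\lambda\rangle$, $\varphi_i(r_\lambda)=0$. Its crystal structure is: with $\sigma_m(x)=x_m+\sum_{k>m}a_{i_m,i_k}x_k$, $\sigma^{(i)}(x)=\max\{\sigma_m(x)\mid i_m=i\}$, $M^{(i)}(x)=\{m\mid i_m=i,\ \sigma_m(x)=\sigma^{(i)}(x)\}$ and $\sigma_0^{(i)}(x)=-\lambda_i+\sum_k a_{i,i_k}x_k$: $\mathrm{wt}(x)=\lambda-\sum_kx_k\alpha_{i_k}$, $\varepsilon_i(x)=\sigma^{(i)}(x)$, $\varphi_i(x)=\varepsilon_i(x)+\langle h_i,\mathrm{wt}(x)\rangle$; $\tilde e_i$ decreases $x_m$ by $1$ for $m=\max M^{(i)}(x)$ if $\sigma^{(i)}(x)>0$ and $\sigma^{(i)}(x)\ge\sigma_0^{(i)}(x)$, and is $0$ otherwise; $\tilde f_i$ increases $x_m$ by $1$ for $m=\min M^{(i)}(x)$ if $\sigma^{(i)}(x)>\sigma_0^{(i)}(x)$, and is $0$ otherwise. **Geometric side.** Let $G$ be the simply connected simple algebraic group over $\mathbb{C}$ of type $D_n$, with maximal torus $T$, opposite Borel subgroups $B=B^+$, $B^-$ containing $T$, unipotent radicals $U=U^+$, $U^-$, Chevalley generators $e_i,f_i$, $x_i(a)=\exp(ae_i)$, $y_i(a)=\exp(af_i)$, simple coroots $\alpha_i^\vee:\mathbb{C}^\times\to T$. Put $\overline{s}_i=x_i(-1)y_i(1)x_i(-1)$ and let $\overline{w}_0$ be the product of the $\overline{s}_i$ along a reduced word of $w_0$.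 Let $B^-_{w_0}=B^-\cap U\overline{w}_0U$ and $\mathbb{B}_{w_0}=TB^-_{w_0}$. Define - $\gamma_i(tu)=\alpha_i(t)$ for $t\in T,u\in U^-$; $\varepsilon_i(tu)=1/\chi_i^-(u)$, where $\chi_i^-:U^-\to\mathbb{C}$ is the additive character with $\chi_i^-(y_j(a))=\delta_{ij}a$; $\varphi_i=\varepsilon_i\gamma_i$; - the rational $\mathbb{C}^\times$-action $e_i^d(g)=x_i((d-1)\varphi_i(g))\cdot g\cdot x_i((d^{-1}-1)\varepsilon_i(g))$; - $f_B(g)=\chi^{st}(\pi^+(\overline{w}_0^{-1}g))+\chi^{st}(\pi^+(\overline{w}_0^{-1}\eta(g)))$, where $\pi^+:B^-U\to U$, $\pi^+(bu)=u$; $\chi^{st}=\sum_i\chi_i$ with $\chi_i:U\to\mathbb{C}$ the additive character $\chi_i(x_j(a))=\delta_{ij}a$; and $\eta$ is the anti-automorphism of $G$ with $\eta(x_i(a))=x_i(a)$, $\eta(y_i(a))=y_i(a)$, $\eta(t)=t^{-1}$ for $t\in T$. The positive structure on $\mathbb{B}_{w_0}$ is $(t,c)\mapsto t\,\Theta^-_{\mathbf{i}_0}(c)$, $t\in T$, $c\in(\mathbb{C}^\times)^N$, where $\Theta^-_{\mathbf{i}_0}(c_1,\dots,c_N)=\pmb{y}_{i_1}(c_1)\cdots\pmb{y}_{i_N}(c_N)$ and $\pmb{y}_i(c)=y_i(c)\alpha_i^\vee(c^{-1})$. **Ultra-discretization.** $\mathcal{UD}$ replaces a subtraction-free rational function by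 the piecewise-linear function obtained by multiplication $\mapsto+$, division $\mapsto-$, addition $\mapsto\min$, positive constants $\mapsto0$, with $c_k\mapsto x_k$. In the coordinates $(t,c)$, $f_B$ is a subtraction-free function of $\alpha_1(t),\dots,\alpha_n(t)$ and $c$; $\mathcal{UD}(f_B)(\lambda,x)$ denotes its ultra-discretization with $\mathcal{UD}(\alpha_k(t))$ identified with $\lambda_k$. The action $e_i^d$ leaves $t$ fixed and acts on $c$ by subtraction-free formulas in $d,c$ independent of $t$; let $\tilde e_i^{\,m}:\mathbb{Z}^N\to\mathbb{Z}^N$ ($m\in\mathbb{Z}$) be its ultra-discretization with $d\mapsto m$. Set $$B_{f_B,\Theta^-_{\mathbf{i}_0}}[\lambda]=\{x\in\mathbb{Z}^N\mid\mathcal{UD}(f_B)(\lambda,x)\ge0\},$$ with $\tilde e_i(x)=\tilde e_i^{\,1}(x)$ and $\tilde f_i(x)=\tilde e_i^{\,-1}(x)$ if the result lies in this set, and $0$ otherwise; $\mathrm{wt}_i=\mathcal{UD}(\gamma_i)$, i.e. $\mathrm{wt}_i(x)=\lambda_i-\sum_ka_{i_k,i}x_k$; $\varepsilon_i=\mathcal{UD}(\varepsilon_i)$; $\varphi_i=\varepsilon_i+\mathrm{wt}_i$. The Langlands dual of $D_n$ is $D_n$ (the Cartan matrix is symmetric), and weights and coweights are identified accordingly. *)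

theory Defs
  imports Complex_Main "HOL-Algebra.Generated_Groups"
begin

section \<open>Root data\<close>

definition cartan :: "nat \<Rightarrow> nat \<Rightarrow> nat \<Rightarrow> int" where
  "cartan n i j =
     (if i \<notin> {1..n} \<or> j \<notin> {1..n} then 0
      else if i = j then 2
      else if (i + 1 = j \<or> j + 1 = i) \<and> {i, j} \<noteq> {n - 1, n} \<or> {i, j} = {n - 2, n} then -1
      else 0)"

text \<open>An element \<open>\<mu>\<close> of the weight lattice is given by its coordinates \<open>\<mu> j = \<langle>h\<^sub>j, \<mu>\<rangle>\<close> with
  respect to the fundamental weights, and \<open>\<mu> j = 0\<close> for \<open>j \<notin> {1..n}\<close>.  The simple root \<open>\<alpha>\<^sub>i\<close> is
  thus the \<open>i\<close>-th column of the Cartan matrix.\<close>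

type_synonym weight = "nat \<Rightarrow> int"

definition fund_weight :: "nat \<Rightarrow> weight" where
  "fund_weight i = (\<lambda>j. if j = i then 1 else 0)"

definition simple_root :: "nat \<Rightarrow> nat \<Rightarrow> weight" where
  "simple_root n i = (\<lambda>j. cartan n j i)"

definition dominant_weights :: "nat \<Rightarrow> weight set" where
  "dominant_weights n = {l. (\<forall>k\<in>{1..n}. l k \<ge> 0) \<and> (\<forall>k. k \<notin> {1..n} \<longrightarrow> l k = 0)}"

abbreviation len :: "nat \<Rightarrow> nat" where
  "len n \<equiv> n * (n - 1)"

text \<open>\<open>letter n k\<close> is the \<open>k\<close>-th letter, \<open>1 \<le> k \<le> len n\<close>, of the reduced word \<open>(1 2 \<dots> n)\<^sup>n\<^sup>-\<^sup>1\<close>.\<close>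

definition letter :: "nat \<Rightarrow> nat \<Rightarrow> nat" where
  "letter n k = (k - 1) mod n + 1"

text \<open>\<open>\<int>\<^sup>N\<close> with \<open>N = len n\<close>: coordinates are numbered from 1.\<close>

definition lattice :: "nat \<Rightarrow> (nat \<Rightarrow> int) set" where
  "lattice n = {x. \<forall>k. k \<notin> {1..len n} \<longrightarrow> x k = 0}"

section \<open>Crystals\<close>

text \<open>All crystals considered here have integer valued \<open>\<epsilon>\<^sub>i\<close>, \<open>\<phi>\<^sub>i\<close>; the element \<open>0\<close> outside the
  crystal is \<open>None\<close>.\<close>

record 'b crystal =
  elems :: "'b set"
  wt :: "'b \<Rightarrow> weight"
  eps :: "nat \<Rightarrow> 'b \<Rightarrow> int"
  phi :: "nat \<Rightarrow> 'b \<Rightarrow> int"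
  etil :: "nat \<Rightarrow> 'b \<Rightarrow> 'b option"
  ftil :: "nat \<Rightarrow> 'b \<Rightarrow> 'b option"

definition is_crystal :: "nat \<Rightarrow> 'b crystal \<Rightarrow> bool" where
  "is_crystal n C \<longleftrightarrow>
    (\<forall>i\<in>{1..n}. \<forall>b\<in>elems C.
       phi C i b = eps C i b + wt C b i \<and>
       (\<forall>b'. etil C i b = Some b' \<longrightarrow>
          b' \<in> elems C \<and> wt C b' = (\<lambda>j. wt C b j + simple_root n i j) \<and>
          eps C i b' = eps C i b - 1 \<and> phi C i b' = phi C i b + 1) \<and>
       (\<forall>b'. ftil C i b = Some b' \<longrightarrow>
          b' \<in> elems C \<and> wt C b' = (\<lambda>j. wt C b j - simple_root n i j) \<and>
          eps C i b' = eps C i b + 1 \<and> phi C i b' = phi C i b - 1) \<and>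
       (\<forall>b'\<in>elems C. etil C i b = Some b' \<longleftrightarrow> ftil C i b' = Some b))"

definition crystal_iso :: "nat \<Rightarrow> 'b crystal \<Rightarrow> 'c crystal \<Rightarrow> ('b \<Rightarrow> 'c) \<Rightarrow> bool" where
  "crystal_iso n C D \<psi> \<longleftrightarrow>
     is_crystal n C \<and> is_crystal n D \<and> bij_betw \<psi> (elems C) (elems D) \<and>
     (\<forall>b\<in>elems C. wt D (\<psi> b) = wt C b) \<and>
     (\<forall>i\<in>{1..n}. \<forall>b\<in>elems C.
        eps D i (\<psi> b) = eps C i b \<and> phi D i (\<psi> b) = phi C i b \<and>
        etil D i (\<psi> b) = map_option \<psi> (etil C i b) \<and>
        ftil D i (\<psi> b) = map_option \<psi> (ftil C i b))"

section \<open>The polyhedral realization\<close>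

text \<open>\<open>dbl n x j i\<close> is \<open>x\<^sub>i\<^sup>(\<^sup>j\<^sup>)\<close>: the superscript comes first.\<close>

definition dbl :: "nat \<Rightarrow> (nat \<Rightarrow> int) \<Rightarrow> nat \<Rightarrow> nat \<Rightarrow> int" where
  "dbl n x j i = (if j \<in> {1..n - 1} \<and> i \<in> {1..n} then x ((j - 1) * n + i) else 0)"

definition Xi :: "nat \<Rightarrow> nat \<Rightarrow> ((nat \<Rightarrow> int) \<Rightarrow> int) set" where
  "Xi n k =
    (if 1 \<le> k \<and> k \<le> n - 2 then
       {(\<lambda>x. dbl n x k i - dbl n x (k + 1) (i - 1)) | i. 1 \<le> i \<and> i \<le> n - 2} \<union>
       {(\<lambda>x. dbl n x k (n - 1) + dbl n x k n - dbl n x (k + 1) (n - 2)),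
        (\<lambda>x. dbl n x (k + 1) (n - 2) - dbl n x (k + 1) (n - 1) - dbl n x (k + 1) n)} \<union>
       {(\<lambda>x. dbl n x k n - dbl n x (k + 1) (n - 1)),
        (\<lambda>x. dbl n x k (n - 1) - dbl n x (k + 1) n)} \<union>
       {(\<lambda>x. dbl n x j (n + k - j - 1) - dbl n x j (n + k - j)) | j. k + 2 \<le> j \<and> j \<le> n - 1}
     else if k = n - 1 then {\<lambda>x. dbl n x (n - 1) (n - 1)}
     else if k = n then {\<lambda>x. dbl n x (n - 1) n}
     else {})"

text \<open>The sequences \<open>\<mu>\<^sub>1 > \<dots> > \<mu>\<^sub>l\<close>; \<open>\<mu>\<^sub>k\<close> is \<open>mu ! (k - 1)\<close>.\<close>

definition M_seqs :: "nat \<Rightarrow> nat list set" where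
  "M_seqs n = {mu. mu \<noteq> [] \<and> sorted_wrt (>) mu \<and> set mu \<subseteq> {0<..<n}}"

definition X1 :: "nat \<Rightarrow> (nat \<Rightarrow> int) \<Rightarrow> nat \<Rightarrow> nat \<Rightarrow> int" where
  "X1 n x j i = (if even j \<and> i = n - 1 then dbl n x j n
                 else if even j \<and> i = n then dbl n x j (n - 1)
                 else dbl n x j i)"

definition X2 :: "nat \<Rightarrow> (nat \<Rightarrow> int) \<Rightarrow> nat \<Rightarrow> nat \<Rightarrow> int" where
  "X2 n x j i = (if odd j \<and> i = n - 1 then dbl n x j n
                 else if odd j \<and> i = n then dbl n x j (n - 1)
                 else dbl n x j i)"

definition eps_mu :: "nat list \<Rightarrow> int" where
  "eps_mu mu = (if last mu = 1 then 0 else 1)"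

definition phi1 :: "nat \<Rightarrow> nat list \<Rightarrow> (nat \<Rightarrow> int) \<Rightarrow> int" where
  "phi1 n mu x =
     (\<Sum>k = 1..length mu. X1 n x (mu ! (k - 1) + k - 1) (n - mu ! (k - 1) - 1)
                        - X1 n x (mu ! (k - 1) + k - 1) (n - mu ! (k - 1)))
     + eps_mu mu * X1 n x (length mu) n"

definition phi2 :: "nat \<Rightarrow> nat list \<Rightarrow> (nat \<Rightarrow> int) \<Rightarrow> int" where
  "phi2 n mu x =
     (\<Sum>k = 1..length mu. X2 n x (mu ! (k - 1) + k - 1) (n - mu ! (k - 1) - 1)
                        - X2 n x (mu ! (k - 1) + k - 1) (n - mu ! (k - 1)))
     + eps_mu mu * X2 n x (length mu) n"

definition Xi' :: "nat \<Rightarrow> nat \<Rightarrow> ((nat \<Rightarrow> int) \<Rightarrow> int) set" where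
  "Xi' n k =
    (if 1 \<le> k \<and> k \<le> n - 2 then
       {(\<lambda>x. dbl n x j (k - j) - dbl n x j (k - j + 1)) | j. 1 \<le> j \<and> j \<le> k}
     else if k = n - 1 then {phi1 n mu | mu. mu \<in> M_seqs n}
     else if k = n then {phi2 n mu | mu. mu \<in> M_seqs n}
     else {})"

definition Sigma_set :: "nat \<Rightarrow> weight \<Rightarrow> (nat \<Rightarrow> int) set" where
  "Sigma_set n l =
     {x \<in> lattice n. (\<forall>k\<in>{1..n}. \<forall>f\<in>Xi n k. f x \<ge> 0) \<and>
                     (\<forall>k\<in>{1..n}. \<forall>g\<in>Xi' n k. l k + g x \<ge> 0)}"

definition sig :: "nat \<Rightarrow> nat \<Rightarrow> (nat \<Rightarrow> int) \<Rightarrow> int" where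
  "sig n m x = x m + (\<Sum>k\<in>{m<..len n}. cartan n (letter n m) (letter n k) * x k)"

definition sig_max :: "nat \<Rightarrow> nat \<Rightarrow> (nat \<Rightarrow> int) \<Rightarrow> int" where
  "sig_max n i x = Max {sig n m x | m. m \<in> {1..len n} \<and> letter n m = i}"

definition sig_argmax :: "nat \<Rightarrow> nat \<Rightarrow> (nat \<Rightarrow> int) \<Rightarrow> nat set" where
  "sig_argmax n i x = {m \<in> {1..len n}. letter n m = i \<and> sig n m x = sig_max n i x}"

definition sig0 :: "nat \<Rightarrow> weight \<Rightarrow> nat \<Rightarrow> (nat \<Rightarrow> int) \<Rightarrow> int" where
  "sig0 n l i x = - l i + (\<Sum>k\<in>{1..len n}. cartan n i (letter n k) * x k)"

definition Sigma_wt :: "nat \<Rightarrow> weight \<Rightarrow> (nat \<Rightarrow> int) \<Rightarrow> weight" where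
  "Sigma_wt n l x = (\<lambda>j. l j - (\<Sum>k\<in>{1..len n}. x k * simple_root n (letter n k) j))"

definition Sigma_crystal :: "nat \<Rightarrow> weight \<Rightarrow> (nat \<Rightarrow> int) crystal" where
  "Sigma_crystal n l =
    \<lparr>elems = Sigma_set n l,
     wt = Sigma_wt n l,
     eps = (\<lambda>i x. sig_max n i x),
     phi = (\<lambda>i x. sig_max n i x + Sigma_wt n l x i),
     etil = (\<lambda>i x. if sig_max n i x > 0 \<and> sig_max n i x \<ge> sig0 n l i x
                    then (let m = Max (sig_argmax n i x) in Some (x(m := x m - 1))) else None),
     ftil = (\<lambda>i x. if sig_max n i x > sig0 n l i x
                    then (let m = Min (sig_argmax n i x) in Some (x(m := x m + 1))) else None)\<rparr>"

section \<open>The group\<close>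

text \<open>The simply connected group of type \<open>D\<^sub>n\<close> over \<open>\<complex>\<close> is realized as the Chevalley group attached
  to the direct sum of the three minuscule representations, with highest weights \<open>\<Lambda>\<^sub>1\<close> (natural
  representation, dimension \<open>2n\<close>) and \<open>\<Lambda>\<^sub>n\<^sub>-\<^sub>1\<close>, \<open>\<Lambda>\<^sub>n\<close> (half-spin, dimension \<open>2\<^sup>n\<^sup>-\<^sup>1\<close> each).  The
  weights of this representation span the full weight lattice, so the group is \<open>Spin\<^sub>2\<^sub>n(\<complex>)\<close>.
  All weights are minuscule, of multiplicity one, and the basis vectors \<open>v\<^sub>\<mu>\<close> can be normalized such
  that \<open>e\<^sub>i v\<^sub>\<mu> = v\<^sub>\<mu>\<^sub>+\<^sub>\<alpha>\<^sub>i\<close> if \<open>\<langle>h\<^sub>i, \<mu>\<rangle> = -1\<close>, \<open>f\<^sub>i v\<^sub>\<mu> = v\<^sub>\<mu>\<^sub>-\<^sub>\<alpha>\<^sub>i\<close> if \<open>\<langle>h\<^sub>i, \<mu>\<rangle> = 1\<close>, and zero otherwise.\<close>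

inductive_set min_weights :: "nat \<Rightarrow> weight set" for n where
  highest: "i \<in> {1, n - 1, n} \<Longrightarrow> fund_weight i \<in> min_weights n"
| lower: "\<mu> \<in> min_weights n \<Longrightarrow> i \<in> {1..n} \<Longrightarrow> \<mu> i = 1 \<Longrightarrow>
            (\<lambda>j. \<mu> j - simple_root n i j) \<in> min_weights n"

text \<open>A vector \<open>\<Sum>\<^sub>\<mu> v(\<mu>) v\<^sub>\<mu>\<close> is given by its coefficient function \<open>v\<close>; coefficients at
  \<open>\<mu> \<notin> min_weights n\<close> are left alone by all group elements below.\<close>

type_synonym vec = "weight \<Rightarrow> complex"
type_synonym elt = "vec \<Rightarrow> vec"

definition chev_e :: "nat \<Rightarrow> nat \<Rightarrow> elt" where
  "chev_e n i v = (\<lambda>\<mu>. if \<mu> \<in> min_weights n \<and> \<mu> i = 1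
                        then v (\<lambda>j. \<mu> j - simple_root n i j) else 0)"

definition chev_f :: "nat \<Rightarrow> nat \<Rightarrow> elt" where
  "chev_f n i v = (\<lambda>\<mu>. if \<mu> \<in> min_weights n \<and> \<mu> i = -1
                        then v (\<lambda>j. \<mu> j + simple_root n i j) else 0)"

lemma chev_e_square: "i \<in> {1..n} \<Longrightarrow> chev_e n i (chev_e n i v) = (\<lambda>\<mu>. 0)"
  by (auto simp: chev_e_def simple_root_def cartan_def)

lemma chev_f_square: "i \<in> {1..n} \<Longrightarrow> chev_f n i (chev_f n i v) = (\<lambda>\<mu>. 0)"
  by (auto simp: chev_f_def simple_root_def cartan_def)

text \<open>\<open>exp (a e\<^sub>i) = 1 + a e\<^sub>i\<close> and \<open>exp (a f\<^sub>i) = 1 + a f\<^sub>i\<close> by the two lemmas above.\<close>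

definition xg :: "nat \<Rightarrow> nat \<Rightarrow> complex \<Rightarrow> elt" where
  "xg n i a = (\<lambda>v \<mu>. v \<mu> + a * chev_e n i v \<mu>)"

definition yg :: "nat \<Rightarrow> nat \<Rightarrow> complex \<Rightarrow> elt" where
  "yg n i a = (\<lambda>v \<mu>. v \<mu> + a * chev_f n i v \<mu>)"

definition coroot :: "nat \<Rightarrow> nat \<Rightarrow> complex \<Rightarrow> elt" where
  "coroot n i a = (\<lambda>v \<mu>. if \<mu> \<in> min_weights n then (a powi \<mu> i) * v \<mu> else v \<mu>)"

text \<open>The generators below are bijective, so the subgroups they generate may be formed in the group of
  all bijections.\<close>

definition Amb :: "elt monoid" where
  "Amb = \<lparr>carrier = {g. bij g}, mult = (\<circ>), one = id\<rparr>"

definition Gp :: "nat \<Rightarrow> elt set" where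
  "Gp n = generate Amb ({xg n i a | i a. i \<in> {1..n}} \<union> {yg n i a | i a. i \<in> {1..n}})"

definition Tor :: "nat \<Rightarrow> elt set" where
  "Tor n = generate Amb {coroot n i a | i a. i \<in> {1..n} \<and> a \<noteq> 0}"

definition Upos :: "nat \<Rightarrow> elt set" where
  "Upos n = generate Amb {xg n i a | i a. i \<in> {1..n}}"

definition Uneg :: "nat \<Rightarrow> elt set" where
  "Uneg n = generate Amb {yg n i a | i a. i \<in> {1..n}}"

definition Bneg :: "nat \<Rightarrow> elt set" where
  "Bneg n = {t \<circ> u | t u. t \<in> Tor n \<and> u \<in> Uneg n}"

definition word_prod :: "nat \<Rightarrow> (nat \<Rightarrow> elt) \<Rightarrow> elt" where
  "word_prod n g = foldr (\<circ>) (map g [1..<len n + 1]) id"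

definition sbar :: "nat \<Rightarrow> nat \<Rightarrow> elt" where
  "sbar n i = xg n i (-1) \<circ> yg n i 1 \<circ> xg n i (-1)"

definition w0bar :: "nat \<Rightarrow> elt" where
  "w0bar n = word_prod n (\<lambda>k. sbar n (letter n k))"

definition Bw0 :: "nat \<Rightarrow> elt set" where
  "Bw0 n = Bneg n \<inter> {u \<circ> w0bar n \<circ> u' | u u'. u \<in> Upos n \<and> u' \<in> Upos n}"

definition TBw0 :: "nat \<Rightarrow> elt set" where
  "TBw0 n = {t \<circ> b | t b. t \<in> Tor n \<and> b \<in> Bw0 n}"

section \<open>The decorated geometric crystal\<close>

definition root_char :: "nat \<Rightarrow> nat \<Rightarrow> elt \<Rightarrow> complex" where
  "root_char n i t =
     (THE z. \<forall>a. t \<circ> xg n i a \<circ> inv\<^bsub>Amb\<^esub> t = xg n i (z * a))"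

definition chi :: "nat \<Rightarrow> nat \<Rightarrow> elt \<Rightarrow> complex" where
  "chi n i = (THE \<chi>. \<chi> \<in> extensional (Upos n) \<and>
      (\<forall>u\<in>Upos n. \<forall>u'\<in>Upos n. \<chi> (u \<circ> u') = \<chi> u + \<chi> u') \<and>
      (\<forall>j\<in>{1..n}. \<forall>a. \<chi> (xg n j a) = (if i = j then a else 0)))"

definition chi_neg :: "nat \<Rightarrow> nat \<Rightarrow> elt \<Rightarrow> complex" where
  "chi_neg n i = (THE \<chi>. \<chi> \<in> extensional (Uneg n) \<and>
      (\<forall>u\<in>Uneg n. \<forall>u'\<in>Uneg n. \<chi> (u \<circ> u') = \<chi> u + \<chi> u') \<and>
      (\<forall>j\<in>{1..n}. \<forall>a. \<chi> (yg n j a) = (if i = j then a else 0)))"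

definition tor_part :: "nat \<Rightarrow> elt \<Rightarrow> elt" where
  "tor_part n g = (THE t. t \<in> Tor n \<and> (\<exists>u\<in>Uneg n. g = t \<circ> u))"

definition neg_part :: "nat \<Rightarrow> elt \<Rightarrow> elt" where
  "neg_part n g = (THE u. u \<in> Uneg n \<and> (\<exists>t\<in>Tor n. g = t \<circ> u))"

definition pi_pos :: "nat \<Rightarrow> elt \<Rightarrow> elt" where
  "pi_pos n g = (THE u. u \<in> Upos n \<and> (\<exists>b\<in>Bneg n. g = b \<circ> u))"

definition eta :: "nat \<Rightarrow> elt \<Rightarrow> elt" where
  "eta n = (THE f. f \<in> extensional (Gp n) \<and> bij_betw f (Gp n) (Gp n) \<and>
      (\<forall>g\<in>Gp n. \<forall>h\<in>Gp n. f (g \<circ> h) = f h \<circ> f g) \<and>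
      (\<forall>i\<in>{1..n}. \<forall>a. f (xg n i a) = xg n i a \<and> f (yg n i a) = yg n i a) \<and>
      (\<forall>t\<in>Tor n. f t = inv\<^bsub>Amb\<^esub> t))"

definition gc_gamma :: "nat \<Rightarrow> nat \<Rightarrow> elt \<Rightarrow> complex" where
  "gc_gamma n i g = root_char n i (tor_part n g)"

text \<open>A rational function: it is undefined where \<open>chi_neg n i (neg_part n g) = 0\<close>.\<close>

definition gc_eps :: "nat \<Rightarrow> nat \<Rightarrow> elt \<Rightarrow> complex" where
  "gc_eps n i g = 1 / chi_neg n i (neg_part n g)"

definition gc_phi :: "nat \<Rightarrow> nat \<Rightarrow> elt \<Rightarrow> complex" where
  "gc_phi n i g = gc_eps n i g * gc_gamma n i g"

definition gc_act :: "nat \<Rightarrow> nat \<Rightarrow> complex \<Rightarrow> elt \<Rightarrow> elt" where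
  "gc_act n i d g =
     xg n i ((d - 1) * gc_phi n i g) \<circ> g \<circ> xg n i ((inverse d - 1) * gc_eps n i g)"

definition chi_st :: "nat \<Rightarrow> elt \<Rightarrow> complex" where
  "chi_st n u = (\<Sum>i\<in>{1..n}. chi n i u)"

definition decoration :: "nat \<Rightarrow> elt \<Rightarrow> complex" where
  "decoration n g =
     chi_st n (pi_pos n (inv\<^bsub>Amb\<^esub> (w0bar n) \<circ> g)) +
     chi_st n (pi_pos n (inv\<^bsub>Amb\<^esub> (w0bar n) \<circ> eta n g))"

definition ybold :: "nat \<Rightarrow> nat \<Rightarrow> complex \<Rightarrow> elt" where
  "ybold n i c = yg n i c \<circ> coroot n i (inverse c)"

definition Theta :: "nat \<Rightarrow> (nat \<Rightarrow> complex) \<Rightarrow> elt" where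
  "Theta n c = word_prod n (\<lambda>k. ybold n (letter n k) (c k))"

section \<open>Ultra-discretization\<close>

datatype 'v sfexpr =
    Var 'v
  | Const real
  | Add "'v sfexpr" "'v sfexpr"
  | Mul "'v sfexpr" "'v sfexpr"
  | Quot "'v sfexpr" "'v sfexpr"

fun pos_consts :: "'v sfexpr \<Rightarrow> bool" where
  "pos_consts (Var v) = True"
| "pos_consts (Const r) = (r > 0)"
| "pos_consts (Add p q) = (pos_consts p \<and> pos_consts q)"
| "pos_consts (Mul p q) = (pos_consts p \<and> pos_consts q)"
| "pos_consts (Quot p q) = (pos_consts p \<and> pos_consts q)"

fun sf_eval :: "('v \<Rightarrow> complex) \<Rightarrow> 'v sfexpr \<Rightarrow> complex" where
  "sf_eval \<rho> (Var v) = \<rho> v"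
| "sf_eval \<rho> (Const r) = of_real r"
| "sf_eval \<rho> (Add p q) = sf_eval \<rho> p + sf_eval \<rho> q"
| "sf_eval \<rho> (Mul p q) = sf_eval \<rho> p * sf_eval \<rho> q"
| "sf_eval \<rho> (Quot p q) = sf_eval \<rho> p / sf_eval \<rho> q"

fun sf_defined :: "('v \<Rightarrow> complex) \<Rightarrow> 'v sfexpr \<Rightarrow> bool" where
  "sf_defined \<rho> (Var v) = True"
| "sf_defined \<rho> (Const r) = True"
| "sf_defined \<rho> (Add p q) = (sf_defined \<rho> p \<and> sf_defined \<rho> q)"
| "sf_defined \<rho> (Mul p q) = (sf_defined \<rho> p \<and> sf_defined \<rho> q)"
| "sf_defined \<rho> (Quot p q) = (sf_defined \<rho> p \<and> sf_defined \<rho> q \<and> sf_eval \<rho> q \<noteq> 0)"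

fun sf_trop :: "('v \<Rightarrow> int) \<Rightarrow> 'v sfexpr \<Rightarrow> int" where
  "sf_trop \<rho> (Var v) = \<rho> v"
| "sf_trop \<rho> (Const r) = 0"
| "sf_trop \<rho> (Add p q) = min (sf_trop \<rho> p) (sf_trop \<rho> q)"
| "sf_trop \<rho> (Mul p q) = sf_trop \<rho> p + sf_trop \<rho> q"
| "sf_trop \<rho> (Quot p q) = sf_trop \<rho> p - sf_trop \<rho> q"

text \<open>\<open>RootVar i\<close> stands for \<open>\<alpha>\<^sub>i(t)\<close>, \<open>CoordVar k\<close> for \<open>c\<^sub>k\<close> and \<open>ParVar\<close> for the parameter \<open>d\<close> of
  the \<open>\<complex>\<^sup>\<times>\<close>-action.\<close>

datatype coord = RootVar nat | CoordVar nat | ParVar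

fun assign :: "(nat \<Rightarrow> 'r) \<Rightarrow> (nat \<Rightarrow> 'r) \<Rightarrow> 'r \<Rightarrow> coord \<Rightarrow> 'r" where
  "assign r c d (RootVar i) = r i"
| "assign r c d (CoordVar k) = c k"
| "assign r c d ParVar = d"

text \<open>The positive structure \<open>(t, c) \<mapsto> t \<Theta>(c)\<close> takes values in \<open>TBw0 n\<close>; the last conjunct only makes
  explicit where the rational functions below live.\<close>

definition in_chart :: "nat \<Rightarrow> elt \<Rightarrow> (nat \<Rightarrow> complex) \<Rightarrow> bool" where
  "in_chart n t c \<longleftrightarrow> t \<in> Tor n \<and> (\<forall>k\<in>{1..len n}. c k \<noteq> 0) \<and> t \<circ> Theta n c \<in> TBw0 n"

text \<open>The subtraction-free expression \<open>E\<close> in \<open>\<alpha>\<^sub>1(t), \<dots>, \<alpha>\<^sub>n(t), c\<^sub>1, \<dots>, c\<^sub>N\<close> represents the rational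
  function \<open>F\<close> on \<open>TBw0 n\<close>.\<close>

definition represents :: "nat \<Rightarrow> (elt \<Rightarrow> complex) \<Rightarrow> coord sfexpr \<Rightarrow> bool" where
  "represents n F E \<longleftrightarrow>
     pos_consts E \<and> set_sfexpr E \<subseteq> RootVar ` {1..n} \<union> CoordVar ` {1..len n} \<and>
     (\<forall>t c. in_chart n t c \<longrightarrow>
        (let \<rho> = assign (\<lambda>i. root_char n i t) c 0
         in sf_defined \<rho> E \<longrightarrow> F (t \<circ> Theta n c) = sf_eval \<rho> E))"

text \<open>The result is independent of the choice of \<open>E\<close>, as two subtraction-free expressions of the same
  rational function have the same ultra-discretization.\<close>

definition UD :: "nat \<Rightarrow> (elt \<Rightarrow> complex) \<Rightarrow> weight \<Rightarrow> (nat \<Rightarrow> int) \<Rightarrow> int" where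
  "UD n F = (THE p. \<exists>E. represents n F E \<and> p = (\<lambda>l x. sf_trop (assign l x 0) E))"

text \<open>The tuple \<open>E\<close> of subtraction-free expressions in \<open>d, c\<^sub>1, \<dots>, c\<^sub>N\<close> represents the rational action
  \<open>e\<^sub>i\<^sup>d\<close> in the chart: \<open>e\<^sub>i\<^sup>d(t \<Theta>(c)) = t \<Theta>(E(d, c))\<close> wherever both sides are defined.\<close>

definition represents_act :: "nat \<Rightarrow> nat \<Rightarrow> (nat \<Rightarrow> coord sfexpr) \<Rightarrow> bool" where
  "represents_act n i E \<longleftrightarrow>
     (\<forall>k\<in>{1..len n}. pos_consts (E k) \<and>
        set_sfexpr (E k) \<subseteq> {ParVar} \<union> CoordVar ` {1..len n}) \<and>
     (\<forall>t c d. in_chart n t c \<and> d \<noteq> 0 \<and> chi_neg n i (neg_part n (t \<circ> Theta n c)) \<noteq> 0 \<longrightarrow>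
        (let \<rho> = assign (\<lambda>_. 0) c d
         in (\<forall>k\<in>{1..len n}. sf_defined \<rho> (E k) \<and> sf_eval \<rho> (E k) \<noteq> 0) \<longrightarrow>
            gc_act n i d (t \<circ> Theta n c) = t \<circ> Theta n (\<lambda>k. sf_eval \<rho> (E k))))"

definition UD_act :: "nat \<Rightarrow> nat \<Rightarrow> int \<Rightarrow> (nat \<Rightarrow> int) \<Rightarrow> (nat \<Rightarrow> int)" where
  "UD_act n i = (THE p. \<exists>E. represents_act n i E \<and>
     p = (\<lambda>m x k. if k \<in> {1..len n} then sf_trop (assign (\<lambda>_. 0) x m) (E k) else 0))"

definition B_set :: "nat \<Rightarrow> weight \<Rightarrow> (nat \<Rightarrow> int) set" where
  "B_set n l = {x \<in> lattice n. UD n (decoration n) l x \<ge> 0}"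

definition B_crystal :: "nat \<Rightarrow> weight \<Rightarrow> (nat \<Rightarrow> int) crystal" where
  "B_crystal n l =
    \<lparr>elems = B_set n l,
     wt = (\<lambda>x i. if i \<in> {1..n} then UD n (gc_gamma n i) l x else 0),
     eps = (\<lambda>i x. UD n (gc_eps n i) l x),
     phi = (\<lambda>i x. UD n (gc_eps n i) l x + UD n (gc_gamma n i) l x),
     etil = (\<lambda>i x. if UD_act n i 1 x \<in> B_set n l then Some (UD_act n i 1 x) else None),
     ftil = (\<lambda>i x. if UD_act n i (-1) x \<in> B_set n l then Some (UD_act n i (-1) x) else None)\<rparr>"

end

theory Submission
  imports Defs
begin

text \<open>
  The isomorphism is the identity of \<open>\<int>\<^sup>N\<close>.  Each factor is \<open>x\<^sub>i(1/c) s\<^sub>i x\<^sub>i(c)\<close>, so \<open>\<Theta>(c) = u w\<^sub>0 u'\<close> with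
  \<open>u, u' \<in> U\<close>, and \<open>f\<^sub>B(t \<Theta>(c)) = \<Sum> \<chi>\<^sub>i(u') + \<Sum> \<alpha>\<^sub>i(t) \<chi>\<^sub>i(u)\<close>.  The characters are matrix coefficients:
  the natural representation gives all \<open>\<chi>\<^sub>i(u')\<close> and the \<open>\<chi>\<^sub>i(u)\<close> with \<open>i \<le> n - 2\<close>, the half-spin
  representations give the other two, as sums over the lists in \<open>M_seqs n\<close>.  All of them are sums of
  Laurent monomials in \<open>c\<close> whose exponents are the forms in \<open>Xi\<close> and \<open>Xi'\<close>; hence the two sets agree.
  Moving \<open>x\<^sub>i((d - 1) \<phi>\<^sub>i)\<close> through \<open>\<Theta>(c)\<close> gives the action in coordinates; its tropical form changes the
  one coordinate where \<open>\<sigma>\<^sub>m\<close> is maximal last (\<open>d = 1\<close>) or first (\<open>d = -1\<close>).  The step stays in the set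
  iff \<open>\<epsilon>\<^sub>i > 0\<close> or \<open>\<phi>\<^sub>i > 0\<close>, respectively, by the tropical form of
  \<open>f\<^sub>B(e\<^sub>i\<^sup>d g) = f\<^sub>B(g) + (d - 1) \<phi>\<^sub>i(g) + (1/d - 1) \<epsilon>\<^sub>i(g)\<close>.  Uniqueness of ultra-discretizations and all
  tropical identities come from comparing growth along curves \<open>c\<^sub>k = s\<^sup>x\<^sup>k\<close> as \<open>s \<rightarrow> 0\<close>.\<close>

section \<open>Weights of the minuscule representations\<close>

text \<open>Characters, torus and unipotent parts, \<eta> and both ultra-discretizations are
  definite descriptions, so each must first be shown to denote. This is where triangularity with
  respect to a level function, an explicit model of \<eta> and the injectivity of
  \<open>Theta n\<close> enter. Roots are handled through their subgroups: a root is positive when a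
  conjugate of a simple root subgroup lies in U. All of this is organized around the Coxeter
  element, whose (n-1)-st power is the lift of w0 and which permutes the vectors
  \<plusminus>\<epsilon>_p in a simple way. A separate obstacle is that \<eta> reverses words, so
  the lift of w0 must be shown to equal the one of the reversed word. The matrix coefficients are
  not obtained by expanding products: rows of partial products are compared with rows of u w0 u' on
  the test vectors \<delta>_\<nu> pulled back by u', where both sides become triangular. That a step
  leaves the set when \<epsilon>_i or \<phi>_i is 0 follows from \<epsilon>_i, \<phi>_i \<ge> 0 on
  the set, which is read off at the last and at the first occurrence of the letter i.\<close>

lemma cartan_sym: "cartan n i j = cartan n j i"
  by (auto simp: cartan_def insert_commute)

lemma cartan_diag: "i \<in> {1..n} \<Longrightarrow> cartan n i i = 2"
  by (auto simp: cartan_def)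

lemma cartan_off: "i \<noteq> j \<Longrightarrow> cartan n i j = 0 \<or> cartan n i j = -1"
  by (auto simp: cartan_def)

definition reflect :: "nat \<Rightarrow> nat \<Rightarrow> weight \<Rightarrow> weight" where
  "reflect n i \<mu> = (\<lambda>j. \<mu> j - cartan n j i * \<mu> i)"

text \<open>\<open>ep n p\<close> and \<open>en n p\<close> are \<open>\<epsilon>\<^sub>p\<close> and \<open>-\<epsilon>\<^sub>p\<close>; \<open>sw n S\<close> is \<open>(\<plusminus>\<epsilon>\<^sub>1 \<plusminus> \<dots> \<plusminus> \<epsilon>\<^sub>n) / 2\<close> with minus signs at \<open>S\<close>.\<close>

definition ep :: "nat \<Rightarrow> nat \<Rightarrow> weight" where
  "ep n p = (\<lambda>j. if 1 \<le> j \<and> j < n then of_bool (j = p) - of_bool (j + 1 = p)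
                 else if j = n then of_bool (p + 1 = n) + of_bool (p = n) else 0)"

definition en :: "nat \<Rightarrow> nat \<Rightarrow> weight" where
  "en n p = (\<lambda>j. - ep n p j)"

definition sw :: "nat \<Rightarrow> nat set \<Rightarrow> weight" where
  "sw n S = (\<lambda>j. if 1 \<le> j \<and> j < n then of_bool (j + 1 \<in> S) - of_bool (j \<in> S)
                 else if j = n then 1 - of_bool (n - 1 \<in> S) - of_bool (n \<in> S) else 0)"

text \<open>The action of \<open>s_i\<close> on sets of minus signs: for i < n two neighbouring
  positions are exchanged; for i = n positions n - 1 and n are exchanged and both signs
  change.\<close>

definition sact :: "nat \<Rightarrow> nat \<Rightarrow> nat set \<Rightarrow> nat set" where
  "sact n i S =
     (if i < n then {k. if k = i then i + 1 \<in> S else if k = i + 1 then i \<in> S else k \<in> S}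
      else {k. if k = n - 1 then n \<notin> S else if k = n then n - 1 \<notin> S else k \<in> S})"

locale type_D =
  fixes n :: nat
  assumes n4: "4 \<le> n"
begin

abbreviation "mw \<equiv> min_weights n"

lemma cartan_simps:
  "1 \<le> i \<Longrightarrow> i < n \<Longrightarrow> cartan n j i =
     (if j = i then 2 else if 1 \<le> j \<and> j < n \<and> (j + 1 = i \<or> j = i + 1) then -1
      else if j = n \<and> i = n - 2 then -1 else 0)"
  "cartan n j n = (if j = n then 2 else if j = n - 2 then -1 else 0)"
  using n4 by (auto simp: cartan_def doubleton_eq_iff)

lemma refl_ep:
  assumes "i \<in> {1..n}" "p \<in> {1..n}"
  shows "reflect n i (ep n p) =
    (if i < n then (if p = i then ep n (i + 1) else if p = i + 1 then ep n i else ep n p)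
     else (if p = n then en n (n - 1) else if p = n - 1 then en n n else ep n p))"
proof (cases "i < n")
  case True
  show ?thesis
  proof
    fix j
    consider "j = i" | "j + 1 = i" | "j = i + 1" "j < n" | "j = n" "i = n - 1" | "j = n" "i = n - 2" | "j = n" "i \<noteq> n - 1" "i \<noteq> n - 2"
      | "j \<noteq> i" "j + 1 \<noteq> i" "j \<noteq> i + 1" "j \<noteq> n" using True by linarith
    then show "reflect n i (ep n p) j = (if i < n then (if p = i then ep n (i + 1) else if p = i + 1 then ep n i else ep n p)
     else (if p = n then en n (n - 1) else if p = n - 1 then en n n else ep n p)) j"
      by cases (use True assms n4 in \<open>auto simp: reflect_def cartan_simps ep_def of_bool_def\<close>)
  qed
next
  case False
  then have i: "i = n" using assms by auto
  show ?thesis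
  proof
    fix j
    consider "j = n" | "j + 1 = n" | "j + 2 = n" | "j + 2 < n" | "j > n" by linarith
    then show "reflect n i (ep n p) j = (if i < n then (if p = i then ep n (i + 1) else if p = i + 1 then ep n i else ep n p)
     else (if p = n then en n (n - 1) else if p = n - 1 then en n n else ep n p)) j"
      unfolding i
      by cases (use assms n4 in \<open>auto simp: reflect_def cartan_simps ep_def en_def of_bool_def\<close>)
  qed
qed

lemma refl_uminus: "reflect n i (\<lambda>j. - \<mu> j) = (\<lambda>j. - reflect n i \<mu> j)"
  by (auto simp: reflect_def)

lemma refl_en:
  assumes "i \<in> {1..n}" "p \<in> {1..n}"
  shows "reflect n i (en n p) =
    (if i < n then (if p = i then en n (i + 1) else if p = i + 1 then en n i else en n p)
     else (if p = n then ep n (n - 1) else if p = n - 1 then ep n n else en n p))"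
  unfolding en_def refl_uminus refl_ep[OF assms] by auto

lemma refl_sw:
  assumes "i \<in> {1..n}"
  shows "reflect n i (sw n S) = sw n (sact n i S)"
proof (cases "i < n")
  case True
  show ?thesis
  proof
    fix j
    consider "j = i" | "j + 1 = i" | "j = i + 1" "j < n" | "j = n" "i = n - 1" | "j = n" "i = n - 2" | "j = n" "i \<noteq> n - 1" "i \<noteq> n - 2"
      | "j \<noteq> i" "j + 1 \<noteq> i" "j \<noteq> i + 1" "j \<noteq> n" using True by linarith
    then show "reflect n i (sw n S) j = sw n (sact n i S) j"
      by cases (use True assms n4 in \<open>auto simp: reflect_def cartan_simps sw_def sact_def of_bool_def\<close>)
  qed
next
  case False
  then have i: "i = n" using assms by auto
  show ?thesis
  proof
    fix j
    consider "j = n" | "j + 1 = n" | "j + 2 = n" | "j + 2 < n" | "j > n" by linarith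
    then show "reflect n i (sw n S) j = sw n (sact n i S) j"
      unfolding i
      by cases (use assms n4 in \<open>auto simp: reflect_def cartan_simps sw_def sact_def of_bool_def\<close>)
  qed
qed

lemma fund_ep: "fund_weight 1 = ep n 1"
  using n4 by (auto simp: fund_weight_def ep_def fun_eq_iff)

lemma fund_sw: "fund_weight n = sw n {}" "fund_weight (n - 1) = sw n {n}"
  using n4 by (auto simp: fund_weight_def sw_def fun_eq_iff)

lemma lower_refl: "\<mu> i = 1 \<Longrightarrow> (\<lambda>j. \<mu> j - simple_root n i j) = reflect n i \<mu>"
  by (auto simp: simple_root_def reflect_def)

lemma raise_refl: "\<mu> i = -1 \<Longrightarrow> (\<lambda>j. \<mu> j + simple_root n i j) = reflect n i \<mu>"
  by (auto simp: simple_root_def reflect_def)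

lemma refl_forms:
  assumes "i \<in> {1..n}" "\<mu> \<in> ep n ` {1..n} \<union> en n ` {1..n} \<union> range (sw n)"
  shows "reflect n i \<mu> \<in> ep n ` {1..n} \<union> en n ` {1..n} \<union> range (sw n)"
proof -
  define W where "W = ep n ` {1..n} \<union> en n ` {1..n} \<union> range (sw n)"
  have W: "p \<in> {1..n} \<Longrightarrow> ep n p \<in> W" "p \<in> {1..n} \<Longrightarrow> en n p \<in> W" "sw n S \<in> W" for p S
    unfolding W_def by blast+
  consider p where "p \<in> {1..n}" "\<mu> = ep n p" | p where "p \<in> {1..n}" "\<mu> = en n p" | S where "\<mu> = sw n S"
    using assms(2) by blast
  then have "reflect n i \<mu> \<in> W"
  proof cases
    case (1 p)
    show ?thesis unfolding 1(2) refl_ep[OF assms(1) 1(1)]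
      using assms(1) 1(1) n4 W by (cases "i < n") simp_all
  next
    case (2 p)
    show ?thesis unfolding 2(2) refl_en[OF assms(1) 2(1)]
      using assms(1) 2(1) n4 W by (cases "i < n") simp_all
  next
    case 3
    then show ?thesis by (simp only: refl_sw[OF assms(1)] W)
  qed
  then show ?thesis by (simp only: W_def)
qed

lemma mw_forms: "\<mu> \<in> mw \<Longrightarrow> \<mu> \<in> ep n ` {1..n} \<union> en n ` {1..n} \<union> range (sw n)"
proof (induction rule: min_weights.induct)
  case (highest i)
  then consider "i = 1" | "i = n - 1" | "i = n" by auto
  then show ?case
    by cases (use fund_ep fund_sw n4 in auto)
next
  case (lower \<mu> i)
  have eq: "(\<lambda>j. \<mu> j - simple_root n i j) = reflect n i \<mu>" using lower_refl[of \<mu> i, OF lower(3)] .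
  show ?case unfolding eq by (rule refl_forms[OF lower(2) lower(4)])
qed

lemma mw_lower: "\<mu> \<in> mw \<Longrightarrow> i \<in> {1..n} \<Longrightarrow> \<mu> i = 1 \<Longrightarrow> reflect n i \<mu> \<in> mw"
  using min_weights.lower[of \<mu> n i] lower_refl[of \<mu> i] by simp

lemma ep_at: "1 \<le> p \<Longrightarrow> p \<le> n \<Longrightarrow> ep n p p = 1"
  using n4 by (auto simp: ep_def)

lemma ep_mw: "p \<in> {1..n} \<Longrightarrow> ep n p \<in> mw"
proof (induction p)
  case 0 then show ?case by auto
next
  case (Suc p)
  show ?case
  proof (cases "p = 0")
    case True
    then show ?thesis using min_weights.highest[of 1 n] fund_ep by simp
  next
    case False
    then have "ep n p \<in> mw" using Suc by auto
    moreover have "reflect n p (ep n p) = ep n (Suc p)" using refl_ep[of p p] Suc False by auto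
    moreover have "ep n p p = 1" using ep_at Suc False by auto
    ultimately show ?thesis using mw_lower[of "ep n p" p] Suc False by auto
  qed
qed

lemma en_mw: "p \<in> {1..n} \<Longrightarrow> en n p \<in> mw"
proof (induction "n - p" arbitrary: p)
  case 0
  then have p: "p = n" by auto
  have "reflect n n (ep n (n - 1)) = en n n" using refl_ep[of n "n - 1"] n4 by auto
  moreover have "ep n (n - 1) n = 1" using n4 by (auto simp: ep_def)
  ultimately show ?case using mw_lower[of "ep n (n - 1)" n] ep_mw[of "n - 1"] n4 p by auto
next
  case (Suc k)
  then have "en n (p + 1) \<in> mw" by auto
  moreover have "reflect n p (en n (p + 1)) = en n p" using refl_en[of p "p + 1"] Suc by auto
  moreover have "en n (p + 1) p = 1" using Suc by (auto simp: en_def ep_def)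
  ultimately show ?case using mw_lower[of "en n (p + 1)" p] Suc by auto
qed

text \<open>\<open>sw\<close> accepts arbitrary sets, and positions outside {1..n} are invisible.
  The path model relies on this when it places an auxiliary sign at position 0.\<close>

lemma sw_Int: "sw n (S \<inter> {1..n}) = sw n S"
  using n4 by (auto simp: sw_def of_bool_def fun_eq_iff)

text \<open>Every sign pattern is reached from {} or {n} by lowering. The measure adds up the
  distances of the minus signs from n + 1. If no sign can be moved one place to the right, the signs
  form a final segment of {1..n}; it is {} or {n}, or it contains n - 1 and n, and this pair is
  removed by \<open>s_n\<close>.\<close>

lemma sw_mw: "sw n S \<in> mw"
proof -
  have "S \<subseteq> {1..n} \<Longrightarrow> sw n S \<in> mw" for S
  proof (induction "\<Sum>k\<in>S. n + 1 - k" arbitrary: S rule: less_induct)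
    case (less S)
    have fin: "finite S" using less finite_subset by blast
    consider "S = {}" | "S = {n}" | p where "p \<in> S" "p < n" "p + 1 \<notin> S"
      | "n \<in> S" "n - 1 \<in> S"
    proof -
      have "(\<exists>p\<in>S. p < n \<and> p + 1 \<notin> S) \<or> S = {} \<or> S = {n} \<or> (n \<in> S \<and> n - 1 \<in> S)"
      proof (rule ccontr)
        assume H: "\<not> ?thesis"
        then have up: "p \<in> S \<Longrightarrow> p < n \<Longrightarrow> p + 1 \<in> S" for p by blast
        have "p \<in> S \<Longrightarrow> p \<le> q \<Longrightarrow> q \<le> n \<Longrightarrow> q \<in> S" for p q
        proof (induction q)
          case 0 then show ?case by auto
        next
          case (Suc q) then show ?case using up[of q] by (cases "p = Suc q") auto
        qed
        moreover obtain p where "p \<in> S" using H by auto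
        ultimately have nS: "n \<in> S" using less(2) by auto
        then obtain p' where "p' \<in> S" "p' \<noteq> n" using H by blast
        then have "p' \<le> n - 1" using less(2) by force
        then have "n - 1 \<in> S" using \<open>\<And>q p. p \<in> S \<Longrightarrow> p \<le> q \<Longrightarrow> q \<le> n \<Longrightarrow> q \<in> S\<close> \<open>p' \<in> S\<close> by auto
        then show False using H nS by auto
      qed
      then show ?thesis using that by blast
    qed
    then show ?case
    proof cases
      case 1
      then show ?thesis using min_weights.highest[of n n] fund_sw by simp
    next
      case 2
      then show ?thesis using min_weights.highest[of "n - 1" n] fund_sw by simp
    next
      case (3 p)
      let ?S = "insert (p + 1) (S - {p})"
      have p1: "1 \<le> p" using 3 less(2) by auto
      have "(\<Sum>k\<in>?S. n + 1 - k) < (\<Sum>k\<in>S. n + 1 - k)"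
        using 3 p1 fin by (simp add: sum.remove[of S p])
      moreover have "?S \<subseteq> {1..n}" using less(2) 3 by auto
      ultimately have "sw n ?S \<in> mw" using less(1) by blast
      moreover have "sact n p ?S = S" using 3 by (auto simp: sact_def)
      moreover have "sw n ?S p = 1" using 3 p1 by (auto simp: sw_def)
      ultimately show ?thesis using mw_lower[of "sw n ?S" p] refl_sw[of p ?S] p1 3 by auto
    next
      case 4
      let ?S = "S - {n - 1, n}"
      have "(\<Sum>k\<in>?S. n + 1 - k) < (\<Sum>k\<in>S. n + 1 - k)"
        using 4 fin n4 by (intro sum_strict_mono2[of _ _ n]) auto
      moreover have "?S \<subseteq> {1..n}" using less(2) by auto
      ultimately have "sw n ?S \<in> mw" using less(1) by blast
      moreover have "sact n n ?S = S" using 4 n4 by (auto simp: sact_def)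
      moreover have "sw n ?S n = 1" using 4 n4 by (auto simp: sw_def)
      ultimately show ?thesis using mw_lower[of "sw n ?S" n] refl_sw[of n ?S] n4 by auto
    qed
  qed
  from this[of "S \<inter> {1..n}"] show ?thesis using sw_Int by simp
qed

lemma mw_eq: "mw = ep n ` {1..n} \<union> en n ` {1..n} \<union> range (sw n)"
  using mw_forms ep_mw en_mw sw_mw by blast

lemma refl_mw: "\<mu> \<in> mw \<Longrightarrow> i \<in> {1..n} \<Longrightarrow> reflect n i \<mu> \<in> mw"
  unfolding mw_eq by (rule refl_forms)

lemma ep_values: "ep n p i = -1 \<or> ep n p i = 0 \<or> ep n p i = 1"
  by (auto simp: ep_def of_bool_def)

lemma sw_values: "sw n p i = -1 \<or> sw n p i = 0 \<or> sw n p i = 1"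
  by (auto simp: sw_def of_bool_def)

lemma mw_values: "\<mu> \<in> mw \<Longrightarrow> \<mu> i = -1 \<or> \<mu> i = 0 \<or> \<mu> i = 1"
  unfolding mw_eq using ep_values[of _ i] sw_values[of _ i] unfolding en_def by fastforce

end

section \<open>Root subgroups and simple reflections\<close>

abbreviation finv :: "('a \<Rightarrow> 'b) \<Rightarrow> 'b \<Rightarrow> 'a" where "finv \<equiv> inv_into UNIV"

lemma group_Amb: "group Amb"
proof (rule groupI)
  fix x assume "x \<in> carrier Amb"
  then show "\<exists>y\<in>carrier Amb. y \<otimes>\<^bsub>Amb\<^esub> x = \<one>\<^bsub>Amb\<^esub>"
    by (intro bexI[of _ "finv x"]) (auto simp: Amb_def bij_imp_bij_inv bij_is_inj)
qed (auto simp: Amb_def bij_comp comp_assoc)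

lemma inv_Amb: "bij g \<Longrightarrow> inv\<^bsub>Amb\<^esub> g = finv g"
proof -
  assume b: "bij g"
  interpret group Amb by (rule group_Amb)
  show ?thesis
    by (rule inv_equality) (use b in \<open>simp_all add: Amb_def bij_imp_bij_inv bij_is_inj\<close>)
qed

context
  fixes S :: "elt set"
  assumes S: "\<forall>g\<in>S. bij g"
begin

lemma S_carrier: "S \<subseteq> carrier Amb"
  using S by (auto simp: Amb_def)

lemma gen_bij: "g \<in> generate Amb S \<Longrightarrow> bij g"
  using group.generate_in_carrier[OF group_Amb S_carrier] by (auto simp: Amb_def)

lemma gen_id: "id \<in> generate Amb S"
  using generate.one[of Amb S] by (simp add: Amb_def)

lemma gen_comp: "g \<in> generate Amb S \<Longrightarrow> h \<in> generate Amb S \<Longrightarrow> g \<circ> h \<in> generate Amb S"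
  using generate.eng[of g Amb S h] by (simp add: Amb_def)

lemma gen_inv: "g \<in> generate Amb S \<Longrightarrow> finv g \<in> generate Amb S"
  using group.generate_m_inv_closed[OF group_Amb S_carrier, of g] inv_Amb[OF gen_bij, of g] by simp

text \<open>For generating sets closed under inversion the generated group is generated as a monoid,
  so the induction has no case for inverses of elements already built.\<close>

lemma gen_induct [consumes 1, case_names inv id incl comp]:
  assumes "g \<in> generate Amb S"
    and inv: "\<And>s. s \<in> S \<Longrightarrow> finv s \<in> S"
    and "P id" "\<And>s. s \<in> S \<Longrightarrow> P s"
    and "\<And>g h. g \<in> generate Amb S \<Longrightarrow> h \<in> generate Amb S \<Longrightarrow> P g \<Longrightarrow> P h \<Longrightarrow> P (g \<circ> h)"
  shows "P g"
  using assms(1)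
proof induction
  case one
  have "\<one>\<^bsub>Amb\<^esub> = id" by (simp add: Amb_def)
  then show ?case using assms(3) by metis
next
  case (incl h) then show ?case using assms by auto
next
  case (inv h) then show ?case using assms S inv_Amb by auto
next
  case (eng h1 h2)
  have "h1 \<otimes>\<^bsub>Amb\<^esub> h2 = h1 \<circ> h2" by (simp add: Amb_def)
  then show ?case using assms(5)[of h1 h2] eng by metis
qed

end

lemma comp_inv_cancel:
  "bij g \<Longrightarrow> finv g \<circ> g = id" "bij g \<Longrightarrow> g \<circ> finv g = id"
  "bij g \<Longrightarrow> finv g \<circ> (g \<circ> h) = h" "bij g \<Longrightarrow> g \<circ> (finv g \<circ> h) = h"
  by (auto simp: bij_def fun_eq_iff surj_f_inv_f)

lemma inv_comp: "bij g \<Longrightarrow> bij h \<Longrightarrow> finv (g \<circ> h) = finv h \<circ> finv g"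
  by (rule o_inv_distrib)

lemma inv_eqI: "g \<circ> h = id \<Longrightarrow> h \<circ> g = id \<Longrightarrow> finv g = h"
  by (metis inv_unique_comp)

definition cj :: "elt \<Rightarrow> elt \<Rightarrow> elt" where
  "cj g h = g \<circ> h \<circ> finv g"

lemma cj_comp: "bij g \<Longrightarrow> cj g (h \<circ> k) = cj g h \<circ> cj g k"
  by (simp add: cj_def comp_assoc comp_inv_cancel)

lemma cj_id: "bij g \<Longrightarrow> cj g id = id"
  by (simp add: cj_def comp_inv_cancel)

lemma cj_cj: "bij g \<Longrightarrow> bij g' \<Longrightarrow> cj (g \<circ> g') h = cj g (cj g' h)"
  by (simp add: cj_def comp_assoc inv_comp)

lemma cj_by_id: "cj id h = h"
  by (simp add: cj_def)

lemma cj_eqI: "bij g \<Longrightarrow> g \<circ> h = k \<circ> g \<Longrightarrow> cj g h = k"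
  by (simp add: cj_def comp_assoc comp_inv_cancel)

lemma cj_eqD: "bij g \<Longrightarrow> cj g h = k \<Longrightarrow> g \<circ> h = k \<circ> g"
  by (auto simp: cj_def comp_assoc comp_inv_cancel)

lemma cj_swap: "bij g \<Longrightarrow> cj g h = k \<Longrightarrow> cj (finv g) k = h"
  by (auto simp: cj_def comp_assoc comp_inv_cancel bij_imp_bij_inv inv_inv_eq)

section \<open>Root subgroups and lifted reflections as operators on coefficient functions\<close>

context type_D
begin

abbreviation "I \<equiv> {1..n}"

text \<open>Both exp(a e_i), for s = 1, and exp(a f_i), for s = -1: in the normalized minuscule
  basis each adds a multiple of the coefficient at the reflected weight. With one symbol every fact
  about U and the opposite unipotent group is proved once.\<close>

definition xs :: "int \<Rightarrow> nat \<Rightarrow> complex \<Rightarrow> elt" where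
  "xs s i a v = (\<lambda>\<mu>. if \<mu> \<in> mw \<and> \<mu> i = s then v \<mu> + a * v (reflect n i \<mu>) else v \<mu>)"

definition sb :: "nat \<Rightarrow> elt" where
  "sb i v = (\<lambda>\<mu>. if \<mu> \<in> mw \<and> \<mu> i = 1 then - v (reflect n i \<mu>)
                else if \<mu> \<in> mw \<and> \<mu> i = -1 then v (reflect n i \<mu>) else v \<mu>)"

lemma xg_xs: "xg n i a = xs 1 i a"
  by (auto simp: xg_def chev_e_def xs_def lower_refl fun_eq_iff)

lemma yg_xs: "yg n i a = xs (-1) i a"
  by (auto simp: yg_def chev_f_def xs_def raise_refl fun_eq_iff)

lemma reflect_at: "reflect n i \<mu> j = \<mu> j - cartan n j i * \<mu> i"
  by (simp add: reflect_def)

lemma reflect_zero: "\<mu> i = 0 \<Longrightarrow> reflect n i \<mu> = \<mu>"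
  by (auto simp: reflect_def)

lemma reflect_reflect: "i \<in> I \<Longrightarrow> reflect n i (reflect n i \<mu>) = \<mu>"
  by (auto simp: reflect_def cartan_diag fun_eq_iff algebra_simps)

lemma reflect_commute: "cartan n i j = 0 \<Longrightarrow> reflect n i (reflect n j \<mu>) = reflect n j (reflect n i \<mu>)"
  using cartan_sym[of n i j] by (auto simp: reflect_def fun_eq_iff algebra_simps)

lemmas op_simps = xs_def sb_def refl_mw reflect_at cartan_diag reflect_reflect

lemma xs_add: "i \<in> I \<Longrightarrow> s = 1 \<or> s = -1 \<Longrightarrow> xs s i a \<circ> xs s i b = xs s i (a + b)"
  by (auto simp: fun_eq_iff op_simps algebra_simps)

lemma xs_zero: "xs s i 0 = id"
  by (auto simp: fun_eq_iff xs_def)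

lemma inv_xs: "i \<in> I \<Longrightarrow> s = 1 \<or> s = -1 \<Longrightarrow> finv (xs s i a) = xs s i (- a)"
  by (rule inv_eqI) (auto simp: xs_add xs_zero)

lemma bij_xs: "i \<in> I \<Longrightarrow> s = 1 \<or> s = -1 \<Longrightarrow> bij (xs s i a)"
  by (rule o_bij[of "xs s i (- a)"]) (auto simp: xs_add xs_zero)

lemma sbar_sb: "i \<in> I \<Longrightarrow> sbar n i = sb i"
  unfolding sbar_def xg_xs yg_xs by (auto simp: fun_eq_iff op_simps)

text \<open>The same lift with the roles of e and f exchanged. It is used to carry a conjugation
  known on the two root subgroups of a simple root over to \<open>sb\<close>.\<close>

lemma sb_y: "i \<in> I \<Longrightarrow> sb i = xs (-1) i 1 \<circ> xs 1 i (-1) \<circ> xs (-1) i 1"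
  by (auto simp: fun_eq_iff op_simps)

lemma bij_sb: "i \<in> I \<Longrightarrow> bij (sb i)"
  by (simp only: sb_y bij_comp bij_xs simp_thms)

lemma sb_xs_same: "i \<in> I \<Longrightarrow> s = 1 \<or> s = -1 \<Longrightarrow> sb i \<circ> xs s i a = xs (- s) i (- a) \<circ> sb i"
  by (auto simp: fun_eq_iff op_simps)

lemma sb_xs_commute:
  assumes "i \<in> I" "j \<in> I" "cartan n i j = 0"
  shows "sb i \<circ> xs s j a = xs s j a \<circ> sb i"
  using assms cartan_sym[of n i j] by (auto simp: fun_eq_iff op_simps reflect_commute[OF assms(3)])

lemma xs_xs_commute:
  assumes "i \<in> I" "j \<in> I" "cartan n i j = 0"
  shows "xs s i a \<circ> xs s' j b = xs s' j b \<circ> xs s i a"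
  using assms cartan_sym[of n i j] by (auto simp: fun_eq_iff op_simps reflect_commute[OF assms(3)] algebra_simps)

text \<open>The sum of the two coordinates is a coordinate of a reflected minuscule weight, hence in
  {-1, 0, 1}; this excludes (1, 1) and (-1, -1). The rank-two identities below are checked by
  running through the seven remaining cases.\<close>

lemma adjacent_values:
  assumes "\<mu> \<in> mw" "i \<in> I" "j \<in> I" "cartan n i j = -1"
  shows "\<mu> i = 0 \<and> \<mu> j = 0 \<or> \<mu> i = 1 \<and> \<mu> j = 0 \<or> \<mu> i = -1 \<and> \<mu> j = 0 \<or> \<mu> i = 0 \<and> \<mu> j = 1 \<or>
         \<mu> i = 0 \<and> \<mu> j = -1 \<or> \<mu> i = 1 \<and> \<mu> j = -1 \<or> \<mu> i = -1 \<and> \<mu> j = 1"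
proof -
  have "reflect n i \<mu> j = \<mu> j + \<mu> i" using assms cartan_sym[of n i j] by (simp add: reflect_at)
  then have "\<mu> j + \<mu> i = -1 \<or> \<mu> j + \<mu> i = 0 \<or> \<mu> j + \<mu> i = 1"
    using mw_values[OF refl_mw[OF assms(1,2)], of j] by metis
  then show ?thesis
    using mw_values[OF assms(1), of i] mw_values[OF assms(1), of j]
    by (elim disjE) (simp_all only:, simp_all)
qed

lemma xs_hit: "\<mu> \<in> mw \<Longrightarrow> \<mu> i = s \<Longrightarrow> xs s i a v \<mu> = v \<mu> + a * v (reflect n i \<mu>)"
  by (simp add: xs_def)

lemma xs_miss: "\<mu> i \<noteq> s \<Longrightarrow> xs s i a v \<mu> = v \<mu>"
  by (simp add: xs_def)

lemma sb_values: "\<mu> \<in> mw \<Longrightarrow> \<mu> i = 1 \<Longrightarrow> sb i v \<mu> = - v (reflect n i \<mu>)"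
  "\<mu> \<in> mw \<Longrightarrow> \<mu> i = -1 \<Longrightarrow> sb i v \<mu> = v (reflect n i \<mu>)"
  "\<mu> i = 0 \<Longrightarrow> sb i v \<mu> = v \<mu>"
  by (simp_all add: sb_def)

lemma outside_mw: "\<mu> \<notin> mw \<Longrightarrow> xs s i a v \<mu> = v \<mu>" "\<mu> \<notin> mw \<Longrightarrow> sb i v \<mu> = v \<mu>"
  by (simp_all add: xs_def sb_def)

text \<open>Group form of \<open>s_i s_j\<close> \<alpha>_i = \<alpha>_j, with the same parameter on
  both sides.\<close>

lemma sb_sb_xs:
  assumes "i \<in> I" "j \<in> I" "cartan n i j = -1" "s = 1 \<or> s = -1"
  shows "sb i \<circ> (sb j \<circ> xs s i a) = xs s j a \<circ> (sb i \<circ> sb j)"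
proof (intro ext)
  fix v \<mu>
  have c: "cartan n j i = -1" using assms cartan_sym[of n i j] by simp
  show "(sb i \<circ> (sb j \<circ> xs s i a)) v \<mu> = (xs s j a \<circ> (sb i \<circ> sb j)) v \<mu>"
  proof (cases "\<mu> \<in> mw")
    case True
    show ?thesis
      using adjacent_values[OF True assms(1-3)] assms(4)
      by (elim disjE conjE)
        (simp_all add: xs_hit xs_miss sb_values refl_mw reflect_at cartan_diag reflect_reflect True assms(3) assms(1,2)[simplified] c)
  qed (simp add: outside_mw)
qed

text \<open>The root subgroup of s(\<alpha>_i + \<alpha>_j) has no symbol of its own; its elements
  are written as commutators of generators, which makes membership in the unipotent group
  immediate.\<close>

lemma sb_xs_adjacent:
  assumes "i \<in> I" "j \<in> I" "cartan n i j = -1" "s = 1 \<or> s = -1"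
  shows "sb i \<circ> xs s j a =
     (xs s i 1 \<circ> xs s j (- of_int s * a) \<circ> xs s i (-1) \<circ> xs s j (of_int s * a)) \<circ> sb i"
proof (intro ext)
  fix v \<mu>
  have c: "cartan n j i = -1" using assms cartan_sym[of n i j] by simp
  show "(sb i \<circ> xs s j a) v \<mu> =
     ((xs s i 1 \<circ> xs s j (- of_int s * a) \<circ> xs s i (-1) \<circ> xs s j (of_int s * a)) \<circ> sb i) v \<mu>"
  proof (cases "\<mu> \<in> mw")
    case True
    show ?thesis
      using adjacent_values[OF True assms(1-3)] assms(4)
      by (elim disjE conjE)
        (simp_all add: xs_hit xs_miss sb_values refl_mw reflect_at cartan_diag reflect_reflect True assms(3) assms(1,2)[simplified] c algebra_simps)
  qed (simp add: outside_mw)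
qed

end

section \<open>Levels and characters of the unipotent radicals\<close>

definition delta :: "weight \<Rightarrow> vec" where
  "delta \<kappa> = (\<lambda>\<mu>. if \<mu> = \<kappa> then 1 else 0)"

definition lin :: "elt \<Rightarrow> bool" where
  "lin g \<longleftrightarrow> (\<forall>v w c. g (\<lambda>\<mu>. v \<mu> + c * w \<mu>) = (\<lambda>\<mu>. g v \<mu> + c * g w \<mu>))"

lemma lin_comp: "lin g \<Longrightarrow> lin h \<Longrightarrow> lin (g \<circ> h)"
  by (simp add: lin_def)

lemma lin_id: "lin id"
  by (simp add: lin_def)

lemma lin_apply: "lin g \<Longrightarrow> g (\<lambda>\<mu>. v \<mu> + c * w \<mu>) \<mu> = g v \<mu> + c * g w \<mu>"
  by (simp add: lin_def)

lemma lin_add: "lin g \<Longrightarrow> g (\<lambda>\<mu>. v \<mu> + w \<mu>) \<mu> = g v \<mu> + g w \<mu>"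
  using lin_apply[of g v 1 w] by simp

context type_D
begin

section \<open>Solving linear systems with the Cartan matrix, and the level of a weight\<close>

lemma cartan_vals:
  "1 \<le> i \<Longrightarrow> i < n - 2 \<Longrightarrow> cartan n (Suc i) i = -1"
  "1 < i \<Longrightarrow> i < n \<Longrightarrow> cartan n (i - 1) i = -1"
  "cartan n (n - 1) (n - 2) = -1" "cartan n n (n - 2) = -1"
  "cartan n (n - 2) (n - 1) = -1" "cartan n (n - 2) n = -1"
  using n4 by (auto simp: cartan_def doubleton_eq_iff)

lemma cartan_sum:
  fixes f :: "nat \<Rightarrow> real"
  assumes "i \<in> I"
  shows "(\<Sum>j\<in>I. f j * cartan n j i) =
    (if i < n - 2 then 2 * f i - (if i = 1 then 0 else f (i - 1)) - f (i + 1)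
     else if i = n - 2 then 2 * f i - f (i - 1) - f (n - 1) - f n
     else 2 * f i - f (n - 2))"
proof -
  have *: "(\<Sum>j\<in>I. f j * cartan n j i) = (\<Sum>j\<in>J. f j * cartan n j i)"
    if "J \<subseteq> I" "\<And>j. j \<in> I \<Longrightarrow> j \<notin> J \<Longrightarrow> cartan n j i = 0" for J
    by (rule sum.mono_neutral_right) (use that in auto)
  consider "i = 1" | "1 < i" "i < n - 2" | "i = n - 2" | "i = n - 1" | "i = n" using assms by force
  then show ?thesis
  proof cases
    case 1
    then have "(\<Sum>j\<in>I. f j * cartan n j i) = (\<Sum>j\<in>{i, i + 1}. f j * cartan n j i)"
      using n4 by (intro *) (auto simp: cartan_def doubleton_eq_iff)
    moreover have "i < n - 2" using 1 n4 by simp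
    ultimately show ?thesis using 1 n4 cartan_vals(1)[of i] cartan_diag[of i n] by simp
  next
    case 2
    then have "(\<Sum>j\<in>I. f j * cartan n j i) = (\<Sum>j\<in>{i - 1, i, i + 1}. f j * cartan n j i)"
      using n4 by (intro *) (auto simp: cartan_def doubleton_eq_iff)
    moreover have "i - 1 \<noteq> i" "i - 1 \<noteq> i + 1" "i - Suc 0 \<noteq> i" using 2 by auto
    ultimately show ?thesis using 2 n4 cartan_vals(1,2)[of i] cartan_diag[of i n] by simp
  next
    case 3
    then have 1: "(\<Sum>j\<in>I. f j * cartan n j i) = (\<Sum>j\<in>{i - 1, i, n - 1, n}. f j * cartan n j i)"
      using n4 by (intro *) (auto simp: cartan_def doubleton_eq_iff)
    have ne: "i - 1 \<noteq> i" "i - 1 \<noteq> n - 1" "i - 1 \<noteq> n" "i \<noteq> n - 1" "i \<noteq> n" "n - 1 \<noteq> n" and lt: "1 < i" "i < n" using 3 n4 by auto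
    have 2: "(\<Sum>j\<in>{i - 1, i, n - 1, n}. f j * cartan n j i)
        = f (i - 1) * cartan n (i - 1) i + (f i * cartan n i i + (f (n - 1) * cartan n (n - 1) i + f n * cartan n n i))"
      by (simp only: sum.insert finite.intros sum.empty insert_iff empty_iff simp_thms add_0_right ne)
    have "cartan n (n - 1) i = -1" "cartan n n i = -1" "cartan n (i - 1) i = -1" "cartan n i i = 2"
      using cartan_vals(2)[OF lt] cartan_vals(3,4) cartan_diag[OF assms] 3 by simp_all
    then show ?thesis unfolding 1 2 using 3 by (simp only:) simp
  next
    case 4
    then have "(\<Sum>j\<in>I. f j * cartan n j i) = (\<Sum>j\<in>{n - 2, i}. f j * cartan n j i)"
      using n4 by (intro *) (auto simp: cartan_def doubleton_eq_iff)
    moreover have "n - 2 \<noteq> i" "\<not> i < n - 2" "i \<in> I" using 4 n4 by auto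
    ultimately show ?thesis using cartan_vals(5) cartan_diag[of i n] by (simp add: 4)
  next
    case 5
    then have "(\<Sum>j\<in>I. f j * cartan n j i) = (\<Sum>j\<in>{n - 2, i}. f j * cartan n j i)"
      using n4 by (intro *) (auto simp: cartan_def doubleton_eq_iff)
    moreover have "n - 2 \<noteq> i" "\<not> i < n - 2" "i \<in> I" using 5 n4 by auto
    ultimately show ?thesis using cartan_vals(6) cartan_diag[of i n] by (simp add: 5)
  qed
qed

text \<open>The solution is read off in the orthogonal coordinates \<open>e\<close> of the (co)weight with coordinates \<open>l\<close>.\<close>

lemma cartan_invertible:
  fixes l :: "nat \<Rightarrow> real"
  shows "\<exists>y :: nat \<Rightarrow> real. \<forall>i\<in>I. (\<Sum>j\<in>I. y j * real_of_int (cartan n j i)) = l i"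
proof -
  define e where "e p = (\<Sum>i\<in>{p..n - 2}. l i) + (l (n - 1) + l n) / 2" for p
  define d where "d = (l n - l (n - 1)) / 2"
  define Y where "Y j = (\<Sum>p\<in>{1..j}. e p)" for j
  define y where "y j = (if j \<le> n - 2 then Y j else if j = n - 1 then (Y (n - 1) - d) / 2 else (Y (n - 1) + d) / 2)" for j
  have e: "e p - e (p + 1) = l p" if "p \<le> n - 2" for p
    using that by (simp add: e_def sum.atLeast_Suc_atMost)
  have en: "e (n - 1) = (l (n - 1) + l n) / 2" using n4 by (simp add: e_def)
  have Ys: "Y (Suc j) = Y j + e (Suc j)" for j by (simp add: Y_def)
  have Y1: "Y (n - 1) = Y (n - 2) + e (n - 1)" using Ys[of "n - 2"] n4 by (simp add: numeral_2_eq_2 Suc_diff_Suc)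
  have "(\<Sum>j\<in>I. y j * cartan n j i) = l i" if i: "i \<in> I" for i
  proof -
    obtain k where k: "i = Suc k" using i by (cases i) auto
    consider "i < n - 2" | "i = n - 2" | "i = n - 1" | "i = n" using i by force
    then show ?thesis
    proof cases
      case 1
      then show ?thesis unfolding cartan_sum[OF i]
        using e[of i] Ys[of k] Ys[of i] k by (auto simp: y_def Y_def)
    next
      case 2
      then have c: "\<not> i < n - 2" "k \<le> n - 2" "i - 1 = k" "\<not> n - 1 \<le> n - 2" "\<not> n \<le> n - 2" "n \<noteq> n - 1" using k n4 by auto
      have "e i = e (n - 1) + l i" using e[of i] 2 n4 by (simp add: Suc_diff_Suc numeral_2_eq_2)
      moreover have "y i = Y k + e i" using 2 k Ys[of k] by (simp add: y_def)
      moreover have "y (i - 1) = Y k" using c by (simp add: y_def)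
      moreover have "y (n - 1) = (Y k + e i + e (n - 1) - d) / 2" "y n = (Y k + e i + e (n - 1) + d) / 2"
        using c Y1 Ys[of k] 2 k by (simp_all add: y_def)
      moreover have "(\<Sum>j\<in>I. y j * cartan n j i) = 2 * y i - y (i - 1) - y (n - 1) - y n"
        unfolding cartan_sum[OF i] using 2 by simp
      ultimately show ?thesis by (simp only:) (simp add: field_simps)
    next
      case 3
      then have c: "\<not> i < n - 2" "i \<noteq> n - 2" "\<not> n - 1 \<le> n - 2" using n4 by auto
      have "y i = (Y (n - 2) + e (n - 1) - d) / 2" "y (n - 2) = Y (n - 2)" using c 3 Y1 by (simp_all add: y_def)
      moreover have "(\<Sum>j\<in>I. y j * cartan n j i) = 2 * y i - y (n - 2)"
        unfolding cartan_sum[OF i] by (simp only: c if_False)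
      ultimately show ?thesis using en by (simp only: 3) (simp add: d_def field_simps)
    next
      case 4
      then have c: "\<not> i < n - 2" "i \<noteq> n - 2" "\<not> n \<le> n - 2" "n \<noteq> n - 1" using n4 by auto
      have "y i = (Y (n - 2) + e (n - 1) + d) / 2" "y (n - 2) = Y (n - 2)" using c 4 Y1 by (simp_all add: y_def)
      moreover have "(\<Sum>j\<in>I. y j * cartan n j i) = 2 * y i - y (n - 2)"
        unfolding cartan_sum[OF i] by (simp only: c if_False)
      ultimately show ?thesis using en by (simp only: 4) (simp add: d_def field_simps)
    qed
  qed
  then show ?thesis by blast
qed

definition rho_vec :: "nat \<Rightarrow> real" where
  "rho_vec = (SOME y. \<forall>i\<in>I. (\<Sum>j\<in>I. y j * real_of_int (cartan n j i)) = (1::real))"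

text \<open>Pairing with the coweight that takes the value 1 on every simple root. It may be
  half-integral on half-spin weights; the floor makes it an integer and still lets a reflection
  shift it by exactly the integer \<mu> i.\<close>

definition lev :: "weight \<Rightarrow> int" where
  "lev \<mu> = \<lfloor>\<Sum>j\<in>I. rho_vec j * \<mu> j\<rfloor>"

lemma lev_reflect: "i \<in> I \<Longrightarrow> lev (reflect n i \<mu>) = lev \<mu> - \<mu> i"
proof -
  assume i: "i \<in> I"
  have "\<forall>i\<in>I. (\<Sum>j\<in>I. rho_vec j * cartan n j i) = 1"
    unfolding rho_vec_def using someI_ex[of "\<lambda>y::nat \<Rightarrow> real. \<forall>i\<in>I. (\<Sum>j\<in>I. y j * real_of_int (cartan n j i)) = 1"] cartan_invertible[of "\<lambda>_. 1"] by blast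
  then have r: "(\<Sum>j\<in>I. rho_vec j * cartan n j i) = 1" using i by blast
  have "(\<Sum>j\<in>I. rho_vec j * reflect n i \<mu> j) = (\<Sum>j\<in>I. rho_vec j * \<mu> j) - \<mu> i * (\<Sum>j\<in>I. rho_vec j * cartan n j i)"
    by (simp add: reflect_at right_diff_distrib sum_subtractf sum_distrib_left mult_ac)
  then show ?thesis unfolding lev_def r by simp
qed

section \<open>The two unipotent subgroups and their additive characters\<close>

definition Ug :: "int \<Rightarrow> elt set" where
  "Ug s = generate Amb {xs s i a | i a. i \<in> I}"

lemma Upos_Ug: "Upos n = Ug 1"
  unfolding Upos_def Ug_def xg_xs ..

lemma Uneg_Ug: "Uneg n = Ug (-1)"
  unfolding Uneg_def Ug_def yg_xs ..

lemma bij_gens: "s = 1 \<or> s = -1 \<Longrightarrow> \<forall>g\<in>{xs s i a | i a. i \<in> I}. bij g"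
  using bij_xs by blast

lemma Ug_ops:
  assumes s: "s = 1 \<or> s = -1"
  shows "id \<in> Ug s" "g \<in> Ug s \<Longrightarrow> h \<in> Ug s \<Longrightarrow> g \<circ> h \<in> Ug s" "g \<in> Ug s \<Longrightarrow> finv g \<in> Ug s"
    "g \<in> Ug s \<Longrightarrow> bij g" "i \<in> I \<Longrightarrow> xs s i a \<in> Ug s"
  unfolding Ug_def
  using gen_id[OF bij_gens[OF s]] gen_comp[OF bij_gens[OF s]] gen_inv[OF bij_gens[OF s]] gen_bij[OF bij_gens[OF s]]
  by (blast intro: generate.incl)+

lemma Ug_induct [consumes 2, case_names id incl comp]:
  assumes s: "s = 1 \<or> s = -1" and "g \<in> Ug s" "P id" "\<And>i a. i \<in> I \<Longrightarrow> P (xs s i a)"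
    "\<And>g h. g \<in> Ug s \<Longrightarrow> h \<in> Ug s \<Longrightarrow> P g \<Longrightarrow> P h \<Longrightarrow> P (g \<circ> h)"
  shows "P g"
proof (rule gen_induct[where P = P, OF bij_gens[OF s] assms(2)[unfolded Ug_def]])
  fix h assume "h \<in> {xs s i a | i a. i \<in> I}"
  then show "finv h \<in> {xs s i a | i a. i \<in> I}" "P h" using inv_xs[OF _ s] assms(4) by auto
qed (use assms(3,5) in \<open>simp_all add: Ug_def\<close>)

lemma lin_xs: "lin (xs s i a)"
  by (auto simp: lin_def xs_def fun_eq_iff algebra_simps)

lemma lin_Ug: "s = 1 \<or> s = -1 \<Longrightarrow> g \<in> Ug s \<Longrightarrow> lin g"
  by (rule Ug_induct[of s g lin]) (auto simp: lin_xs lin_comp lin_id)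

text \<open>A generator changes the coefficient at \<mu> only by coefficients one step lower in the
  s-level, so nothing is added if the vector vanishes on all lower levels.\<close>

lemma Ug_unipotent:
  assumes "s = 1 \<or> s = -1" "g \<in> Ug s" "\<And>\<kappa>. s * lev \<kappa> < s * lev \<mu> \<Longrightarrow> v \<kappa> = 0"
  shows "g v \<mu> = v \<mu>"
proof -
  have "\<forall>v \<mu>. (\<forall>\<kappa>. s * lev \<kappa> < s * lev \<mu> \<longrightarrow> v \<kappa> = 0) \<longrightarrow> g v \<mu> = v \<mu>"
    using assms(1,2)
  proof (induction rule: Ug_induct)
    case (incl i a)
    then show ?case using lev_reflect assms(1) by (auto simp: xs_def)
  next
    case (comp g h)
    show ?case
    proof (intro allI impI)
      fix v :: vec and \<mu> assume v: "\<forall>\<kappa>. s * lev \<kappa> < s * lev \<mu> \<longrightarrow> v \<kappa> = 0"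
      have "h v \<kappa> = v \<kappa>" if "s * lev \<kappa> \<le> s * lev \<mu>" for \<kappa>
        using comp.IH(2) v that by (meson order.strict_trans2)
      then show "(g \<circ> h) v \<mu> = v \<mu>" using comp.IH(1) v by simp
    qed
  qed simp
  then show ?thesis using assms(3) by blast
qed

definition wts :: "int \<Rightarrow> nat \<Rightarrow> weight" where
  "wts s i = (if s = 1 then ep n i else en n i)"

lemma wts: "s = 1 \<or> s = -1 \<Longrightarrow> i \<in> I \<Longrightarrow> wts s i \<in> mw" "s = 1 \<or> s = -1 \<Longrightarrow> i \<in> I \<Longrightarrow> wts s i i = s"
  using ep_mw en_mw ep_at by (auto simp: wts_def en_def)

text \<open>The character as a matrix coefficient of the natural representation: the i-th coordinate
  of \<epsilon>_i is 1 for every i, including i = n, so \<epsilon>_i and its reflection differ by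
  one simple root.\<close>

definition chiv :: "int \<Rightarrow> nat \<Rightarrow> elt \<Rightarrow> complex" where
  "chiv s i u = u (delta (reflect n i (wts s i))) (wts s i)"

lemma chiv_gen:
  assumes "s = 1 \<or> s = -1" "i \<in> I" "j \<in> I"
  shows "chiv s i (xs s j a) = (if i = j then a else 0)"
proof -
  let ?m = "wts s i"
  have m: "?m i = s" "?m \<in> mw" using wts assms by auto
  have ne: "?m \<noteq> reflect n i ?m" using lev_reflect[of i ?m] assms m by auto
  have "reflect n j ?m \<noteq> reflect n i ?m" if "j \<noteq> i" "?m j = s"
  proof
    assume "reflect n j ?m = reflect n i ?m"
    then have "reflect n j ?m i = reflect n i ?m i" by simp
    then show False using that m assms cartan_diag[of i n] cartan_off[of i j n] by (auto simp: reflect_at)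
  qed
  then show ?thesis using ne m by (auto simp: chiv_def xs_def delta_def)
qed

text \<open>The vector u' \<delta>_\<kappa> is \<delta>_\<kappa> plus terms of higher s-level. The
  weight where the coefficient is read lies just one level above \<kappa>, so u leaves the
  contribution of these terms unchanged and the coefficients add.\<close>

lemma chiv_comp:
  assumes s: "s = 1 \<or> s = -1" and "i \<in> I" "u \<in> Ug s" "u' \<in> Ug s"
  shows "chiv s i (u \<circ> u') = chiv s i u + chiv s i u'"
proof -
  let ?m = "wts s i" let ?k = "reflect n i (wts s i)"
  have m: "?m i = s" "?m \<in> mw" using wts assms by auto
  have lk: "s * lev ?k = s * lev ?m - 1" using lev_reflect[of i ?m] assms m by auto
  define z where "z = u' (delta ?k)"
  have z: "z \<kappa> = delta ?k \<kappa>" if "s * lev \<kappa> \<le> s * lev ?k" for \<kappa>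
    unfolding z_def by (rule Ug_unipotent[OF s assms(4)]) (use that in \<open>auto simp: delta_def\<close>)
  define z' where "z' \<mu> = z \<mu> - delta ?k \<mu>" for \<mu>
  have "u z' ?m = z' ?m"
    by (rule Ug_unipotent[OF s assms(3)]) (use z lk in \<open>auto simp: z'_def\<close>)
  moreover have "u (\<lambda>\<mu>. delta ?k \<mu> + z' \<mu>) ?m = u (delta ?k) ?m + u z' ?m"
    by (rule lin_add[OF lin_Ug[OF s assms(3)]])
  moreover have "(\<lambda>\<mu>. delta ?k \<mu> + z' \<mu>) = z" by (simp add: z'_def)
  moreover have "?m \<noteq> ?k" using lk by auto
  ultimately show ?thesis by (auto simp: chiv_def z_def z'_def delta_def)
qed

lemma chiv_id: "s = 1 \<or> s = -1 \<Longrightarrow> i \<in> I \<Longrightarrow> chiv s i id = 0"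
  using chiv_gen[of s i i 0] by (simp add: xs_zero)

lemma chiv_inv: "s = 1 \<or> s = -1 \<Longrightarrow> i \<in> I \<Longrightarrow> u \<in> Ug s \<Longrightarrow> chiv s i (finv u) = - chiv s i u"
  using chiv_comp[of s i u "finv u"] chiv_id[of s i] Ug_ops(3,4)[of s u]
  by (simp add: comp_inv_cancel eq_neg_iff_add_eq_0 add.commute)

text \<open>First-order expansion: if z vanishes more than one level below \<mu>, only the part of u
  of degree one in the generators is seen, and that part is given by the characters. It holds at
  every minuscule weight, so the same characters can be read off half-spin weights.\<close>

lemma Ug_coeff:
  assumes s: "s = 1 \<or> s = -1" and "u \<in> Ug s" and "\<mu> \<in> mw" and "\<And>\<kappa>. s * lev \<kappa> < s * lev \<mu> - 1 \<Longrightarrow> z \<kappa> = 0"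
  shows "u z \<mu> = z \<mu> + (\<Sum>i\<in>{i\<in>I. \<mu> i = s}. chiv s i u * z (reflect n i \<mu>))"
proof -
  have "\<forall>z. (\<forall>\<kappa>. s * lev \<kappa> < s * lev \<mu> - 1 \<longrightarrow> z \<kappa> = 0) \<longrightarrow>
    u z \<mu> = z \<mu> + (\<Sum>i\<in>{i\<in>I. \<mu> i = s}. chiv s i u * z (reflect n i \<mu>))"
    using assms(1,2)
  proof (induction rule: Ug_induct)
    case id
    have "(\<Sum>i\<in>{i\<in>I. \<mu> i = s}. chiv s i id * z (reflect n i \<mu>)) = 0" for z
      by (rule sum.neutral) (simp add: chiv_id[OF s])
    then show ?case by (simp add: id_def)
  next
    case (incl j a)
    have "(\<Sum>i\<in>{i\<in>I. \<mu> i = s}. chiv s i (xs s j a) * z (reflect n i \<mu>))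
        = (if \<mu> j = s then a * z (reflect n j \<mu>) else 0)" for z
    proof -
      have "(\<Sum>i\<in>{i\<in>I. \<mu> i = s}. chiv s i (xs s j a) * z (reflect n i \<mu>))
        = (\<Sum>i\<in>{i\<in>I. \<mu> i = s}. if i = j then a * z (reflect n j \<mu>) else 0)"
        by (rule sum.cong) (auto simp: chiv_gen[OF s _ incl])
      then show ?thesis using incl by simp
    qed
    then show ?case using assms(3) by (cases "\<mu> j = s") (simp_all only: xs_hit xs_miss simp_thms if_True if_False add_0_right)
  next
    case (comp g h)
    show ?case
    proof (intro allI impI)
      fix z :: vec assume z: "\<forall>\<kappa>. s * lev \<kappa> < s * lev \<mu> - 1 \<longrightarrow> z \<kappa> = 0"
      have hz: "h z \<kappa> = z \<kappa>" if "s * lev \<kappa> \<le> s * lev \<mu> - 1" for \<kappa>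
        by (rule Ug_unipotent[OF s comp.hyps(2)]) (use z that in auto)
      have lv: "s * lev (reflect n i \<mu>) \<le> s * lev \<mu> - 1" if "i \<in> I" "\<mu> i = s" for i
        using lev_reflect[OF that(1), of \<mu>] that s by auto
      have "(g \<circ> h) z \<mu> = h z \<mu> + (\<Sum>i\<in>{i\<in>I. \<mu> i = s}. chiv s i g * h z (reflect n i \<mu>))"
        using comp.IH(1) hz z by simp
      also have "(\<Sum>i\<in>{i\<in>I. \<mu> i = s}. chiv s i g * h z (reflect n i \<mu>))
          = (\<Sum>i\<in>{i\<in>I. \<mu> i = s}. chiv s i g * z (reflect n i \<mu>))"
        using hz lv by (intro sum.cong refl) simp
      also have "h z \<mu> = z \<mu> + (\<Sum>i\<in>{i\<in>I. \<mu> i = s}. chiv s i h * z (reflect n i \<mu>))"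
        using comp.IH(2) z by simp
      finally have "(g \<circ> h) z \<mu> = z \<mu> + (\<Sum>i\<in>{i\<in>I. \<mu> i = s}. chiv s i (g \<circ> h) * z (reflect n i \<mu>))"
        by (simp add: chiv_comp[OF s _ comp.hyps] distrib_right sum.distrib)
      then show "(g \<circ> h) z \<mu> = z \<mu> + (\<Sum>i\<in>{i\<in>I. \<mu> i = s}. chiv s i (g \<circ> h) * z (reflect n i \<mu>))" .
    qed
  qed
  then show ?thesis using assms(4) by blast
qed

text \<open>The values on generators determine an additive map on the group, and \<open>chiv\<close>
  has them; \<open>extensional\<close> removes the freedom outside. This evaluates
  \<open>chi\<close> and \<open>chi_neg\<close>.\<close>

lemma the_character:
  assumes s: "s = 1 \<or> s = -1" and i: "i \<in> I"
  shows "(THE \<chi>. \<chi> \<in> extensional (Ug s) \<and>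
      (\<forall>u\<in>Ug s. \<forall>u'\<in>Ug s. \<chi> (u \<circ> u') = \<chi> u + \<chi> u') \<and>
      (\<forall>j\<in>I. \<forall>a. \<chi> (xs s j a) = (if i = j then a else 0))) = restrict (chiv s i) (Ug s)"
proof (rule the_equality)
  show "restrict (chiv s i) (Ug s) \<in> extensional (Ug s) \<and>
      (\<forall>u\<in>Ug s. \<forall>u'\<in>Ug s. restrict (chiv s i) (Ug s) (u \<circ> u') = restrict (chiv s i) (Ug s) u + restrict (chiv s i) (Ug s) u') \<and>
      (\<forall>j\<in>I. \<forall>a. restrict (chiv s i) (Ug s) (xs s j a) = (if i = j then a else 0))"
    using chiv_comp[OF s i] chiv_gen[OF s i] Ug_ops[OF s] by simp
next
  fix f assume f: "f \<in> extensional (Ug s) \<and> (\<forall>u\<in>Ug s. \<forall>u'\<in>Ug s. f (u \<circ> u') = f u + f u') \<and>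
      (\<forall>j\<in>I. \<forall>a. f (xs s j a) = (if i = j then a else 0))"
  have "f u = chiv s i u" if "u \<in> Ug s" for u
    using s that
  proof (induction rule: Ug_induct)
    case id
    have "f (id \<circ> id) = f id + f id" using f Ug_ops(1)[OF s] by blast
    then show ?case using chiv_id[OF s i] by (simp add: id_def comp_def)
  next
    case (incl j a) then show ?case using f chiv_gen[OF s i] by simp
  next
    case (comp g h)
    have "f (g \<circ> h) = f g + f h" using f comp.hyps by blast
    then show ?case using chiv_comp[OF s i comp.hyps] comp.IH by (simp add: comp_def)
  qed
  then show "f = restrict (chiv s i) (Ug s)" using f by (intro extensionalityI[of _ "Ug s"]) auto
qed

lemma chi_chiv: "i \<in> I \<Longrightarrow> u \<in> Ug 1 \<Longrightarrow> chi n i u = chiv 1 i u"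
  unfolding chi_def Upos_Ug xg_xs by (subst the_character[of 1 i]) simp_all

lemma chi_neg_chiv: "i \<in> I \<Longrightarrow> u \<in> Ug (-1) \<Longrightarrow> chi_neg n i u = chiv (-1) i u"
  unfolding chi_neg_def Uneg_Ug yg_xs by (subst the_character[of "-1" i]) simp_all

section \<open>The torus\<close>

definition diag :: "(weight \<Rightarrow> complex) \<Rightarrow> elt" where
  "diag \<tau> v = (\<lambda>\<mu>. \<tau> \<mu> * v \<mu>)"

text \<open>The diagonal entries \<tau> form a character of the weights whose value on \<alpha>_i is
  \<rho> i, stated only along reflections of minuscule weights, where \<mu> and its reflection
  differ by \<mu> i times \<alpha>_i.\<close>

definition tor_data :: "(weight \<Rightarrow> complex) \<Rightarrow> (nat \<Rightarrow> complex) \<Rightarrow> bool" where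
  "tor_data \<tau> \<rho> \<longleftrightarrow> (\<forall>\<mu>. \<tau> \<mu> \<noteq> 0) \<and> (\<forall>i. \<rho> i \<noteq> 0) \<and>
     (\<forall>i\<in>I. \<forall>\<mu>\<in>mw. \<tau> (reflect n i \<mu>) = \<tau> \<mu> * \<rho> i powi (- \<mu> i))"

lemma diag_comp: "diag \<sigma> \<circ> diag \<tau> = diag (\<lambda>\<mu>. \<sigma> \<mu> * \<tau> \<mu>)"
  by (auto simp: diag_def fun_eq_iff)

lemma diag_one: "diag (\<lambda>\<mu>. 1) = id"
  by (auto simp: diag_def)

lemma diag_inverse: "(\<And>\<mu>. \<tau> \<mu> \<noteq> 0) \<Longrightarrow> bij (diag \<tau>)" "(\<And>\<mu>. \<tau> \<mu> \<noteq> 0) \<Longrightarrow> finv (diag \<tau>) = diag (\<lambda>\<mu>. inverse (\<tau> \<mu>))"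
proof -
  assume a: "\<And>\<mu>. \<tau> \<mu> \<noteq> 0"
  have 1: "diag \<tau> \<circ> diag (\<lambda>\<mu>. inverse (\<tau> \<mu>)) = id" "diag (\<lambda>\<mu>. inverse (\<tau> \<mu>)) \<circ> diag \<tau> = id"
    using a by (simp_all add: diag_comp diag_one)
  show "bij (diag \<tau>)" by (rule o_bij[OF 1(2,1)])
  show "finv (diag \<tau>) = diag (\<lambda>\<mu>. inverse (\<tau> \<mu>))" by (rule inv_eqI[OF 1])
qed

lemma coroot_diag: "coroot n i a = diag (\<lambda>\<mu>. if \<mu> \<in> mw then a powi \<mu> i else 1)"
  by (auto simp: coroot_def diag_def fun_eq_iff)

lemma coroot_data:
  assumes "i \<in> I" "a \<noteq> 0"
  shows "tor_data (\<lambda>\<mu>. if \<mu> \<in> mw then a powi \<mu> i else 1) (\<lambda>j. a powi cartan n i j)"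
  unfolding tor_data_def
proof (intro conjI allI ballI)
  fix j \<mu> assume j: "j \<in> I" and m: "\<mu> \<in> mw"
  have "a powi (\<mu> i - cartan n i j * \<mu> j) = a powi \<mu> i * (a powi cartan n i j) powi (- \<mu> j)"
    using assms(2) by (simp add: power_int_diff power_int_minus power_int_mult divide_inverse)
  then show "(if reflect n j \<mu> \<in> mw then a powi reflect n j \<mu> i else 1) =
      (if \<mu> \<in> mw then a powi \<mu> i else 1) * (a powi cartan n i j) powi (- \<mu> j)"
    using m refl_mw[OF m j] by (simp add: reflect_at)
qed (use assms in auto)

lemma tor_data_mult: "tor_data \<sigma> \<rho> \<Longrightarrow> tor_data \<tau> \<pi> \<Longrightarrow> tor_data (\<lambda>\<mu>. \<sigma> \<mu> * \<tau> \<mu>) (\<lambda>i. \<rho> i * \<pi> i)"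
  by (auto simp: tor_data_def power_int_mult_distrib)

lemma tor_data_one: "tor_data (\<lambda>\<mu>. 1) (\<lambda>i. 1)"
  by (simp add: tor_data_def)

definition Tgens :: "elt set" where
  "Tgens = {coroot n i a | i a. i \<in> I \<and> a \<noteq> 0}"

lemma Tor_gen: "Tor n = generate Amb Tgens"
  by (simp add: Tor_def Tgens_def)

lemma bij_Tgens: "\<forall>g\<in>Tgens. bij g"
  by (auto simp: Tgens_def coroot_diag intro!: diag_inverse split: if_splits)

lemma Tor_ops:
  "id \<in> Tor n" "g \<in> Tor n \<Longrightarrow> h \<in> Tor n \<Longrightarrow> g \<circ> h \<in> Tor n" "g \<in> Tor n \<Longrightarrow> finv g \<in> Tor n"
  "g \<in> Tor n \<Longrightarrow> bij g" "i \<in> I \<Longrightarrow> a \<noteq> 0 \<Longrightarrow> coroot n i a \<in> Tor n"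
proof -
  show "id \<in> Tor n" unfolding Tor_gen by (rule gen_id[OF bij_Tgens])
  show "g \<circ> h \<in> Tor n" if "g \<in> Tor n" "h \<in> Tor n" using that unfolding Tor_gen by (rule gen_comp[OF bij_Tgens])
  show "finv g \<in> Tor n" if "g \<in> Tor n" using that unfolding Tor_gen by (rule gen_inv[OF bij_Tgens])
  show "bij g" if "g \<in> Tor n" using that unfolding Tor_gen by (rule gen_bij[OF bij_Tgens])
  show "coroot n i a \<in> Tor n" if "i \<in> I" "a \<noteq> 0"
    unfolding Tor_gen by (rule generate.incl) (use that in \<open>unfold Tgens_def, blast\<close>)
qed

lemma Tor_induct:
  assumes "g \<in> Tor n" "P id" "\<And>i a. i \<in> I \<Longrightarrow> a \<noteq> 0 \<Longrightarrow> P (coroot n i a)"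
    "\<And>g h. g \<in> Tor n \<Longrightarrow> h \<in> Tor n \<Longrightarrow> P g \<Longrightarrow> P h \<Longrightarrow> P (g \<circ> h)"
  shows "P g"
proof (rule gen_induct[where P = P, OF bij_Tgens assms(1)[unfolded Tor_gen]])
  fix h assume "h \<in> Tgens"
  then obtain i a where h: "i \<in> I" "a \<noteq> 0" "h = coroot n i a" by (auto simp: Tgens_def)
  have "finv h = coroot n i (inverse a)"
    unfolding h(3) coroot_diag
    by (subst diag_inverse(2)) (use h in \<open>auto simp: power_int_inverse if_distrib cong: if_cong\<close>)
  then show "finv h \<in> Tgens" unfolding Tgens_def mem_Collect_eq using h by (intro exI[of _ i] exI[of _ "inverse a"]) simp
  show "P h" using assms(3) h by simp
qed (use assms(2,4) in \<open>simp_all add: Tor_gen\<close>)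

lemma Tor_data: "t \<in> Tor n \<Longrightarrow> \<exists>\<tau> \<rho>. tor_data \<tau> \<rho> \<and> t = diag \<tau>"
proof (rule Tor_induct[where P = "\<lambda>t. \<exists>\<tau> \<rho>. tor_data \<tau> \<rho> \<and> t = diag \<tau>"])
  show "\<exists>\<tau> \<rho>. tor_data \<tau> \<rho> \<and> id = diag \<tau>" by (rule exI[of _ "\<lambda>\<mu>. 1"], rule exI[of _ "\<lambda>i. 1"]) (simp only: tor_data_one diag_one simp_thms)
  show "\<exists>\<tau> \<rho>. tor_data \<tau> \<rho> \<and> coroot n i a = diag \<tau>" if "i \<in> I" "a \<noteq> 0" for i a
    using coroot_data[OF that] coroot_diag by blast
  show "\<exists>\<tau> \<rho>. tor_data \<tau> \<rho> \<and> g \<circ> h = diag \<tau>"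
    if gh: "\<exists>\<tau> \<rho>. tor_data \<tau> \<rho> \<and> g = diag \<tau>" "\<exists>\<tau> \<rho>. tor_data \<tau> \<rho> \<and> h = diag \<tau>" for g h
  proof -
    obtain \<tau> \<rho> where 1: "tor_data \<tau> \<rho>" "g = diag \<tau>" using gh(1) by blast
    obtain \<sigma> \<pi> where 2: "tor_data \<sigma> \<pi>" "h = diag \<sigma>" using gh(2) by blast
    show ?thesis unfolding 1(2) 2(2) diag_comp using tor_data_mult[OF 1(1) 2(1)] by blast
  qed
qed

lemma diag_xs:
  assumes "tor_data \<tau> \<rho>" "i \<in> I"
  shows "diag \<tau> \<circ> xs s i a = xs s i (\<rho> i powi s * a) \<circ> diag \<tau>"
proof (intro ext)
  fix v \<mu>
  have "\<tau> \<mu> = \<rho> i powi \<mu> i * \<tau> (reflect n i \<mu>)" if "\<mu> \<in> mw"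
    using assms that by (auto simp: tor_data_def power_int_minus field_simps)
  then show "(diag \<tau> \<circ> xs s i a) v \<mu> = (xs s i (\<rho> i powi s * a) \<circ> diag \<tau>) v \<mu>"
    by (auto simp: diag_def xs_def algebra_simps)
qed

lemma root_char_data:
  assumes "tor_data \<tau> \<rho>" "i \<in> I"
  shows "root_char n i (diag \<tau>) = \<rho> i"
proof -
  have b: "bij (diag \<tau>)" using assms(1) by (auto simp: tor_data_def intro: diag_inverse)
  have c: "diag \<tau> \<circ> xg n i a \<circ> inv\<^bsub>Amb\<^esub> (diag \<tau>) = xg n i (\<rho> i * a)" for a
    using cj_eqI[OF b diag_xs[OF assms, of 1 a]] by (simp add: cj_def inv_Amb[OF b] xg_xs)
  show ?thesis unfolding root_char_def
  proof (rule the_equality)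
    show "\<forall>a. diag \<tau> \<circ> xg n i a \<circ> inv\<^bsub>Amb\<^esub> (diag \<tau>) = xg n i (\<rho> i * a)"
      using c by blast
    fix z assume z: "\<forall>a. diag \<tau> \<circ> xg n i a \<circ> inv\<^bsub>Amb\<^esub> (diag \<tau>) = xg n i (z * a)"
    have "xs 1 i (\<rho> i * 1) = xs 1 i (z * 1)" using c[of 1, symmetric] z[rule_format, of 1] unfolding xg_xs by (rule trans)
    then have "chiv 1 i (xs 1 i (\<rho> i * 1)) = chiv 1 i (xs 1 i (z * 1))" by (rule arg_cong)
    then show "z = \<rho> i" using chiv_gen[of 1 i i] assms(2) by simp
  qed
qed

lemma Tor_root_char:
  assumes "t \<in> Tor n"
  obtains \<tau> where "tor_data \<tau> (\<lambda>i. if i \<in> I then root_char n i t else 1)" "t = diag \<tau>"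
proof -
  obtain \<tau> \<rho> where 1: "tor_data \<tau> \<rho>" "t = diag \<tau>" using Tor_data[OF assms] by blast
  \<comment> \<open>The value 1 outside the index set is a filler: \<open>tor_data\<close> asks for
    nonzero \<rho> at every index, while \<open>root_char\<close> is controlled only on
    {1..n}.\<close>
  have "tor_data \<tau> (\<lambda>i. if i \<in> I then root_char n i t else 1)"
    using 1(1) root_char_data[OF 1(1)] unfolding tor_data_def 1(2) by simp
  then show ?thesis using that 1 by blast
qed

lemma root_char_nonzero: "t \<in> Tor n \<Longrightarrow> i \<in> I \<Longrightarrow> root_char n i t \<noteq> 0"
  by (erule Tor_root_char) (simp only: tor_data_def if_True, metis)

lemma Tor_xs:
  assumes "t \<in> Tor n" "i \<in> I"
  shows "t \<circ> xs s i a = xs s i (root_char n i t powi s * a) \<circ> t"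
proof -
  obtain \<tau> where 1: "tor_data \<tau> (\<lambda>i. if i \<in> I then root_char n i t else 1)" "t = diag \<tau>"
    by (rule Tor_root_char[OF assms(1)])
  show ?thesis using diag_xs[OF 1(1) assms(2), of s a] assms(2) unfolding 1(2) by simp
qed

lemma root_char_comp:
  assumes "t \<in> Tor n" "t' \<in> Tor n" "i \<in> I"
  shows "root_char n i (t \<circ> t') = root_char n i t * root_char n i t'"
proof -
  obtain \<tau> \<rho> where 1: "tor_data \<tau> \<rho>" "t = diag \<tau>" using Tor_data[OF assms(1)] by blast
  obtain \<sigma> \<pi> where 2: "tor_data \<sigma> \<pi>" "t' = diag \<sigma>" using Tor_data[OF assms(2)] by blast
  have "root_char n i t = \<rho> i" "root_char n i t' = \<pi> i" "root_char n i (t \<circ> t') = \<rho> i * \<pi> i"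
    unfolding 1(2) 2(2) diag_comp
    using root_char_data[OF 1(1) assms(3)] root_char_data[OF 2(1) assms(3)]
      root_char_data[OF tor_data_mult[OF 1(1) 2(1)] assms(3)] by simp_all
  then show ?thesis by simp
qed

lemma root_char_coroot: "i \<in> I \<Longrightarrow> j \<in> I \<Longrightarrow> a \<noteq> 0 \<Longrightarrow> root_char n i (coroot n j a) = a powi cartan n j i"
  unfolding coroot_diag by (subst root_char_data[OF coroot_data]) auto

lemma root_char_id: "i \<in> I \<Longrightarrow> root_char n i id = 1"
  using root_char_data[OF tor_data_one, of i] by (simp add: diag_one)

lemma Tor_normalizes:
  assumes s: "s = 1 \<or> s = -1" and t: "t \<in> Tor n" and u: "u \<in> Ug s"
  shows "cj t u \<in> Ug s \<and> (\<forall>i\<in>I. chiv s i (cj t u) = root_char n i t powi s * chiv s i u)"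
proof (rule Ug_induct[where P = "\<lambda>u. cj t u \<in> Ug s \<and> (\<forall>i\<in>I. chiv s i (cj t u) = root_char n i t powi s * chiv s i u)", OF s u])
  have b: "bij t" using Tor_ops t by blast
  show "cj t id \<in> Ug s \<and> (\<forall>i\<in>I. chiv s i (cj t id) = root_char n i t powi s * chiv s i id)"
    unfolding cj_id[OF b] using Ug_ops(1)[OF s] chiv_id[OF s] by simp
  show "cj t (xs s j a) \<in> Ug s \<and> (\<forall>i\<in>I. chiv s i (cj t (xs s j a)) = root_char n i t powi s * chiv s i (xs s j a))"
    if "j \<in> I" for j a
    unfolding cj_eqI[OF b Tor_xs[OF t that, of s a]]
    using Ug_ops(5)[OF s that] chiv_gen[OF s _ that] by simp
  show "cj t (g \<circ> h) \<in> Ug s \<and> (\<forall>i\<in>I. chiv s i (cj t (g \<circ> h)) = root_char n i t powi s * chiv s i (g \<circ> h))"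
    if "g \<in> Ug s" "h \<in> Ug s" and
      "cj t g \<in> Ug s \<and> (\<forall>i\<in>I. chiv s i (cj t g) = root_char n i t powi s * chiv s i g)"
      "cj t h \<in> Ug s \<and> (\<forall>i\<in>I. chiv s i (cj t h) = root_char n i t powi s * chiv s i h)" for g h
    unfolding cj_comp[OF b]
    using that Ug_ops(2)[OF s] chiv_comp[OF s] by (simp add: distrib_left)
qed

lemma Tor_pass:
  assumes s: "s = 1 \<or> s = -1" and t: "t \<in> Tor n" and u: "u \<in> Ug s"
  obtains u' where "u' \<in> Ug s" "u \<circ> t = t \<circ> u'" "\<And>i. i \<in> I \<Longrightarrow> chiv s i u' = root_char n i t powi (- s) * chiv s i u"
proof -
  have t': "finv t \<in> Tor n" and b: "bij t" using Tor_ops t by blast+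
  have 1: "cj (finv t) u \<in> Ug s" "\<forall>i\<in>I. chiv s i (cj (finv t) u) = root_char n i (finv t) powi s * chiv s i u"
    using Tor_normalizes[OF s t' u] by auto
  have "root_char n i (finv t) = inverse (root_char n i t)" if "i \<in> I" for i
    using root_char_comp[OF t t' that] root_char_id[OF that] unfolding comp_inv_cancel(2)[OF b]
    by (simp add: inverse_unique)
  then have "chiv s i (cj (finv t) u) = root_char n i t powi (- s) * chiv s i u" if "i \<in> I" for i
    using 1(2) that by (simp add: power_int_inverse power_int_minus)
  moreover have "u \<circ> t = t \<circ> cj (finv t) u"
    using b by (simp add: cj_def comp_assoc comp_inv_cancel bij_imp_bij_inv inv_inv_eq)
  ultimately show ?thesis using that 1(1) by blast
qed

text \<open>Split the vector at the level of \<mu>. On the half whose s-level is at most that of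
  \<mu>, u' has no effect at \<mu>; on the other half u, and hence t u = u', gives 0 at \<mu>.
  Together u' acts as the identity.\<close>

lemma triangular_trivial:
  assumes s: "s = 1 \<or> s = -1" and t: "t \<in> Tor n" and u: "u \<in> Ug s" and u': "u' \<in> Ug (- s)" and eq: "t \<circ> u = u'"
  shows "u' = id"
proof (intro ext)
  fix v :: vec and \<mu>
  have s': "- s = 1 \<or> - s = -1" using s by auto
  define v1 where "v1 \<kappa> = (if - s * lev \<kappa> < - s * lev \<mu> then v \<kappa> else 0)" for \<kappa>
  define v2 where "v2 \<kappa> = (if - s * lev \<kappa> < - s * lev \<mu> then 0 else v \<kappa>)" for \<kappa>
  have "u' v2 \<mu> = v2 \<mu>" by (rule Ug_unipotent[OF s' u']) (auto simp: v2_def)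
  moreover have "u v1 \<mu> = v1 \<mu>" by (rule Ug_unipotent[OF s u]) (auto simp: v1_def)
  then have "u' v1 \<mu> = 0" using Tor_data[OF t] eq by (auto simp: diag_def v1_def)
  moreover have "u' (\<lambda>\<kappa>. v1 \<kappa> + v2 \<kappa>) \<mu> = u' v1 \<mu> + u' v2 \<mu>" by (rule lin_add[OF lin_Ug[OF s' u']])
  moreover have "(\<lambda>\<kappa>. v1 \<kappa> + v2 \<kappa>) = v" by (auto simp: v1_def v2_def)
  ultimately show "u' v \<mu> = id v \<mu>" by (simp add: v2_def)
qed

lemma Tor_Uneg_unique:
  assumes "t \<in> Tor n" "t' \<in> Tor n" "u \<in> Ug (-1)" "u' \<in> Ug (-1)" "t \<circ> u = t' \<circ> u'"
  shows "t = t' \<and> u = u'"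
proof -
  have b: "bij t'" "bij u" using Tor_ops(4) Ug_ops(4)[of "-1"] assms by auto
  have "finv t' \<circ> t = u' \<circ> finv u"
  proof -
    have "finv t' \<circ> t = finv t' \<circ> (t \<circ> u) \<circ> finv u" using b by (simp add: comp_assoc comp_inv_cancel)
    also have "\<dots> = u' \<circ> finv u" unfolding assms(5) using b by (simp add: comp_assoc comp_inv_cancel)
    finally show ?thesis .
  qed
  then have eq: "(finv t' \<circ> t) \<circ> id = u' \<circ> finv u" by simp
  have m: "finv t' \<circ> t \<in> Tor n" "u' \<circ> finv u \<in> Ug (- 1)" "id \<in> Ug 1" using Tor_ops Ug_ops[of "-1"] Ug_ops[of 1] assms by auto
  have e: "u' \<circ> finv u = id" using triangular_trivial[OF _ m(1,3,2) eq] by simp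
  then have "u' \<circ> finv u \<circ> u = u" by simp
  then have "u = u'" using b by (simp add: comp_assoc comp_inv_cancel)
  moreover have "t' \<circ> (finv t' \<circ> t) = t'" using e eq by simp
  then have "t = t'" using b by (simp add: comp_inv_cancel)
  ultimately show ?thesis by simp
qed

lemma parts:
  assumes "t \<in> Tor n" "u \<in> Ug (-1)"
  shows "tor_part n (t \<circ> u) = t" "neg_part n (t \<circ> u) = u"
  unfolding tor_part_def neg_part_def Uneg_Ug
  by (rule the_equality; use assms Tor_Uneg_unique in blast)+

text \<open>Two factorizations differ by an element lying both in the torus times the lower
  unipotent group and in U; it is the identity by \<open>triangular_trivial\<close> once the torus
  factor has been moved to the left.\<close>

lemma pi_pos_eq:
  assumes "t \<in> Tor n" "u \<in> Ug (-1)" "p \<in> Ug 1"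
  shows "pi_pos n (t \<circ> u \<circ> p) = p"
  unfolding pi_pos_def Upos_Ug Bneg_def Uneg_Ug
proof (rule the_equality)
  show "p \<in> Ug 1 \<and> (\<exists>b\<in>{t \<circ> u |t u. t \<in> Tor n \<and> u \<in> Ug (- 1)}. t \<circ> u \<circ> p = b \<circ> p)" using assms by blast
next
  fix p' assume "p' \<in> Ug 1 \<and> (\<exists>b\<in>{t \<circ> u |t u. t \<in> Tor n \<and> u \<in> Ug (- 1)}. t \<circ> u \<circ> p = b \<circ> p')"
  then obtain t' u' where p': "p' \<in> Ug 1" "t' \<in> Tor n" "u' \<in> Ug (-1)" and eq: "t \<circ> u \<circ> p = t' \<circ> u' \<circ> p'" by blast
  have b: "bij t'" "bij u" "bij p" "bij u'" "bij p'" using Tor_ops(4) Ug_ops(4)[of "-1"] Ug_ops(4)[of 1] assms p' by auto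
  have x: "finv t' \<circ> t \<in> Tor n" "finv u' \<in> Ug (-1)" using Tor_ops Ug_ops[of "-1"] assms p' by auto
  obtain w where w: "w \<in> Ug (-1)" "finv u' \<circ> (finv t' \<circ> t) = (finv t' \<circ> t) \<circ> w"
    by (rule Tor_pass[OF _ x]) auto
  have "finv u' \<circ> finv t' \<circ> (t \<circ> u \<circ> p) \<circ> finv p = p' \<circ> finv p"
    unfolding eq using b by (simp add: comp_assoc comp_inv_cancel)
  moreover have "finv u' \<circ> finv t' \<circ> (t \<circ> u \<circ> p) \<circ> finv p = finv u' \<circ> (finv t' \<circ> t) \<circ> u"
    using b by (simp add: comp_assoc comp_inv_cancel)
  ultimately have "(finv t' \<circ> t) \<circ> (w \<circ> u) = p' \<circ> finv p" using w(2) by (simp add: comp_assoc)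
  moreover have "w \<circ> u \<in> Ug (-1)" "p' \<circ> finv p \<in> Ug (- (-1))" using Ug_ops[of "-1"] Ug_ops[of 1] w assms p' by auto
  ultimately have "p' \<circ> finv p = id" using triangular_trivial[of "-1"] x by blast
  then have "p' \<circ> finv p \<circ> p = p" by simp
  then show "p' = p" using b by (simp add: comp_assoc comp_inv_cancel)
qed

section \<open>Conjugation by the Coxeter element\<close>

definition W :: "nat list \<Rightarrow> elt" where
  "W ls = foldr (\<circ>) (map sb ls) id"

lemma W_Nil: "W [] = id"
  by (simp add: W_def)

lemma W_Cons: "W (i # ys) = sb i \<circ> W ys"
  by (simp add: W_def)

lemma W_single: "W [i] = sb i"
  by (simp add: W_def)

lemma W_append: "W (ks @ ys) = W ks \<circ> W ys"
  by (induction ks) (simp_all only: append_Nil append_Cons W_Nil W_Cons comp_assoc id_o)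

lemma bij_W: "set ls \<subseteq> I \<Longrightarrow> bij (W ls)"
proof (induction ls)
  case Nil then show ?case by (simp only: W_Nil bij_id)
next
  case (Cons i ls)
  then have "bij (sb i)" "bij (W ls)" using bij_sb[of i] by auto
  then show ?case unfolding W_Cons by (rule bij_comp[rotated])
qed

lemma cj_W_append: "set ks \<subseteq> I \<Longrightarrow> set ys \<subseteq> I \<Longrightarrow> cj (W (ks @ ys)) h = cj (W ks) (cj (W ys) h)"
  unfolding W_append by (rule cj_cj[OF bij_W bij_W])

lemma cj_W_Cons: "i \<in> I \<Longrightarrow> set ys \<subseteq> I \<Longrightarrow> cj (W (i # ys)) h = cj (sb i) (cj (W ys) h)"
  unfolding W_Cons by (rule cj_cj[OF bij_sb bij_W])

lemma cj_W_Nil: "cj (W []) h = h"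
  by (simp only: W_Nil cj_by_id)

lemma cj_sb_commute: "i \<in> I \<Longrightarrow> j \<in> I \<Longrightarrow> cartan n i j = 0 \<Longrightarrow> cj (sb i) (xs s j a) = xs s j a"
  by (rule cj_eqI) (auto intro: bij_sb sb_xs_commute)

lemma cj_sb_same: "i \<in> I \<Longrightarrow> s = 1 \<or> s = -1 \<Longrightarrow> cj (sb i) (xs s i a) = xs (- s) i (- a)"
  by (rule cj_eqI) (auto intro: bij_sb sb_xs_same)

lemma cj_sb_sb:
  assumes "i \<in> I" "j \<in> I" "cartan n i j = -1" "s = 1 \<or> s = -1"
  shows "cj (sb i) (cj (sb j) (xs s i a)) = xs s j a"
proof -
  have b: "bij (sb i)" "bij (sb j)" using bij_sb assms by auto
  show ?thesis unfolding cj_cj[OF b, symmetric]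
    by (rule cj_eqI[OF bij_comp[OF b(2,1)]]) (use sb_sb_xs[OF assms] in \<open>simp only: comp_assoc\<close>)
qed

lemma cj_cj_cj: "bij f \<Longrightarrow> bij g \<Longrightarrow> bij k \<Longrightarrow> cj (f \<circ> g \<circ> k) h = cj f (cj g (cj k h))"
  by (simp only: cj_cj bij_comp)

lemma cj_sb_adjacent: "i \<in> I \<Longrightarrow> j \<in> I \<Longrightarrow> cartan n i j = -1 \<Longrightarrow> s = 1 \<or> s = -1 \<Longrightarrow>
    cj (sb i) (xs s j a) = xs s i 1 \<circ> xs s j (- of_int s * a) \<circ> xs s i (-1) \<circ> xs s j (of_int s * a)"
  by (rule cj_eqI) (auto intro: bij_sb simp only: sb_xs_adjacent)

lemma cj_sb_transfer:
  assumes "bij g" "i \<in> I" "j \<in> I"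
    "\<And>s a. s = 1 \<or> s = -1 \<Longrightarrow> cj g (xs s i a) = xs s j a"
  shows "cj g (sb i) = sb j"
  using assms(2,3) by (simp add: sb_y cj_comp[OF assms(1)] assms(4))

lemma sb_dual: "i \<in> I \<Longrightarrow> sb i = xs 1 i (-1) \<circ> xs (-1) i 1 \<circ> xs 1 i (-1)"
  using sbar_sb[of i] by (simp add: sbar_def xg_xs yg_xs)

text \<open>The variant for conjugations that exchange positive and negative root subgroups, such as
  the one by w0. The image of one expression for \<open>sb\<close> is the other one.\<close>

lemma cj_sb_transfer':
  assumes "bij g" "i \<in> I" "j \<in> I"
    "\<And>s a. s = 1 \<or> s = -1 \<Longrightarrow> cj g (xs s i a) = xs (- s) j (- a)"
  shows "cj g (sb i) = sb j"
  unfolding sb_y[OF assms(2)] cj_comp[OF assms(1)] using assms(4)[of 1] assms(4)[of "-1"] sb_dual[OF assms(3)] by simp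

lemma braid: "i \<in> I \<Longrightarrow> j \<in> I \<Longrightarrow> cartan n i j = -1 \<Longrightarrow> sb i \<circ> sb j \<circ> sb i = sb j \<circ> sb i \<circ> sb j"
proof -
  assume a: "i \<in> I" "j \<in> I" "cartan n i j = -1"
  have b: "bij (sb i \<circ> sb j)" by (rule bij_comp[OF bij_sb[OF a(2)] bij_sb[OF a(1)]])
  have "cj (sb i \<circ> sb j) (sb i) = sb j"
    by (rule cj_sb_transfer[OF b a(1,2)]) (use cj_sb_sb[OF a] cj_cj[OF bij_sb[OF a(1)] bij_sb[OF a(2)]] in auto)
  then show ?thesis using cj_eqD[OF b] by (simp add: comp_assoc)
qed

lemma sb_commute: "i \<in> I \<Longrightarrow> j \<in> I \<Longrightarrow> cartan n i j = 0 \<Longrightarrow> sb i \<circ> sb j = sb j \<circ> sb i"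
  by (rule cj_eqD[OF bij_sb]) (auto intro!: cj_sb_transfer bij_sb cj_sb_commute)

lemma W_sb_commute: "set ls \<subseteq> I \<Longrightarrow> j \<in> I \<Longrightarrow> (\<And>i. i \<in> set ls \<Longrightarrow> cartan n i j = 0) \<Longrightarrow> W ls \<circ> sb j = sb j \<circ> W ls"
proof (induction ls)
  case (Cons i ls)
  have ih: "W ls \<circ> sb j = sb j \<circ> W ls" by (rule Cons.IH) (use Cons.prems in auto)
  have c: "sb i \<circ> sb j = sb j \<circ> sb i" by (rule sb_commute) (use Cons.prems in auto)
  have "W (i # ls) \<circ> sb j = sb i \<circ> (W ls \<circ> sb j)" by (simp only: W_Cons comp_assoc)
  also have "\<dots> = (sb i \<circ> sb j) \<circ> W ls" by (simp only: ih comp_assoc)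
  also have "\<dots> = sb j \<circ> W (i # ls)" by (simp only: c W_Cons comp_assoc)
  finally show ?case .
qed (simp only: W_Nil id_o o_id)

lemma cj_W_commute: "set ls \<subseteq> I \<Longrightarrow> j \<in> I \<Longrightarrow> (\<And>i. i \<in> set ls \<Longrightarrow> cartan n i j = 0) \<Longrightarrow> cj (W ls) (xs s j a) = xs s j a"
proof (induction ls)
  case Nil then show ?case by (simp only: cj_W_Nil)
next
  case (Cons i ls)
  have "cj (W ls) (xs s j a) = xs s j a" using Cons by auto
  moreover have "cj (sb i) (xs s j a) = xs s j a" by (rule cj_sb_commute) (use Cons.prems in auto)
  moreover have "cj (W (i # ls)) (xs s j a) = cj (sb i) (cj (W ls) (xs s j a))" by (rule cj_W_Cons) (use Cons.prems in auto)
  ultimately show ?case by simp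
qed

text \<open>The element g sends the root s \<alpha>_i to a positive root, expressed through root
  subgroups.\<close>

definition in_U :: "elt \<Rightarrow> nat \<Rightarrow> int \<Rightarrow> bool" where
  "in_U g i s \<longleftrightarrow> (\<forall>a. cj g (xs s i a) \<in> Ug 1)"

text \<open>\<open>s_i\<close> \<alpha>_j = \<alpha>_i + \<alpha>_j, and the corresponding subgroup
  consists of commutators of the two simple ones.\<close>

lemma in_U_adjacent:
  assumes g: "bij g" and ij: "i \<in> I" "j \<in> I" "cartan n i j = -1" and "in_U g i 1" "in_U g j 1"
  shows "in_U (g \<circ> sb i) j 1"
  unfolding in_U_def cj_cj[OF g bij_sb[OF ij(1)]]
  using assms(5,6) unfolding in_U_def
  by (auto simp: cj_sb_adjacent[OF ij] cj_comp[OF g] intro!: Ug_ops(2))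

text \<open>Here \<alpha>_i is the sum of \<alpha>_i + \<alpha>_j and -\<alpha>_j; the root subgroup
  of \<alpha>_i is recovered as commutators of the other two by conjugating the commutator formula
  back with \<open>s_j\<close>.\<close>

lemma in_U_commutator:
  assumes g: "bij g" and ij: "i \<in> I" "j \<in> I" "cartan n i j = -1" and "in_U (g \<circ> sb i) j 1" "in_U g j (-1)"
  shows "in_U g i 1"
  unfolding in_U_def
proof
  fix a
  have c: "cartan n j i = -1" using ij cartan_sym[of n i j] by simp
  have b: "bij (sb j)" "bij (finv (sb j))" using bij_sb[OF ij(2)] bij_imp_bij_inv by blast+
  have 1: "cj (finv (sb j)) (xs 1 j x) = xs (-1) j (- x)" for x
    by (rule cj_swap[OF b(1)]) (use cj_sb_same[of j "-1" "- x"] ij in simp)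
  have 2: "cj (finv (sb j)) (xs 1 i x) = cj (sb i) (xs 1 j x)" for x
    by (rule cj_swap[OF b(1)]) (use cj_sb_sb[OF ij(2,1) c] in simp)
  have "xs 1 i a = cj (finv (sb j)) (cj (sb j) (xs 1 i a))"
    using cj_swap[OF b(1)] by simp
  also have "\<dots> = xs (-1) j (-1) \<circ> cj (sb i) (xs 1 j (- a)) \<circ> xs (-1) j 1 \<circ> cj (sb i) (xs 1 j a)"
    by (simp add: cj_sb_adjacent[OF ij(2,1) c] cj_comp[OF b(2)] 1 2)
  finally have 3: "cj g (xs 1 i a) = cj g (xs (-1) j (-1)) \<circ> cj (g \<circ> sb i) (xs 1 j (- a)) \<circ> cj g (xs (-1) j 1) \<circ> cj (g \<circ> sb i) (xs 1 j a)"
    by (simp add: cj_comp[OF g] cj_cj[OF g bij_sb[OF ij(1)]])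
  show "cj g (xs 1 i a) \<in> Ug 1"
    unfolding 3 using assms(5,6) unfolding in_U_def by (intro Ug_ops(2)) auto
qed

lemma upt_snoc: "p \<le> q \<Longrightarrow> [p..<Suc q] = [p..<q] @ [q]"
  by simp

text \<open>\<open>s_p\<close> ... \<open>s_(q-1)\<close> \<alpha>_q = \<alpha>_p + ... +
  \<alpha>_q; one letter is peeled off at the right end.\<close>

lemma in_U_chain:
  "1 \<le> p \<Longrightarrow> p \<le> q \<Longrightarrow> q \<le> n - 1 \<Longrightarrow> in_U (W [p..<q]) q 1"
proof (induction "q - p" arbitrary: q)
  case 0
  then have "q = p" "p \<in> I" by auto
  then show ?case using Ug_ops(5)[of 1 p] by (simp add: in_U_def cj_W_Nil)
next
  case (Suc k)
  then obtain q' where q': "q = Suc q'" by (cases q) auto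
  have I: "q' \<in> I" "q \<in> I" "set [p..<q'] \<subseteq> I" using Suc q' by auto
  have "in_U (W [p..<q'] \<circ> sb q') q 1"
  proof (rule in_U_adjacent[OF bij_W[OF I(3)] I(1,2)])
    show "cartan n q' q = -1" using Suc q' n4 by (auto simp: cartan_def doubleton_eq_iff)
    show "in_U (W [p..<q']) q' 1" using Suc q' by (intro Suc(1)) auto
    have "cj (W [p..<q']) (xs 1 q a) = xs 1 q a" for a
      by (rule cj_W_commute[OF I(3,2)]) (use Suc q' in \<open>auto simp: cartan_def doubleton_eq_iff\<close>)
    then show "in_U (W [p..<q']) q 1" unfolding in_U_def using Ug_ops(5)[of 1] I(2) by simp
  qed
  then show ?case using Suc q' by (simp add: upt_snoc W_append W_single del: upt_Suc)
qed

text \<open>The branch to the last node: the root is \<alpha>_p + ... + \<alpha>_(n-2) +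
  \<alpha>_n.\<close>

lemma in_U_chain_n:
  "1 \<le> p \<Longrightarrow> p \<le> n - 1 \<Longrightarrow> in_U (W [p..<n - 1]) n 1"
proof (cases "p = n - 1")
  case True
  then show ?thesis using Ug_ops(5)[of 1 n] n4 by (simp add: in_U_def cj_W_Nil)
next
  case False
  assume p: "1 \<le> p" "p \<le> n - 1"
  have I: "n - 2 \<in> I" "n \<in> I" "set [p..<n - 2] \<subseteq> I" using p n4 by auto
  have "in_U (W [p..<n - 2] \<circ> sb (n - 2)) n 1"
  proof (rule in_U_adjacent[OF bij_W[OF I(3)] I(1,2)])
    show "cartan n (n - 2) n = -1" using cartan_vals by simp
    show "in_U (W [p..<n - 2]) (n - 2) 1" using p False by (intro in_U_chain) auto
    have "cj (W [p..<n - 2]) (xs 1 n a) = xs 1 n a" for a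
      by (rule cj_W_commute[OF I(3,2)]) (auto simp: cartan_def doubleton_eq_iff)
    then show "in_U (W [p..<n - 2]) n 1" unfolding in_U_def using Ug_ops(5)[of 1] I(2) by simp
  qed
  moreover have "[p..<n - 1] = [p..<n - 2] @ [n - 2]"
    using upt_snoc[of p "n - 2"] p False n4 by (simp add: Suc_diff_Suc numeral_2_eq_2)
  ultimately show ?thesis by (simp only: W_append W_single)
qed

text \<open>On weights the Coxeter element sends \<epsilon>_1 to \<epsilon>_2, ..., \<epsilon>_(n-2)
  to \<epsilon>_(n-1), \<epsilon>_(n-1) to -\<epsilon>_1, and \<epsilon>_n to -\<epsilon>_n. The
  lemmas below establish what this means for root subgroups, with exact parameters.\<close>

definition cox :: elt where
  "cox = W [1..<n + 1]"

lemma bij_cox: "bij cox"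
  unfolding cox_def by (rule bij_W) auto

lemma cox_split: "cox = W ([1..<n - 2] @ [n - 2, n - 1, n])"
proof -
  have "[1..<n + 1] = [1..<n - 2] @ [n - 2..<n + 1]"
    using upt_add_eq_append[of 1 "n - 2" 3] n4 by simp
  also have "[n - 2..<n + 1] = [n - 2, n - 1, n]"
    using n4 by (simp add: upt_conv_Cons Suc_diff_Suc numeral_2_eq_2)
  finally show ?thesis by (simp only: cox_def)
qed

lemma cj_cox: "cj cox h = cj (W [1..<n - 2]) (cj (sb (n - 2)) (cj (sb (n - 1)) (cj (sb n) h)))"
proof -
  have "set [1..<n - 2] \<subseteq> I" "set [n - 2, n - 1, n] \<subseteq> I" "set [n - 1, n] \<subseteq> I" "set [n] \<subseteq> I" "n - 2 \<in> I" "n - 1 \<in> I" "n \<in> I" "set [] \<subseteq> I"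
    using n4 by auto
  then show ?thesis unfolding cox_split by (simp only: cj_W_append cj_W_Cons cj_W_Nil)
qed

text \<open>\<alpha>_i goes to \<alpha>_(i+1): the letters after i + 1 do not meet \<alpha>_i,
  \<open>s_i s_(i+1)\<close> moves it to \<alpha>_(i+1), and the letters before i do not meet that
  root. The bound i + 3 \<le> n keeps away from the branch point.\<close>

lemma cox_shift_xs:
  assumes "1 \<le> i" "i + 3 \<le> n" "s = 1 \<or> s = -1"
  shows "cj cox (xs s i a) = xs s (i + 1) a"
proof -
  have l: "[1..<n + 1] = [1..<i] @ i # (i + 1) # [i + 2..<n + 1]"
    using assms upt_add_eq_append[of 1 i "n + 1 - i"] by (simp add: upt_conv_Cons)
  have I: "set [1..<i] \<subseteq> I" "set (i # (i + 1) # [i + 2..<n + 1]) \<subseteq> I" "set ((i + 1) # [i + 2..<n + 1]) \<subseteq> I"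
    "set [i + 2..<n + 1] \<subseteq> I" "i \<in> I" "i + 1 \<in> I" using assms by auto
  have 1: "cj (W [i + 2..<n + 1]) (xs s i a) = xs s i a"
    by (rule cj_W_commute[OF I(4,5)]) (use assms in \<open>auto simp: cartan_def doubleton_eq_iff\<close>)
  have 2: "cj (sb i) (cj (sb (i + 1)) (xs s i a)) = xs s (i + 1) a"
    by (rule cj_sb_sb[OF I(5,6) _ assms(3)]) (use assms in \<open>auto simp: cartan_def doubleton_eq_iff\<close>)
  have 3: "cj (W [1..<i]) (xs s (i + 1) a) = xs s (i + 1) a"
    by (rule cj_W_commute[OF I(1,6)]) (use assms in \<open>auto simp: cartan_def doubleton_eq_iff\<close>)
  show ?thesis unfolding cox_def l cj_W_append[OF I(1,2)] cj_W_Cons[OF I(5,3)] cj_W_Cons[OF I(6,4)] 1 2 3 ..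
qed

lemma cox_shift_sb: "1 \<le> i \<Longrightarrow> i + 3 \<le> n \<Longrightarrow> cj cox (sb i) = sb (i + 1)"
  by (rule cj_sb_transfer[OF bij_cox _ _ cox_shift_xs]) simp_all

lemma cox_shift_list:
  "(\<And>i. i \<in> set ls \<Longrightarrow> 1 \<le> i \<and> i + 3 \<le> n) \<Longrightarrow> cj cox (cj (W ls) h) = cj (W (map Suc ls)) (cj cox h)"
proof (induction ls)
  case Nil
  then show ?case by (simp only: list.map cj_W_Nil)
next
  case (Cons i ls)
  have i: "1 \<le> i" "i + 3 \<le> n" "i \<in> I" "Suc i \<in> I" using Cons(2)[of i] by auto
  have ls: "set ls \<subseteq> I" "set (map Suc ls) \<subseteq> I" using Cons(2) by fastforce+
  have e: "cox \<circ> sb i = sb (Suc i) \<circ> cox" using cox_shift_sb[OF i(1,2)] cj_eqD[OF bij_cox] by simp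
  have "cj cox (cj (W (i # ls)) h) = cj (cox \<circ> sb i) (cj (W ls) h)"
    unfolding cj_W_Cons[OF i(3) ls(1)] cj_cj[OF bij_cox bij_sb[OF i(3)]] ..
  also have "\<dots> = cj (sb (Suc i)) (cj cox (cj (W ls) h))"
    unfolding e cj_cj[OF bij_sb[OF i(4)] bij_cox] ..
  also have "cj cox (cj (W ls) h) = cj (W (map Suc ls)) (cj cox h)" by (rule Cons.IH) (use Cons(2) in simp)
  also have "cj (sb (Suc i)) \<dots> = cj (W (map Suc (i # ls))) (cj cox h)"
    unfolding list.map cj_W_Cons[OF i(4) ls(2)] ..
  finally show ?case .
qed

lemma cox_shift_W:
  "1 \<le> p \<Longrightarrow> q + 2 \<le> n \<Longrightarrow> cj cox (cj (W [p..<q]) h) = cj (W [p + 1..<q + 1]) (cj cox h)"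
  using cox_shift_list[of "[p..<q]" h] by (simp add: map_Suc_upt del: upt_Suc)

text \<open>\<open>Ztop p e\<close> is conjugate to the root subgroup of \<open>\<epsilon>\<^sub>p - \<epsilon>\<^sub>n\<close> for \<open>e = n - 1\<close> and of
  \<open>\<epsilon>\<^sub>p + \<epsilon>\<^sub>n\<close> for \<open>e = n\<close>.\<close>

definition Ztop :: "nat \<Rightarrow> nat \<Rightarrow> complex \<Rightarrow> elt" where
  "Ztop p e a = cj (W [p..<n - 1]) (xs 1 e a)"

lemma cartan_ends: "cartan n (n - 1) n = 0" "cartan n n (n - 1) = 0"
  using n4 by (auto simp: cartan_def doubleton_eq_iff)

lemma end_nodes: "n - 2 \<in> I" "n - 1 \<in> I" "n \<in> I"
  "cartan n (n - 1) (n - 2) = -1" "cartan n n (n - 2) = -1" "cartan n (n - 2) (n - 1) = -1" "cartan n (n - 2) n = -1"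
  "cartan n (n - 1) n = 0" "cartan n n (n - 1) = 0"
  using cartan_vals(3-6) cartan_ends n4 by simp_all

lemma Ztop_in_U: "1 \<le> p \<Longrightarrow> p \<le> n - 1 \<Longrightarrow> e = n - 1 \<or> e = n \<Longrightarrow> Ztop p e a \<in> Ug 1"
  using in_U_chain[of p "n - 1"] in_U_chain_n[of p] by (auto simp: Ztop_def in_U_def)

lemma cox_Ztop:
  assumes "1 \<le> p" "p \<le> n - 2"
  shows "cj cox (Ztop p (n - 1) a) = Ztop (p + 1) n a" "cj cox (Ztop p n a) = Ztop (p + 1) (n - 1) a"
proof -
  note N = end_nodes
  have l: "[p..<n - 1] = [p..<n - 2] @ [n - 2]"
    using upt_snoc[of p "n - 2"] assms n4 by (simp add: Suc_diff_Suc numeral_2_eq_2)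
  have I: "set [p..<n - 2] \<subseteq> I" "set [n - 2] \<subseteq> I" "set [1..<n - 2] \<subseteq> I" using assms n4 by auto
  have l2: "n - 2 + 1 = n - 1" using n4 by simp
  have W1: "W [n - 2] = sb (n - 2)" by (rule W_single)
  have C: "cj cox (cj (W [p..<n - 1]) h) = cj (W [p + 1..<n - 1]) (cj cox (cj (sb (n - 2)) h))" for h
    unfolding l cj_W_append[OF I(1,2)] W1 using cox_shift_W[of p "n - 2"] assms unfolding l2 by simp
  have swap: "cj (sb (n - 1)) (cj (sb n) h) = cj (sb n) (cj (sb (n - 1)) h)" for h
    using cj_cj[OF bij_sb[OF N(2)] bij_sb[OF N(3)]] cj_cj[OF bij_sb[OF N(3)] bij_sb[OF N(2)]] sb_commute[OF N(2,3,8)] by metis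
  have K: "cj (W [1..<n - 2]) (xs 1 e a) = xs 1 e a" if "e = n - 1 \<or> e = n" for e
    by (rule cj_W_commute[OF I(3)]) (use that n4 in \<open>auto simp: cartan_def doubleton_eq_iff\<close>)
  have "cj cox (cj (sb (n - 2)) (xs 1 (n - 1) a)) = xs 1 n a"
    unfolding cj_cox swap using cj_sb_sb[OF N(2,1,4)] cj_sb_sb[OF N(1,3,7)] K by simp
  then show "cj cox (Ztop p (n - 1) a) = Ztop (p + 1) n a" unfolding Ztop_def C by simp
  have "cj cox (cj (sb (n - 2)) (xs 1 n a)) = xs 1 (n - 1) a"
    unfolding cj_cox using cj_sb_sb[OF N(3,1,5)] cj_sb_sb[OF N(1,2,6)] K by simp
  then show "cj cox (Ztop p n a) = Ztop (p + 1) (n - 1) a" unfolding Ztop_def C by simp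
qed

text \<open>-\<alpha>_(n-1) goes to \<epsilon>_1 - \<epsilon>_n and -\<alpha>_n to \<epsilon>_1 +
  \<epsilon>_n: negative roots first become positive here.\<close>

lemma cox_top_neg:
  "cj cox (xs (-1) (n - 1) a) = Ztop 1 (n - 1) (- a)" "cj cox (xs (-1) n a) = Ztop 1 n (- a)"
proof -
  note N = end_nodes
  have l: "[1..<n - 1] = [1..<n - 2] @ [n - 2]"
    using upt_snoc[of 1 "n - 2"] n4 by (simp add: Suc_diff_Suc numeral_2_eq_2)
  have I: "set [1..<n - 2] \<subseteq> I" "set [n - 2] \<subseteq> I" using n4 by auto
  have W1: "W [n - 2] = sb (n - 2)" by (rule W_single)
  show "cj cox (xs (-1) (n - 1) a) = Ztop 1 (n - 1) (- a)" "cj cox (xs (-1) n a) = Ztop 1 n (- a)"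
    unfolding Ztop_def l cj_W_append[OF I] W1 cj_cox
    using cj_sb_commute[OF N(3,2,9)] cj_sb_commute[OF N(2,3,8)] cj_sb_same[OF N(2), of "-1"] cj_sb_same[OF N(3), of "-1"] by simp_all
qed

text \<open>\<open>s_2\<close> ... \<open>s_q\<close> and \<open>s_1\<close> ...
  \<open>s_(q-1)\<close> together send \<alpha>_q to \<alpha>_1. The new letter q + 1 commutes past
  the inner chain up to q - 1, which leaves the rank-two identity and the statement for q.\<close>

lemma shifted_chain:
  assumes "1 \<le> q" "q \<le> n - 2" "s = 1 \<or> s = -1"
  shows "cj (W [2..<q + 1]) (cj (W [1..<q]) (xs s q a)) = xs s 1 a"
  using assms(1,2)
proof (induction q)
  case 0
  then show ?case by simp
next
  case (Suc q)
  show ?case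
  proof (cases "q = 0")
    case True
    then show ?thesis by (simp add: cj_W_Nil)
  next
    case False
    note step = Suc.prems False
  have I: "set [2..<q + 1] \<subseteq> I" "set [Suc q] \<subseteq> I" "set [1..<q] \<subseteq> I" "set [q] \<subseteq> I" "q \<in> I" "Suc q \<in> I" using step by auto
  have l: "[2..<Suc q + 1] = [2..<q + 1] @ [Suc q]" "[1..<Suc q] = [1..<q] @ [q]" using step by auto
  have W1: "W [Suc q] = sb (Suc q)" "W [q] = sb q" by (rule W_single)+
  have "W [1..<q] \<circ> sb (Suc q) = sb (Suc q) \<circ> W [1..<q]"
    by (rule W_sb_commute[OF I(3,6)]) (use step in \<open>auto simp: cartan_def doubleton_eq_iff\<close>)
  then have swap: "cj (sb (Suc q)) (cj (W [1..<q]) h) = cj (W [1..<q]) (cj (sb (Suc q)) h)" for h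
    using cj_cj[OF bij_sb[OF I(6)] bij_W[OF I(3)]] cj_cj[OF bij_W[OF I(3)] bij_sb[OF I(6)]] by metis
  have c: "cartan n (Suc q) q = -1" using step n4 by (auto simp: cartan_def doubleton_eq_iff)
  show ?thesis
    unfolding l cj_W_append[OF I(1,2)] cj_W_append[OF I(3,4)] W1 swap cj_sb_sb[OF I(6,5) c assms(3)]
    by (rule Suc.IH) (use step in simp_all)
  qed
qed

text \<open>Two applications are needed, since \<alpha>_(n-2) is first sent to \<epsilon>_(n-1) +
  \<epsilon>_1, which is not simple, and only then to -\<alpha>_1.\<close>

lemma cox_cox:
  assumes s: "s = 1 \<or> s = -1"
  shows "cj cox (cj cox (xs s (n - 2) a)) = xs (- s) 1 (- a)"
proof -
  note N = end_nodes
  have I: "set [1..<n - 2] \<subseteq> I" "set [n - 2] \<subseteq> I" "set [2..<n - 2] \<subseteq> I" "set [2..<n - 2 + 1] \<subseteq> I" using n4 by auto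
  have W1: "W [n - 2] = sb (n - 2)" by (rule W_single)
  have swap: "cj (sb (n - 1)) (cj (sb n) h) = cj (sb n) (cj (sb (n - 1)) h)" for h
    using cj_cj[OF bij_sb[OF N(2)] bij_sb[OF N(3)]] cj_cj[OF bij_sb[OF N(3)] bij_sb[OF N(2)]] sb_commute[OF N(2,3,8)] by metis
  have br: "cj (sb (n - 1)) (cj (sb (n - 2)) (cj (sb (n - 1)) h)) = cj (sb (n - 2)) (cj (sb (n - 1)) (cj (sb (n - 2)) h))" for h
  proof -
    have b: "bij (sb (n - 1))" "bij (sb (n - 2))" using bij_sb N by auto
    show ?thesis
      using arg_cong[OF braid[OF N(2,1,4)], of "\<lambda>g. cj g h"] by (simp only: cj_cj_cj b)
  qed
  \<comment> \<open>On roots the five reflections fix \<alpha>_(n-2); the braid relation turns the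
    word into three rank-two identities, so that no sign appears.\<close>
  have fix_: "cj (sb (n - 1)) (cj (sb n) (cj (sb (n - 2)) (cj (sb (n - 1)) (cj (sb n) (xs s (n - 2) a))))) = xs s (n - 2) a"
  proof -
    have "cj (sb (n - 1)) (cj (sb n) (cj (sb (n - 2)) (cj (sb (n - 1)) (cj (sb n) (xs s (n - 2) a)))))
        = cj (sb n) (cj (sb (n - 2)) (cj (sb (n - 1)) (cj (sb (n - 2)) (cj (sb n) (xs s (n - 2) a)))))"
      unfolding swap[of "cj (sb (n - 2)) _"] br ..
    also have "\<dots> = xs s (n - 2) a"
      by (simp only: cj_sb_sb[OF N(1,3,7) s] cj_sb_commute[OF N(2,3,8)] cj_sb_sb[OF N(3,1,5) s])
    finally show ?thesis .
  qed
  have l2: "[1..<n - 2] @ [n - 2] = [1..<n - 2 + 1]" using n4 by simp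
  have "cj cox (cj cox (xs s (n - 2) a)) =
     cj (W [2..<n - 2 + 1]) (cj cox (cj (sb (n - 2)) (cj (sb (n - 1)) (cj (sb n) (xs s (n - 2) a)))))"
    unfolding cj_cox[of "xs s (n - 2) a"] using cox_shift_W[of 1 "n - 2"] n4 by (simp add: numeral_2_eq_2)
  also have "\<dots> = cj (W [2..<n - 2 + 1]) (cj (W [1..<n - 2]) (cj (sb (n - 2)) (xs s (n - 2) a)))"
    unfolding cj_cox fix_ ..
  also have "\<dots> = xs (- s) 1 (- a)"
    unfolding cj_sb_same[OF N(1) s] by (rule shifted_chain) (use n4 s in auto)
  finally show ?thesis .
qed

lemma bij_funpow_cox: "bij (cox ^^ k)"
  using bij_cox by (induction k) (auto simp: bij_comp id_def[symmetric])

lemma cj_cox_Suc: "cj (cox ^^ Suc k) h = cj (cox ^^ k) (cj cox h)"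
  unfolding funpow_Suc_right by (rule cj_cj[OF bij_funpow_cox bij_cox])

lemma cj_cox_add: "cj (cox ^^ (k + m)) h = cj (cox ^^ k) (cj (cox ^^ m) h)"
  unfolding funpow_add by (rule cj_cj[OF bij_funpow_cox bij_funpow_cox])

lemma cox_pow_shift:
  assumes "s = 1 \<or> s = -1" "1 \<le> i" "i + k \<le> n - 2"
  shows "cj (cox ^^ k) (xs s i a) = xs s (i + k) a"
  using assms(2,3)
proof (induction k arbitrary: i)
  case 0 then show ?case by (simp add: cj_by_id id_def[symmetric])
next
  case (Suc k)
  then have "cj cox (xs s i a) = xs s (i + 1) a" using assms(1) n4 by (intro cox_shift_xs) auto
  then show ?case using Suc.IH[of "i + 1"] Suc.prems by (simp only: cj_cox_Suc) simp
qed

text \<open>n - 2 - i steps move \<alpha>_i to \<alpha>_(n-2), two more give -\<alpha>_1, and the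
  remaining k - (n - i) steps shift the index of the negative root.\<close>

lemma cox_pow_flip:
  assumes s: "s = 1 \<or> s = -1" and i: "1 \<le> i" "i \<le> n - 2" "n - i \<le> k" "k \<le> n - 1"
  shows "cj (cox ^^ k) (xs s i a) = xs (- s) (k + i + 1 - n) (- a)"
proof -
  have "k = (k - (n - i)) + (2 + (n - 2 - i))" using i by simp
  then have "cj (cox ^^ k) (xs s i a) = cj (cox ^^ (k - (n - i))) (cj (cox ^^ 2) (cj (cox ^^ (n - 2 - i)) (xs s i a)))"
    using cj_cox_add by metis
  also have "cj (cox ^^ (n - 2 - i)) (xs s i a) = xs s (n - 2) a"
    using cox_pow_shift[OF s, of i "n - 2 - i"] i by simp
  also have "cj (cox ^^ 2) (xs s (n - 2) a) = xs (- s) 1 (- a)"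
    using cox_cox[OF s] by (simp add: numeral_2_eq_2 cj_cj[OF bij_cox bij_cox])
  also have "cj (cox ^^ (k - (n - i))) (xs (- s) 1 (- a)) = xs (- s) (1 + (k - (n - i))) (- a)"
    by (rule cox_pow_shift) (use s i in auto)
  also have "1 + (k - (n - i)) = k + i + 1 - n" using i by simp
  finally show ?thesis .
qed

end

section \<open>The Bruhat cell and the anti-automorphism\<close>

lemma foldr_comp_append: "foldr (\<circ>) (ks @ ls) id = foldr (\<circ>) ks id \<circ> foldr (\<circ>) ls id"
  by (induction ks) (simp_all only: append_Nil append_Cons foldr.simps comp_assoc id_o o_apply id_apply)

lemma foldr_blocks:
  "foldr (\<circ>) (map g [1..<n * m + 1]) id =
   foldr (\<circ>) (map (\<lambda>j. foldr (\<circ>) (map (\<lambda>i. g (j * n + i)) [1..<n + 1]) id) [0..<m]) id"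
proof (induction m)
  case (Suc m)
  have "[1..<n * Suc m + 1] = [1..<n * m + 1] @ [n * m + 1..<n * m + 1 + n]"
    using upt_add_eq_append[of 1 "n * m + 1" n] by (simp add: algebra_simps)
  also have "[n * m + 1..<n * m + 1 + n] = map (\<lambda>i. m * n + i) [1..<n + 1]"
    by (rule nth_equalityI) (auto simp: algebra_simps simp del: upt_Suc)
  finally have l: "[1..<n * Suc m + 1] = [1..<n * m + 1] @ map (\<lambda>i. m * n + i) [1..<n + 1]" .
  have r: "[0..<Suc m] = [0..<m] @ [m]" by simp
  show ?case unfolding l r map_append foldr_comp_append Suc.IH
    by (simp add: comp_def del: upt_Suc)
qed simp

lemma foldr_const: "foldr (\<circ>) (map (\<lambda>j. f) [0..<m]) id = f ^^ m"
proof (induction m)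
  case (Suc m)
  have r: "[0..<Suc m] = [0..<m] @ [m]" by simp
  have "foldr (\<circ>) (map (\<lambda>j. f) [0..<Suc m]) id = f ^^ m \<circ> f"
    unfolding r map_append foldr_comp_append Suc.IH by simp
  then show ?case by (simp only: funpow_Suc_right)
qed (simp add: id_def)

lemma letter_block: "1 \<le> i \<Longrightarrow> i \<le> n \<Longrightarrow> letter n (j * n + i) = i"
  by (cases i) (auto simp: letter_def)

context type_D
begin

lemma cox_pow_W:
  "1 \<le> p \<Longrightarrow> q + k + 1 \<le> n \<Longrightarrow> cj (cox ^^ k) (cj (W [p..<q]) h) = cj (W [p + k..<q + k]) (cj (cox ^^ k) h)"
proof (induction k arbitrary: p q h)
  case 0
  then show ?case by (simp add: cj_by_id id_def[symmetric])
next
  case (Suc k)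
  have "cj cox (cj (W [p..<q]) h) = cj (W [p + 1..<q + 1]) (cj cox h)"
    by (rule cox_shift_W) (use Suc.prems in auto)
  moreover have "cj (cox ^^ k) (cj (W [p + 1..<q + 1]) (cj cox h)) = cj (W [p + 1 + k..<q + 1 + k]) (cj (cox ^^ k) (cj cox h))"
    by (rule Suc.IH) (use Suc.prems in auto)
  ultimately show ?case by (simp only: cj_cox_Suc) simp
qed

text \<open>\<open>2 * n - 1 - e\<close> exchanges n - 1 and n; each step changes the sign of
  \<epsilon>_n.\<close>

lemma cox_pow_Ztop':
  assumes "e = n - 1 \<or> e = n" "1 \<le> p" "p + k \<le> n - 1"
  shows "cj (cox ^^ k) (Ztop p e a) = Ztop (p + k) (if even k then e else 2 * n - 1 - e) a"
  using assms
proof (induction k arbitrary: p e)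
  case 0 then show ?case by (simp add: cj_by_id id_def[symmetric])
next
  case (Suc k)
  have 1: "cj cox (Ztop p e a) = Ztop (p + 1) (2 * n - 1 - e) a"
    using Suc.prems cox_Ztop[of p] n4 by (auto simp: mult_2)
  have "cj (cox ^^ k) (Ztop (p + 1) (2 * n - 1 - e) a) =
      Ztop (p + 1 + k) (if even k then 2 * n - 1 - e else 2 * n - 1 - (2 * n - 1 - e)) a"
    by (rule Suc.IH) (use Suc.prems in auto)
  moreover have "2 * n - 1 - (2 * n - 1 - e) = e" using Suc.prems n4 by auto
  ultimately show ?case unfolding cj_cox_Suc 1 by simp
qed

text \<open>These are the roots attached to the letters of the word for w0; their positivity is the
  form in which reducedness is used. The induction descends in i. Where \<alpha>_i cannot be
  followed directly, it is the sum of \<alpha>_i + \<alpha>_(i+1), covered by induction, and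
  -\<alpha>_(i+1), which the power of the Coxeter element has already made positive.\<close>

lemma pos_roots:
  assumes "j \<le> n - 2"
  shows "i \<in> I \<Longrightarrow> in_U (cox ^^ j \<circ> W [1..<i]) i 1"
proof (induction "n - i" arbitrary: i rule: less_induct)
  case less
  have W: "bij (W [1..<i])" using less.prems by (intro bij_W) auto
  note cjg = cj_cj[OF bij_funpow_cox[of j] W]
  have zt: "cj (cox ^^ j) (Ztop 1 e a) \<in> Ug 1" if "e = n - 1 \<or> e = n" for e a
    unfolding cox_pow_Ztop'[OF that order_refl, of j, simplified] using that assms n4
    by (subst cox_pow_Ztop') (auto intro!: Ztop_in_U)
  consider "i = n" | "i = n - 1" | "i + j \<le> n - 2" | "i \<le> n - 2" "n - 1 \<le> i + j" using less.prems by force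
  then show ?case
  proof cases
    case 1
    have "[1..<n] = [1..<n - 1] @ [n - 1]" using upt_snoc[of 1 "n - 1"] n4 by simp
    moreover have "set [1..<n - 1] \<subseteq> I" "set [n - 1] \<subseteq> I" using n4 by auto
    ultimately have "cj (W [1..<i]) (xs 1 i a) = Ztop 1 n a" for a
      unfolding 1 using cj_W_append[of "[1..<n - 1]" "[n - 1]"] cj_sb_commute[OF end_nodes(2,3,8)]
      by (simp add: W_single Ztop_def del: upt_Suc)
    then show ?thesis unfolding in_U_def cjg using zt by simp
  next
    case 2
    have "cj (W [1..<i]) (xs 1 i a) = Ztop 1 (n - 1) a" for a by (simp add: 2 Ztop_def)
    then show ?thesis unfolding in_U_def cjg using zt by simp
  next
    case 3
    have "cj (cox ^^ j) (cj (W [1..<i]) (xs 1 i a)) \<in> Ug 1" for a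
    proof -
      have "cj (cox ^^ j) (cj (W [1..<i]) (xs 1 i a)) = cj (W [1 + j..<i + j]) (cj (cox ^^ j) (xs 1 i a))"
        by (rule cox_pow_W) (use 3 n4 in auto)
      also have "cj (cox ^^ j) (xs 1 i a) = xs 1 (i + j) a" by (rule cox_pow_shift) (use 3 less.prems in auto)
      also have "cj (W [1 + j..<i + j]) (xs 1 (i + j) a) \<in> Ug 1"
        using in_U_chain[of "1 + j" "i + j"] 3 less.prems unfolding in_U_def by auto
      finally show ?thesis .
    qed
    then show ?thesis unfolding in_U_def cjg by blast
  next
    case 4
    have i1: "i + 1 \<in> I" "1 \<le> i" using 4 less.prems n4 by auto
    have l: "[1..<i + 1] = [1..<i] @ [i]" using i1 by simp
    show ?thesis
    proof (rule in_U_commutator[OF bij_comp[OF W bij_funpow_cox] less.prems i1(1)])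
      show "cartan n i (i + 1) = -1" using 4 i1 n4 by (auto simp: cartan_def doubleton_eq_iff)
      have "in_U (cox ^^ j \<circ> W [1..<i + 1]) (i + 1) 1" by (rule less.hyps) (use 4 i1 n4 in auto)
      then show "in_U (cox ^^ j \<circ> W [1..<i] \<circ> sb i) (i + 1) 1" unfolding l W_append W_single by (simp only: comp_assoc)
      have c: "cj (W [1..<i]) (xs (-1) (i + 1) a) = xs (-1) (i + 1) a" for a
        by (rule cj_W_commute) (use 4 i1 n4 in \<open>auto simp: cartan_def doubleton_eq_iff\<close>)
      have "cj (cox ^^ j) (xs (-1) (i + 1) a) \<in> Ug 1" for a
      proof (cases "i + 1 \<le> n - 2")
        case True
        have "cj (cox ^^ j) (xs (-1) (i + 1) a) = xs (- (-1)) (j + (i + 1) + 1 - n) (- a)"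
          by (rule cox_pow_flip) (use True 4 i1 assms in auto)
        moreover have "j + (i + 1) + 1 - n \<in> I" using 4 assms i1 by auto
        ultimately show ?thesis using Ug_ops(5)[of 1 "j + (i + 1) + 1 - n"] by simp
      next
        case False
        \<comment> \<open>One factor of the Coxeter element turns -\<alpha>_(n-1) into \<epsilon>_1
          - \<epsilon>_n, and the other factors keep that root positive.\<close>
        then have i: "i + 1 = n - 1" and "j \<noteq> 0" using 4 n4 by auto
        then obtain k where k: "j = Suc k" by (cases j) auto
        have "cj (cox ^^ k) (Ztop 1 (n - 1) (- a)) = Ztop (1 + k) (if even k then n - 1 else 2 * n - 1 - (n - 1)) (- a)"
          by (rule cox_pow_Ztop') (use assms k n4 in auto)
        also have "\<dots> \<in> Ug 1" by (rule Ztop_in_U) (use assms k n4 in auto)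
        finally show ?thesis unfolding i k cj_cox_Suc cox_top_neg .
      qed
      then show "in_U (cox ^^ j \<circ> W [1..<i]) (i + 1) (-1)" unfolding in_U_def cjg c by blast
    qed
  qed
qed

section \<open>Bruhat cells and the radical of a minimal parabolic subgroup\<close>

definition cell :: "elt \<Rightarrow> elt set" where
  "cell w = {u \<circ> w \<circ> u' | u u'. u \<in> Ug 1 \<and> u' \<in> Ug 1}"

text \<open>The unipotent radical of the minimal parabolic subgroup, as the elements whose \<open>X\<^sub>i\<close>-conjugates
  stay in \<open>U\<close> after conjugation by \<open>s\<^sub>i\<close>.\<close>

definition radical :: "nat \<Rightarrow> elt set" where
  "radical i = {h \<in> Ug 1. \<forall>a. cj (finv (sb i)) (cj (xs 1 i a) h) \<in> Ug 1}"

lemma radical_id: "i \<in> I \<Longrightarrow> id \<in> radical i"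
  using Ug_ops(1)[of 1] bij_imp_bij_inv[OF bij_sb] by (simp add: radical_def cj_id bij_xs)

lemma radical_comp: "i \<in> I \<Longrightarrow> g \<in> radical i \<Longrightarrow> h \<in> radical i \<Longrightarrow> g \<circ> h \<in> radical i"
  using Ug_ops(2)[of 1] bij_imp_bij_inv[OF bij_sb, of i] by (simp add: radical_def cj_comp bij_xs)

lemma radical_conj: "i \<in> I \<Longrightarrow> h \<in> radical i \<Longrightarrow> cj (xs 1 i a) h \<in> radical i"
proof -
  assume a: "i \<in> I" "h \<in> radical i"
  have b: "bij (xs 1 i b)" for b using bij_xs[OF a(1)] by simp
  have "cj (xs 1 i a) h \<in> Ug 1" using a Ug_ops[of 1] by (simp add: cj_def radical_def)
  moreover have "cj (xs 1 i b) (cj (xs 1 i a) h) = cj (xs 1 i (b + a)) h" for b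
    using cj_cj[OF b b, of b a h] xs_add[OF a(1), of 1 b a] by simp
  ultimately show ?thesis using a(2) by (simp add: radical_def)
qed

text \<open>The conjugate of \<open>x_j(b)\<close> by \<open>x_i(a)\<close> is \<open>x_j(b)\<close>
  times an element of the root subgroup of \<alpha>_i + \<alpha>_j, which \<open>s_i\<close> turns
  into the one of \<alpha>_j.\<close>

lemma xs_conj_adjacent:
  assumes "i \<in> I" "j \<in> I" "cartan n i j = -1"
  shows "xs 1 i a \<circ> xs 1 j b \<circ> xs 1 i (- a) \<circ> sb i = xs 1 j b \<circ> sb i \<circ> xs 1 j (- (a * b))"
proof (intro ext)
  fix v \<mu>
  have c: "cartan n j i = -1" using assms cartan_sym[of n i j] by simp
  show "(xs 1 i a \<circ> xs 1 j b \<circ> xs 1 i (- a) \<circ> sb i) v \<mu> = (xs 1 j b \<circ> sb i \<circ> xs 1 j (- (a * b))) v \<mu>"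
  proof (cases "\<mu> \<in> mw")
    case True
    show ?thesis
      using adjacent_values[OF True assms(1-3)]
      by (elim disjE conjE)
        (simp_all add: xs_hit xs_miss sb_values refl_mw reflect_at cartan_diag reflect_reflect True assms(3) assms(1,2)[simplified] c algebra_simps)
  qed (simp add: outside_mw)
qed

lemma radical_xs:
  assumes "i \<in> I" "j \<in> I" "i \<noteq> j"
  shows "xs 1 j b \<in> radical i"
proof -
  have bs: "bij (sb i)" "bij (finv (sb i))" "bij (sb j)" using bij_sb assms bij_imp_bij_inv by auto
  have bx: "bij (xs 1 i a)" for a using bij_xs assms by auto
  have U: "xs 1 k a \<in> Ug 1" if "k \<in> I" for k a using Ug_ops(5)[of 1] that by simp
  have "cj (finv (sb i)) (cj (xs 1 i a) (xs 1 j b)) \<in> Ug 1" for a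
  proof (cases "cartan n i j = 0")
    case True
    have "cj (xs 1 i a) (xs 1 j b) = xs 1 j b"
      by (rule cj_eqI[OF bx]) (rule xs_xs_commute[OF assms(1,2) True])
    moreover have "cj (finv (sb i)) (xs 1 j b) = xs 1 j b"
      by (rule cj_swap[OF bs(1)]) (rule cj_sb_commute[OF assms(1,2) True])
    ultimately show ?thesis using U assms by simp
  next
    case False
    then have c: "cartan n i j = -1" "cartan n j i = -1" using cartan_off[OF assms(3), of n] cartan_sym[of n i j] by auto
    have 1: "cj (finv (sb i)) (xs 1 j b) = cj (sb j) (xs 1 i b)"
      by (rule cj_swap[OF bs(1)]) (use cj_sb_sb[OF assms(1,2) c(1)] in simp)
    have "cj (xs 1 i a) (xs 1 j b) = xs 1 i a \<circ> xs 1 j b \<circ> xs 1 i (- a)"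
      using inv_xs[OF assms(1), of 1 a] by (simp add: cj_def)
    also have "\<dots> = (xs 1 i a \<circ> xs 1 j b \<circ> xs 1 i (- a) \<circ> sb i) \<circ> finv (sb i)"
      using bs by (simp add: comp_assoc comp_inv_cancel)
    also have "\<dots> = xs 1 j b \<circ> cj (sb i) (xs 1 j (- (a * b)))"
      unfolding xs_conj_adjacent[OF assms(1,2) c(1)] by (simp add: cj_def comp_assoc)
    finally have "cj (finv (sb i)) (cj (xs 1 i a) (xs 1 j b)) = cj (sb j) (xs 1 i b) \<circ> xs 1 j (- (a * b))"
      using cj_swap[OF bs(1)] by (simp add: cj_comp[OF bs(2)] 1)
    moreover have "cj (sb j) (xs 1 i b) \<in> Ug 1"
      unfolding cj_sb_adjacent[OF assms(2,1) c(2) disjI1[OF refl]] by (intro Ug_ops(2) U assms) auto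
    ultimately show ?thesis using Ug_ops(2)[of 1] U assms by simp
  qed
  then show ?thesis using U assms by (simp add: radical_def)
qed

text \<open>U is the product of the i-th root subgroup and the radical: the radical contains the
  other generators and is stable under conjugation by \<open>x_i\<close>, so all factors
  \<open>x_i\<close> can be collected on the left.\<close>

lemma radical_decomp:
  assumes i: "i \<in> I" and u: "u \<in> Ug 1"
  shows "\<exists>a. \<exists>h\<in>radical i. u = xs 1 i a \<circ> h"
proof (rule Ug_induct[where P = "\<lambda>u. \<exists>a. \<exists>h\<in>radical i. u = xs 1 i a \<circ> h", OF _ u])
  show "\<exists>a. \<exists>h\<in>radical i. id = xs 1 i a \<circ> h"
    by (rule exI[of _ 0], rule bexI[OF _ radical_id[OF i]]) (simp add: xs_zero)
  show "\<exists>a. \<exists>h\<in>radical i. xs 1 j b = xs 1 i a \<circ> h" if j: "j \<in> I" for j b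
  proof (cases "i = j")
    case True
    show ?thesis by (rule exI[of _ b], rule bexI[OF _ radical_id[OF i]]) (simp add: True)
  next
    case False
    show ?thesis by (rule exI[of _ 0], rule bexI[OF _ radical_xs[OF i j False]]) (simp add: xs_zero)
  qed
  show "\<exists>a. \<exists>h\<in>radical i. g \<circ> g' = xs 1 i a \<circ> h"
    if gg: "\<exists>a. \<exists>h\<in>radical i. g = xs 1 i a \<circ> h" "\<exists>a. \<exists>h\<in>radical i. g' = xs 1 i a \<circ> h" for g g'
  proof -
    obtain a h where 1: "h \<in> radical i" "g = xs 1 i a \<circ> h" using gg(1) by blast
    obtain b k where 2: "k \<in> radical i" "g' = xs 1 i b \<circ> k" using gg(2) by blast
    have bx: "bij (xs 1 i b)" using bij_xs[OF i] by simp
    have "cj (xs 1 i (- b)) h = xs 1 i (- b) \<circ> h \<circ> xs 1 i b"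
      using inv_xs[OF i, of 1 "- b"] by (simp add: cj_def)
    moreover have "xs 1 i (a + b) \<circ> xs 1 i (- b) = xs 1 i a" using xs_add[OF i, of 1 "a + b" "- b"] by simp
    ultimately have "xs 1 i (a + b) \<circ> (cj (xs 1 i (- b)) h \<circ> k) = xs 1 i a \<circ> h \<circ> xs 1 i b \<circ> k"
      by (simp only: comp_assoc[symmetric])
    then have "g \<circ> g' = xs 1 i (a + b) \<circ> (cj (xs 1 i (- b)) h \<circ> k)"
      unfolding 1(2) 2(2) by (simp only: comp_assoc)
    then show ?thesis using radical_comp[OF i radical_conj[OF i 1(1)] 2(1)] by blast
  qed
qed simp

text \<open>Only the \<open>x_i\<close>-part of the right unipotent factor fails to pass
  \<open>s_i\<close>. It is moved to the left through w instead, where it stays in U because w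
  \<alpha>_i is positive.\<close>

lemma cell_step:
  assumes w: "bij w" and i: "i \<in> I" and wi: "in_U w i 1" and g: "g \<in> cell w"
  shows "g \<circ> (xs 1 i a \<circ> sb i \<circ> xs 1 i b) \<in> cell (w \<circ> sb i)"
proof -
  obtain u u' where u: "u \<in> Ug 1" "u' \<in> Ug 1" "g = u \<circ> w \<circ> u'" using g by (auto simp: cell_def)
  have X: "xs 1 i c \<in> Ug 1" for c using Ug_ops(5)[of 1] i by simp
  have "u' \<circ> xs 1 i a \<in> Ug 1" using u X Ug_ops(2)[of 1] by simp
  then obtain c h where ch: "h \<in> radical i" "u' \<circ> xs 1 i a = xs 1 i c \<circ> h" using radical_decomp[OF i] by blast
  have b: "bij (sb i)" "bij (finv (sb i))" using bij_sb i bij_imp_bij_inv by blast+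
  define h' where "h' = cj (finv (sb i)) h"
  have "cj (finv (sb i)) (cj (xs 1 i 0) h) \<in> Ug 1" using ch(1) unfolding radical_def by blast
  then have h': "h' \<in> Ug 1" unfolding xs_zero cj_by_id h'_def .
  have 1: "h \<circ> sb i = sb i \<circ> h'"
    unfolding h'_def cj_def using b by (simp add: comp_assoc comp_inv_cancel inv_inv_eq)
  define v where "v = cj w (xs 1 i c)"
  have v: "v \<in> Ug 1" using wi by (simp add: v_def in_U_def)
  have 2: "w \<circ> xs 1 i c = v \<circ> w" unfolding v_def by (rule cj_eqD[OF w refl])
  have "g \<circ> (xs 1 i a \<circ> sb i \<circ> xs 1 i b) = u \<circ> w \<circ> (u' \<circ> xs 1 i a) \<circ> sb i \<circ> xs 1 i b"
    unfolding u(3) by (simp only: comp_assoc)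
  also have "\<dots> = u \<circ> (w \<circ> xs 1 i c) \<circ> (h \<circ> sb i) \<circ> xs 1 i b" unfolding ch(2) by (simp only: comp_assoc)
  also have "\<dots> = (u \<circ> v) \<circ> (w \<circ> sb i) \<circ> (h' \<circ> xs 1 i b)" unfolding 1 2 by (simp only: comp_assoc)
  finally show ?thesis unfolding cell_def using Ug_ops(2)[of 1] u(1) v h' X by blast
qed

lemma ybold_Bruhat: "i \<in> I \<Longrightarrow> c \<noteq> 0 \<Longrightarrow> ybold n i c = xs 1 i (inverse c) \<circ> sb i \<circ> xs 1 i c"
proof (intro ext)
  fix v \<mu>
  assume a: "i \<in> I" "c \<noteq> 0"
  show "ybold n i c v \<mu> = (xs 1 i (inverse c) \<circ> sb i \<circ> xs 1 i c) v \<mu>"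
  proof (cases "\<mu> \<in> mw")
    case True
    show ?thesis using mw_values[OF True, of i]
      by (elim disjE) (simp_all add: ybold_def yg_xs coroot_def xs_hit xs_miss sb_values refl_mw reflect_at
          cartan_diag reflect_reflect True a(2) a(1)[simplified] field_simps)
  qed (simp add: outside_mw ybold_def yg_xs coroot_def)
qed

definition yblock :: "(nat \<Rightarrow> complex) \<Rightarrow> elt" where
  "yblock c = foldr (\<circ>) (map (\<lambda>i. ybold n i (c i)) [1..<n + 1]) id"

lemma Theta_blocks: "Theta n c = foldr (\<circ>) (map (\<lambda>j. yblock (\<lambda>i. c (j * n + i))) [0..<n - 1]) id"
proof -
  have "map (\<lambda>i. ybold n (letter n (j * n + i)) (c (j * n + i))) [1..<n + 1] =
      map (\<lambda>i. ybold n i (c (j * n + i))) [1..<n + 1]" for j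
    by (rule map_cong) (auto simp: letter_block)
  then show ?thesis unfolding Theta_def word_prod_def foldr_blocks yblock_def by (simp only:)
qed

lemma w0bar_cox: "w0bar n = cox ^^ (n - 1)"
proof -
  have "map (\<lambda>i. sbar n (letter n (j * n + i))) [1..<n + 1] = map sb [1..<n + 1]" for j
    by (rule map_cong) (auto simp: letter_block sbar_sb)
  then show ?thesis unfolding w0bar_def word_prod_def foldr_blocks cox_def W_def
    by (simp only: foldr_const)
qed

lemma cell_block:
  assumes "g \<in> cell (cox ^^ j)" "j \<le> n - 2" "\<And>i. i \<in> I \<Longrightarrow> c i \<noteq> 0"
  shows "g \<circ> yblock c \<in> cell (cox ^^ Suc j)"
proof -
  have "k \<le> n \<Longrightarrow> g \<circ> foldr (\<circ>) (map (\<lambda>i. ybold n i (c i)) [1..<k + 1]) id \<in> cell (cox ^^ j \<circ> W [1..<k + 1])" for k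
  proof (induction k)
    case 0
    then show ?case using assms(1) by (simp add: W_Nil)
  next
    case (Suc k)
    have I: "Suc k \<in> I" "set [1..<k + 1] \<subseteq> I" using Suc by auto
    have l: "[1..<Suc k + 1] = [1..<k + 1] @ [Suc k]" by simp
    have "g \<circ> foldr (\<circ>) (map (\<lambda>i. ybold n i (c i)) [1..<Suc k + 1]) id =
      (g \<circ> foldr (\<circ>) (map (\<lambda>i. ybold n i (c i)) [1..<k + 1]) id) \<circ>
        (xs 1 (Suc k) (inverse (c (Suc k))) \<circ> sb (Suc k) \<circ> xs 1 (Suc k) (c (Suc k)))"
      unfolding l map_append foldr_comp_append using ybold_Bruhat[OF I(1) assms(3)[OF I(1)]]
      by (simp add: comp_assoc del: upt_Suc)
    also have "\<dots> \<in> cell (cox ^^ j \<circ> W [1..<k + 1] \<circ> sb (Suc k))"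
    proof (rule cell_step[OF bij_comp[OF bij_W[OF I(2)] bij_funpow_cox] I(1)])
      show "in_U (cox ^^ j \<circ> W [1..<k + 1]) (Suc k) 1"
        using pos_roots[OF assms(2) I(1)] by (simp only: Suc_eq_plus1)
    qed (rule Suc.IH, use Suc.prems in simp)
    finally show ?case unfolding l W_append W_single by (simp only: comp_assoc)
  qed
  from this[of n] show ?thesis by (simp only: yblock_def cox_def[symmetric] funpow_Suc_right order_refl)
qed

lemma Theta_cell:
  assumes "\<And>k. k \<in> {1..len n} \<Longrightarrow> c k \<noteq> 0"
  shows "Theta n c \<in> cell (w0bar n)"
proof -
  have "m \<le> n - 1 \<Longrightarrow> foldr (\<circ>) (map (\<lambda>j. yblock (\<lambda>i. c (j * n + i))) [0..<m]) id \<in> cell (cox ^^ m)" for m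
  proof (induction m)
    case 0
    have "id \<in> cell id" unfolding cell_def using Ug_ops(1)[of 1] by (intro CollectI exI[of _ id]) simp
    then show ?case by (simp add: id_def)
  next
    case (Suc m)
    have l: "[0..<Suc m] = [0..<m] @ [m]" by simp
    have "c (m * n + i) \<noteq> 0" if "i \<in> I" for i
    proof (rule assms)
      have "(m + 1) * n \<le> (n - 1) * n" using Suc by (intro mult_right_mono) auto
      then show "m * n + i \<in> {1..len n}" using that by (auto simp: algebra_simps)
    qed
    then have "foldr (\<circ>) (map (\<lambda>j. yblock (\<lambda>i. c (j * n + i))) [0..<m]) id \<circ> yblock (\<lambda>i. c (m * n + i)) \<in> cell (cox ^^ Suc m)"
    proof (rule cell_block[rotated 2])
      show "foldr (\<circ>) (map (\<lambda>j. yblock (\<lambda>i. c (j * n + i))) [0..<m]) id \<in> cell (cox ^^ m)"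
        by (rule Suc.IH) (use Suc.prems in simp)
    qed (use Suc.prems in auto)
    moreover have "foldr (\<circ>) (map f [0..<Suc m]) id = foldr (\<circ>) (map f [0..<m]) id \<circ> f m" for f :: "nat \<Rightarrow> elt"
      unfolding l map_append foldr_comp_append by simp
    ultimately show ?case by (simp only:)
  qed
  then show ?thesis unfolding Theta_blocks w0bar_cox by blast
qed

text \<open>\<open>flip\<close> is the anti-automorphism \<open>\<eta>\<close>: inversion followed by conjugation with the sign of the level.\<close>

definition sgnop :: elt where
  "sgnop = diag (\<lambda>\<mu>. (-1) powi lev \<mu>)"

definition flip :: "elt \<Rightarrow> elt" where
  "flip g = sgnop \<circ> finv g \<circ> sgnop"

lemma sgnop_sgnop: "sgnop \<circ> sgnop = id"
  unfolding sgnop_def diag_comp by (simp add: power_int_mult_distrib[symmetric] diag_one)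

lemma sgnop_cancel: "sgnop \<circ> (sgnop \<circ> g) = g"
  by (simp add: comp_assoc[symmetric] sgnop_sgnop)

lemma flip_comp: "bij g \<Longrightarrow> bij h \<Longrightarrow> flip (g \<circ> h) = flip h \<circ> flip g"
  by (simp add: flip_def inv_comp comp_assoc sgnop_cancel)

lemma flip_id: "flip id = id"
  by (simp add: flip_def sgnop_sgnop)

lemma flip_flip: "bij g \<Longrightarrow> flip (flip g) = g"
proof -
  assume b: "bij g"
  have "finv (flip g) = sgnop \<circ> g \<circ> sgnop"
    by (rule inv_eqI) (simp_all add: flip_def comp_assoc sgnop_cancel comp_inv_cancel[OF b] sgnop_sgnop)
  then show ?thesis by (simp add: flip_def[of "flip g"] comp_assoc sgnop_cancel sgnop_sgnop)
qed

text \<open>Inversion negates the parameter; the two coefficients involved lie on adjacent levels,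
  so conjugation by the sign of the level negates it again.\<close>

lemma flip_xs: "i \<in> I \<Longrightarrow> s = 1 \<or> s = -1 \<Longrightarrow> flip (xs s i a) = xs s i a"
proof (intro ext)
  fix v \<mu>
  assume a: "i \<in> I" "s = 1 \<or> s = -1"
  have "(-1) powi lev (reflect n i \<mu>) = - ((-1 :: complex) powi lev \<mu>)" if "\<mu> i = s"
    using a that by (auto simp: lev_reflect[OF a(1)] power_int_diff power_int_add)
  moreover have "((-1 :: complex) powi lev \<mu>) * (-1) powi lev \<mu> = 1" by (simp add: power_int_mult_distrib[symmetric])
  ultimately show "flip (xs s i a) v \<mu> = xs s i a v \<mu>"
    by (auto simp: flip_def inv_xs[OF a] sgnop_def diag_def xs_def algebra_simps)
qed

lemma flip_sb: "i \<in> I \<Longrightarrow> flip (sb i) = sb i"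
  by (simp add: sb_dual flip_comp bij_xs bij_comp flip_xs comp_assoc)

lemma flip_W: "set ls \<subseteq> I \<Longrightarrow> flip (W ls) = W (rev ls)"
proof (induction ls)
  case Nil
  show ?case unfolding W_Nil rev.simps by (rule flip_id)
next
  case (Cons i ls)
  then have i: "i \<in> I" "set ls \<subseteq> I" by auto
  have "flip (W ls) = W (rev ls)" by (rule Cons.IH[OF i(2)])
  then show ?case
    unfolding W_Cons rev.simps W_append W_single flip_comp[OF bij_sb[OF i(1)] bij_W[OF i(2)]] flip_sb[OF i(1)]
    by (simp only: W_Nil o_id Cons.IH[OF i(2)])
qed

lemma flip_pow: "bij g \<Longrightarrow> flip (g ^^ k) = flip g ^^ k"
proof (induction k)
  case 0 then show ?case using flip_id by (simp add: id_def)
next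
  case (Suc k)
  have "bij (g ^^ k)" using Suc.prems by (induction k) (auto simp: bij_comp id_def[symmetric])
  then have "flip (g ^^ Suc k) = flip (g ^^ k) \<circ> flip g"
    unfolding funpow.simps using flip_comp[OF Suc.prems] by simp
  then show ?case unfolding Suc.IH[OF Suc.prems] funpow_Suc_right .
qed

section \<open>Conjugation by the longest element and the decoration\<close>

abbreviation "w0 \<equiv> w0bar n"

lemma bij_w0: "bij w0"
  unfolding w0bar_cox by (rule bij_funpow_cox)

lemma cj_w0_low:
  assumes "s = 1 \<or> s = -1" "1 \<le> i" "i \<le> n - 2"
  shows "cj w0 (xs s i a) = xs (- s) i (- a)"
proof -
  have "cj w0 (xs s i a) = xs (- s) (n - 1 + i + 1 - n) (- a)"
    unfolding w0bar_cox by (rule cox_pow_flip) (use assms n4 in auto)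
  moreover have "n - 1 + i + 1 - n = i" using n4 by simp
  ultimately show ?thesis by simp
qed

text \<open>-w0 fixes the last two nodes for even n and exchanges them for odd n.\<close>

lemma cj_w0_top:
  assumes "e = n - 1 \<or> e = n"
  shows "cj w0 (xs (-1) e a) = xs 1 (if even n then e else 2 * n - 1 - e) (- a)"
proof -
  obtain k where k: "n - 1 = Suc k" using n4 by (cases "n - 1") auto
  have "cj w0 (xs (-1) e a) = cj (cox ^^ k) (Ztop 1 e (- a))"
    unfolding w0bar_cox k cj_cox_Suc using assms cox_top_neg by auto
  also have "\<dots> = Ztop (1 + k) (if even k then e else 2 * n - 1 - e) (- a)"
    by (rule cox_pow_Ztop') (use assms k in auto)
  also have "1 + k = n - 1" using k by simp
  also have "even k \<longleftrightarrow> even n" using k n4 by (cases n) auto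
  finally show ?thesis by (simp add: Ztop_def W_Nil cj_by_id)
qed

lemma w0_covers:
  assumes "i \<in> I"
  shows "\<exists>j\<in>I. \<forall>a. cj w0 (xs (-1) j a) = xs 1 i (- a)"
proof (cases "i \<le> n - 2")
  case True
  then show ?thesis using cj_w0_low[of "-1" i] assms by (intro bexI[of _ i]) auto
next
  case False
  then have e: "i = n - 1 \<or> i = n" using assms by auto
  define j where "j = (if even n then i else 2 * n - 1 - i)"
  have j: "j = n - 1 \<or> j = n" "(if even n then j else 2 * n - 1 - j) = i" using e n4 by (auto simp: j_def mult_2)
  then have "j \<in> I" using n4 by auto
  then show ?thesis using cj_w0_top[OF j(1)] unfolding j(2) by (intro bexI[of _ j]) auto
qed

lemma Upos_w0: "u \<in> Ug 1 \<Longrightarrow> cj (finv w0) u \<in> Ug (-1)"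
proof (rule Ug_induct[of 1 u "\<lambda>u. cj (finv w0) u \<in> Ug (-1)"])
  have b: "bij (finv w0)" by (rule bij_imp_bij_inv[OF bij_w0])
  show "cj (finv w0) id \<in> Ug (-1)" using cj_id[OF b] Ug_ops(1)[of "-1"] by simp
  show "cj (finv w0) (xs 1 i a) \<in> Ug (-1)" if i: "i \<in> I" for i a
  proof -
    obtain j where j: "j \<in> I" "\<forall>a. cj w0 (xs (-1) j a) = xs 1 i (- a)" using w0_covers[OF i] by blast
    have "cj (finv w0) (xs 1 i a) = xs (-1) j (- a)"
      by (rule cj_swap[OF bij_w0]) (simp add: j(2))
    then show ?thesis using Ug_ops(5)[of "-1" j] j(1) by simp
  qed
  show "cj (finv w0) (g \<circ> h) \<in> Ug (-1)" if "cj (finv w0) g \<in> Ug (-1)" "cj (finv w0) h \<in> Ug (-1)" for g h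
    using cj_comp[OF b] Ug_ops(2)[of "-1"] that by simp
qed auto

text \<open>Group form of \<open>s_i h_j\<close> = \<open>h_j\<close> -
  \<open>a_ji h_i\<close>.\<close>

lemma coroot_sb:
  assumes "i \<in> I" "j \<in> I" "a \<noteq> 0"
  shows "coroot n j a \<circ> sb i = sb i \<circ> (coroot n j a \<circ> coroot n i (a powi (- cartan n j i)))"
proof (intro ext)
  fix v \<mu>
  show "(coroot n j a \<circ> sb i) v \<mu> = (sb i \<circ> (coroot n j a \<circ> coroot n i (a powi (- cartan n j i)))) v \<mu>"
  proof (cases "\<mu> \<in> mw")
    case True
    have *: "a powi (\<mu> j - cartan n j i) * (a powi (- cartan n j i)) powi (-1) = a powi \<mu> j"
      "a powi (\<mu> j + cartan n j i) * (a powi (- cartan n j i)) powi 1 = a powi \<mu> j"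
      using assms(3) by (simp_all add: power_int_minus power_int_diff power_int_add)
    show ?thesis using mw_values[OF True, of i]
    proof (elim disjE)
      assume m: "\<mu> i = -1"
      then show ?thesis using * True refl_mw[OF True assms(1)] cartan_diag[OF assms(1)]
        by (simp add: coroot_def sb_values(2)[of \<mu> i, OF True m] reflect_at mult.assoc[symmetric])
    next
      assume m: "\<mu> i = 0"
      then show ?thesis using * True by (simp add: coroot_def sb_values(3)[of \<mu> i, OF m])
    next
      assume m: "\<mu> i = 1"
      then show ?thesis using * True refl_mw[OF True assms(1)] cartan_diag[OF assms(1)]
        by (simp add: coroot_def sb_values(1)[of \<mu> i, OF True m] reflect_at mult.assoc[symmetric])
    qed
  qed (simp add: outside_mw coroot_def)
qed

definition normalizes :: "elt \<Rightarrow> bool" where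
  "normalizes g \<longleftrightarrow> bij g \<and> (\<forall>t\<in>Tor n. cj (finv g) t \<in> Tor n)"

lemma normalizes_sb: "i \<in> I \<Longrightarrow> normalizes (sb i)"
  unfolding normalizes_def
proof (intro conjI ballI)
  assume i: "i \<in> I"
  show "bij (sb i)" by (rule bij_sb[OF i])
  have b: "bij (finv (sb i))" by (rule bij_imp_bij_inv[OF bij_sb[OF i]])
  fix t assume "t \<in> Tor n"
  then show "cj (finv (sb i)) t \<in> Tor n"
  proof (rule Tor_induct[where P = "\<lambda>t. cj (finv (sb i)) t \<in> Tor n"])
    show "cj (finv (sb i)) id \<in> Tor n" using cj_id[OF b] Tor_ops(1) by simp
    show "cj (finv (sb i)) (coroot n j a) \<in> Tor n" if "j \<in> I" "a \<noteq> 0" for j a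
    proof -
      have "cj (finv (sb i)) (coroot n j a) = coroot n j a \<circ> coroot n i (a powi (- cartan n j i))"
        unfolding cj_def using coroot_sb[OF i that] bij_sb[OF i]
        by (simp add: comp_assoc inv_inv_eq comp_inv_cancel)
      then show ?thesis using Tor_ops(2,5) i that by simp
    qed
    show "cj (finv (sb i)) (g \<circ> h) \<in> Tor n" if "cj (finv (sb i)) g \<in> Tor n" "cj (finv (sb i)) h \<in> Tor n" for g h
      using cj_comp[OF b] Tor_ops(2) that by simp
  qed
qed

lemma normalizes_comp: "normalizes g \<Longrightarrow> normalizes h \<Longrightarrow> normalizes (g \<circ> h)"
  unfolding normalizes_def by (simp add: bij_comp inv_comp cj_cj bij_imp_bij_inv)

lemma normalizes_id: "normalizes id"
  unfolding normalizes_def by (simp add: cj_by_id)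

lemma normalizes_W: "set ls \<subseteq> I \<Longrightarrow> normalizes (W ls)"
proof (induction ls)
  case Nil show ?case unfolding W_Nil by (rule normalizes_id)
next
  case (Cons i ls)
  then show ?case unfolding W_Cons by (intro normalizes_comp normalizes_sb) auto
qed

lemma normalizes_pow: "normalizes g \<Longrightarrow> normalizes (g ^^ k)"
proof (induction k)
  case 0 then show ?case using normalizes_id by (simp add: id_def)
next
  case (Suc k) then show ?case unfolding funpow.simps by (intro normalizes_comp) auto
qed

lemma normalizes_w0: "normalizes w0"
  unfolding w0bar_cox cox_def by (intro normalizes_pow normalizes_W) auto

section \<open>Invariance of the lift of w0 under reversal of the word\<close>

definition commutes :: "elt \<Rightarrow> bool" where
  "commutes q \<longleftrightarrow> w0 \<circ> q = q \<circ> w0"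

lemma commutes_W: "set ls \<subseteq> {1..n - 2} \<Longrightarrow> commutes (W ls)"
proof (induction ls)
  case Nil show ?case unfolding W_Nil commutes_def by simp
next
  case (Cons i ls)
  then have i: "1 \<le> i" "i \<le> n - 2" "i \<in> I" by auto
  have "cj w0 (sb i) = sb i"
    by (rule cj_sb_transfer'[OF bij_w0 i(3,3)]) (rule cj_w0_low[OF _ i(1,2)])
  then have 1: "w0 \<circ> sb i = sb i \<circ> w0" by (rule cj_eqD[OF bij_w0])
  have 2: "w0 \<circ> W ls = W ls \<circ> w0" using Cons unfolding commutes_def by simp
  have "w0 \<circ> (sb i \<circ> W ls) = sb i \<circ> W ls \<circ> w0"
    using 1 2 by (simp only: comp_assoc[symmetric]) (simp only: comp_assoc)
  then show ?case unfolding W_Cons commutes_def .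
qed

text \<open>Sources of the orientation of the Dynkin diagram attached to a Coxeter element are moved to the
  end of the word until it is reversed; only letters fixed by \<open>-w\<^sub>0\<close> are moved.\<close>

definition cox_rot :: "nat \<Rightarrow> elt" where
  "cox_rot k = W [k + 1..<n + 1] \<circ> W (rev [1..<k + 1])"

lemma cox_rot_step:
  assumes "k + 1 \<le> n - 2"
  shows "cox_rot k \<circ> W (rev [1..<k + 2]) = W (rev [1..<k + 2]) \<circ> cox_rot (k + 1)"
proof -
  have comm: "W [k + 2..<n + 1] \<circ> W ls = W ls \<circ> W [k + 2..<n + 1]" if "set ls \<subseteq> {1..k}" for ls
    using that
  proof (induction ls)
    case Nil show ?case unfolding W_Nil by simp
  next
    case (Cons i ls)
    have 1: "W [k + 2..<n + 1] \<circ> sb i = sb i \<circ> W [k + 2..<n + 1]"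
      by (rule W_sb_commute) (use Cons.prems assms in \<open>auto simp: cartan_def doubleton_eq_iff\<close>)
    have 2: "W [k + 2..<n + 1] \<circ> W ls = W ls \<circ> W [k + 2..<n + 1]" by (rule Cons.IH) (use Cons.prems in simp)
    have "W [k + 2..<n + 1] \<circ> (sb i \<circ> W ls) = sb i \<circ> W ls \<circ> W [k + 2..<n + 1]"
      using 1 2 by (simp only: comp_assoc[symmetric]) (simp only: comp_assoc)
    then show ?case unfolding W_Cons .
  qed
  have "set (rev [1..<k + 1]) \<subseteq> {1..k}" by auto
  note c = comm[OF this]
  have l: "W [k + 1..<n + 1] = sb (k + 1) \<circ> W [k + 2..<n + 1]"
  proof -
    have "[k + 1..<n + 1] = (k + 1) # [Suc (k + 1)..<n + 1]" by (rule upt_conv_Cons) (use assms in simp)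
    then show ?thesis by (simp only: W_Cons) (simp only: Suc_eq_plus1 add.assoc one_add_one)
  qed
  have r: "W (rev [1..<k + 2]) = sb (k + 1) \<circ> W (rev [1..<k + 1])" by (simp add: W_Cons)
  have e: "k + 1 + 1 = k + 2" by simp
  have c': "W [k + 2..<n + 1] \<circ> (W (rev [1..<k + 1]) \<circ> X) = W (rev [1..<k + 1]) \<circ> (W [k + 2..<n + 1] \<circ> X)" for X
    using c by (simp only: comp_assoc[symmetric])
  show ?thesis unfolding cox_rot_def e l r by (simp only: comp_assoc c')
qed

lemma cox_rot_conj: "k \<le> n - 2 \<Longrightarrow> \<exists>q. commutes q \<and> bij q \<and> cox \<circ> q = q \<circ> cox_rot k"
proof (induction k)
  case 0
  have "cox_rot 0 = cox" by (simp add: cox_rot_def cox_def W_Nil del: upt_Suc)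
  then show ?case by (intro exI[of _ id]) (simp add: commutes_def comp_def id_def bij_id[unfolded id_def])
next
  case (Suc k)
  have "k \<le> n - 2" using Suc.prems by simp
  from Suc.IH[OF this] obtain q where q: "commutes q" "bij q" "cox \<circ> q = q \<circ> cox_rot k" by blast
  define p where "p = W (rev [1..<k + 2])"
  have p: "commutes p" unfolding p_def by (rule commutes_W) (use Suc.prems in auto)
  have bp: "bij p" unfolding p_def by (rule bij_W) (use Suc.prems n4 in auto)
  have "cox_rot k \<circ> p = p \<circ> cox_rot (Suc k)" using cox_rot_step[of k] Suc.prems by (simp add: p_def)
  then have "cox \<circ> (q \<circ> p) = (q \<circ> p) \<circ> cox_rot (Suc k)"
    using q(3) by (simp only: comp_assoc[symmetric]) (simp only: comp_assoc)
  moreover have "commutes (q \<circ> p)"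
    using p q(1) unfolding commutes_def by (simp only: comp_assoc[symmetric]) (simp only: comp_assoc)
  ultimately show ?case using bij_comp[OF bp q(2)] by blast
qed

lemma cox_rot_end: "cox_rot (n - 2) = W (rev [1..<n + 1])"
proof -
  have 1: "[n - 2 + 1..<n + 1] = [n - 1, n]" using n4 by (simp add: upt_conv_Cons Suc_diff_Suc numeral_2_eq_2)
  have 2: "[1..<n + 1] = [1..<n - 2 + 1] @ [n - 1, n]"
    using upt_add_eq_append[of 1 "n - 1" 2] n4 by (simp add: upt_conv_Cons Suc_diff_Suc numeral_2_eq_2)
  have 3: "rev ([1..<n - 2 + 1] @ [n - 1, n]) = n # (n - 1) # rev [1..<n - 2 + 1]" by simp
  show ?thesis unfolding cox_rot_def 1 2 3 W_Cons W_Nil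
    using sb_commute[OF end_nodes(2,3,8)] by (simp only: comp_assoc[symmetric] o_id)
qed

text \<open>\<open>flip\<close> reverses words, so it sends \<open>cox\<close> to the reversed
  Coxeter element c' and w0 to the (n-1)-st power of c'. An element q that commutes with w0
  conjugates \<open>cox\<close> into c'; hence the two powers, conjugate under q, coincide.\<close>

lemma flip_w0: "flip w0 = w0"
proof -
  obtain q where q: "commutes q" "bij q" "cox \<circ> q = q \<circ> cox_rot (n - 2)" using cox_rot_conj[of "n - 2"] by auto
  define c' where "c' = W (rev [1..<n + 1])"
  have q3: "cox \<circ> q = q \<circ> c'" using q(3) unfolding cox_rot_end c'_def .
  have "cox ^^ k \<circ> q = q \<circ> c' ^^ k" for k
  proof (induction k)
    case 0 show ?case unfolding funpow.simps by simp
  next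
    case (Suc k)
    have "cox ^^ Suc k \<circ> q = cox \<circ> (cox ^^ k \<circ> q)" unfolding funpow.simps by (simp only: comp_assoc)
    also have "\<dots> = (cox \<circ> q) \<circ> c' ^^ k" unfolding Suc.IH by (simp only: comp_assoc)
    also have "\<dots> = q \<circ> c' ^^ Suc k" unfolding q3 funpow.simps by (simp only: comp_assoc)
    finally show ?case .
  qed
  then have "w0 \<circ> q = q \<circ> c' ^^ (n - 1)" unfolding w0bar_cox .
  then have "q \<circ> w0 = q \<circ> c' ^^ (n - 1)" using q(1) unfolding commutes_def by simp
  then have "finv q \<circ> (q \<circ> w0) = finv q \<circ> (q \<circ> c' ^^ (n - 1))" by simp
  then have "w0 = c' ^^ (n - 1)" unfolding comp_inv_cancel(3)[OF q(2)] .
  moreover have "flip w0 = flip cox ^^ (n - 1)" unfolding w0bar_cox by (rule flip_pow[OF bij_cox])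
  moreover have "flip cox = c'" unfolding cox_def c'_def by (rule flip_W) auto
  ultimately show ?thesis by simp
qed

section \<open>The whole group, \<eta>, and the decoration on the cell of w0\<close>

definition Ggens :: "elt set" where
  "Ggens = {xs s i a | s i a. (s = 1 \<or> s = -1) \<and> i \<in> I}"

lemma Gp_gens: "Gp n = generate Amb Ggens"
proof -
  have "{xg n i a | i a. i \<in> {1..n}} \<union> {yg n i a | i a. i \<in> {1..n}} = Ggens"
    unfolding xg_xs yg_xs Ggens_def by blast
  then show ?thesis unfolding Gp_def by (simp only:)
qed

lemma bij_Ggens: "\<forall>g\<in>Ggens. bij g"
  unfolding Ggens_def using bij_xs by blast

lemma Gp_ops:
  "id \<in> Gp n" "g \<in> Gp n \<Longrightarrow> h \<in> Gp n \<Longrightarrow> g \<circ> h \<in> Gp n" "g \<in> Gp n \<Longrightarrow> finv g \<in> Gp n"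
  "g \<in> Gp n \<Longrightarrow> bij g" "i \<in> I \<Longrightarrow> s = 1 \<or> s = -1 \<Longrightarrow> xs s i a \<in> Gp n"
proof -
  show "id \<in> Gp n" unfolding Gp_gens by (rule gen_id[OF bij_Ggens])
  show "g \<circ> h \<in> Gp n" if "g \<in> Gp n" "h \<in> Gp n" using that unfolding Gp_gens by (rule gen_comp[OF bij_Ggens])
  show "finv g \<in> Gp n" if "g \<in> Gp n" using that unfolding Gp_gens by (rule gen_inv[OF bij_Ggens])
  show "bij g" if "g \<in> Gp n" using that unfolding Gp_gens by (rule gen_bij[OF bij_Ggens])
  show "xs s i a \<in> Gp n" if "i \<in> I" "s = 1 \<or> s = -1"
    unfolding Gp_gens by (rule generate.incl) (use that in \<open>unfold Ggens_def, blast\<close>)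
qed

lemma Gp_induct:
  assumes "g \<in> Gp n" "P id" "\<And>s i a. s = 1 \<or> s = -1 \<Longrightarrow> i \<in> I \<Longrightarrow> P (xs s i a)"
    "\<And>g h. g \<in> Gp n \<Longrightarrow> h \<in> Gp n \<Longrightarrow> P g \<Longrightarrow> P h \<Longrightarrow> P (g \<circ> h)"
  shows "P g"
proof (rule gen_induct[where P = P, OF bij_Ggens assms(1)[unfolded Gp_gens]])
  fix h assume "h \<in> Ggens"
  then obtain s i a where h: "s = 1 \<or> s = -1" "i \<in> I" "h = xs s i a" by (auto simp: Ggens_def)
  show "finv h \<in> Ggens" unfolding h(3) inv_xs[OF h(2,1)] using h(1,2) unfolding Ggens_def by blast
  show "P h" unfolding h(3) by (rule assms(3)[OF h(1,2)])
qed (use assms(2,4) in \<open>simp_all add: Gp_gens\<close>)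

lemma Ug_Gp: "s = 1 \<or> s = -1 \<Longrightarrow> u \<in> Ug s \<Longrightarrow> u \<in> Gp n"
  by (rule Ug_induct[of s u "\<lambda>u. u \<in> Gp n"]) (auto intro: Gp_ops)

lemma sb_Gp: "i \<in> I \<Longrightarrow> sb i \<in> Gp n"
  unfolding sb_dual by (intro Gp_ops(2,5)) auto

lemma W_Gp: "set ls \<subseteq> I \<Longrightarrow> W ls \<in> Gp n"
proof (induction ls)
  case Nil show ?case unfolding W_Nil by (rule Gp_ops(1))
next
  case (Cons i ls) then show ?case unfolding W_Cons by (intro Gp_ops(2) sb_Gp) auto
qed

lemma w0_Gp: "w0 \<in> Gp n"
proof -
  have c: "cox \<in> Gp n" unfolding cox_def by (rule W_Gp) auto
  have "cox ^^ k \<in> Gp n" for k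
  proof (induction k)
    case 0 then show ?case using Gp_ops(1) by (simp add: id_def)
  next
    case (Suc k) then show ?case unfolding funpow.simps using c by (intro Gp_ops(2)) auto
  qed
  then show ?thesis unfolding w0bar_cox .
qed

text \<open>The Bruhat form of \<open>ybold\<close> is solved for its torus factor. The torus has to
  lie in the group before \<eta> can be applied to t \<Theta>(c).\<close>

lemma coroot_Gp: "i \<in> I \<Longrightarrow> a \<noteq> 0 \<Longrightarrow> coroot n i a \<in> Gp n"
proof -
  assume a: "i \<in> I" "a \<noteq> 0"
  have "ybold n i (inverse a) = xs (-1) i (inverse a) \<circ> coroot n i a" by (simp add: ybold_def yg_xs)
  then have "xs (-1) i (- inverse a) \<circ> ybold n i (inverse a) = (xs (-1) i (- inverse a) \<circ> xs (-1) i (inverse a)) \<circ> coroot n i a"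
    by (simp only: comp_assoc)
  also have "\<dots> = coroot n i a" using xs_add[OF a(1), of "-1"] by (simp add: xs_zero)
  finally have "coroot n i a = xs (-1) i (- inverse a) \<circ> (xs 1 i a \<circ> sb i \<circ> xs 1 i (inverse a))"
    using ybold_Bruhat[of i "inverse a"] a by simp
  then show ?thesis using Gp_ops(2,5) sb_Gp a by simp
qed

lemma Tor_Gp: "t \<in> Tor n \<Longrightarrow> t \<in> Gp n"
  by (rule Tor_induct[where P = "\<lambda>t. t \<in> Gp n"]) (auto intro: Gp_ops coroot_Gp)

lemma flip_Gp: "g \<in> Gp n \<Longrightarrow> flip g \<in> Gp n"
proof (rule Gp_induct[where P = "\<lambda>g. flip g \<in> Gp n"])
  show "flip id \<in> Gp n" unfolding flip_id by (rule Gp_ops(1))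
  show "flip (xs s i a) \<in> Gp n" if "s = 1 \<or> s = -1" "i \<in> I" for s i a
    unfolding flip_xs[OF that(2,1)] by (rule Gp_ops(5)[OF that(2,1)])
  show "flip (g \<circ> h) \<in> Gp n" if "g \<in> Gp n" "h \<in> Gp n" "flip g \<in> Gp n" "flip h \<in> Gp n" for g h
    unfolding flip_comp[OF Gp_ops(4)[OF that(1)] Gp_ops(4)[OF that(2)]] by (rule Gp_ops(2)[OF that(4,3)])
qed

lemma flip_Tor: "t \<in> Tor n \<Longrightarrow> flip t = finv t"
proof -
  assume t: "t \<in> Tor n"
  obtain \<tau> \<rho> where "tor_data \<tau> \<rho>" "finv t = diag \<tau>" using Tor_data[OF Tor_ops(3)[OF t]] by blast
  moreover have "(-1) powi lev \<mu> * (c * (-1) powi lev \<mu>) = (c :: complex)" for \<mu> c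
    by (simp add: mult.left_commute power_int_mult_distrib[symmetric])
  ultimately show ?thesis by (simp only: flip_def sgnop_def diag_comp mult.assoc)
qed

text \<open>A map with the prescribed values that reverses products is determined by induction over
  the generators, so \<open>flip\<close> restricted to the group is the only candidate.\<close>

lemma eta_flip: "g \<in> Gp n \<Longrightarrow> eta n g = flip g"
proof -
  assume g: "g \<in> Gp n"
  have "eta n = restrict flip (Gp n)"
    unfolding eta_def
  proof (rule the_equality)
    have "bij_betw flip (Gp n) (Gp n)"
      by (rule bij_betw_byWitness[where f' = flip]) (auto simp: flip_flip Gp_ops(4) flip_Gp)
    then have "bij_betw (restrict flip (Gp n)) (Gp n) (Gp n)" by (rule bij_betw_cong[THEN iffD1, rotated]) simp
    then show "restrict flip (Gp n) \<in> extensional (Gp n) \<and> bij_betw (restrict flip (Gp n)) (Gp n) (Gp n) \<and>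
      (\<forall>g\<in>Gp n. \<forall>h\<in>Gp n. restrict flip (Gp n) (g \<circ> h) = restrict flip (Gp n) h \<circ> restrict flip (Gp n) g) \<and>
      (\<forall>i\<in>I. \<forall>a. restrict flip (Gp n) (xg n i a) = xg n i a \<and> restrict flip (Gp n) (yg n i a) = yg n i a) \<and>
      (\<forall>t\<in>Tor n. restrict flip (Gp n) t = inv\<^bsub>Amb\<^esub> t)"
      unfolding xg_xs yg_xs
      using Gp_ops flip_comp flip_xs flip_Tor Tor_Gp Tor_ops(4) inv_Amb by simp
  next
    fix f assume f: "f \<in> extensional (Gp n) \<and> bij_betw f (Gp n) (Gp n) \<and>
      (\<forall>g\<in>Gp n. \<forall>h\<in>Gp n. f (g \<circ> h) = f h \<circ> f g) \<and>
      (\<forall>i\<in>I. \<forall>a. f (xg n i a) = xg n i a \<and> f (yg n i a) = yg n i a) \<and>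
      (\<forall>t\<in>Tor n. f t = inv\<^bsub>Amb\<^esub> t)"
    have "f g = flip g" if "g \<in> Gp n" for g
    proof (rule Gp_induct[where P = "\<lambda>g. f g = flip g", OF that])
      have "f id = inv\<^bsub>Amb\<^esub> id" using f Tor_ops(1) by blast
      then show "f id = flip id" using inv_Amb[of id] flip_id by simp
      show "f (xs s i a) = flip (xs s i a)" if "s = 1 \<or> s = -1" "i \<in> I" for s i a
        unfolding flip_xs[OF that(2,1)] using f that unfolding xg_xs yg_xs by blast
      show "f (g \<circ> h) = flip (g \<circ> h)" if "g \<in> Gp n" "h \<in> Gp n" "f g = flip g" "f h = flip h" for g h
        unfolding flip_comp[OF Gp_ops(4)[OF that(1)] Gp_ops(4)[OF that(2)]] that(3,4)[symmetric] using f that(1,2) by blast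
    qed
    then show "f = restrict flip (Gp n)" using f by (intro extensionalityI[of _ "Gp n"]) auto
  qed
  then show ?thesis using g by simp
qed

lemma flip_Ug:
  assumes s: "s = 1 \<or> s = -1" and u: "u \<in> Ug s"
  shows "flip u \<in> Ug s \<and> (\<forall>i\<in>I. chiv s i (flip u) = chiv s i u)"
proof (rule Ug_induct[where P = "\<lambda>u. flip u \<in> Ug s \<and> (\<forall>i\<in>I. chiv s i (flip u) = chiv s i u)", OF s u])
  show "flip id \<in> Ug s \<and> (\<forall>i\<in>I. chiv s i (flip id) = chiv s i id)"
    unfolding flip_id using Ug_ops(1)[OF s] by simp
  show "flip (xs s j a) \<in> Ug s \<and> (\<forall>i\<in>I. chiv s i (flip (xs s j a)) = chiv s i (xs s j a))" if "j \<in> I" for j a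
    unfolding flip_xs[OF that s] using Ug_ops(5)[OF s that] by simp
  show "flip (g \<circ> h) \<in> Ug s \<and> (\<forall>i\<in>I. chiv s i (flip (g \<circ> h)) = chiv s i (g \<circ> h))"
    if "g \<in> Ug s" "h \<in> Ug s" and "flip g \<in> Ug s \<and> (\<forall>i\<in>I. chiv s i (flip g) = chiv s i g)"
      "flip h \<in> Ug s \<and> (\<forall>i\<in>I. chiv s i (flip h) = chiv s i h)" for g h
    unfolding flip_comp[OF Ug_ops(4)[OF s that(1)] Ug_ops(4)[OF s that(2)]]
    using that Ug_ops(2)[OF s] chiv_comp[OF s] by simp
qed

text \<open>Conjugation by w0 makes u opposite unipotent, so the first U-part is u'. Since \<eta>
  gives \<eta>(u') w0 \<eta>(u) with the inverse of t at the right end, moving that torus element to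
  the left conjugates \<eta>(u) by t; this is where the factors \<alpha>_i(t) come from.\<close>

lemma decoration_cell:
  assumes t: "t \<in> Tor n" and u: "u \<in> Ug 1" and u': "u' \<in> Ug 1"
  shows "decoration n (t \<circ> (u \<circ> w0 \<circ> u')) =
    (\<Sum>i\<in>I. chiv 1 i u') + (\<Sum>i\<in>I. root_char n i t * chiv 1 i u)"
proof -
  have b: "bij w0" "bij (finv w0)" "bij t" "bij u" "bij u'" using bij_w0 bij_imp_bij_inv Tor_ops(4)[OF t] Ug_ops(4)[of 1] u u' by auto
  have tn: "cj (finv w0) t \<in> Tor n" using normalizes_w0 t by (simp add: normalizes_def)
  have "finv w0 \<circ> (t \<circ> (u \<circ> w0 \<circ> u')) = cj (finv w0) t \<circ> cj (finv w0) u \<circ> u'"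
    using b by (simp add: cj_def comp_assoc comp_inv_cancel inv_inv_eq)
  then have 1: "pi_pos n (finv w0 \<circ> (t \<circ> (u \<circ> w0 \<circ> u'))) = u'"
    using pi_pos_eq[OF tn Upos_w0[OF u] u'] by simp
  have g: "t \<circ> (u \<circ> w0 \<circ> u') \<in> Gp n" using Gp_ops(2) Tor_Gp[OF t] Ug_Gp[of 1] u u' w0_Gp by simp
  have e: "eta n (t \<circ> (u \<circ> w0 \<circ> u')) = flip u' \<circ> w0 \<circ> flip u \<circ> finv t"
    unfolding eta_flip[OF g] using b by (simp add: flip_comp bij_comp flip_w0 flip_Tor[OF t] comp_assoc)
  have fu: "flip u \<in> Ug 1" "\<And>i. i \<in> I \<Longrightarrow> chiv 1 i (flip u) = chiv 1 i u" and fu': "flip u' \<in> Ug 1"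
    using flip_Ug[of 1 u] flip_Ug[of 1 u'] u u' by auto
  obtain y where y: "y \<in> Ug (-1)" "cj (finv w0) (flip u') \<circ> finv t = finv t \<circ> y"
    by (rule Tor_pass[of "-1", OF _ Tor_ops(3)[OF t] Upos_w0[OF fu']]) auto
  have "finv w0 \<circ> eta n (t \<circ> (u \<circ> w0 \<circ> u')) = (cj (finv w0) (flip u') \<circ> finv t) \<circ> cj t (flip u)"
    unfolding e using b by (simp add: cj_def comp_assoc comp_inv_cancel inv_inv_eq)
  also have "\<dots> = finv t \<circ> y \<circ> cj t (flip u)" unfolding y(2) ..
  finally have 2: "pi_pos n (finv w0 \<circ> eta n (t \<circ> (u \<circ> w0 \<circ> u'))) = cj t (flip u)"
    using pi_pos_eq[OF Tor_ops(3)[OF t] y(1)] Tor_normalizes[of 1, OF _ t fu(1)] by simp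
  have 3: "cj t (flip u) \<in> Ug 1" "\<And>i. i \<in> I \<Longrightarrow> chiv 1 i (cj t (flip u)) = root_char n i t * chiv 1 i u"
    using Tor_normalizes[of 1, OF _ t fu(1)] fu(2) by auto
  show ?thesis
    unfolding decoration_def inv_Amb[OF b(1)] 1 2 chi_st_def
    using chi_chiv u' 3 by simp
qed

section \<open>Matrix coefficients of the natural representation\<close>

lemma yb_eval:
  assumes "i \<in> I" "\<mu> \<in> mw" "c \<noteq> 0"
  shows "\<mu> i = -1 \<Longrightarrow> ybold n i c z \<mu> = c * z \<mu> + z (reflect n i \<mu>)"
    "\<mu> i = 1 \<Longrightarrow> ybold n i c z \<mu> = z \<mu> / c"
    "\<mu> i = 0 \<Longrightarrow> ybold n i c z \<mu> = z \<mu>"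
  using assms refl_mw[OF assms(2,1)] cartan_diag[OF assms(1)]
  by (auto simp: ybold_def yg_xs xs_def coroot_def reflect_at field_simps)

text \<open>The convention c 0 = 1 is the multiplicative form of x_0 = 0 and avoids separate cases
  at the left end of the diagram.\<close>

definition good :: "(nat \<Rightarrow> complex) \<Rightarrow> bool" where
  "good c \<longleftrightarrow> c 0 = 1 \<and> (\<forall>i\<in>I. c i \<noteq> 0)"

lemma goodD: "good c \<Longrightarrow> i \<in> I \<Longrightarrow> c i \<noteq> 0" "good c \<Longrightarrow> c 0 = 1"
  by (auto simp: good_def)

lemma good_nz: "good c \<Longrightarrow> i \<le> n \<Longrightarrow> c i \<noteq> 0"
  by (cases "i = 0") (auto simp: good_def)

section \<open>The action of a single block on the natural representation\<close>

definition ysuf :: "(nat \<Rightarrow> complex) \<Rightarrow> nat \<Rightarrow> elt" where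
  "ysuf c k = foldr (\<circ>) (map (\<lambda>i. ybold n i (c i)) [k..<n + 1]) id"

lemma yblock_ysuf: "yblock c = ysuf c 1"
  by (simp only: yblock_def ysuf_def)

lemma ysuf_step: "k \<le> n \<Longrightarrow> ysuf c k z \<mu> = ybold n k (c k) (ysuf c (k + 1) z) \<mu>"
proof -
  assume k: "k \<le> n"
  have "[k..<n + 1] = k # [k + 1..<n + 1]" using upt_conv_Cons[of k "n + 1"] k by simp
  then show ?thesis by (simp add: ysuf_def del: upt_Suc)
qed

lemma ysuf_end: "ysuf c (n + 1) = id"
  by (simp add: ysuf_def)

lemma ysuf_skip:
  assumes "good c" "\<mu> \<in> mw" "1 \<le> k" "k \<le> m" "m \<le> n + 1" "\<And>j. k \<le> j \<Longrightarrow> j < m \<Longrightarrow> \<mu> j = 0"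
  shows "ysuf c k z \<mu> = ysuf c m z \<mu>"
  using assms(3-)
proof (induction "m - k" arbitrary: k)
  case 0
  then show ?case by simp
next
  case (Suc d)
  have k: "k \<in> I" "k \<le> n" "k < m" using Suc by auto
  have "ysuf c k z \<mu> = ysuf c (k + 1) z \<mu>"
    unfolding ysuf_step[OF k(2)] by (rule yb_eval(3)[OF k(1) assms(2) goodD(1)[OF assms(1) k(1)]]) (use Suc k in auto)
  also have "\<dots> = ysuf c m z \<mu>" by (rule Suc.hyps(1)) (use Suc.hyps(2) Suc.prems k in auto)
  finally show ?case .
qed

lemma ysuf_neg: "good c \<Longrightarrow> \<mu> \<in> mw \<Longrightarrow> k \<in> I \<Longrightarrow> \<mu> k = -1 \<Longrightarrow>
    ysuf c k z \<mu> = c k * ysuf c (k + 1) z \<mu> + ysuf c (k + 1) z (reflect n k \<mu>)"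
  by (simp add: ysuf_step yb_eval(1) goodD)

lemma ysuf_pos: "good c \<Longrightarrow> \<mu> \<in> mw \<Longrightarrow> k \<in> I \<Longrightarrow> \<mu> k = 1 \<Longrightarrow> ysuf c k z \<mu> = ysuf c (k + 1) z \<mu> / c k"
  by (simp add: ysuf_step yb_eval(2) goodD)

lemma ep_vals:
  "1 \<le> j \<Longrightarrow> j < n \<Longrightarrow> ep n p j = (if j = p then 1 else if j + 1 = p then -1 else 0)"
  "ep n p n = (if p + 1 = n \<or> p = n then 1 else 0)"
  using n4 by (auto simp: ep_def)

lemma en_vals:
  "1 \<le> j \<Longrightarrow> j < n \<Longrightarrow> en n p j = (if j = p then -1 else if j + 1 = p then 1 else 0)"
  "en n p n = (if p + 1 = n \<or> p = n then -1 else 0)"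
  using n4 by (auto simp: en_def ep_vals)

lemma Suc_n: "n - 1 + 1 = n" "n - 2 + 1 = n - 1" "Suc (n - 2) = n - 1" "Suc (n - Suc 0) = n"
  using n4 by auto

lemma refl_adjacent:
  assumes "1 \<le> m" "m < n"
  shows "reflect n m (ep n (m + 1)) = ep n m" "reflect n m (ep n m) = ep n (m + 1)"
    "reflect n m (en n (m + 1)) = en n m" "reflect n m (en n m) = en n (m + 1)"
proof -
  have m: "m \<in> I" "m + 1 \<in> I" "m + 1 \<noteq> m" using assms by auto
  show "reflect n m (ep n (m + 1)) = ep n m" "reflect n m (ep n m) = ep n (m + 1)"
    "reflect n m (en n (m + 1)) = en n m" "reflect n m (en n m) = en n (m + 1)"
    using refl_ep[OF m(1,2)] refl_ep[OF m(1,1)] refl_en[OF m(1,2)] refl_en[OF m(1,1)]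
    by (simp_all only: assms(2) m(3) if_True if_False simp_thms)
qed

lemma eval_ep:
  assumes g: "good c" and m: "2 \<le> m" "m \<le> n - 2"
  shows "yblock c z (ep n m) = c (m - 1) / c m * z (ep n m) + z (ep n (m - 1))"
proof -
  have mm: "m \<in> I" "m - 1 \<in> I" "m - 1 + 1 = m" using m by auto
  note E = ep_mw[OF mm(1)] ep_mw[OF mm(2)]
  have 1: "yblock c z (ep n m) = ysuf c (m - 1) z (ep n m)"
    unfolding yblock_ysuf by (rule ysuf_skip[OF g E(1)]) (use m in \<open>auto simp: ep_vals\<close>)
  have 2: "ysuf c (m - 1) z (ep n m) = c (m - 1) * ysuf c m z (ep n m) + ysuf c m z (reflect n (m - 1) (ep n m))"
    using ysuf_neg[OF g E(1) mm(2), of z] m mm by (simp add: ep_vals)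
  have 3: "reflect n (m - 1) (ep n m) = ep n (m - 1)" using refl_adjacent(1)[of "m - 1"] m unfolding mm(3) by simp
  have 4: "ysuf c m z (ep n m) = ysuf c (m + 1) z (ep n m) / c m"
    by (rule ysuf_pos[OF g E(1) mm(1)]) (use m in \<open>simp add: ep_vals\<close>)
  have 5: "ysuf c (m + 1) z (ep n m) = ysuf c (n + 1) z (ep n m)"
    by (rule ysuf_skip[OF g E(1)]) (use m in \<open>auto simp: ep_vals le_less_Suc_eq less_Suc_eq\<close>)
  have 6: "ysuf c m z (ep n (m - 1)) = ysuf c (n + 1) z (ep n (m - 1))"
    by (rule ysuf_skip[OF g E(2)]) (use m in \<open>auto simp: ep_vals le_less_Suc_eq less_Suc_eq\<close>)
  show ?thesis unfolding 1 2 3 4 5 6 ysuf_end by simp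
qed

lemma ends_in: "n - 2 \<in> I" "n - 1 \<in> I" "n \<in> I"
  using n4 by auto

lemma eval_ep_pen:
  assumes g: "good c"
  shows "yblock c z (ep n (n - 1)) = c (n - 2) / (c (n - 1) * c n) * z (ep n (n - 1)) + z (ep n (n - 2))"
proof -
  note E = ep_mw[OF ends_in(2)] ep_mw[OF ends_in(1)]
  have 1: "yblock c z (ep n (n - 1)) = ysuf c (n - 2) z (ep n (n - 1))"
    unfolding yblock_ysuf by (rule ysuf_skip[OF g E(1)]) (use n4 in \<open>auto simp: ep_vals\<close>)
  have 2: "ysuf c (n - 2) z (ep n (n - 1)) = c (n - 2) * ysuf c (n - 1) z (ep n (n - 1)) + ysuf c (n - 1) z (reflect n (n - 2) (ep n (n - 1)))"
    using ysuf_neg[OF g E(1) ends_in(1), of z] n4 by (simp add: ep_vals Suc_n)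
  have 3: "reflect n (n - 2) (ep n (n - 1)) = ep n (n - 2)" using refl_adjacent(1)[of "n - 2"] n4 unfolding Suc_n by simp
  have 4: "ysuf c (n - 1) z (ep n (n - 1)) = ysuf c n z (ep n (n - 1)) / c (n - 1)"
    using ysuf_pos[OF g E(1) ends_in(2), of z] n4 by (simp add: ep_vals Suc_n)
  have 5: "ysuf c n z (ep n (n - 1)) = ysuf c (n + 1) z (ep n (n - 1)) / c n"
    by (rule ysuf_pos[OF g E(1) ends_in(3)]) (use n4 in \<open>simp add: ep_vals\<close>)
  have 6: "ysuf c (n - 1) z (ep n (n - 2)) = ysuf c (n + 1) z (ep n (n - 2))"
  proof (rule ysuf_skip[OF g E(2)])
    fix j assume "n - 1 \<le> j" "j < n + 1"
    then have "j = n - 1 \<or> j = n" using n4 by auto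
    then show "ep n (n - 2) j = 0" using n4 by (auto simp: ep_vals)
  qed (use n4 in auto)
  show ?thesis unfolding 1 2 3 4 5 6 ysuf_end by simp
qed

lemma eval_ep_last:
  assumes g: "good c"
  shows "yblock c z (ep n n) = (c (n - 1) * z (ep n n) + z (ep n (n - 1))) / c n"
proof -
  note E = ep_mw[OF ends_in(3)] ep_mw[OF ends_in(2)]
  have 1: "yblock c z (ep n n) = ysuf c (n - 1) z (ep n n)"
    unfolding yblock_ysuf by (rule ysuf_skip[OF g E(1)]) (use n4 in \<open>auto simp: ep_vals\<close>)
  have 2: "ysuf c (n - 1) z (ep n n) = c (n - 1) * ysuf c n z (ep n n) + ysuf c n z (reflect n (n - 1) (ep n n))"
    using ysuf_neg[OF g E(1) ends_in(2), of z] n4 by (simp add: ep_vals Suc_n)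
  have 3: "reflect n (n - 1) (ep n n) = ep n (n - 1)" using refl_adjacent(1)[of "n - 1"] n4 unfolding Suc_n by simp
  have 4: "ysuf c n z (ep n p) = ysuf c (n + 1) z (ep n p) / c n" if "p = n - 1 \<or> p = n" for p
    by (rule ysuf_pos[OF g _ ends_in(3)]) (use n4 E that in \<open>auto simp: ep_vals\<close>)
  show ?thesis unfolding 1 2 3 using 4 by (simp add: ysuf_end[simplified] add_divide_distrib)
qed

lemma ysuf_last_en:
  assumes g: "good c"
  shows "ysuf c n z (en n n) = c n * z (en n n) + z (ep n (n - 1))"
    "ysuf c n z (en n (n - 1)) = c n * z (en n (n - 1)) + z (ep n n)"
proof -
  have r: "reflect n n (en n n) = ep n (n - 1)" "reflect n n (en n (n - 1)) = ep n n"
    using refl_en[OF ends_in(3,3)] refl_en[OF ends_in(3,2)] n4 by simp_all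
  have v: "en n n n = -1" "en n (n - 1) n = -1" using n4 by (simp_all add: en_vals)
  show "ysuf c n z (en n n) = c n * z (en n n) + z (ep n (n - 1))"
    "ysuf c n z (en n (n - 1)) = c n * z (en n (n - 1)) + z (ep n n)"
    using ysuf_neg[OF g en_mw[OF ends_in(3)] ends_in(3) v(1), of z] ysuf_neg[OF g en_mw[OF ends_in(2)] ends_in(3) v(2), of z]
    by (simp_all only: r ysuf_end id_apply)
qed

lemma eval_en_last:
  assumes g: "good c"
  shows "yblock c z (en n n) = (c n * z (en n n) + z (ep n (n - 1))) / c (n - 1)"
proof -
  note E = en_mw[OF ends_in(3)]
  have 1: "yblock c z (en n n) = ysuf c (n - 1) z (en n n)"
    unfolding yblock_ysuf by (rule ysuf_skip[OF g E(1)]) (use n4 in \<open>auto simp: en_vals\<close>)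
  have 2: "ysuf c (n - 1) z (en n n) = ysuf c n z (en n n) / c (n - 1)"
    using ysuf_pos[OF g E(1) ends_in(2), of z] n4 by (simp add: en_vals Suc_n)
  show ?thesis unfolding 1 2 ysuf_last_en[OF g] ..
qed

text \<open>The row at -\<epsilon>_p of the letters p, ..., n of a block. A path stops at some
  -\<epsilon>_m with m \<le> n - 2 and weight c m, or runs into the fork formed by the letters n - 1
  and n.\<close>

definition tail :: "(nat \<Rightarrow> complex) \<Rightarrow> vec \<Rightarrow> nat \<Rightarrow> complex" where
  "tail c z p = (\<Sum>m\<in>{p..n - 2}. c m * z (en n m)) + c (n - 1) * (c n * z (en n (n - 1)) + z (ep n n))
      + c n * z (en n n) + z (ep n (n - 1))"

lemma ysuf_en:
  assumes g: "good c" and p: "1 \<le> p" "p \<le> n - 1"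
  shows "ysuf c p z (en n p) = tail c z p"
  using p
proof (induction "n - 1 - p" arbitrary: p)
  case 0
  then have p: "p = n - 1" by simp
  have v: "en n (n - 1) (n - 1) = -1" using n4 by (simp add: en_vals)
  have r: "reflect n (n - 1) (en n (n - 1)) = en n n" using refl_en[OF ends_in(2,2)] n4 by (simp add: Suc_n)
  have "ysuf c (n - 1) z (en n (n - 1)) = c (n - 1) * ysuf c n z (en n (n - 1)) + ysuf c n z (en n n)"
    using ysuf_neg[OF g en_mw[OF ends_in(2)] ends_in(2) v, of z] unfolding r Suc_n .
  moreover have "{n - 1..n - 2} = {}" using n4 by auto
  ultimately show ?case unfolding p tail_def by (simp only: ysuf_last_en[OF g] sum.empty) simp
next
  case (Suc d)
  have p: "p \<in> I" "p + 1 \<in> I" "p \<le> n - 2" "p < n" using Suc n4 by auto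
  have v: "en n p p = -1" using p by (simp add: en_vals)
  have r: "reflect n p (en n p) = en n (p + 1)" using refl_en[OF p(1,1)] p by simp
  have "ysuf c p z (en n p) = c p * ysuf c (p + 1) z (en n p) + ysuf c (p + 1) z (en n (p + 1))"
    using ysuf_neg[OF g en_mw[OF p(1)] p(1) v, of z] unfolding r .
  also have "ysuf c (p + 1) z (en n p) = ysuf c (n + 1) z (en n p)"
    by (rule ysuf_skip[OF g en_mw[OF p(1)]]) (use p in \<open>auto simp: en_vals less_Suc_eq le_less_Suc_eq\<close>)
  also have "ysuf c (p + 1) z (en n (p + 1)) = tail c z (p + 1)"
    by (rule Suc.hyps(1)) (use Suc.hyps(2) p in auto)
  finally show ?case using p by (simp add: tail_def ysuf_end[simplified] sum.atLeast_Suc_atMost)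
qed

lemma eval_en:
  assumes g: "good c" and p: "1 \<le> p" "p \<le> n - 1"
  shows "yblock c z (en n p) = tail c z p / c (p - 1)"
proof (cases "p = 1")
  case True
  then show ?thesis using ysuf_en[OF g p] goodD(2)[OF g] by (simp add: yblock_ysuf)
next
  case False
  have pp: "p \<in> I" "p - 1 \<in> I" "p - 1 + 1 = p" using p False by auto
  have 1: "yblock c z (en n p) = ysuf c (p - 1) z (en n p)"
    unfolding yblock_ysuf by (rule ysuf_skip[OF g en_mw[OF pp(1)]]) (use p False in \<open>auto simp: en_vals\<close>)
  have v: "en n p (p - 1) = 1" using p False by (auto simp: en_vals)
  show ?thesis unfolding 1 ysuf_pos[OF g en_mw[OF pp(1)] pp(2) v] pp(3) ysuf_en[OF g p] ..
qed

lemma tail_Suc: "p \<le> n - 2 \<Longrightarrow> tail c z p = c p * z (en n p) + tail c z (p + 1)"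
  by (simp add: tail_def sum.atLeast_Suc_atMost)

text \<open>Consecutive tails differ by a single term, so two rows of the block give back one
  coefficient of the argument. This inverts the block on the lowest part of the
  representation.\<close>

lemma en_recover:
  assumes g: "good c" and p: "1 \<le> p" "p \<le> n - 2"
  shows "z (en n p) = c (p - 1) / c p * yblock c z (en n p) - yblock c z (en n (p + 1))"
proof -
  have nz: "c (p - 1) \<noteq> 0" "c p \<noteq> 0" using good_nz[OF g] p n4 by auto
  show ?thesis using eval_en[OF g, of p z] eval_en[OF g, of "p + 1" z] tail_Suc[of p c z] p n4 nz
    by (simp add: field_simps)
qed

section \<open>Products of consecutive blocks\<close>

definition Pb :: "(nat \<Rightarrow> nat \<Rightarrow> complex) \<Rightarrow> nat \<Rightarrow> nat \<Rightarrow> elt" where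
  "Pb b s k = foldr (\<circ>) (map (\<lambda>j. yblock (b j)) [s..<s + k]) id"

lemma Pb_0: "Pb b s 0 = id"
  by (simp add: Pb_def)

lemma Pb_Suc: "Pb b s (Suc k) = yblock (b s) \<circ> Pb b (s + 1) k"
proof -
  have "[s..<s + Suc k] = s # [s + 1..<s + 1 + k]" using upt_conv_Cons[of s "s + Suc k"] by simp
  then show ?thesis by (simp add: Pb_def del: upt_Suc)
qed

lemma Pb_split: "Pb b s (k + m) = Pb b s k \<circ> Pb b (s + k) m"
proof -
  have "[s..<s + (k + m)] = [s..<s + k] @ [s + k..<s + k + m]" using upt_add_eq_append[of s "s + k" m] by (simp add: add.assoc)
  then show ?thesis unfolding Pb_def by (simp only: map_append foldr_comp_append)
qed

text \<open>For s = 1 the exponents of the terms are the forms of \<open>Xi' n k\<close> with k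
  \<le> n - 2; the general s serves the induction over blocks.\<close>

definition ratio_sum :: "(nat \<Rightarrow> nat \<Rightarrow> complex) \<Rightarrow> nat \<Rightarrow> nat \<Rightarrow> complex" where
  "ratio_sum b s k = (\<Sum>j\<in>{1..k}. b (s + j - 1) (k - j) / b (s + j - 1) (k - j + 1))"

lemma ratio_sum_Suc: "ratio_sum b s (Suc k) = b s k / b s (Suc k) + ratio_sum b (s + 1) k"
proof -
  have "ratio_sum b s (Suc k) = b s k / b s (Suc k) + (\<Sum>j\<in>{Suc 1..Suc k}. b (s + j - 1) (Suc k - j) / b (s + j - 1) (Suc k - j + 1))"
    unfolding ratio_sum_def by (subst sum.atLeast_Suc_atMost) simp_all
  also have "(\<Sum>j\<in>{Suc 1..Suc k}. b (s + j - 1) (Suc k - j) / b (s + j - 1) (Suc k - j + 1)) = ratio_sum b (s + 1) k"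
    unfolding ratio_sum_def sum.shift_bounds_cl_Suc_ivl by simp
  finally show ?thesis .
qed

text \<open>Stripping blocks from the left one at a time expresses the bottom row of what remains through the
  rows of the whole product.\<close>

lemma bottom_functional:
  assumes b: "\<And>j. good (b j)"
  shows "k \<le> n - 2 \<Longrightarrow> \<exists>a :: nat \<Rightarrow> complex. a 0 = 0 \<and> a (k + 1) = (-1) ^ k \<and> a k = - ((-1) ^ k * ratio_sum b s k) \<and>
     (\<forall>z. z (en n 1) = (\<Sum>m\<in>{1..k + 1}. a m * Pb b s k z (en n m)))"
proof (induction k arbitrary: s)
  case 0
  show ?case
    by (rule exI[of _ "\<lambda>m. if m = 1 then 1 else 0"]) (simp add: Pb_0 ratio_sum_def)
next
  case (Suc k)
  have "k \<le> n - 2" using Suc.prems by simp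
  from Suc.IH[OF this, of "s + 1"] obtain a where a: "a 0 = 0" "a (k + 1) = (-1) ^ k" "a k = - ((-1) ^ k * ratio_sum b (s + 1) k)"
    and az: "\<And>z. z (en n 1) = (\<Sum>m\<in>{1..k + 1}. a m * Pb b (s + 1) k z (en n m))"
    using Suc.IH[of "s + 1"] by auto
  let ?c = "b s"
  \<comment> \<open>\<open>en_recover\<close> is substituted for every coefficient of the vector:
    row m receives a multiple of a m from its own index and -a (m - 1) from the index below.\<close>
  define a' where "a' m = (if m \<le> k + 1 then a m * (?c (m - 1) / ?c m) else 0) - (if m = 0 then 0 else a (m - 1))" for m
  have "z (en n 1) = (\<Sum>m\<in>{1..k + 2}. a' m * Pb b s (Suc k) z (en n m))" for z
  proof -
    define y where "y = Pb b (s + 1) k z"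
    define w where "w m = yblock ?c y (en n m)" for m
    have "z (en n 1) = (\<Sum>m\<in>{1..k + 1}. a m * y (en n m))" using az[of z] by (simp add: y_def)
    also have "\<dots> = (\<Sum>m\<in>{1..k + 1}. a m * (?c (m - 1) / ?c m) * w m - a m * w (m + 1))"
    proof (rule sum.cong[OF refl])
      fix m assume m: "m \<in> {1..k + 1}"
      have e: "y (en n m) = ?c (m - 1) / ?c m * w m - w (m + 1)"
        unfolding w_def by (rule en_recover[OF b]) (use m Suc.prems in auto)
      show "a m * y (en n m) = a m * (?c (m - 1) / ?c m) * w m - a m * w (m + 1)"
        unfolding e by (simp only: right_diff_distrib mult.assoc)
    qed
    also have "\<dots> = (\<Sum>m\<in>{1..k + 1}. a m * (?c (m - 1) / ?c m) * w m) - (\<Sum>m\<in>{1..k + 1}. a m * w (m + 1))"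
      by (rule sum_subtractf)
    also have "(\<Sum>m\<in>{1..k + 1}. a m * w (m + 1)) = (\<Sum>m\<in>{2..k + 2}. a (m - 1) * w m)"
      by (rule sum.reindex_bij_witness[of _ "\<lambda>m. m - 1" "\<lambda>m. m + 1"]) auto
    also have "\<dots> = (\<Sum>m\<in>{1..k + 2}. a (m - 1) * w m)"
      by (rule sum.mono_neutral_left) (auto simp: a(1) not_le less_Suc_eq)
    also have "(\<Sum>m\<in>{1..k + 1}. a m * (?c (m - 1) / ?c m) * w m) =
        (\<Sum>m\<in>{1..k + 2}. (if m \<le> k + 1 then a m * (?c (m - 1) / ?c m) else 0) * w m)"
      by (rule sum.mono_neutral_cong_left) auto
    also have "(\<Sum>m\<in>{1..k + 2}. (if m \<le> k + 1 then a m * (?c (m - 1) / ?c m) else 0) * w m) -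
        (\<Sum>m\<in>{1..k + 2}. a (m - 1) * w m) = (\<Sum>m\<in>{1..k + 2}. a' m * w m)"
      unfolding sum_subtractf[symmetric] by (rule sum.cong) (auto simp: a'_def left_diff_distrib)
    finally have "z (en n 1) = (\<Sum>m\<in>{1..k + 2}. a' m * w m)" .
    then show ?thesis by (simp add: w_def y_def Pb_Suc)
  qed
  moreover have "a' (Suc k + 1) = (-1) ^ Suc k" "a' 0 = 0" using a by (simp_all add: a'_def)
  moreover have "a' (Suc k) = - ((-1) ^ Suc k * ratio_sum b s (Suc k))"
    using a by (simp add: a'_def ratio_sum_Suc algebra_simps)
  ultimately show ?case by (intro exI[of _ a']) simp
qed

text \<open>The vector has natural components only in the span of the highest weights \<epsilon>_1,
  ..., \<epsilon>_q; half-spin components are unrestricted.\<close>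

definition low_zero :: "nat \<Rightarrow> vec \<Rightarrow> bool" where
  "low_zero q v \<longleftrightarrow> (\<forall>m\<in>I. v (en n m) = 0) \<and> (\<forall>m. q < m \<and> m \<le> n \<longrightarrow> v (ep n m) = 0)"

lemma low_zero_step:
  assumes g: "good c" and v: "low_zero q v" and q: "1 \<le> q" "q \<le> n - 2"
  shows "low_zero (q + 1) (yblock c v)" "yblock c v (ep n (q + 1)) = v (ep n q)"
    "2 \<le> q \<Longrightarrow> yblock c v (ep n q) = c (q - 1) / c q * v (ep n q) + v (ep n (q - 1))"
proof -
  have z: "v (ep n m) = 0" if "q < m" "m \<le> n" for m using v that by (auto simp: low_zero_def)
  have z': "v (en n m) = 0" if "m \<in> I" for m using v that by (auto simp: low_zero_def)
  have zz: "v (ep n n) = 0" "v (ep n (n - 1)) = 0" using z q n4 by auto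
  have "tail c v p = 0" if "1 \<le> p" for p
  proof -
    have "(\<Sum>m\<in>{p..n - 2}. c m * v (en n m)) = 0" by (rule sum.neutral) (use that z' in auto)
    then show ?thesis unfolding tail_def using that z' zz ends_in by simp
  qed
  then have 1: "yblock c v (en n p) = 0" if "p \<in> I" for p
    using eval_en[OF g, of p v] eval_en_last[OF g, of v] that zz z' by (cases "p = n") auto
  have 2: "yblock c v (ep n m) = 0" if that': "q + 1 < m" "m \<le> n" for m
  proof -
    consider "m \<le> n - 2" | "m = n - 1" | "m = n" using that' by arith
    then show ?thesis
    proof cases
      case 1 then show ?thesis using eval_ep[OF g, of m v] z[of m] z[of "m - 1"] that' q by simp
    next
      case 2 then show ?thesis using eval_ep_pen[OF g, of v] z[of "n - 2"] zz that' by simp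
    next
      case 3 then show ?thesis using eval_ep_last[OF g, of v] zz by simp
    qed
  qed
  show "low_zero (q + 1) (yblock c v)" using 1 2 by (simp add: low_zero_def)
  show "yblock c v (ep n (q + 1)) = v (ep n q)"
  proof (cases "q = n - 2")
    case True then show ?thesis using eval_ep_pen[OF g, of v] zz by (simp add: Suc_n)
  next
    case False then show ?thesis using eval_ep[OF g, of "q + 1" v] z[of "q + 1"] q by simp
  qed
  show "2 \<le> q \<Longrightarrow> yblock c v (ep n q) = c (q - 1) / c q * v (ep n q) + v (ep n (q - 1))"
    using eval_ep[OF g, of q v] q by simp
qed

text \<open>Each block raises the lowest occurring index by one. The extreme coefficient is carried
  along unchanged, while its neighbour collects one ratio from every block.\<close>

lemma low_zero_blocks:
  assumes b: "\<And>j. good (b j)" and v: "low_zero (q + 1) v" and q: "1 \<le> q"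
  shows "q + r \<le> n - 2 \<Longrightarrow> low_zero (q + r + 1) (Pb b s r v) \<and> Pb b s r v (ep n (q + r + 1)) = v (ep n (q + 1)) \<and>
    Pb b s r v (ep n (q + r)) = v (ep n q) + (\<Sum>j\<in>{s..<s + r}. b j (q + (s + r - 1 - j)) / b j (q + (s + r - j))) * v (ep n (q + 1))"
proof (induction r arbitrary: s)
  case 0
  then show ?case using v by (simp add: Pb_0)
next
  case (Suc r)
  define y where "y = Pb b (s + 1) r v"
  have y: "low_zero (q + r + 1) y" "y (ep n (q + r + 1)) = v (ep n (q + 1))"
    "y (ep n (q + r)) = v (ep n q) + (\<Sum>j\<in>{s + 1..<s + 1 + r}. b j (q + (s + 1 + r - 1 - j)) / b j (q + (s + 1 + r - j))) * v (ep n (q + 1))"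
    using Suc.IH[of "s + 1"] Suc.prems by (auto simp: y_def)
  have P: "Pb b s (Suc r) v = yblock (b s) y" by (simp add: Pb_Suc y_def)
  have 1: "1 \<le> q + r + 1" "q + r + 1 \<le> n - 2" "2 \<le> q + r + 1" using Suc.prems q by auto
  note S = low_zero_step[OF b y(1) 1(1,2), of s]
  have s: "(\<Sum>j\<in>{s..<s + Suc r}. b j (q + (s + Suc r - 1 - j)) / b j (q + (s + Suc r - j))) =
     b s (q + r) / b s (q + r + 1) + (\<Sum>j\<in>{s + 1..<s + 1 + r}. b j (q + (s + 1 + r - 1 - j)) / b j (q + (s + 1 + r - j)))"
    by (subst sum.atLeast_Suc_lessThan) simp_all
  show ?case unfolding P s using S(1,2) S(3)[OF 1(3)] y(2,3) by (simp add: algebra_simps)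
qed

text \<open>The exponents of its terms are exactly the forms of \<open>Xi n k\<close> for k \<le> n
  - 2. The last sum may be empty.\<close>

definition upper_coeff :: "(nat \<Rightarrow> nat \<Rightarrow> complex) \<Rightarrow> nat \<Rightarrow> complex" where
  "upper_coeff b k =
     (\<Sum>i\<in>{1..n - 2}. b k i / b (k + 1) (i - 1)) + b k (n - 1) * b k n / b (k + 1) (n - 2)
     + b (k + 1) (n - 2) / (b (k + 1) (n - 1) * b (k + 1) n)
     + b k (n - 1) / b (k + 1) n + b k n / b (k + 1) (n - 1)
     + (\<Sum>j\<in>{k + 2..<n}. b j (n + k - j - 1) / b j (n + k - j))"

text \<open>The blocks from k + 2 on push the vector down to \<epsilon>_(n-1). Block k + 1 then
  reaches every -\<epsilon>_p, and block k is read at -\<epsilon>_1 by \<open>tail\<close>; the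
  result is linear in the two lowest coefficients of v.\<close>

lemma bottom_row:
  assumes b: "\<And>j. good (b j)" and v: "low_zero (k + 1) v" and k: "1 \<le> k" "k \<le> n - 2"
  shows "Pb b k (n - k) v (en n 1) = v (ep n k) + upper_coeff b k * v (ep n (k + 1))"
proof -
  \<comment> \<open>The number of blocks after k + 1, so that exactly the two blocks k and k + 1 are
    evaluated by hand.\<close>
  define r where "r = n - 2 - k"
  have r: "n - k = Suc (Suc r)" "k + r = n - 2" "k + r + 1 = n - 1" "k + 2 + r = n" using k n4 by (auto simp: r_def)
  define y where "y = Pb b (k + 2) r v"
  define w where "w = yblock (b (k + 1)) y"
  let ?S = "\<Sum>j\<in>{k + 2..<n}. b j (n + k - j - 1) / b j (n + k - j)"
  have S: "(\<Sum>j\<in>{k + 2..<k + 2 + r}. b j (k + (k + 2 + r - 1 - j)) / b j (k + (k + 2 + r - j))) = ?S"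
    unfolding r(4)
  proof (rule sum.cong)
    fix j assume "j \<in> {k + 2..<n}"
    then have "k + (n - 1 - j) = n + k - j - 1" "k + (n - j) = n + k - j" by auto
    then show "b j (k + (n - 1 - j)) / b j (k + (n - j)) = b j (n + k - j - 1) / b j (n + k - j)" by simp
  qed simp
  have y: "low_zero (n - 1) y" "y (ep n (n - 1)) = v (ep n (k + 1))" "y (ep n (n - 2)) = v (ep n k) + ?S * v (ep n (k + 1))"
    using low_zero_blocks[where b = b and r = r and s = "k + 2", OF b v k(1)] unfolding S unfolding y_def[symmetric] r(2) Suc_n by auto
  have yz: "y (ep n n) = 0" "\<And>m. m \<in> I \<Longrightarrow> y (en n m) = 0" using y(1) n4 by (auto simp: low_zero_def)
  let ?c = "b (k + 1)" let ?Y = "y (ep n (n - 1))"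
  have t: "tail ?c y p = ?Y" if "1 \<le> p" for p
  proof -
    have "(\<Sum>m\<in>{p..n - 2}. ?c m * y (en n m)) = 0" by (rule sum.neutral) (use that yz in auto)
    then show ?thesis unfolding tail_def using that yz ends_in by simp
  qed
  have w1: "w (en n p) = ?Y / ?c (p - 1)" if "1 \<le> p" "p \<le> n - 1" for p
    unfolding w_def eval_en[OF b that] t[OF that(1)] ..
  have w2: "w (en n n) = ?Y / ?c (n - 1)" unfolding w_def eval_en_last[OF b] using yz ends_in by simp
  have w3: "w (ep n n) = ?Y / ?c n" unfolding w_def eval_ep_last[OF b] using yz by simp
  have w4: "w (ep n (n - 1)) = ?c (n - 2) / (?c (n - 1) * ?c n) * ?Y + y (ep n (n - 2))" unfolding w_def by (rule eval_ep_pen[OF b])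
  have "Pb b k (n - k) v (en n 1) = yblock (b k) w (en n 1)"
    unfolding r(1) Pb_Suc w_def y_def by (simp add: add.assoc)
  also have "\<dots> = tail (b k) w 1" using eval_en[OF b[of k], of 1 w] n4 goodD(2)[OF b[of k]] by simp
  also have "\<dots> = (\<Sum>m\<in>{1..n - 2}. b k m / ?c (m - 1) * ?Y) + b k (n - 1) * (b k n * (?Y / ?c (n - 2)) + ?Y / ?c n)
      + b k n * (?Y / ?c (n - 1)) + (?c (n - 2) / (?c (n - 1) * ?c n) * ?Y + y (ep n (n - 2)))"
  proof -
    have "(\<Sum>m\<in>{1..n - 2}. b k m * w (en n m)) = (\<Sum>m\<in>{1..n - 2}. b k m / ?c (m - 1) * ?Y)"
      by (rule sum.cong) (auto simp: w1)
    moreover have "n - 1 - 1 = n - 2" by simp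
    ultimately show ?thesis unfolding tail_def w2 w3 w4 using w1[of "n - 1"] n4 by simp
  qed
  also have "\<dots> = v (ep n k) + upper_coeff b k * v (ep n (k + 1))"
    unfolding y(2,3) upper_coeff_def sum_distrib_right[symmetric] by (simp add: algebra_simps)
  finally show ?thesis .
qed

section \<open>Characters read off the natural representation\<close>

lemma sb_sign:
  assumes "i \<in> I" "\<kappa> \<in> mw"
  shows "\<exists>e :: complex. (e = 1 \<or> e = -1) \<and> (\<forall>z. sb i z \<kappa> = e * z (reflect n i \<kappa>))"
  using mw_values[OF assms(2), of i]
proof (elim disjE)
  assume "\<kappa> i = 0"
  then show ?thesis using reflect_zero[of \<kappa> i] by (intro exI[of _ 1]) (simp add: sb_values(3))
qed (rule exI[of _ 1], simp add: sb_values assms, rule exI[of _ "-1"], simp add: sb_values assms)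

lemma W_sign:
  "set ls \<subseteq> I \<Longrightarrow> \<kappa> \<in> mw \<Longrightarrow> fold (reflect n) ls \<kappa> \<in> mw \<and>
    (\<exists>e :: complex. (e = 1 \<or> e = -1) \<and> (\<forall>z. W ls z \<kappa> = e * z (fold (reflect n) ls \<kappa>)))"
proof (induction ls arbitrary: \<kappa>)
  case Nil
  then show ?case by (auto simp: W_Nil intro: exI[of _ 1])
next
  case (Cons i ls)
  then have i: "i \<in> I" "set ls \<subseteq> I" by auto
  obtain e :: complex where e: "e = 1 \<or> e = -1" "\<And>z. sb i z \<kappa> = e * z (reflect n i \<kappa>)"
    using sb_sign[OF i(1) Cons.prems(2)] by blast
  obtain f :: complex where f: "f = 1 \<or> f = -1" "\<And>z. W ls z (reflect n i \<kappa>) = f * z (fold (reflect n) ls (reflect n i \<kappa>))"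
    and m: "fold (reflect n) ls (reflect n i \<kappa>) \<in> mw"
    using Cons.IH[OF i(2) refl_mw[OF Cons.prems(2) i(1)]] by blast
  have "W (i # ls) z \<kappa> = (e * f) * z (fold (reflect n) (i # ls) \<kappa>)" for z
    by (simp add: W_Cons e(2) f(2))
  moreover have "e * f = 1 \<or> e * f = -1" using e(1) f(1) by auto
  ultimately show ?case using m by auto
qed

text \<open>Vectors are coefficient functions, so the value of \<open>cox z\<close> at \<kappa> is
  read from z at \<open>ccox\<close> \<kappa>. Therefore \<open>ccox\<close> is the inverse of the
  Coxeter element on weights.\<close>

definition ccox :: "weight \<Rightarrow> weight" where
  "ccox \<kappa> = fold (reflect n) [1..<n + 1] \<kappa>"

lemma cox_sign:
  "\<kappa> \<in> mw \<Longrightarrow> (ccox ^^ k) \<kappa> \<in> mw \<and>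
    (\<exists>e :: complex. (e = 1 \<or> e = -1) \<and> (\<forall>z. (cox ^^ k) z \<kappa> = e * z ((ccox ^^ k) \<kappa>)))"
proof (induction k arbitrary: \<kappa>)
  case 0
  then show ?case by (auto intro: exI[of _ 1])
next
  case (Suc k)
  have I: "set [1..<n + 1] \<subseteq> I" by auto
  obtain e :: complex where e: "e = 1 \<or> e = -1" "\<And>z. cox z \<kappa> = e * z (ccox \<kappa>)" and c: "ccox \<kappa> \<in> mw"
    using W_sign[OF I Suc.prems] unfolding cox_def ccox_def by blast
  obtain f :: complex where f: "f = 1 \<or> f = -1" "\<And>z. (cox ^^ k) z (ccox \<kappa>) = f * z ((ccox ^^ k) (ccox \<kappa>))"
    and m: "(ccox ^^ k) (ccox \<kappa>) \<in> mw"
    using Suc.IH[OF c] by blast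
  have s: "(ccox ^^ Suc k) \<kappa> = (ccox ^^ k) (ccox \<kappa>)" by (simp add: funpow_swap1)
  have "(cox ^^ Suc k) z \<kappa> = cox ((cox ^^ k) z) \<kappa>" for z by simp
  then have "(cox ^^ Suc k) z \<kappa> = (e * f) * z ((ccox ^^ Suc k) \<kappa>)" for z
    unfolding e(2) f(2) s by (simp only: mult.assoc)
  moreover have "e * f = 1 \<or> e * f = -1" using e(1) f(1) by auto
  ultimately show ?case using m unfolding s by blast
qed

lemma w0_outside: "\<kappa> \<notin> mw \<Longrightarrow> w0 z \<kappa> = z \<kappa>"
proof -
  assume k: "\<kappa> \<notin> mw"
  have W: "W ls z \<kappa> = z \<kappa>" for ls z
    by (induction ls arbitrary: z) (simp_all add: W_Nil W_Cons outside_mw(2)[OF k])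
  have "(cox ^^ j) z \<kappa> = z \<kappa>" for j z
    by (induction j arbitrary: z) (simp_all add: cox_def W)
  then show ?thesis unfolding w0bar_cox .
qed

lemma fold_fix: "(\<And>i. i \<in> set ls \<Longrightarrow> \<kappa> i = 0) \<Longrightarrow> fold (reflect n) ls \<kappa> = \<kappa>"
  by (induction ls) (auto simp: reflect_zero)

lemma upt_split3: "1 \<le> i \<Longrightarrow> i \<le> n \<Longrightarrow> [1..<n + 1] = [1..<i] @ [i] @ [i + 1..<n + 1]"
  using upt_add_eq_append[of 1 i "n + 1 - i"] upt_conv_Cons[of i "n + 1"] by simp

lemma ccox_ep: "2 \<le> m \<Longrightarrow> m \<le> n - 1 \<Longrightarrow> ccox (ep n m) = ep n (m - 1)"
proof -
  assume m: "2 \<le> m" "m \<le> n - 1"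
  have s: "[1..<n + 1] = [1..<m - 1] @ [m - 1] @ [m..<n + 1]" using upt_split3[of "m - 1"] m by simp
  have 1: "fold (reflect n) [1..<m - 1] (ep n m) = ep n m"
    by (rule fold_fix) (use m in \<open>auto simp: ep_vals\<close>)
  have 2: "reflect n (m - 1) (ep n m) = ep n (m - 1)" using refl_adjacent(1)[of "m - 1"] m by simp
  have 3: "fold (reflect n) [m..<n + 1] (ep n (m - 1)) = ep n (m - 1)"
    by (rule fold_fix) (use m n4 in \<open>auto simp: ep_vals le_less_Suc_eq less_Suc_eq\<close>)
  show ?thesis unfolding ccox_def s fold_append comp_def 1 by (simp only: fold_simps 2 3)
qed

lemma ccox_en: "2 \<le> m \<Longrightarrow> m \<le> n - 1 \<Longrightarrow> ccox (en n m) = en n (m - 1)"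
proof -
  assume m: "2 \<le> m" "m \<le> n - 1"
  have s: "[1..<n + 1] = [1..<m - 1] @ [m - 1] @ [m..<n + 1]" using upt_split3[of "m - 1"] m by simp
  have 1: "fold (reflect n) [1..<m - 1] (en n m) = en n m"
    by (rule fold_fix) (use m in \<open>auto simp: en_vals\<close>)
  have 2: "reflect n (m - 1) (en n m) = en n (m - 1)" using refl_adjacent(3)[of "m - 1"] m by simp
  have 3: "fold (reflect n) [m..<n + 1] (en n (m - 1)) = en n (m - 1)"
    by (rule fold_fix) (use m n4 in \<open>auto simp: en_vals le_less_Suc_eq less_Suc_eq\<close>)
  show ?thesis unfolding ccox_def s fold_append comp_def 1 by (simp only: fold_simps 2 3)
qed

lemma ccox_en1: "ccox (en n 1) = ep n (n - 1)"
proof -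
  have "k \<le> n - 1 \<Longrightarrow> fold (reflect n) [1..<k + 1] (en n 1) = en n (k + 1)" for k
  proof (induction k)
    case (Suc k)
    then have "fold (reflect n) [1..<k + 1] (en n 1) = en n (k + 1)" by simp
    moreover have "reflect n (k + 1) (en n (k + 1)) = en n (k + 1 + 1)"
      by (rule refl_adjacent(4)) (use Suc.prems n4 in auto)
    ultimately show ?case by simp
  qed simp
  from this[of "n - 1"] have "fold (reflect n) [1..<n] (en n 1) = en n n" using n4 by (simp del: upt_Suc)
  moreover have "reflect n n (en n n) = ep n (n - 1)"
    using refl_en[OF ends_in(3,3)] by simp
  moreover have "[1..<n + 1] = [1..<n] @ [n]" using n4 by simp
  ultimately show ?thesis by (simp add: ccox_def del: upt_Suc)
qed

lemma ccox_pow_ep: "1 \<le> m \<Longrightarrow> m + k \<le> n - 1 \<Longrightarrow> (ccox ^^ k) (ep n (m + k)) = ep n m"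
proof (induction k)
  case (Suc k)
  have "(ccox ^^ Suc k) (ep n (m + Suc k)) = (ccox ^^ k) (ccox (ep n (m + Suc k)))" by (simp add: funpow_swap1)
  also have "ccox (ep n (m + Suc k)) = ep n (m + k)" using ccox_ep[of "m + Suc k"] Suc.prems by simp
  finally show ?case using Suc by simp
qed simp

lemma ccox_pow_en: "1 \<le> m \<Longrightarrow> m + k \<le> n - 1 \<Longrightarrow> (ccox ^^ k) (en n (m + k)) = en n m"
proof (induction k)
  case (Suc k)
  have "(ccox ^^ Suc k) (en n (m + Suc k)) = (ccox ^^ k) (ccox (en n (m + Suc k)))" by (simp add: funpow_swap1)
  also have "ccox (en n (m + Suc k)) = en n (m + k)" using ccox_en[of "m + Suc k"] Suc.prems by simp
  finally show ?case using Suc by simp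
qed simp

lemma ccox_flip: "1 \<le> m \<Longrightarrow> m \<le> n - 1 \<Longrightarrow> (ccox ^^ (n - 1)) (en n m) = ep n m"
proof -
  assume m: "1 \<le> m" "m \<le> n - 1"
  have f: "(f ^^ (p + (1 + q))) x = (f ^^ p) (f ((f ^^ q) x))" for f :: "weight \<Rightarrow> weight" and p q x
    by (simp add: funpow_add funpow_swap1)
  have "(n - 1 - m) + (1 + (m - 1)) = n - 1" using m by simp
  then have "(ccox ^^ (n - 1)) (en n m) = (ccox ^^ (n - 1 - m)) (ccox ((ccox ^^ (m - 1)) (en n m)))"
    using f[of "n - 1 - m" "m - 1" ccox "en n m"] by simp
  also have "(ccox ^^ (m - 1)) (en n m) = en n 1" using ccox_pow_en[of 1 "m - 1"] m by simp
  also have "(ccox ^^ (n - 1 - m)) (ccox (en n 1)) = ep n m" using ccox_pow_ep[of m "n - 1 - m"] m unfolding ccox_en1 by simp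
  finally show ?thesis .
qed

lemma w0_en: "1 \<le> m \<Longrightarrow> m \<le> n - 1 \<Longrightarrow> \<exists>e. e \<noteq> 0 \<and> (\<forall>z. w0 z (en n m) = e * z (ep n m))"
proof -
  assume m: "1 \<le> m" "m \<le> n - 1"
  then have "en n m \<in> mw" by (intro en_mw) auto
  then obtain e :: complex where "e = 1 \<or> e = -1" "\<forall>z. (cox ^^ (n - 1)) z (en n m) = e * z ((ccox ^^ (n - 1)) (en n m))"
    using cox_sign[of "en n m" "n - 1"] by blast
  then show ?thesis unfolding w0bar_cox ccox_flip[OF m] by (intro exI[of _ e]) auto
qed

lemma ccox_sw: "(ccox ^^ k) (sw n S) \<in> range (sw n)"
proof -
  have f: "fold (reflect n) ls (sw n S) \<in> range (sw n)" if "set ls \<subseteq> I" for ls S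
    using that by (induction ls arbitrary: S) (auto simp: refl_sw)
  have c: "ccox (sw n S) \<in> range (sw n)" for S unfolding ccox_def by (rule f) auto
  show ?thesis
  proof (induction k)
    case (Suc k)
    then obtain T where "(ccox ^^ k) (sw n S) = sw n T" by blast
    then show ?case using c by simp
  qed simp
qed

text \<open>The sum of the last two coordinates is even for natural weights and odd for half-spin
  weights.\<close>

lemma natural_not_spin: "p \<in> I \<Longrightarrow> ep n p \<noteq> sw n S" "p \<in> I \<Longrightarrow> en n p \<noteq> sw n S"
proof -
  have "1 \<le> n - 1" "n - 1 < n" "n - 1 + 1 = n" using n4 by auto
  then have s: "odd (sw n S (n - 1) + sw n S n)" by (simp add: sw_def of_bool_def)
  have e: "even (ep n p (n - 1) + ep n p n)" using n4 by (auto simp: ep_vals)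
  show "ep n p \<noteq> sw n S" using s e by auto
  have "even (en n p (n - 1) + en n p n)" using e by (simp add: en_def)
  then show "en n p \<noteq> sw n S" using s by auto
qed

lemma lev_ep_Suc: "1 \<le> m \<Longrightarrow> m < n \<Longrightarrow> lev (ep n (m + 1)) = lev (ep n m) - 1"
  using lev_reflect[of m "ep n m"] refl_adjacent(2)[of m] by (simp add: ep_vals)

lemma lev_en_Suc: "1 \<le> m \<Longrightarrow> m < n \<Longrightarrow> lev (en n (m + 1)) = lev (en n m) + 1"
  using lev_reflect[of m "en n m"] refl_adjacent(4)[of m] by (simp add: en_vals)

lemma lev_ep: "1 \<le> m \<Longrightarrow> m \<le> n \<Longrightarrow> lev (ep n m) = lev (ep n n) + (int n - int m)"
proof (induction "n - m" arbitrary: m)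
  case (Suc d)
  then have "lev (ep n (m + 1)) = lev (ep n n) + (int n - int (m + 1))" by (intro Suc.hyps(1)) auto
  then show ?case using lev_ep_Suc[of m] Suc by simp
qed simp

lemma refl_ends: "reflect n n (ep n (n - 1)) = en n n" "reflect n n (en n n) = ep n (n - 1)"
proof -
  have "n - 1 \<noteq> n" "\<not> n < n" using n4 by auto
  then show "reflect n n (ep n (n - 1)) = en n n" "reflect n n (en n n) = ep n (n - 1)"
    using refl_ep[OF ends_in(3,2)] refl_en[OF ends_in(3,3)] by (simp_all only: if_True if_False simp_thms)
qed

text \<open>Together with \<open>lev_ep\<close>: the levels descend along \<epsilon>_1, ...,
  \<epsilon>_(n-1), then \<epsilon>_n and -\<epsilon>_n share a level, and then they descend along
  -\<epsilon>_(n-1), ..., -\<epsilon>_1.\<close>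

lemma lev_en: "1 \<le> m \<Longrightarrow> m \<le> n \<Longrightarrow> lev (en n m) = lev (ep n n) - (int n - int m)"
proof (induction "n - m" arbitrary: m)
  case 0
  have "lev (en n n) = lev (ep n (n - 1)) - 1"
    using lev_reflect[OF ends_in(3), of "ep n (n - 1)"] n4 unfolding refl_ends by (simp add: ep_vals)
  then show ?case using 0 lev_ep[of "n - 1"] n4 by simp
next
  case (Suc d)
  then have "lev (en n (m + 1)) = lev (ep n n) - (int n - int (m + 1))" by (intro Suc.hyps(1)) auto
  moreover have "lev (en n (m + 1)) = lev (en n m) + 1" by (rule lev_en_Suc) (use Suc in auto)
  ultimately show ?case by simp
qed

lemma ep_inj: "p \<in> I \<Longrightarrow> q \<in> I \<Longrightarrow> ep n p = ep n q \<longleftrightarrow> p = q"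
proof
  assume a: "p \<in> I" "q \<in> I" "ep n p = ep n q"
  have "lev (ep n p) = lev (ep n q)" by (simp only: a(3))
  then have "int n - int p = int n - int q" using lev_ep[of p] lev_ep[of q] a(1,2) by simp
  then show "p = q" by simp
qed simp

lemma en_inj: "p \<in> I \<Longrightarrow> q \<in> I \<Longrightarrow> en n p = en n q \<longleftrightarrow> p = q"
proof
  assume a: "p \<in> I" "q \<in> I" "en n p = en n q"
  have "lev (en n p) = lev (en n q)" by (simp only: a(3))
  then have "int n - int p = int n - int q" using lev_en[of p] lev_en[of q] a(1,2) by simp
  then show "p = q" by simp
qed simp

lemma ep_en: "p \<in> I \<Longrightarrow> q \<in> I \<Longrightarrow> ep n p \<noteq> en n q"
proof
  assume a: "p \<in> I" "q \<in> I" "ep n p = en n q"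
  have "lev (ep n p) = lev (en n q)" by (simp only: a(3))
  then have "int n - int p = - (int n - int q)" using lev_ep[of p] lev_en[of q] a(1,2) by simp
  moreover have "int p \<le> int n" "int q \<le> int n" using a by auto
  ultimately have "int p = int n" "int q = int n" by linarith+
  then have pq: "p = n" "q = n" by simp_all
  have "ep n n n = en n n n" using a(3) unfolding pq by (rule fun_cong)
  then show False using n4 by (simp add: ep_vals en_vals)
qed

text \<open>A weight of so low a level is either -\<epsilon>_p with p \<le> k, whose coefficient
  comes from \<epsilon>_p, different from \<nu>, or a half-spin weight, whose coefficient comes from
  a half-spin weight.\<close>

lemma w0_delta_vanish:
  assumes nu: "\<nu> \<in> insert (en n n) (ep n ` I)" and k: "k \<le> n - 1" "\<And>m. 1 \<le> m \<Longrightarrow> m \<le> k \<Longrightarrow> \<nu> \<noteq> ep n m"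
    and l: "lev \<kappa> \<le> lev (ep n n) - (int n - int k)"
  shows "w0 (delta \<nu>) \<kappa> = 0"
proof (cases "\<kappa> \<in> mw")
  case False
  have "\<nu> \<in> mw" using nu ep_mw en_mw n4 by auto
  then have "\<kappa> \<noteq> \<nu>" using False by auto
  then show ?thesis by (simp add: w0_outside[OF False] delta_def)
next
  case True
  then consider p where "p \<in> I" "\<kappa> = ep n p" | p where "p \<in> I" "\<kappa> = en n p" | S where "\<kappa> = sw n S"
    using mw_forms[OF True] by blast
  then show ?thesis
  proof cases
    case (1 p)
    then show ?thesis using l k(1) lev_ep[of p] n4 by auto
  next
    case (2 p)
    then have p: "1 \<le> p" "p \<le> k" using l lev_en[of p] by auto
    obtain e where "\<And>z. w0 z (en n p) = e * z (ep n p)" using w0_en[of p] p k(1) by fastforce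
    then show ?thesis using k(2)[OF p] 2 by (simp add: delta_def)
  next
    case (3 S)
    obtain e :: complex where "\<And>z. w0 z \<kappa> = e * z ((ccox ^^ (n - 1)) \<kappa>)"
      using cox_sign[OF True, of "n - 1"] unfolding w0bar_cox by blast
    moreover obtain T where "(ccox ^^ (n - 1)) \<kappa> = sw n T" using ccox_sw[of "n - 1" S] 3 by blast
    moreover have "\<nu> \<noteq> sw n T"
    proof (cases "\<nu> = en n n")
      case True then show ?thesis using natural_not_spin(2)[OF ends_in(3), of T] by simp
    next
      case False
      then obtain q where "q \<in> I" "\<nu> = ep n q" using nu by blast
      then show ?thesis using natural_not_spin(1)[of q T] by simp
    qed
    ultimately show ?thesis by (auto simp: delta_def)
  qed
qed

text \<open>\<open>bottom_functional\<close> is applied to the image of v under the blocks k, ..., n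
  - 1: the row at -\<epsilon>_1 of the last blocks becomes a combination of k rows of the whole
  product.\<close>

lemma functional_split:
  assumes b: "\<And>j. good (b j)" and k: "1 \<le> k" "k \<le> n - 1"
  shows "\<exists>a :: nat \<Rightarrow> complex. a 0 = 0 \<and> a k = (-1) ^ (k - 1) \<and> a (k - 1) = - ((-1) ^ (k - 1) * ratio_sum b 1 (k - 1)) \<and>
     (\<forall>v. Pb b k (n - k) v (en n 1) = (\<Sum>m\<in>{1..k}. a m * Pb b 1 (n - 1) v (en n m)))"
proof -
  have k': "k - 1 \<le> n - 2" "k - 1 + 1 = k" "1 + (k - 1) = k" "n - 1 = (k - 1) + (n - k)" using k by auto
  obtain a :: "nat \<Rightarrow> complex" where a: "a 0 = 0" "a k = (-1) ^ (k - 1)" "a (k - 1) = - ((-1) ^ (k - 1) * ratio_sum b 1 (k - 1))"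
    "\<And>z. z (en n 1) = (\<Sum>m\<in>{1..k}. a m * Pb b 1 (k - 1) z (en n m))"
    using bottom_functional[where b = b and s = 1, OF b k'(1)] unfolding k'(2) by blast
  have "Pb b 1 (n - 1) v = Pb b 1 (k - 1) (Pb b k (n - k) v)" for v
    unfolding k'(4) Pb_split k'(3) by simp
  then have "Pb b k (n - k) v (en n 1) = (\<Sum>m\<in>{1..k}. a m * Pb b 1 (n - 1) v (en n m))" for v
    using a(4)[of "Pb b k (n - k) v"] by simp
  then show ?thesis using a(1-3) by blast
qed

lemma last_row:
  assumes b: "\<And>j. good (b j)"
  shows "Pb b (n - 1) 1 v (en n 1) = tail (b (n - 1)) v 1"
  using eval_en[OF b, of 1 "n - 1" v] goodD(2)[OF b] n4 Pb_Suc[of b "n - 1" 0] by (simp add: Pb_0)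

lemma bottom_zero:
  assumes b: "\<And>j. good (b j)" and k: "1 \<le> k" "k \<le> n - 1" and v: "low_zero (k - 1) v"
  shows "Pb b k (n - k) v (en n 1) = 0"
proof -
  have z: "v (ep n m) = 0" if "k \<le> m" "m \<le> n" for m using v that k by (auto simp: low_zero_def)
  have z': "v (en n m) = 0" if "m \<in> I" for m using v that by (auto simp: low_zero_def)
  show ?thesis
  proof (cases "k = n - 1")
    case True
    have "(\<Sum>m\<in>{1..n - 2}. b k m * v (en n m)) = 0" by (rule sum.neutral) (use z' in auto)
    then have "tail (b k) v 1 = 0" unfolding tail_def using z z' ends_in True by simp
    moreover have "n - k = 1" using True n4 by simp
    ultimately show ?thesis using last_row[where b = b, OF b, of v] True by simp
  next
    case False
    have "low_zero (k + 1) v" using v by (auto simp: low_zero_def)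
    then show ?thesis using bottom_row[where b = b, OF b _ k(1), of v] z k False by simp
  qed
qed

lemma inv_delta:
  assumes u': "u' \<in> Ug 1" and l: "lev \<kappa> \<le> lev \<nu>"
  shows "finv u' (delta \<nu>) \<kappa> = delta \<nu> \<kappa>"
  by (rule Ug_unipotent[of 1]) (use Ug_ops(3)[of 1] u' l in \<open>auto simp: delta_def\<close>)

lemma low_zero_inv_delta:
  assumes u': "u' \<in> Ug 1" and nu: "\<nu> = ep n q" "1 \<le> q" "q \<le> n"
  shows "low_zero q (finv u' (delta \<nu>))"
  unfolding low_zero_def
proof (intro conjI ballI allI impI)
  fix m assume m: "m \<in> I"
  have "lev (en n m) \<le> lev \<nu>" using nu lev_ep[of q] lev_en[of m] m by auto
  then show "finv u' (delta \<nu>) (en n m) = 0" using inv_delta[OF u'] ep_en[of q m] nu m by (auto simp: delta_def)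
next
  fix m assume m: "q < m \<and> m \<le> n"
  have "lev (ep n m) \<le> lev \<nu>" using nu lev_ep[of q] lev_ep[of m] m by auto
  then show "finv u' (delta \<nu>) (ep n m) = 0" using inv_delta[OF u'] ep_inj[of q m] nu m by (auto simp: delta_def)
qed

section \<open>Comparison of a product of blocks with a factorization through w0\<close>

context
  fixes b :: "nat \<Rightarrow> nat \<Rightarrow> complex" and u u' :: elt
  assumes b: "\<And>j. good (b j)" and u: "u \<in> Ug 1" and u': "u' \<in> Ug 1" and eq: "Pb b 1 (n - 1) = u \<circ> w0 \<circ> u'"
begin

text \<open>Test vectors pulled back by u' eliminate u' from the right-hand side, and they stay
  unitriangular on the other side.\<close>

lemma Pb_test: "Pb b 1 (n - 1) (finv u' v) = u (w0 v)"
  using Ug_ops(4)[of 1 u'] u' unfolding eq by (simp add: bij_is_surj surj_f_inv_f)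

text \<open>The lowest natural weight in w0 \<delta>_\<nu> for \<nu> = \<epsilon>_q is
  -\<epsilon>_q. Unipotence settles the rows up to that level, and the first-order expansion yields
  the row one level higher.\<close>

lemma u_w0_delta:
  assumes q: "1 \<le> q" "q \<le> n - 1"
  obtains e where "e \<noteq> 0" "\<And>m. 1 \<le> m \<Longrightarrow> m < q \<Longrightarrow> u (w0 (delta (ep n q))) (en n m) = 0"
    "u (w0 (delta (ep n q))) (en n q) = e" "q \<le> n - 2 \<Longrightarrow> u (w0 (delta (ep n q))) (en n (q + 1)) = chiv 1 q u * e"
proof -
  have qI: "q \<in> I" using q by auto
  obtain e where e: "e \<noteq> 0" "\<And>z. w0 z (en n q) = e * z (ep n q)" using w0_en[OF q] by blast
  define y where "y = w0 (delta (ep n q))"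
  have van: "y \<kappa> = 0" if "lev \<kappa> < lev (en n q)" for \<kappa>
    unfolding y_def
  proof (rule w0_delta_vanish[where k = "q - 1"])
    show "ep n q \<noteq> ep n m" if "1 \<le> m" "m \<le> q - 1" for m using ep_inj[OF qI, of m] that q by auto
    show "lev \<kappa> \<le> lev (ep n n) - (int n - int (q - 1))" using that lev_en[of q] q by auto
  qed (use qI q in auto)
  have ye: "y (en n q) = e" using e(2) by (simp add: y_def delta_def)
  have "u y (en n m) = 0" if m: "1 \<le> m" "m < q" for m
  proof -
    have l: "lev (en n m) < lev (en n q)" using lev_en[of m] lev_en[of q] m q by auto
    have "u y (en n m) = y (en n m)" by (rule Ug_unipotent[of 1]) (use u van l in auto)
    then show ?thesis using van l by simp
  qed
  moreover have "u y (en n q) = e" unfolding ye[symmetric] by (rule Ug_unipotent[of 1]) (use u van in auto)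
  moreover have "u y (en n (q + 1)) = chiv 1 q u * e" if q2: "q \<le> n - 2"
  proof -
    have q1: "q + 1 \<in> I" "1 \<le> q + 1" "q + 1 \<le> n - 1" "q < n" using q q2 n4 by auto
    obtain f where "\<And>z. w0 z (en n (q + 1)) = f * z (ep n (q + 1))" using w0_en[OF q1(2,3)] by blast
    then have y1: "y (en n (q + 1)) = 0" using ep_inj[OF q1(1) qI] by (simp add: y_def delta_def)
    have S: "{i \<in> I. en n (q + 1) i = 1} = {q}"
    proof -
      have "en n (q + 1) i = 1 \<longleftrightarrow> i = q" if "i \<in> I" for i
        using that q q2 n4 by (cases "i = n") (auto simp: en_vals)
      then show ?thesis using qI by blast
    qed
    have "u y (en n (q + 1)) = y (en n (q + 1)) + (\<Sum>i\<in>{i\<in>I. en n (q + 1) i = 1}. chiv 1 i u * y (reflect n i (en n (q + 1))))"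
      by (rule Ug_coeff) (use u en_mw[OF q1(1)] van lev_en_Suc[OF q(1) q1(4)] in auto)
    also have "\<dots> = chiv 1 q u * e"
      unfolding S y1 using refl_adjacent(3)[OF q(1) q1(4)] ye by simp
    finally show ?thesis .
  qed
  ultimately show ?thesis using that[OF e(1)] unfolding y_def by blast
qed

text \<open>The row of the blocks after k vanishes on the test vector for \<epsilon>_k. Written
  through the whole product, only the rows at -\<epsilon>_k and -\<epsilon>_(k+1) survive, with
  values e and \<chi>_k(u) e, and the known coefficients of these rows give the character.\<close>

lemma chi_left:
  assumes k: "1 \<le> k" "k \<le> n - 2"
  shows "chiv 1 k u = ratio_sum b 1 k"
proof -
  have k1: "1 \<le> k + 1" "k + 1 \<le> n - 1" "k \<le> n - 1" "k \<le> n" using k n4 by auto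
  obtain a :: "nat \<Rightarrow> complex" where a: "a (k + 1) = (-1) ^ k" "a k = - ((-1) ^ k * ratio_sum b 1 k)"
    "\<And>v. Pb b (k + 1) (n - (k + 1)) v (en n 1) = (\<Sum>m\<in>{1..k + 1}. a m * Pb b 1 (n - 1) v (en n m))"
    using functional_split[where b = b, OF b k1(1,2)] by auto
  obtain e where e: "e \<noteq> 0" "\<And>m. 1 \<le> m \<Longrightarrow> m < k \<Longrightarrow> u (w0 (delta (ep n k))) (en n m) = 0"
    "u (w0 (delta (ep n k))) (en n k) = e" "u (w0 (delta (ep n k))) (en n (k + 1)) = chiv 1 k u * e"
    using u_w0_delta[OF k(1) k1(3)] k(2) by metis
  have "low_zero (k + 1 - 1) (finv u' (delta (ep n k)))" using low_zero_inv_delta[OF u' refl k(1) k1(4)] by simp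
  then have "0 = (\<Sum>m\<in>{1..k + 1}. a m * u (w0 (delta (ep n k))) (en n m))"
    using bottom_zero[where b = b, OF b k1(1,2), of "finv u' (delta (ep n k))"] unfolding a(3) Pb_test by simp
  also have "\<dots> = (\<Sum>m\<in>{k, k + 1}. a m * u (w0 (delta (ep n k))) (en n m))"
    by (rule sum.mono_neutral_right) (use e(2) k in auto)
  also have "\<dots> = (a k + a (k + 1) * chiv 1 k u) * e" using e(3,4) by (simp add: algebra_simps)
  finally have "(-1) ^ k * (chiv 1 k u - ratio_sum b 1 k) = 0" using e(1) a(1,2) by (simp add: algebra_simps)
  then show ?thesis by simp
qed

text \<open>The functional involves only rows at -\<epsilon>_m with m \<le> k, and by the choice of
  \<nu> all of these vanish on u w0 \<delta>_\<nu>.\<close>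

lemma test_right:
  assumes k: "1 \<le> k" "k \<le> n - 1" and nu: "\<nu> \<in> insert (en n n) (ep n ` I)" "\<And>m. 1 \<le> m \<Longrightarrow> m \<le> k \<Longrightarrow> \<nu> \<noteq> ep n m"
  shows "Pb b k (n - k) (finv u' (delta \<nu>)) (en n 1) = 0"
proof -
  obtain a :: "nat \<Rightarrow> complex" where a: "\<And>v. Pb b k (n - k) v (en n 1) = (\<Sum>m\<in>{1..k}. a m * Pb b 1 (n - 1) v (en n m))"
    using functional_split[where b = b, OF b k] by blast
  have van: "w0 (delta \<nu>) \<kappa> = 0" if "lev \<kappa> \<le> lev (en n k)" for \<kappa>
    by (rule w0_delta_vanish[OF nu(1) k(2) nu(2)]) (use that lev_en[of k] k in auto)
  have "u (w0 (delta \<nu>)) (en n m) = 0" if "m \<in> {1..k}" for m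
  proof -
    have l: "lev (en n m) \<le> lev (en n k)" using that k lev_en[of m] lev_en[of k] by auto
    have "u (w0 (delta \<nu>)) (en n m) = w0 (delta \<nu>) (en n m)"
      by (rule Ug_unipotent[of 1]) (use u van l in auto)
    then show ?thesis using van l by simp
  qed
  then show ?thesis unfolding a Pb_test by (intro sum.neutral) simp
qed

lemma inv_coeff:
  assumes k: "k \<in> I" "k \<le> n - 1" and i: "i \<in> I" "ep n k i = 1"
    and uni: "\<And>j. j \<in> I \<Longrightarrow> ep n k j = 1 \<Longrightarrow> j \<noteq> i \<Longrightarrow> reflect n j (ep n k) \<noteq> reflect n i (ep n k)"
  shows "finv u' (delta (reflect n i (ep n k))) (ep n k) = - chiv 1 i u'"
proof -
  let ?nu = "reflect n i (ep n k)"
  have l: "lev ?nu = lev (ep n k) - 1" using lev_reflect[OF i(1), of "ep n k"] i(2) by simp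
  have "finv u' (delta ?nu) (ep n k) = delta ?nu (ep n k) +
      (\<Sum>j\<in>{j\<in>I. ep n k j = 1}. chiv 1 j (finv u') * delta ?nu (reflect n j (ep n k)))"
    by (rule Ug_coeff) (use Ug_ops(3)[of 1] u' ep_mw[OF k(1)] l in \<open>auto simp: delta_def\<close>)
  also have "(\<Sum>j\<in>{j\<in>I. ep n k j = 1}. chiv 1 j (finv u') * delta ?nu (reflect n j (ep n k))) =
      (\<Sum>j\<in>{i}. chiv 1 j (finv u') * delta ?nu (reflect n j (ep n k)))"
    by (rule sum.mono_neutral_right) (use i uni in \<open>auto simp: delta_def\<close>)
  also have "\<dots> = - chiv 1 i u'" using chiv_inv[of 1 i u'] i u' by (simp add: delta_def)
  also have "delta ?nu (ep n k) = 0" using l by (auto simp: delta_def)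
  finally show ?thesis by simp
qed

text \<open>On the test vector for \<epsilon>_(k+1) the row of \<open>bottom_row\<close> is 0, while
  the two coefficients entering it are -\<chi>_k(u') and 1.\<close>

lemma chi_right:
  assumes k: "1 \<le> k" "k \<le> n - 2"
  shows "chiv 1 k u' = upper_coeff b k"
proof -
  have kI: "k \<in> I" "k + 1 \<in> I" "k \<le> n - 1" "k < n" "k + 1 \<le> n" "1 \<le> k + 1" using k n4 by auto
  have r: "reflect n k (ep n k) = ep n (k + 1)" using refl_adjacent(2) k(1) kI(4) .
  let ?v = "finv u' (delta (ep n (k + 1)))"
  have "Pb b k (n - k) ?v (en n 1) = 0"
    by (rule test_right[OF k(1) kI(3)]) (use kI ep_inj[OF kI(2)] in auto)
  moreover have "?v (ep n k) = - chiv 1 k u'"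
    unfolding r[symmetric]
  proof (rule inv_coeff[OF kI(1,3,1)])
    show "ep n k k = 1" using k kI by (simp add: ep_vals)
    fix j assume "j \<in> I" "ep n k j = 1" "j \<noteq> k"
    then show "reflect n j (ep n k) \<noteq> reflect n k (ep n k)" using k n4 by (cases "j = n") (auto simp: ep_vals split: if_splits)
  qed
  moreover have "?v (ep n (k + 1)) = 1" using inv_delta[OF u'] by (simp add: delta_def)
  ultimately show ?thesis
    using bottom_row[where b = b, OF b low_zero_inv_delta[OF u' refl kI(6,5)] k] by simp
qed

text \<open>The two simple reflections at the fork send \<epsilon>_(n-1) to \<epsilon>_n and to
  -\<epsilon>_n. On the corresponding test vectors the row of the last block vanishes, and it
  contains one parameter minus the character.\<close>

lemma chi_right_end:
  "chiv 1 (n - 1) u' = b (n - 1) (n - 1)" "chiv 1 n u' = b (n - 1) n"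
proof -
  have r: "reflect n (n - 1) (ep n (n - 1)) = ep n n" "reflect n n (ep n (n - 1)) = en n n"
    using refl_adjacent(2)[of "n - 1"] refl_ends n4 by simp_all
  have d: "ep n n \<noteq> en n n" using ep_en ends_in by simp
  have vals: "ep n (n - 1) (n - 1) = 1" "ep n (n - 1) n = 1" using n4 by (simp_all add: ep_vals)
  have only: "j = n - 1 \<or> j = n" if "j \<in> I" "ep n (n - 1) j = 1" for j
    using that by (cases "j = n") (auto simp: ep_vals split: if_splits)
  have k: "1 \<le> n - 1" "n - 1 \<le> n - 1" "n - (n - 1) = 1" using n4 by auto
  have main: "chiv 1 i u' = (if i = n then b (n - 1) n else b (n - 1) (n - 1))" if i: "i = n - 1 \<or> i = n" for i
  proof -
    define nu where "nu = reflect n i (ep n (n - 1))"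
    let ?v = "finv u' (delta nu)"
    have nu: "nu = (if i = n then en n n else ep n n)" using i r by (auto simp: nu_def)
    have l: "lev nu = lev (ep n n)" using nu lev_en[of n] n4 by auto
    have "Pb b (n - 1) (n - (n - 1)) ?v (en n 1) = 0"
    proof (rule test_right[OF k(1,2)])
      show "nu \<in> insert (en n n) (ep n ` I)" using nu ends_in by auto
      fix m assume m: "1 \<le> m" "m \<le> n - 1"
      then have "m \<in> I" "m \<noteq> n" using n4 by auto
      then show "nu \<noteq> ep n m" using nu ep_inj[OF ends_in(3), of m] ep_en[OF _ ends_in(3), of m] by (cases "i = n") auto
    qed
    then have "tail (b (n - 1)) ?v 1 = 0" unfolding k(3) last_row[where b = b, OF b] .
    moreover have z: "?v (en n m) = 0" if "m \<in> I" "m \<le> n - 1" for m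
    proof -
      have "lev (en n m) < lev nu" using that lev_en[of m] l by auto
      then show ?thesis using inv_delta[OF u', of "en n m" nu] by (auto simp: delta_def)
    qed
    moreover have "?v (ep n n) = delta nu (ep n n)" "?v (en n n) = delta nu (en n n)"
      using inv_delta[OF u', of _ nu] l lev_en[of n] n4 by auto
    moreover have "?v (ep n (n - 1)) = - chiv 1 i u'"
      unfolding nu_def
    proof (rule inv_coeff[OF ends_in(2)])
      show "ep n (n - 1) i = 1" "i \<in> I" using i vals ends_in by auto
      fix j assume "j \<in> I" "ep n (n - 1) j = 1" "j \<noteq> i"
      then show "reflect n j (ep n (n - 1)) \<noteq> reflect n i (ep n (n - 1))" using only[of j] i r d by auto
    qed simp
    moreover have "(\<Sum>m\<in>{1..n - 2}. b (n - 1) m * ?v (en n m)) = 0" by (rule sum.neutral) (use z in auto)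
    ultimately have "b (n - 1) (n - 1) * delta nu (ep n n) + b (n - 1) n * delta nu (en n n) - chiv 1 i u' = 0"
      using ends_in by (simp add: tail_def)
    then show ?thesis using nu d by (auto simp: delta_def split: if_splits)
  qed
  show "chiv 1 (n - 1) u' = b (n - 1) (n - 1)" using main[of "n - 1"] n4 by simp
  show "chiv 1 n u' = b (n - 1) n" using main[of n] by simp
qed

end

section \<open>Injectivity of the chart\<close>

lemma yblock_cong: "(\<And>i. i \<in> I \<Longrightarrow> c i = c' i) \<Longrightarrow> yblock c = yblock c'"
  unfolding yblock_def by (intro arg_cong[where f = "\<lambda>l. foldr (\<circ>) l id"] map_cong) auto

lemma Pb_cong: "(\<And>j i. s \<le> j \<Longrightarrow> j < s + k \<Longrightarrow> i \<in> I \<Longrightarrow> b j i = b' j i) \<Longrightarrow> Pb b s k = Pb b' s k"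
  unfolding Pb_def by (intro arg_cong[where f = "\<lambda>l. foldr (\<circ>) l id"] map_cong yblock_cong) auto

lemma bij_Pb: assumes "\<And>j. good (b j)" shows "bij (Pb b s k)"
proof -
  have y: "bij (yblock (b j))" for j
  proof -
    have *: "bij (foldr (\<circ>) (map (\<lambda>i. ybold n i (b j i)) ls) id)" if "set ls \<subseteq> I" for ls
      using that
    proof (induction ls)
      case (Cons i ls)
      have 1: "bij (ybold n i (b j i))"
        using ybold_Bruhat[of i "b j i"] goodD(1)[OF assms, of i j] Cons.prems by (simp add: bij_comp bij_xs bij_sb)
      have 2: "bij (foldr (\<circ>) (map (\<lambda>i. ybold n i (b j i)) ls) id)" by (rule Cons.IH) (use Cons.prems in simp)
      show ?case unfolding list.map foldr.simps comp_def[of "(\<circ>) _"] using bij_comp[OF 2 1] by (simp add: comp_def)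
    qed simp
    show ?thesis unfolding yblock_def by (rule *) auto
  qed
  show ?thesis
  proof (induction k arbitrary: s)
    case 0 show ?case unfolding Pb_0 by (rule bij_id)
  next
    case (Suc k) show ?case unfolding Pb_Suc by (rule bij_comp[OF Suc.IH y])
  qed
qed

lemma tail_high: "(\<And>m. m \<in> {1..n - 2} \<Longrightarrow> z (en n m) = 0) \<Longrightarrow>
    tail c z 1 = c (n - 1) * (c n * z (en n (n - 1)) + z (ep n n)) + c n * z (en n n) + z (ep n (n - 1))"
  unfolding tail_def by (subst sum.neutral) auto

text \<open>The coefficients of the row functionals are forced, from the highest index downwards, by
  vanishing on the test vectors, which depend only on u and u'. So the partial products have equal
  rows at -\<epsilon>_1. Blocks are then compared from the last one backwards: the common factor on
  the right is invertible, and \<open>tail\<close> on basis vectors returns each parameter of a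
  block.\<close>

lemma Pb_inj:
  assumes b: "\<And>j. good (b j)" "\<And>j. good (b' j)" and u: "u \<in> Ug 1" "u' \<in> Ug 1"
    and eq: "Pb b 1 (n - 1) = u \<circ> w0 \<circ> u'" "Pb b' 1 (n - 1) = u \<circ> w0 \<circ> u'"
  shows "\<forall>j\<in>{1..n - 1}. \<forall>i\<in>I. b j i = b' j i"
proof -
  have row: "Pb b K (n - K) v (en n 1) = Pb b' K (n - K) v (en n 1)" if K: "1 \<le> K" "K \<le> n - 1" for K v
  proof -
    obtain a :: "nat \<Rightarrow> complex" where a: "a K = (-1) ^ (K - 1)"
      "\<And>v. Pb b K (n - K) v (en n 1) = (\<Sum>m\<in>{1..K}. a m * Pb b 1 (n - 1) v (en n m))"
      using functional_split[where b = b, OF b(1) K] by blast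
    obtain a' :: "nat \<Rightarrow> complex" where a': "a' K = (-1) ^ (K - 1)"
      "\<And>v. Pb b' K (n - K) v (en n 1) = (\<Sum>m\<in>{1..K}. a' m * Pb b' 1 (n - 1) v (en n m))"
      using functional_split[where b = b', OF b(2) K] by blast
    have "a q = a' q" if "1 \<le> q" "q \<le> K" for q
      using that
    proof (induction "K - q" arbitrary: q rule: less_induct)
      case less
      show ?case
      proof (cases "q = K")
        case True then show ?thesis using a a' by simp
      next
        case False
        then have q: "1 \<le> q" "q < K" "q \<le> n - 1" "q \<le> n" using less.prems K by auto
        obtain e where e: "e \<noteq> 0" "\<And>m. 1 \<le> m \<Longrightarrow> m < q \<Longrightarrow> u (w0 (delta (ep n q))) (en n m) = 0"
          "u (w0 (delta (ep n q))) (en n q) = e"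
          using u_w0_delta[where b = b, OF b(1) u eq(1) q(1,3)] by metis
        have lz: "low_zero (K - 1) (finv u' (delta (ep n q)))"
          using low_zero_inv_delta[OF u(2) refl q(1,4)] q by (auto simp: low_zero_def)
        have 1: "(\<Sum>m\<in>{1..K}. a m * u (w0 (delta (ep n q))) (en n m)) = 0"
          using bottom_zero[where b = b, OF b(1) K lz] unfolding a(2) Pb_test[where b = b, OF b(1) u eq(1)] by simp
        have 2: "(\<Sum>m\<in>{1..K}. a' m * u (w0 (delta (ep n q))) (en n m)) = 0"
          using bottom_zero[where b = b', OF b(2) K lz] unfolding a'(2) Pb_test[where b = b', OF b(2) u eq(2)] by simp
        have "0 = (\<Sum>m\<in>{1..K}. (a m - a' m) * u (w0 (delta (ep n q))) (en n m))"
          using 1 2 by (simp add: left_diff_distrib sum_subtractf)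
        also have "\<dots> = (\<Sum>m\<in>{q}. (a m - a' m) * u (w0 (delta (ep n q))) (en n m))"
        proof (rule sum.mono_neutral_right)
          show "\<forall>m\<in>{1..K} - {q}. (a m - a' m) * u (w0 (delta (ep n q))) (en n m) = 0"
          proof
            fix m assume m: "m \<in> {1..K} - {q}"
            show "(a m - a' m) * u (w0 (delta (ep n q))) (en n m) = 0"
            proof (cases "m < q")
              case True then show ?thesis using e(2)[of m] m by simp
            next
              case False
              then have "a m = a' m" using m q by (intro less.hyps) auto
              then show ?thesis by simp
            qed
          qed
        qed (use q in auto)
        also have "\<dots> = (a q - a' q) * e" using e(3) by simp
        finally show ?thesis using e(1) by simp
      qed
    qed
    then have "(\<Sum>m\<in>{1..K}. a m * Pb b 1 (n - 1) v (en n m)) = (\<Sum>m\<in>{1..K}. a' m * Pb b' 1 (n - 1) v (en n m))"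
      unfolding eq by (intro sum.cong) auto
    then show ?thesis unfolding a(2) a'(2) .
  qed
  have "\<forall>i\<in>I. b j i = b' j i" if "1 \<le> j" "j \<le> n - 1" for j
    using that
  proof (induction "n - j" arbitrary: j rule: less_induct)
    case less
    have nj: "n - j = Suc (n - j - 1)" using less.prems by simp
    define Q where "Q = Pb b (j + 1) (n - j - 1)"
    have Q': "Pb b' (j + 1) (n - j - 1) = Q"
      unfolding Q_def by (rule Pb_cong[symmetric]) (use less.hyps less.prems in auto)
    have "Pb b j (n - j) = Pb b j (Suc (n - j - 1))" "Pb b' j (n - j) = Pb b' j (Suc (n - j - 1))"
      by (rule arg_cong[OF nj])+
    then have e: "Pb b j (n - j) = yblock (b j) \<circ> Q" "Pb b' j (n - j) = yblock (b' j) \<circ> Q"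
      unfolding Pb_Suc Q' Q_def[symmetric] .
    have bQ: "bij Q" unfolding Q_def by (rule bij_Pb[OF b(1)])
    have t: "tail (b j) w 1 = tail (b' j) w 1" for w
    proof -
      have "Q (finv Q w) = w" using bQ by (simp add: bij_is_surj surj_f_inv_f)
      then have "yblock (b j) w (en n 1) = yblock (b' j) w (en n 1)"
        using row[OF less.prems, of "finv Q w"] unfolding e by simp
      then show ?thesis using eval_en[OF b(1), of 1 j w] eval_en[OF b(2), of 1 j w] goodD(2)[OF b(1)] goodD(2)[OF b(2)] n4 by simp
    qed
    show ?case
    proof
      fix i assume i: "i \<in> I"
      consider "i \<le> n - 2" | "i = n - 1" | "i = n" using i by force
      then show "b j i = b' j i"
      proof cases
        case 1
        have "tail c (delta (en n i)) 1 = c i" for c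
        proof -
          have "(\<Sum>m\<in>{1..n - 2}. c m * delta (en n i) (en n m)) = (\<Sum>m\<in>{1..n - 2}. if m = i then c i else 0)"
            by (rule sum.cong) (use en_inj[OF _ i] i 1 in \<open>auto simp: delta_def\<close>)
          also have "\<dots> = c i" using i 1 by simp
          finally have S: "(\<Sum>m\<in>{1..n - 2}. c m * delta (en n i) (en n m)) = c i" .
          have "n - 1 \<noteq> i" "n \<noteq> i" using 1 n4 by auto
          then have "delta (en n i) (en n (n - 1)) = 0" "delta (en n i) (en n n) = 0" "delta (en n i) (ep n n) = 0"
            "delta (en n i) (ep n (n - 1)) = 0"
            using en_inj[OF ends_in(2) i] en_inj[OF ends_in(3) i] ep_en[OF ends_in(2) i] ep_en[OF ends_in(3) i]
            by (simp_all add: delta_def)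
          then show ?thesis unfolding tail_def S by simp
        qed
        then show ?thesis using t[of "delta (en n i)"] by simp
      next
        case 2
        have "delta (ep n n) (en n m) = 0" if "m \<in> I" for m using ep_en[OF ends_in(3) that] by (auto simp: delta_def)
        moreover have "delta (ep n n) (ep n (n - 1)) = 0" using ep_inj[OF ends_in(2,3)] n4 by (simp add: delta_def)
        moreover have "delta (ep n n) (ep n n) = 1" by (simp add: delta_def)
        ultimately have "tail c (delta (ep n n)) 1 = c (n - 1)" for c
          using ends_in by (subst tail_high) auto
        then show ?thesis using t[of "delta (ep n n)"] 2 by simp
      next
        case 3
        have "delta (en n n) (en n m) = 0" if "m \<in> I" "m \<le> n - 1" for m
          using en_inj[OF that(1) ends_in(3)] that(2) n4 by (auto simp: delta_def)
        moreover have "delta (en n n) (ep n m) = 0" if "m \<in> I" for m using ep_en[OF that ends_in(3)] by (auto simp: delta_def)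
        moreover have "delta (en n n) (en n n) = 1" by (simp add: delta_def)
        ultimately have "tail c (delta (en n n)) 1 = c n" for c
          using ends_in by (subst tail_high) auto
        then show ?thesis using t[of "delta (en n n)"] 3 by simp
      qed
    qed
  qed
  then show ?thesis by auto
qed

section \<open>Blocks in the half-spin representations\<close>

lemma sw_at: "1 \<le> i \<Longrightarrow> i < n \<Longrightarrow> sw n T i = of_bool (i + 1 \<in> T) - of_bool (i \<in> T)"
  "sw n T n = 1 - of_bool (n - 1 \<in> T) - of_bool (n \<in> T)"
  using n4 by (auto simp: sw_def)

lemma sw_cong: "(\<And>k. 1 \<le> k \<Longrightarrow> k \<le> n \<Longrightarrow> k \<in> T \<longleftrightarrow> k \<in> T') \<Longrightarrow> sw n T = sw n T'"
proof -
  assume a: "\<And>k. 1 \<le> k \<Longrightarrow> k \<le> n \<Longrightarrow> k \<in> T \<longleftrightarrow> k \<in> T'"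
  then have "T \<inter> I = T' \<inter> I" by auto
  then show ?thesis using sw_Int[of T] sw_Int[of T'] by simp
qed

lemma sw_move:
  assumes g: "good c" and i: "1 \<le> i" "i < n" "i \<in> T" "i + 1 \<notin> T"
  shows "ysuf c i w (sw n T) = c i * ysuf c (i + 1) w (sw n T) + ysuf c (i + 1) w (sw n (insert (i + 1) (T - {i})))"
proof -
  have iI: "i \<in> I" using i by auto
  have "reflect n i (sw n T) = sw n (insert (i + 1) (T - {i}))"
    unfolding refl_sw[OF iI]
    by (rule sw_cong) (use i in \<open>auto simp: sact_def\<close>)
  moreover have "i \<in> I" "sw n T i = -1" using i by (auto simp: sw_at)
  ultimately show ?thesis using ysuf_neg[OF g sw_mw] by simp
qed

lemma sw_pos: "good c \<Longrightarrow> 1 \<le> i \<Longrightarrow> i < n \<Longrightarrow> i \<notin> T \<Longrightarrow> i + 1 \<in> T \<Longrightarrow>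
    ysuf c i w (sw n T) = ysuf c (i + 1) w (sw n T) / c i"
  using ysuf_pos[OF _ sw_mw, of c i T w] by (simp add: sw_at)

lemma sw_skip:
  "good c \<Longrightarrow> 1 \<le> k \<Longrightarrow> k \<le> m \<Longrightarrow> m \<le> n \<Longrightarrow> (\<And>i. k \<le> i \<Longrightarrow> i < m \<Longrightarrow> i \<in> T \<longleftrightarrow> i + 1 \<in> T) \<Longrightarrow>
    ysuf c k w (sw n T) = ysuf c m w (sw n T)"
  by (rule ysuf_skip[OF _ sw_mw]) (auto simp: sw_at)

lemma sw_skip_pen: "good c \<Longrightarrow> (n - 1 \<in> T) = (n \<in> T) \<Longrightarrow> ysuf c (n - 1) w (sw n T) = ysuf c n w (sw n T)"
proof (rule sw_skip)
  fix i assume a: "(n - 1 \<in> T) = (n \<in> T)" "n - 1 \<le> i" "i < n"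
  then have "i = n - 1" "i + 1 = n" by auto
  then show "i \<in> T \<longleftrightarrow> i + 1 \<in> T" using a(1) by simp
qed (use n4 in auto)

lemma sw_last:
  assumes g: "good c"
  shows "n - 1 \<in> T \<Longrightarrow> n \<in> T \<Longrightarrow> ysuf c n w (sw n T) = c n * w (sw n T) + w (sw n (T - {n - 1, n}))"
    "n - 1 \<notin> T \<Longrightarrow> n \<notin> T \<Longrightarrow> ysuf c n w (sw n T) = w (sw n T) / c n"
    "(n - 1 \<in> T) \<noteq> (n \<in> T) \<Longrightarrow> ysuf c n w (sw n T) = w (sw n T)"
proof -
  assume a: "n - 1 \<in> T" "n \<in> T"
  have "reflect n n (sw n T) = sw n (T - {n - 1, n})"
    unfolding refl_sw[OF ends_in(3)] by (rule sw_cong) (use a in \<open>auto simp: sact_def\<close>)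
  moreover have "sw n T n = -1" using a by (simp add: sw_at)
  ultimately show "ysuf c n w (sw n T) = c n * w (sw n T) + w (sw n (T - {n - 1, n}))"
    using ysuf_neg[OF g sw_mw ends_in(3)] by (simp only: ysuf_end id_apply)
next
  assume "n - 1 \<notin> T" "n \<notin> T"
  then have "sw n T n = 1" by (simp add: sw_at)
  then show "ysuf c n w (sw n T) = w (sw n T) / c n"
    using ysuf_pos[OF g sw_mw ends_in(3)] by (simp only: ysuf_end id_apply)
next
  assume "(n - 1 \<in> T) \<noteq> (n \<in> T)"
  then have "sw n T n = 0" by (auto simp: sw_at)
  then have "ysuf c n w (sw n T) = ysuf c (n + 1) w (sw n T)"
    by (intro ysuf_skip[OF g sw_mw]) (use n4 in \<open>auto simp: less_Suc_eq le_less_Suc_eq\<close>)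
  then show "ysuf c n w (sw n T) = w (sw n T)" by (simp only: ysuf_end id_apply)
qed

text \<open>Position n is left out on purpose: the minus signs at 1, ..., n - 1 can decrease by at
  most one per block, while the sign at n only records the parity.\<close>

definition cnt :: "nat set \<Rightarrow> nat" where
  "cnt T = card (T \<inter> {1..n - 1})"

definition vanish :: "vec \<Rightarrow> nat \<Rightarrow> bool" where
  "vanish w r \<longleftrightarrow> (\<forall>T. cnt T > r \<longrightarrow> w (sw n T) = 0)"

lemma cnt_shift:
  assumes "1 \<le> i" "i + 1 < n" "i \<in> T" "i + 1 \<notin> T"
  shows "cnt (insert (i + 1) (T - {i})) = cnt T"
proof -
  have "insert (i + 1) (T - {i}) \<inter> {1..n - 1} = insert (i + 1) ((T \<inter> {1..n - 1}) - {i})" using assms by auto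
  moreover have "card (insert (i + 1) ((T \<inter> {1..n - 1}) - {i})) = Suc (card ((T \<inter> {1..n - 1}) - {i}))"
    by (rule card_insert_disjoint) (use assms in auto)
  moreover have "Suc (card ((T \<inter> {1..n - 1}) - {i})) = card (T \<inter> {1..n - 1})"
    by (rule card_Suc_Diff1) (use assms in auto)
  ultimately show ?thesis by (simp add: cnt_def)
qed

lemma cnt_drop:
  assumes "n - 1 \<in> T" "T' \<inter> {1..n - 1} = (T \<inter> {1..n - 1}) - {n - 1}"
  shows "cnt T = Suc (cnt T')"
  unfolding cnt_def assms(2) by (rule card_Suc_Diff1[symmetric]) (use assms n4 in auto)

text \<open>Moves among the positions 1, ..., n - 1 preserve the count. A sign is lost only by going
  from n - 1 to n or by the letter n removing the pair n - 1, n, and a block contains just one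
  chance for this.\<close>

lemma vanish_yblock:
  assumes g: "good c" and v: "vanish w r"
  shows "vanish (yblock c w) (Suc r)"
proof -
  have w0: "w (sw n T) = 0" if "cnt T > r" for T using v that by (auto simp: vanish_def)
  have last: "ysuf c n w (sw n T) = 0" if "cnt T > Suc r \<or> (cnt T > r \<and> n - 1 \<notin> T)" for T
  proof -
    consider "n - 1 \<in> T" "n \<in> T" | "n - 1 \<notin> T" "n \<notin> T" | "(n - 1 \<in> T) \<noteq> (n \<in> T)" by blast
    then show ?thesis
    proof cases
      case 1
      have "cnt T = Suc (cnt (T - {n - 1, n}))" by (rule cnt_drop[OF 1(1)]) (use n4 in auto)
      then show ?thesis using sw_last(1)[OF g 1, of w] w0[of T] w0[of "T - {n - 1, n}"] that 1 by auto
    next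
      case 2 then show ?thesis using sw_last(2)[OF g 2, of w] w0[of T] that by auto
    next
      case 3 then show ?thesis using sw_last(3)[OF g 3, of w] w0[of T] that by auto
    qed
  qed
  have pen: "ysuf c (n - 1) w (sw n T) = 0" if c: "cnt T > Suc r" for T
  proof -
    consider "n - 1 \<in> T" "n \<notin> T" | "n - 1 \<notin> T" "n \<in> T" | "(n - 1 \<in> T) = (n \<in> T)" by blast
    then show ?thesis
    proof cases
      case 1
      have "cnt T = Suc (cnt (insert n (T - {n - 1})))" by (rule cnt_drop[OF 1(1)]) (use n4 in auto)
      then have "ysuf c n w (sw n (insert n (T - {n - 1}))) = 0" using c n4 by (intro last) auto
      then show ?thesis using sw_move[OF g, of "n - 1" T w] 1 last[of T] c n4 unfolding Suc_n by simp
    next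
      case 2 then show ?thesis using sw_pos[OF g, of "n - 1" T w] last[of T] c n4 unfolding Suc_n by simp
    next
      case 3
      have "ysuf c (n - 1) w (sw n T) = ysuf c n w (sw n T)"
        by (rule sw_skip_pen[OF g]) (use 3 n4 in auto)
      then show ?thesis using last[of T] c by simp
    qed
  qed
  have "\<forall>T. cnt T > Suc r \<longrightarrow> ysuf c k w (sw n T) = 0" if "1 \<le> k" "k \<le> n - 1" for k
    using that
  proof (induction "n - 1 - k" arbitrary: k)
    case 0
    then have "k = n - 1" by simp
    then show ?case using pen by simp
  next
    case (Suc d)
    have k: "1 \<le> k" "k + 1 < n" "k < n" "k + 1 \<le> n - 1" using Suc by auto
    have ih: "\<forall>T. cnt T > Suc r \<longrightarrow> ysuf c (k + 1) w (sw n T) = 0"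
      by (rule Suc.hyps(1)) (use Suc.hyps(2) k in auto)
    show ?case
    proof (intro allI impI)
      fix T assume c: "cnt T > Suc r"
      consider "k \<in> T" "k + 1 \<notin> T" | "k \<notin> T" "k + 1 \<in> T" | "(k \<in> T) = (k + 1 \<in> T)" by blast
      then show "ysuf c k w (sw n T) = 0"
      proof cases
        case 1
        then show ?thesis using sw_move[OF g k(1,3) 1, of w] ih c cnt_shift[OF k(1,2) 1] by simp
      next
        case 2
        then show ?thesis using sw_pos[OF g k(1,3) 2, of w] ih c by simp
      next
        case 3
        have "ysuf c k w (sw n T) = ysuf c (k + 1) w (sw n T)"
          by (rule sw_skip[OF g]) (use 3 k in \<open>auto simp: le_less_Suc_eq less_Suc_eq\<close>)
        then show ?thesis using ih c by simp
      qed
    qed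
  qed
  from this[of 1] show ?thesis unfolding vanish_def yblock_ysuf using n4 by auto
qed

text \<open>The parity of the number of minus signs is fixed in a half-spin representation, so
  losing a sign before position n toggles the one at n.\<close>

definition flipn :: "nat set \<Rightarrow> nat set" where
  "flipn T = (if n \<in> T then T - {n} else insert n T)"

lemma flipn_mem: "k \<noteq> n \<Longrightarrow> k \<in> flipn T \<longleftrightarrow> k \<in> T" "n \<in> flipn T \<longleftrightarrow> n \<notin> T"
  by (auto simp: flipn_def)

text \<open>No sign is left among the remaining positions up to n - 1, so the remaining letters
  cannot bring the count down to r.\<close>

lemma stuck_zero:
  assumes g: "good c" and v: "vanish w r" and k: "1 \<le> k" "k \<le> n - 1" and T: "cnt T > r" "\<And>i. k \<le> i \<Longrightarrow> i \<le> n - 1 \<Longrightarrow> i \<notin> T"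
  shows "ysuf c k w (sw n T) = 0"
proof -
  have w0: "w (sw n T) = 0" using v T by (auto simp: vanish_def)
  have n1: "n - 1 \<notin> T" using T(2)[of "n - 1"] k by simp
  have 1: "ysuf c k w (sw n T) = ysuf c (n - 1) w (sw n T)"
    by (rule sw_skip[OF g k]) (use T n4 in auto)
  have 2: "ysuf c n w (sw n T) = 0"
    using sw_last(2,3)[OF g, of T w] n1 w0 by (cases "n \<in> T") auto
  have 3: "ysuf c (n - 1) w (sw n T) = 0"
  proof (cases "n \<in> T")
    case True
    then show ?thesis using sw_pos[OF g, of "n - 1" T w] n1 n4 2 unfolding Suc_n by simp
  next
    case False
    have "ysuf c (n - 1) w (sw n T) = ysuf c n w (sw n T)"
      by (rule sw_skip_pen[OF g]) (use False n1 n4 in auto)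
    then show ?thesis using 2 by simp
  qed
  show ?thesis unfolding 1 3 ..
qed

text \<open>The set has too many signs for w, so this block must lose one, and the rightmost sign q
  is the only candidate. Any stop on its way gives 0 by \<open>stuck_zero\<close>, and moving on has
  weight 1.\<close>

lemma escape:
  assumes g: "good c" and v: "vanish w r"
  shows "1 \<le> q \<Longrightarrow> q \<le> n - 1 \<Longrightarrow> q \<in> T \<Longrightarrow> cnt T > r \<Longrightarrow> (\<And>i. q < i \<Longrightarrow> i \<le> n - 1 \<Longrightarrow> i \<notin> T) \<Longrightarrow>
    ysuf c q w (sw n T) = w (sw n (flipn (T - {q})))"
proof (induction "n - 1 - q" arbitrary: q T)
  case 0
  then have q: "q = n - 1" by simp
  have w0: "w (sw n T) = 0" using v 0 by (auto simp: vanish_def)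
  have n1: "n - 1 \<in> T" using 0 q by simp
  show ?case
  proof (cases "n \<in> T")
    case True
    have "ysuf c (n - 1) w (sw n T) = ysuf c n w (sw n T)"
      by (rule sw_skip_pen[OF g]) (use True n1 n4 in auto)
    also have "\<dots> = w (sw n (T - {n - 1, n}))" using sw_last(1)[OF g n1 True, of w] w0 by simp
    also have "T - {n - 1, n} = flipn (T - {q})" using True q n4 by (auto simp: flipn_def)
    finally show ?thesis unfolding q .
  next
    case False
    have 1: "ysuf c (n - 1) w (sw n T) = c (n - 1) * ysuf c n w (sw n T) + ysuf c n w (sw n (insert n (T - {n - 1})))"
      using sw_move[OF g, of "n - 1" T w] n1 False n4 unfolding Suc_n by simp
    have 2: "ysuf c n w (sw n T) = 0" using sw_last(3)[OF g, of T w] n1 False w0 by simp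
    have "n - 1 \<noteq> n" using n4 by simp
    then have 3: "ysuf c n w (sw n (insert n (T - {n - 1}))) = w (sw n (insert n (T - {n - 1})))"
      by (intro sw_last(3)[OF g]) auto
    have 4: "insert n (T - {n - 1}) = flipn (T - {q})" using False q by (auto simp: flipn_def)
    show ?thesis unfolding q using 1 2 3 4 q by simp
  qed
next
  case (Suc d)
  have q: "1 \<le> q" "q < n" "q + 1 \<le> n - 1" "q + 1 < n" using Suc by auto
  have q1: "q + 1 \<notin> T" using Suc.prems(5)[of "q + 1"] q by simp
  have 1: "ysuf c q w (sw n T) = c q * ysuf c (q + 1) w (sw n T) + ysuf c (q + 1) w (sw n (insert (q + 1) (T - {q})))"
    by (rule sw_move[OF g q(1,2) Suc.prems(3) q1])
  have 2: "ysuf c (q + 1) w (sw n T) = 0"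
    by (rule stuck_zero[OF g v]) (use q Suc.prems in auto)
  have 3: "ysuf c (q + 1) w (sw n (insert (q + 1) (T - {q}))) = w (sw n (flipn (insert (q + 1) (T - {q}) - {q + 1})))"
    by (rule Suc.hyps(1)) (use Suc.hyps(2) q cnt_shift[OF q(1,4) Suc.prems(3) q1] Suc.prems in auto)
  have 4: "insert (q + 1) (T - {q}) - {q + 1} = T - {q}" using q1 by auto
  show ?case unfolding 1 2 3 4 by simp
qed

text \<open>The sign q must escape, and the sign m may first advance to any k < q. Stopping at k
  contributes c k, and the letter q - 1, which finds q occupied and q - 1 free, contributes the
  denominator. For k = q - 1 both effects are absent, in agreement with the ratio 1.\<close>

lemma mover:
  assumes g: "good c" and v: "vanish w r"
    and T: "\<And>i. p \<le> i \<Longrightarrow> i \<le> n - 1 \<Longrightarrow> i \<notin> T" and p: "1 \<le> p" and q: "p < q" "q \<le> n - 1"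
    and cnt: "\<And>m. p \<le> m \<Longrightarrow> m < q \<Longrightarrow> cnt (insert m (insert q T)) > r"
  shows "p \<le> m \<Longrightarrow> m < q \<Longrightarrow> ysuf c m w (sw n (insert m (insert q T))) =
    (\<Sum>k\<in>{m..q - 1}. c k / c (q - 1) * w (sw n (flipn (insert k T))))"
proof (induction "q - 1 - m" arbitrary: m)
  case 0
  then have m: "m = q - 1" "m + 1 = q" "1 \<le> m" using p by auto
  have qT: "q \<notin> T" "m \<notin> T" using T[of q] T[of m] q 0 by auto
  have "ysuf c m w (sw n (insert m (insert q T))) = ysuf c q w (sw n (insert m (insert q T)))"
    by (rule sw_skip[OF g m(3)]) (use m q in \<open>auto simp: le_less_Suc_eq less_Suc_eq\<close>)
  also have "\<dots> = w (sw n (flipn (insert m (insert q T) - {q})))"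
    by (rule escape[OF g v]) (use p q T cnt[of m] 0 m in auto)
  also have "insert m (insert q T) - {q} = insert m T" using qT m by auto
  finally have "ysuf c m w (sw n (insert m (insert q T))) = w (sw n (flipn (insert m T)))" .
  moreover have "c (q - 1) \<noteq> 0" using good_nz[OF g, of "q - 1"] q by simp
  ultimately show ?case using m(1) by simp
next
  case (Suc d)
  have m: "1 \<le> m" "m < n" "m + 1 < q" "m \<noteq> q" "m + 1 \<noteq> q" "p \<le> m" using Suc p q by auto
  have mT: "m \<notin> T" "m + 1 \<notin> T" "q \<notin> T" "q - 1 \<notin> T" using T[of m] T[of "m + 1"] T[of q] T[of "q - 1"] m q p by auto
  let ?M = "insert m (insert q T)"
  have e: "insert (m + 1) (?M - {m}) = insert (m + 1) (insert q T)" using mT m by auto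
  have 1: "ysuf c m w (sw n ?M) = c m * ysuf c (m + 1) w (sw n ?M) + ysuf c (m + 1) w (sw n (insert (m + 1) (insert q T)))"
    using sw_move[OF g m(1,2), of ?M w] mT m unfolding e by simp
  have "ysuf c (m + 1) w (sw n ?M) = ysuf c (q - 1) w (sw n ?M)"
  proof (rule sw_skip[OF g])
    fix i assume i: "m + 1 \<le> i" "i < q - 1"
    then have "i \<notin> T" "i + 1 \<notin> T" using T[of i] T[of "i + 1"] m q by auto
    then show "i \<in> ?M \<longleftrightarrow> i + 1 \<in> ?M" using i by auto
  qed (use m q in auto)
  also have "\<dots> = ysuf c q w (sw n ?M) / c (q - 1)"
  proof -
    have mq: "1 \<le> q - 1" "q - 1 < n" "q - 1 \<notin> ?M" "q - 1 + 1 \<in> ?M" "q - 1 + 1 = q" using m q mT by auto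
    show ?thesis using sw_pos[OF g mq(1-4), of w] unfolding mq(5) .
  qed
  also have "ysuf c q w (sw n ?M) = w (sw n (flipn (?M - {q})))"
    by (rule escape[OF g v]) (use p q T cnt[of m] m in auto)
  also have "?M - {q} = insert m T" using mT m by auto
  finally have 2: "ysuf c (m + 1) w (sw n ?M) = w (sw n (flipn (insert m T))) / c (q - 1)" .
  have 3: "ysuf c (m + 1) w (sw n (insert (m + 1) (insert q T))) = (\<Sum>k\<in>{m + 1..q - 1}. c k / c (q - 1) * w (sw n (flipn (insert k T))))"
    by (rule Suc.hyps(1)) (use Suc.hyps(2) m in auto)
  have "{m..q - 1} = insert m {m + 1..q - 1}" using m by auto
  then show ?case unfolding 1 2 3 by simp
qed

text \<open>Without a constraint on the count the single sign m may stop at k < n - 1, stay at n -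
  1, or leave. Whether n carries a sign decides which of the letters n - 1 and n produces the
  denominator.\<close>

lemma lone_mover:
  assumes g: "good c"
    and T: "\<And>i. p \<le> i \<Longrightarrow> i \<le> n - 1 \<Longrightarrow> i \<notin> T" and p: "1 \<le> p"
  shows "p \<le> m \<Longrightarrow> m \<le> n - 1 \<Longrightarrow> ysuf c m w (sw n (insert m T)) =
    (\<Sum>k\<in>{m..<n - 1}. c k / (if n \<in> T then c (n - 1) else c n) * w (sw n (insert k T)))
      + (if n \<in> T then c n else c (n - 1)) * w (sw n (insert (n - 1) T)) + w (sw n (flipn T))"
proof (induction "n - 1 - m" arbitrary: m)
  case 0
  then have m: "m = n - 1" by simp
  have n1: "n - 1 \<notin> T" using T[of "n - 1"] 0 by simp
  have nn: "n - 1 \<noteq> n" using n4 by simp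
  let ?M = "insert (n - 1) T"
  show ?case
  proof (cases "n \<in> T")
    case True
    have "ysuf c (n - 1) w (sw n ?M) = ysuf c n w (sw n ?M)"
      by (rule sw_skip_pen[OF g]) (use True n4 in auto)
    also have "\<dots> = c n * w (sw n ?M) + w (sw n (?M - {n - 1, n}))" using sw_last(1)[OF g, of ?M w] True by simp
    also have "?M - {n - 1, n} = flipn T" using True n1 by (auto simp: flipn_def)
    finally show ?thesis using True by (simp add: m)
  next
    case False
    have e: "insert n (?M - {n - 1}) = flipn T" using False n1 by (auto simp: flipn_def)
    have "ysuf c (n - 1) w (sw n ?M) = c (n - 1) * ysuf c n w (sw n ?M) + ysuf c n w (sw n (flipn T))"
      using sw_move[OF g, of "n - 1" ?M w] False nn n4 unfolding Suc_n e by simp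
    moreover have "ysuf c n w (sw n ?M) = w (sw n ?M)" using sw_last(3)[OF g, of ?M w] False nn by simp
    moreover have "ysuf c n w (sw n (flipn T)) = w (sw n (flipn T))"
      by (rule sw_last(3)[OF g]) (use False n1 nn in \<open>auto simp: flipn_mem\<close>)
    ultimately show ?thesis using False by (simp add: m)
  qed
next
  case (Suc d)
  have m: "1 \<le> m" "m < n" "m + 1 \<le> n - 1" "p \<le> m" using Suc p by auto
  have mT: "m \<notin> T" "m + 1 \<notin> T" "n - 1 \<notin> T" using T[of m] T[of "m + 1"] T[of "n - 1"] m by auto
  have nn: "n - 1 \<noteq> n" "n \<noteq> m" "n - 1 \<noteq> m" using n4 m by auto
  let ?M = "insert m T"
  have e: "insert (m + 1) (?M - {m}) = insert (m + 1) T" using mT m by auto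
  have 1: "ysuf c m w (sw n ?M) = c m * ysuf c (m + 1) w (sw n ?M) + ysuf c (m + 1) w (sw n (insert (m + 1) T))"
    using sw_move[OF g m(1,2), of ?M w] mT m unfolding e by simp
  have "ysuf c (m + 1) w (sw n ?M) = ysuf c (n - 1) w (sw n ?M)"
  proof (rule sw_skip[OF g])
    fix i assume i: "m + 1 \<le> i" "i < n - 1"
    then have "i \<notin> T" "i + 1 \<notin> T" using T[of i] T[of "i + 1"] m by auto
    then show "i \<in> ?M \<longleftrightarrow> i + 1 \<in> ?M" using i by auto
  qed (use m in auto)
  also have "\<dots> = w (sw n ?M) / (if n \<in> T then c (n - 1) else c n)"
  proof (cases "n \<in> T")
    case True
    have "ysuf c (n - 1) w (sw n ?M) = ysuf c n w (sw n ?M) / c (n - 1)"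
      using sw_pos[OF g, of "n - 1" ?M w] mT nn True n4 unfolding Suc_n by simp
    moreover have "ysuf c n w (sw n ?M) = w (sw n ?M)"
      by (rule sw_last(3)[OF g]) (use True mT nn in auto)
    ultimately show ?thesis using True by simp
  next
    case False
    have "ysuf c (n - 1) w (sw n ?M) = ysuf c n w (sw n ?M)"
      by (rule sw_skip_pen[OF g]) (use False mT nn n4 in auto)
    moreover have "ysuf c n w (sw n ?M) = w (sw n ?M) / c n"
      by (rule sw_last(2)[OF g]) (use False mT nn in auto)
    ultimately show ?thesis using False by simp
  qed
  finally have 2: "ysuf c (m + 1) w (sw n ?M) = w (sw n ?M) / (if n \<in> T then c (n - 1) else c n)" .
  have 3: "ysuf c (m + 1) w (sw n (insert (m + 1) T)) =
    (\<Sum>k\<in>{m + 1..<n - 1}. c k / (if n \<in> T then c (n - 1) else c n) * w (sw n (insert k T)))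
      + (if n \<in> T then c n else c (n - 1)) * w (sw n (insert (n - 1) T)) + w (sw n (flipn T))"
    by (rule Suc.hyps(1)) (use Suc.hyps(2) m in auto)
  have "{m..<n - 1} = insert m {m + 1..<n - 1}" using m by auto
  then show ?case unfolding 1 2 3 by simp
qed

section \<open>The path model\<close>

lemma sw_inj:
  assumes "sw n T = sw n T'" "i \<in> I"
  shows "i \<in> T \<longleftrightarrow> i \<in> T'"
proof -
  have nn: "1 \<le> n - 1" "n - 1 < n" using n4 by auto
  have e: "sw n T j = sw n T' j" for j using assms(1) by simp
  have a: "(of_bool (n \<in> T) :: int) - of_bool (n - 1 \<in> T) = of_bool (n \<in> T') - of_bool (n - 1 \<in> T')"
    using e[of "n - 1"] sw_at(1)[OF nn] Suc_n by simp
  have b: "(1 :: int) - of_bool (n - 1 \<in> T) - of_bool (n \<in> T) = 1 - of_bool (n - 1 \<in> T') - of_bool (n \<in> T')"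
    using e[of n] sw_at(2) by simp
  have "1 \<le> i \<Longrightarrow> i \<le> n \<Longrightarrow> i \<in> T \<longleftrightarrow> i \<in> T'" for i
  proof (induction "n - i" arbitrary: i)
    case 0
    then have "i = n" by simp
    then show ?case using a b by (auto simp: of_bool_def split: if_splits)
  next
    case (Suc d)
    then have i: "1 \<le> i" "i < n" "i + 1 \<le> n" "d = n - (i + 1)" by auto
    have "(i + 1 \<in> T) = (i + 1 \<in> T')" by (rule Suc.hyps(1)[OF i(4)]) (use i in auto)
    moreover have "(of_bool (i + 1 \<in> T) :: int) - of_bool (i \<in> T) = of_bool (i + 1 \<in> T') - of_bool (i \<in> T')"
      using e[of i] sw_at(1)[OF i(1,2)] by simp
    ultimately show ?case by (auto simp: of_bool_def split: if_splits)
  qed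
  then show ?thesis using assms(2) by auto
qed

lemma delta_sw:
  "delta (sw n T') (sw n T) = (if \<forall>i\<in>I. i \<in> T \<longleftrightarrow> i \<in> T' then 1 else 0)"
proof (cases "\<forall>i\<in>I. i \<in> T \<longleftrightarrow> i \<in> T'")
  case True
  then have "sw n T = sw n T'" by (intro sw_cong) auto
  then show ?thesis using True by (simp add: delta_def)
next
  case False
  then have "sw n T \<noteq> sw n T'" using sw_inj by blast
  then show ?thesis using False by (simp add: delta_def)
qed

definition Nset :: "bool \<Rightarrow> nat set" where
  "Nset e = (if e then {n} else {})"

lemma Nset_mem: "k \<noteq> n \<Longrightarrow> k \<notin> Nset e" "n \<in> Nset e \<longleftrightarrow> e"
  by (auto simp: Nset_def)

text \<open>The states of the path model for the half-spin representations: after \<open>j\<close> blocks, \<open>sst e j q\<close>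
  with \<open>q < n\<close> has one minus sign at \<open>q\<close> beyond those at \<open>1, \<dots>, n - 2 - j\<close>, while \<open>q = n\<close> stands
  for a state that is one block ahead.\<close>

definition sst :: "bool \<Rightarrow> nat \<Rightarrow> nat \<Rightarrow> nat set" where
  "sst e j q = {1..n - 2 - j} \<union> (if q < n then insert q (Nset (e = even j)) else Nset (e \<noteq> even j))"

text \<open>The highest weight met by the states of type e: the sign at n alternates from block to
  block, and after n - 1 blocks its presence is e = odd n.\<close>

abbreviation "top_sw e \<equiv> sw n (Nset (e = odd n))"

definition sval :: "(nat \<Rightarrow> nat \<Rightarrow> complex) \<Rightarrow> bool \<Rightarrow> nat \<Rightarrow> nat \<Rightarrow> complex" where
  "sval b e j q = Pb b (j + 1) (n - 1 - j) (delta (top_sw e)) (sw n (sst e j q))"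

text \<open>The multiplicative form of \<open>X1\<close> for e = False and of \<open>X2\<close> for
  e = True; the exchange of n - 1 and n reflects the alternating sign at position n.\<close>

definition Ysw :: "(nat \<Rightarrow> nat \<Rightarrow> complex) \<Rightarrow> bool \<Rightarrow> nat \<Rightarrow> nat \<Rightarrow> complex" where
  "Ysw b e j i = (if (e \<noteq> even j) \<and> i = n - 1 then b j n else if (e \<noteq> even j) \<and> i = n then b j (n - 1) else b j i)"

lemma vanish_Pb:
  assumes b: "\<And>j. good (b j)"
  shows "vanish (Pb b s k (delta (top_sw e))) k"
proof (induction k arbitrary: s)
  case 0
  have "delta (top_sw e) (sw n T) = 0" if c: "cnt T > 0" for T
  proof -
    obtain i where i: "i \<in> T" "i \<in> {1..n - 1}" using c unfolding cnt_def card_gt_0_iff by blast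
    then have "i \<notin> Nset (e = odd n)" "i \<in> I" by (auto simp: Nset_def)
    then show ?thesis unfolding delta_sw using i by auto
  qed
  then show ?case by (simp add: Pb_0 vanish_def)
next
  case (Suc k)
  then show ?case unfolding Pb_Suc comp_def by (intro vanish_yblock b)
qed

text \<open>Position 0 is invisible to \<open>sw\<close>, so q = 0 encodes the state without signs
  before n, which is the highest weight itself.\<close>

lemma sval_last: "sval b e (n - 1) q = (if q = 0 then 1 else 0)" if "q \<le> n - 1"
proof -
  have n: "n - 1 - (n - 1) = 0" "even (n - 1) = odd n" "n - 2 - (n - 1) = 0" "q < n" using n4 that by auto
  have "sval b e (n - 1) q = delta (top_sw e) (sw n (insert q (Nset (e = odd n))))"
    using n by (simp add: sval_def sst_def Pb_0)
  also have "\<dots> = (if q = 0 then 1 else 0)"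
  proof (cases "q = 0")
    case True
    have "0 \<notin> I" by simp
    then show ?thesis unfolding delta_sw using True by auto
  next
    case False
    then have "q \<in> I" "q \<noteq> n" using n by auto
    then have "\<not> (\<forall>i\<in>I. i \<in> insert q (Nset (e = odd n)) \<longleftrightarrow> i \<in> Nset (e = odd n))"
      using Nset_mem(1)[of q "e = odd n"] by blast
    then show ?thesis unfolding delta_sw using False by simp
  qed
  finally show ?thesis .
qed

lemma sval_last_n: "sval b e (n - 1) n = 0"
proof -
  have n: "n - 1 - (n - 1) = 0" "even (n - 1) = odd n" "n - 2 - (n - 1) = 0" "n \<in> I" using n4 by auto
  have "sval b e (n - 1) n = delta (top_sw e) (sw n (Nset (e \<noteq> odd n)))"
    using n by (simp add: sval_def sst_def Pb_0)
  also have "\<not> (\<forall>i\<in>I. i \<in> Nset (e \<noteq> odd n) \<longleftrightarrow> i \<in> Nset (e = odd n))"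
    using n(4) Nset_mem(2)[of "e \<noteq> odd n"] Nset_mem(2)[of "e = odd n"] by blast
  then have "delta (top_sw e) (sw n (Nset (e \<noteq> odd n))) = 0" unfolding delta_sw by simp
  finally show ?thesis .
qed

text \<open>With p = n - 2 - j the state has p + 1 signs before n, and only p blocks follow this
  one; so one sign must be lost now and \<open>mover\<close> applies to the signs p and q. The signs
  at 1, ..., p - 1 cannot move because their right neighbours are occupied.\<close>

lemma sval_step:
  assumes b: "\<And>j. good (b j)" and j: "j + 3 \<le> n" and q: "n - 1 - j \<le> q" "q \<le> n - 1"
  shows "sval b e j q = (\<Sum>k\<in>{n - 2 - j..q - 1}. b (j + 1) k / b (j + 1) (q - 1) * sval b e (j + 1) k)"
proof -
  define p where "p = n - 2 - j"
  define c where "c = b (j + 1)"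
  define w where "w = Pb b (j + 2) p (delta (top_sw e))"
  define T where "T = {1..p - 1} \<union> Nset (e = even j)"
  have p: "1 \<le> p" "p < q" "p \<le> n - 1" "n - 1 - j = Suc p" "n - 1 - (j + 1) = p" "n - 2 - (j + 1) = p - 1" "q < n" "1 \<le> q"
    using j q by (auto simp: p_def)
  have g: "good c" unfolding c_def by (rule b)
  have T: "i \<notin> T" if "p \<le> i" "i \<le> n - 1" for i using that n4 by (auto simp: T_def Nset_def)
  have S: "sst e j q = insert p (insert q T)" unfolding sst_def p_def[symmetric] T_def using p(1,2,7) by auto
  have cnt: "cnt (insert m (insert q T)) > p" if "p \<le> m" "m < q" for m
  proof -
    have "insert m (insert q {1..p - 1}) \<subseteq> insert m (insert q T) \<inter> {1..n - 1}" using that p(1,7) by (auto simp: T_def)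
    then have "card (insert m (insert q {1..p - 1})) \<le> cnt (insert m (insert q T))"
      unfolding cnt_def by (intro card_mono) auto
    moreover have "card (insert m (insert q {1..p - 1})) = p + 1" using that p by simp
    ultimately show ?thesis by linarith
  qed
  have "sval b e j q = yblock c w (sw n (insert p (insert q T)))"
    unfolding sval_def S p(4) Pb_Suc by (simp add: w_def c_def)
  also have "\<dots> = ysuf c p w (sw n (insert p (insert q T)))"
    unfolding yblock_ysuf by (rule sw_skip[OF g]) (use p(1,2,3,7) in \<open>auto simp: T_def Nset_def\<close>)
  also have "\<dots> = (\<Sum>k\<in>{p..q - 1}. c k / c (q - 1) * w (sw n (flipn (insert k T))))"
    by (rule mover[OF g _ T p(1,2) q(2) cnt]) (use p(1,2) in \<open>auto simp: w_def intro: vanish_Pb b\<close>)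
  also have "\<dots> = (\<Sum>k\<in>{p..q - 1}. c k / c (q - 1) * sval b e (j + 1) k)"
  proof (rule sum.cong)
    fix k assume k: "k \<in> {p..q - 1}"
    then have kn: "k < n" "k \<noteq> n" using p by auto
    have "flipn (insert k T) = sst e (j + 1) k"
      unfolding sst_def p(6) T_def flipn_def using kn p(3) n4 by (auto simp: Nset_def)
    then show "c k / c (q - 1) * w (sw n (flipn (insert k T))) = c k / c (q - 1) * sval b e (j + 1) k"
      unfolding sval_def p(5) w_def by (simp add: add.assoc)
  qed simp
  finally show ?thesis unfolding c_def p_def .
qed

text \<open>The state q = n has one sign fewer than the states q < n, so nothing forces a loss in
  this block and \<open>lone_mover\<close> applies to the last sign.\<close>

lemma sval_step_n:
  assumes b: "\<And>j. good (b j)" and j: "j + 3 \<le> n"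
  shows "sval b e j n = (\<Sum>k\<in>{n - 2 - j..<n - 1}. b (j + 1) k / Ysw b e (j + 1) (n - 1) * sval b e (j + 1) k)
    + Ysw b e (j + 1) n * sval b e (j + 1) (n - 1) + sval b e (j + 1) n"
proof -
  define p where "p = n - 2 - j"
  define c where "c = b (j + 1)"
  define w where "w = Pb b (j + 2) p (delta (top_sw e))"
  define T where "T = {1..p - 1} \<union> Nset (e \<noteq> even j)"
  have p: "1 \<le> p" "p \<le> n - 1" "n - 1 - j = Suc p" "n - 1 - (j + 1) = p" "n - 2 - (j + 1) = p - 1" "p \<noteq> n"
    using j by (auto simp: p_def)
  have g: "good c" unfolding c_def by (rule b)
  have T: "i \<notin> T" if "p \<le> i" "i \<le> n - 1" for i using that n4 by (auto simp: T_def Nset_def)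
  have Tn: "n \<in> T \<longleftrightarrow> e \<noteq> even j" using p by (auto simp: T_def Nset_def)
  have nn: "n - 1 \<noteq> n" using n4 by auto
  have Y: "(if n \<in> T then c (n - 1) else c n) = Ysw b e (j + 1) (n - 1)" "(if n \<in> T then c n else c (n - 1)) = Ysw b e (j + 1) n"
    using nn by (auto simp: Tn Ysw_def c_def)
  have S: "sst e j n = insert p T" unfolding sst_def p_def[symmetric] T_def using p(1) by auto
  have K: "sst e (j + 1) k = insert k T" if "k < n" for k using that unfolding sst_def p(5) T_def by auto
  have Kn: "sst e (j + 1) n = flipn T" unfolding sst_def p(5) T_def flipn_def using p(1,2) n4 by (auto simp: Nset_def)
  have V: "w (sw n (sst e (j + 1) k)) = sval b e (j + 1) k" for k unfolding sval_def p(4) w_def by (simp add: add.assoc)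
  have V': "w (sw n (insert k T)) = sval b e (j + 1) k" if "k < n" for k using V[of k] unfolding K[OF that] .
  have Vn: "w (sw n (flipn T)) = sval b e (j + 1) n" using V[of n] unfolding Kn .
  have "sval b e j n = yblock c w (sw n (insert p T))"
    unfolding sval_def S p(3) Pb_Suc by (simp add: w_def c_def)
  also have "\<dots> = ysuf c p w (sw n (insert p T))"
    unfolding yblock_ysuf by (rule sw_skip[OF g]) (use p(1,2) in \<open>auto simp: T_def Nset_def\<close>)
  also have "\<dots> = (\<Sum>k\<in>{p..<n - 1}. c k / Ysw b e (j + 1) (n - 1) * w (sw n (insert k T)))
      + Ysw b e (j + 1) n * w (sw n (insert (n - 1) T)) + w (sw n (flipn T))"
    unfolding Y[symmetric] by (rule lone_mover[OF g T p(1) order_refl p(2)])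
  also have "(\<Sum>k\<in>{p..<n - 1}. c k / Ysw b e (j + 1) (n - 1) * w (sw n (insert k T)))
     = (\<Sum>k\<in>{p..<n - 1}. c k / Ysw b e (j + 1) (n - 1) * sval b e (j + 1) k)"
    by (rule sum.cong) (auto simp: V')
  also have "w (sw n (insert (n - 1) T)) = sval b e (j + 1) (n - 1)" by (rule V') (use n4 in simp)
  also have "w (sw n (flipn T)) = sval b e (j + 1) n" by (rule Vn)
  finally show ?thesis unfolding c_def p_def .
qed

lemma sval_pen:
  assumes b: "\<And>j. good (b j)" and q: "1 \<le> q" "q \<le> n - 1"
  shows "sval b e (n - 2) q = 1 / b (n - 1) (q - 1)"
proof -
  define c where "c = b (n - 1)"
  define w where "w = delta (top_sw e)"
  define N where "N = Nset (e = even (n - 2))"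
  have g: "good c" unfolding c_def by (rule b)
  have c0: "c 0 = 1" using goodD(2)[OF g] .
  have p: "n - 1 - (n - 2) = Suc 0" "n - 2 - (n - 2) = 0" "n - 2 + 1 = n - 1" "q < n" "q \<noteq> n" using n4 q by auto
  have ev: "even (n - 2) = even n" using n4 by auto
  have S: "sst e (n - 2) q = insert q N" using p by (simp add: sst_def N_def)
  have N: "i \<notin> N" if "i \<noteq> n" for i using that by (auto simp: N_def Nset_def)
  have v: "vanish w 0" using vanish_Pb[of b 0 0 e, OF b] by (simp add: w_def Pb_0)
  have esc: "ysuf c q w (sw n (insert q N)) = 1"
  proof -
    have "cnt (insert q N) > 0" using q by (auto simp: cnt_def card_gt_0_iff)
    then have "ysuf c q w (sw n (insert q N)) = w (sw n (flipn (insert q N - {q})))"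
      by (intro escape[OF g v]) (use q N in auto)
    also have "flipn (insert q N - {q}) = Nset (e = odd n)"
      using p N by (auto simp: flipn_def N_def Nset_def ev)
    finally show ?thesis by (simp add: w_def delta_def)
  qed
  have "sval b e (n - 2) q = yblock c w (sw n (insert q N))"
    unfolding sval_def S p(1) Pb_Suc p(3) Pb_0 by (simp add: w_def c_def)
  also have "\<dots> = 1 / c (q - 1)"
  proof (cases "q = 1")
    case True
    then show ?thesis using esc c0 unfolding yblock_ysuf by simp
  next
    case False
    then have q1: "1 \<le> q - 1" "q - 1 < n" "q - 1 + 1 = q" "q - 1 \<notin> insert q N" "q - 1 + 1 \<in> insert q N" using q N by auto
    have "yblock c w (sw n (insert q N)) = ysuf c (q - 1) w (sw n (insert q N))"
    proof -
      have "i \<in> insert q N \<longleftrightarrow> i + 1 \<in> insert q N" if "1 \<le> i" "i < q - 1" for i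
        using that q N[of i] N[of "i + 1"] by auto
      then show ?thesis unfolding yblock_ysuf by (intro sw_skip[OF g]) (use q1 in auto)
    qed
    also have "\<dots> = 1 / c (q - 1)" using sw_pos[OF g q1(1,2,4,5), of w] esc unfolding q1(3) by simp
    finally show ?thesis .
  qed
  finally show ?thesis unfolding c_def .
qed

lemma sval_pen_n:
  assumes b: "\<And>j. good (b j)"
  shows "sval b e (n - 2) n = 1 / Ysw b e (n - 1) (n - 1)"
proof -
  define c where "c = b (n - 1)"
  define w where "w = delta (top_sw e)"
  define N where "N = Nset (e = odd n)"
  have g: "good c" unfolding c_def by (rule b)
  have p: "n - 1 - (n - 2) = Suc 0" "n - 2 - (n - 2) = 0" "n - 2 + 1 = n - 1" "n - 1 \<noteq> n" using n4 by auto
  have ev: "even (n - 2) = even n" "even (n - 1) = odd n" using n4 by auto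
  have S: "sst e (n - 2) n = N" unfolding sst_def p(2) N_def ev by simp
  have Nn: "n - 1 \<notin> N" "n \<in> N \<longleftrightarrow> e = odd n" using p by (auto simp: N_def Nset_def)
  have w1: "w (sw n N) = 1" by (simp add: w_def N_def delta_def)
  have "i \<in> N \<longleftrightarrow> i + 1 \<in> N" if "1 \<le> i" "i < n - 1" for i
    using that by (auto simp: N_def Nset_def)
  then have skip: "yblock c w (sw n N) = ysuf c (n - 1) w (sw n N)"
    unfolding yblock_ysuf by (intro sw_skip[OF g]) (use n4 in auto)
  have "sval b e (n - 2) n = yblock c w (sw n N)"
    unfolding sval_def S p(1) Pb_Suc p(3) Pb_0 by (simp add: w_def c_def)
  also have "\<dots> = 1 / (if n \<in> N then c (n - 1) else c n)"
  proof (cases "n \<in> N")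
    case True
    have "ysuf c (n - 1) w (sw n N) = ysuf c n w (sw n N) / c (n - 1)"
      using sw_pos[OF g, of "n - 1" N w] Nn(1) True n4 unfolding Suc_n by simp
    also have "ysuf c n w (sw n N) = w (sw n N)" by (rule sw_last(3)[OF g]) (use Nn True in auto)
    finally show ?thesis using skip w1 True by simp
  next
    case False
    have "ysuf c (n - 1) w (sw n N) = ysuf c n w (sw n N)"
      by (rule sw_skip_pen[OF g]) (use False Nn in auto)
    also have "\<dots> = w (sw n N) / c n" by (rule sw_last(2)[OF g]) (use False Nn in auto)
    finally show ?thesis using skip w1 False by simp
  qed
  also have "(if n \<in> N then c (n - 1) else c n) = Ysw b e (n - 1) (n - 1)"
    unfolding Nn(2) by (auto simp: Ysw_def c_def ev)
  finally show ?thesis .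
qed

lemma sval_sum:
  assumes b: "\<And>j. good (b j)" and j: "j + 2 \<le> n" and q: "n - 1 - j \<le> q" "q \<le> n - 1"
  shows "sval b e j q = (\<Sum>k\<in>{n - 2 - j..q - 1}. b (j + 1) k / b (j + 1) (q - 1) * sval b e (j + 1) k)"
proof (cases "j + 2 = n")
  case True
  then have j: "j = n - 2" "n - 2 - j = 0" "j + 1 = n - 1" "1 \<le> q" using q by auto
  have "(\<Sum>k\<in>{n - 2 - j..q - 1}. b (j + 1) k / b (j + 1) (q - 1) * sval b e (j + 1) k)
      = (\<Sum>k\<in>{0..q - 1}. if k = 0 then b (n - 1) 0 / b (n - 1) (q - 1) else 0)"
    unfolding j(2,3) by (rule sum.cong) (use q j in \<open>auto simp: sval_last[unfolded One_nat_def]\<close>)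
  also have "\<dots> = 1 / b (n - 1) (q - 1)" using goodD(2)[OF b] by simp
  finally show ?thesis using sval_pen[OF b j(4) q(2)] j(1) by simp
next
  case False
  then show ?thesis using sval_step[OF b _ q] j by simp
qed

lemma sval_sum_n:
  assumes b: "\<And>j. good (b j)" and j: "j + 2 \<le> n"
  shows "sval b e j n = (\<Sum>k\<in>{n - 2 - j..<n - 1}. b (j + 1) k / Ysw b e (j + 1) (n - 1) * sval b e (j + 1) k)
    + Ysw b e (j + 1) n * sval b e (j + 1) (n - 1) + sval b e (j + 1) n"
proof (cases "j + 2 = n")
  case True
  then have j: "j = n - 2" "n - 2 - j = 0" "j + 1 = n - 1" by auto
  have "(\<Sum>k\<in>{n - 2 - j..<n - 1}. b (j + 1) k / Ysw b e (j + 1) (n - 1) * sval b e (j + 1) k)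
      = (\<Sum>k\<in>{0..<n - 1}. if k = 0 then b (n - 1) 0 / Ysw b e (n - 1) (n - 1) else 0)"
    unfolding j(2,3) by (rule sum.cong) (use j in \<open>auto simp: sval_last[unfolded One_nat_def]\<close>)
  also have "\<dots> = 1 / Ysw b e (n - 1) (n - 1)" using goodD(2)[OF b] n4 by simp
  finally show ?thesis unfolding j(3) using sval_pen_n[OF b] j(1) sval_last[of "n - 1" b e] sval_last_n n4 by simp
next
  case False
  then show ?thesis using sval_step_n[OF b] j by simp
qed

text \<open>The signs fill {1..n - 1 - j}, exactly as many as there are blocks left, so a single
  path of weight 1 remains.\<close>

lemma sval_first:
  assumes b: "\<And>j. good (b j)"
  shows "j \<le> n - 1 \<Longrightarrow> sval b e j (n - 1 - j) = 1"
proof (induction "n - 1 - j" arbitrary: j)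
  case 0
  then have "j = n - 1" by simp
  then show ?case using sval_last[of 0 b e] by simp
next
  case (Suc d)
  have j: "j + 2 \<le> n" "n - 1 - (j + 1) = n - 2 - j" "n - 1 - j - 1 = n - 2 - j" "d = n - 1 - (j + 1)" "n - 2 - j \<le> n"
    "j + 1 \<le> n - 1" using Suc n4 by auto
  have "b (j + 1) (n - 2 - j) \<noteq> 0" by (rule good_nz[OF b j(5)])
  moreover have "sval b e (j + 1) (n - 1 - (j + 1)) = 1" using Suc.hyps(1)[OF j(4,6)] .
  ultimately show ?case using sval_sum[where b = b and e = e and q = "n - 1 - j", OF b j(1)] unfolding j(2,3) by simp
qed

text \<open>The sums for q and q + 1 differ in their common denominator and in one extra summand;
  dividing one by the other turns the step into a two-term recursion.\<close>

lemma sval_rec: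
  assumes b: "\<And>j. good (b j)" and j: "j + 2 \<le> n" and q: "n - 1 - j \<le> q" "q + 1 \<le> n - 1"
  shows "sval b e j (q + 1) = b (j + 1) (q - 1) / b (j + 1) q * sval b e j q + sval b e (j + 1) q"
proof -
  have "n - 2 - j \<le> q" "1 \<le> q" using j q by auto
  then have s: "{n - 2 - j..q} = insert q {n - 2 - j..q - 1}" "q \<notin> {n - 2 - j..q - 1}" by auto
  have nz: "b (j + 1) (q - 1) \<noteq> 0" "b (j + 1) q \<noteq> 0" using good_nz[OF b] q by auto
  have "sval b e j (q + 1) = (\<Sum>k\<in>{n - 2 - j..q}. b (j + 1) k / b (j + 1) q * sval b e (j + 1) k)"
    using sval_sum[where b = b and e = e and q = "q + 1", OF b j] q by simp
  also have "\<dots> = (\<Sum>k\<in>{n - 2 - j..q - 1}. b (j + 1) (q - 1) / b (j + 1) q * (b (j + 1) k / b (j + 1) (q - 1) * sval b e (j + 1) k)) + sval b e (j + 1) q"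
    unfolding s(1) using s(2) nz by simp
  finally show ?thesis using sval_sum[where b = b and e = e, OF b j q(1)] q by (simp add: sum_distrib_left)
qed

lemma sval_rec_n:
  assumes b: "\<And>j. good (b j)" and j: "j + 2 \<le> n"
  shows "sval b e j n = Ysw b e (j + 1) (n - 2) / Ysw b e (j + 1) (n - 1) * sval b e j (n - 1)
     + Ysw b e (j + 1) n * sval b e (j + 1) (n - 1) + sval b e (j + 1) n"
proof -
  have nn: "n - 2 \<noteq> n" "n - 2 \<noteq> n - 1" "{n - 2 - j..n - 2} = {n - 2 - j..<n - 1}" "n - 1 - 1 = n - 2" using n4 by auto
  have nz: "b (j + 1) (n - 2) \<noteq> 0" using good_nz[OF b] by auto
  have Y: "Ysw b e (j + 1) (n - 2) = b (j + 1) (n - 2)" using nn by (simp add: Ysw_def)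
  have "sval b e j (n - 1) = (\<Sum>k\<in>{n - 2 - j..<n - 1}. b (j + 1) k / b (j + 1) (n - 2) * sval b e (j + 1) k)"
    using sval_sum[where b = b and e = e and q = "n - 1", OF b j diff_le_self order_refl] unfolding nn(4) nn(3) .
  then have "b (j + 1) (n - 2) / Ysw b e (j + 1) (n - 1) * sval b e j (n - 1)
      = (\<Sum>k\<in>{n - 2 - j..<n - 1}. b (j + 1) k / Ysw b e (j + 1) (n - 1) * sval b e (j + 1) k)"
    using nz by (simp add: sum_distrib_left)
  then show ?thesis using sval_sum_n[where b = b and e = e, OF b j] Y by simp
qed

section \<open>Characters read off the half-spin representations\<close>

lemma Ug_dominant:
  assumes "u \<in> Ug 1" and d: "\<And>i. i \<in> I \<Longrightarrow> \<Lambda> i \<ge> 0"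
  shows "u (delta \<Lambda>) = delta \<Lambda>"
proof -
  have s: "(1::int) = 1 \<or> (1::int) = -1" by simp
  have r: "xs 1 i a (delta \<Lambda>) \<mu> = delta \<Lambda> \<mu>" if i: "i \<in> I" for i a \<mu>
  proof (cases "\<mu> \<in> mw \<and> \<mu> i = 1")
    case True
    have "reflect n i \<mu> i = - \<mu> i" using i by (simp add: reflect_def cartan_diag)
    then have "reflect n i \<mu> \<noteq> \<Lambda>" using d[OF i] True by auto
    then show ?thesis using True by (simp add: xs_hit delta_def)
  next
    case False
    then show ?thesis using xs_miss[of \<mu> i 1] outside_mw(1)[of \<mu>] by blast
  qed
  show ?thesis
  proof (rule Ug_induct[where P = "\<lambda>u. u (delta \<Lambda>) = delta \<Lambda>", OF s assms(1)])
    show "xs 1 i a (delta \<Lambda>) = delta \<Lambda>" if "i \<in> I" for i a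
      by (rule ext) (rule r[OF that])
  qed simp_all
qed

text \<open>Suppose the coefficient at \<kappa> came from \<Lambda> although \<kappa> i = 1.
  Conjugation by w0 matches some \<open>y_j\<close> with \<open>x_i\<close>; the former does not
  change the coefficient at the dominant weight \<Lambda>, so the latter does not change the one at
  \<kappa>. Then w0 z would vanish at the reflection of \<kappa> for every z, against surjectivity
  of w0.\<close>

lemma w0_dominant:
  assumes d: "\<And>i. i \<in> I \<Longrightarrow> \<Lambda> i \<ge> 0" and k: "\<kappa> \<in> mw" "i \<in> I" "\<kappa> i = 1"
  shows "w0 (delta \<Lambda>) \<kappa> = 0"
proof (rule ccontr)
  assume nz: "w0 (delta \<Lambda>) \<kappa> \<noteq> 0"
  obtain e :: complex where e: "\<And>z. w0 z \<kappa> = e * z ((ccox ^^ (n - 1)) \<kappa>)"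
    using cox_sign[OF k(1), of "n - 1"] unfolding w0bar_cox by blast
  have L: "(ccox ^^ (n - 1)) \<kappa> = \<Lambda>" using nz unfolding e by (simp add: delta_def split: if_splits)
  obtain j where j: "j \<in> I" "\<forall>a. cj w0 (xs (-1) j a) = xs 1 i (- a)" using w0_covers[OF k(2)] by blast
  have "w0 z (reflect n i \<kappa>) = 0" for z
  proof -
    have "w0 \<circ> xs (-1) j 1 = xs 1 i (- 1) \<circ> w0" by (rule cj_eqD[OF bij_w0]) (use j(2) in blast)
    then have "w0 (xs (-1) j 1 z) \<kappa> = xs 1 i (- 1) (w0 z) \<kappa>" by (simp add: fun_eq_iff)
    moreover have "xs (-1) j 1 z \<Lambda> = z \<Lambda>" by (rule xs_miss) (use d[OF j(1)] in auto)
    then have "w0 (xs (-1) j 1 z) \<kappa> = w0 z \<kappa>" unfolding e L by simp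
    ultimately show ?thesis using xs_hit[OF k(1,3), of "-1" "w0 z"] by simp
  qed
  then have z: "w0 z (reflect n i \<kappa>) = 0" for z .
  have "w0 (finv w0 (delta (reflect n i \<kappa>))) = delta (reflect n i \<kappa>)"
    using bij_w0 by (simp add: bij_is_surj surj_f_inv_f)
  then show False using z[of "finv w0 (delta (reflect n i \<kappa>))"] by (simp add: delta_def)
qed

lemma top_sw_dominant:
  assumes "i \<in> I"
  shows "top_sw e i \<ge> 0"
proof (cases "i = n")
  case True
  have "n - 1 \<notin> Nset (e = odd n)" by (rule Nset_mem(1)) (use n4 in simp)
  then show ?thesis using True by (simp add: sw_at)
next
  case False
  then have "1 \<le> i" "i < n" "i \<notin> Nset (e = odd n)" using assms Nset_mem(1)[of i] by auto
  then show ?thesis by (simp add: sw_at)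
qed

text \<open>No coordinate of a weight in the support equals 1. This excludes the natural weights
  other than -\<epsilon>_1, which w0 links to \<epsilon>_1, and forces the minus signs to fill {1..n
  - 1}. The sign at n is left open.\<close>

lemma w0_top_sw:
  assumes "w0 (delta (top_sw e)) \<kappa> \<noteq> 0"
  shows "\<exists>S. \<kappa> = sw n S \<and> {1..n - 1} \<subseteq> S"
proof -
  have L: "top_sw e \<in> mw" by (rule sw_mw)
  have km: "\<kappa> \<in> mw"
  proof (rule ccontr)
    assume a: "\<kappa> \<notin> mw"
    then show False using assms L unfolding w0_outside[OF a] delta_def by (auto split: if_splits)
  qed
  have np: "\<kappa> i \<noteq> 1" if "i \<in> I" for i using w0_dominant[of "top_sw e", OF top_sw_dominant km that] assms by blast
  from km consider p where "p \<in> I" "\<kappa> = ep n p" | p where "p \<in> I" "\<kappa> = en n p" | S where "\<kappa> = sw n S"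
    unfolding mw_eq by blast
  then show ?thesis
  proof cases
    case 1
    then have "\<kappa> p = 1" using ep_at by simp
    then show ?thesis using np[OF 1(1)] by blast
  next
    case 2
    show ?thesis
    proof (cases "p = 1")
      case True
      have "1 \<le> n - 1" using n4 by simp
      then obtain f where "\<forall>z. w0 z (en n 1) = f * z (ep n 1)" using w0_en[OF order_refl] by blast
      then have "w0 (delta (top_sw e)) \<kappa> = f * delta (top_sw e) (ep n 1)" using 2 True by simp
      moreover have "ep n 1 \<noteq> top_sw e" by (rule natural_not_spin(1)) (use n4 in auto)
      ultimately show ?thesis using assms by (simp add: delta_def)
    next
      case False
      then have p: "1 \<le> p - 1" "p - 1 < n" "p - 1 \<noteq> p" "p - 1 + 1 = p" "p - 1 \<in> I" using 2 by auto
      have "\<kappa> (p - 1) = 1" unfolding 2 en_vals(1)[OF p(1,2)] using p(3,4) by simp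
      then show ?thesis using np[OF p(5)] by blast
    qed
  next
    case 3
    have step: "i \<in> S" if "1 \<le> i" "i < n" "i + 1 \<in> S" for i
      using np[of i] that unfolding 3 sw_at(1)[OF that(1,2)] by (auto simp: of_bool_def split: if_splits)
    have nn: "1 \<le> n - 1" "n - 1 < n" "n - 1 + 1 = n" using n4 by auto
    have "n - 1 \<in> S \<or> n \<in> S" using np[of n] n4 unfolding 3 sw_at(2) by (auto simp: of_bool_def split: if_splits)
    then have n1: "n - 1 \<in> S" using step[OF nn(1,2)] unfolding nn(3) by blast
    have "i \<in> S" if "1 \<le> i" "i \<le> n - 1" for i using that
    proof (induction "n - 1 - i" arbitrary: i)
      case 0
      then have "i = n - 1" by simp
      then show ?case using n1 by simp
    next
      case (Suc d)
      then have i: "d = n - 1 - (i + 1)" "1 \<le> i + 1" "i + 1 \<le> n - 1" "i < n" by auto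
      show ?case by (rule step[OF Suc.prems(1) i(4)]) (rule Suc.hyps(1)[OF i(1-3)])
    qed
    then show ?thesis using 3 by auto
  qed
qed

lemma rho_ends: "rho_vec (n - 1) = rho_vec n"
proof -
  have r: "(\<Sum>j\<in>I. rho_vec j * cartan n j i) = 1" if "i \<in> I" for i
    using someI_ex[of "\<lambda>y::nat \<Rightarrow> real. \<forall>i\<in>I. (\<Sum>j\<in>I. y j * real_of_int (cartan n j i)) = 1"]
      cartan_invertible[of "\<lambda>_. 1"] that unfolding rho_vec_def by blast
  have c: "\<not> n - 1 < n - 2" "n - 1 \<noteq> n - 2" "\<not> n < n - 2" "n \<noteq> n - 2" using n4 by auto
  show ?thesis using r[OF ends_in(2)] r[OF ends_in(3)]
    unfolding cartan_sum[OF ends_in(2)] cartan_sum[OF ends_in(3)] by (simp only: c if_False)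
qed

text \<open>The sign at n exchanges the values of the last two coordinates, which enter the level
  with the same weight; so it never has to be decided which half-spin lowest weight occurs.\<close>

lemma lev_low: "{1..n - 1} \<subseteq> S \<Longrightarrow> lev (sw n S) = lev (sw n {1..n - 1})"
proof -
  assume S: "{1..n - 1} \<subseteq> S"
  have nn: "n - 1 \<noteq> n" "n - 1 + 1 = n" "1 \<le> n - 1" "n - 1 < n" using n4 by auto
  have v: "(\<Sum>j\<in>I. rho_vec j * real_of_int (sw n T j)) = - rho_vec n" if T: "{1..n - 1} \<subseteq> T" for T
  proof -
    have m: "i \<in> T" if "1 \<le> i" "i < n" for i using T that by (auto simp: subset_iff)
    have z: "sw n T j = 0" if "j \<in> I - {n - 1, n}" for j
    proof -
      have "j + 1 \<noteq> n" "1 \<le> j" "j < n" "j + 1 < n" using that by auto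
      then show ?thesis using m[of j] m[of "j + 1"] by (simp add: sw_at)
    qed
    have "(\<Sum>j\<in>I. rho_vec j * real_of_int (sw n T j)) = (\<Sum>j\<in>{n - 1, n}. rho_vec j * real_of_int (sw n T j))"
      by (rule sum.mono_neutral_right) (use z ends_in in auto)
    also have "\<dots> = rho_vec (n - 1) * real_of_int (sw n T (n - 1)) + rho_vec n * real_of_int (sw n T n)"
      using nn(1) by simp
    also have "\<dots> = - rho_vec n"
      unfolding rho_ends sw_at(1)[OF nn(3,4)] sw_at(2) nn(2) using m[OF nn(3,4)] by (simp add: of_bool_def)
    finally show ?thesis .
  qed
  show ?thesis unfolding lev_def v[OF S] v[OF order_refl] ..
qed

context
  fixes b :: "nat \<Rightarrow> nat \<Rightarrow> complex" and u u' :: elt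
  assumes b: "\<And>j. good (b j)" and u: "u \<in> Ug 1" and u': "u' \<in> Ug 1" and eq: "Pb b 1 (n - 1) = u \<circ> w0 \<circ> u'"
begin

text \<open>Both U-factors are evaluated on an extremal vector: u' fixes the highest weight vector,
  and w0 makes it a lowest one. The coefficient of u at the weight \<open>low\<close> equals 1 by
  \<open>sval_first\<close>, and one simple reflection above it the first-order expansion leaves
  just \<chi>_i(u), with i = n - 1 or n according to e.\<close>

lemma chi_left_sval: "chiv 1 (if e then n else n - 1) u = sval b e 0 n"
proof -
  define y where "y = w0 (delta (top_sw e))"
  define i where "i = (if e then n else n - 1)"
  define low where "low = sw n (sst e 0 (n - 1))"
  define up where "up = sw n (sst e 0 n)"
  have nn: "n - 1 \<noteq> n" "n - 1 + 1 = n" "1 \<le> n - 1" "n - 1 < n" "n - 2 \<noteq> n" "n - 2 \<noteq> n - 1" "n - 2 + 1 = n - 1" "1 \<le> n - 2" "n - 2 < n" using n4 by auto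
  have iI: "i \<in> I" using ends_in by (simp add: i_def)
  have lowS: "sst e 0 (n - 1) = {1..n - 1} \<union> Nset e" using nn by (auto simp: sst_def)
  have upS: "sst e 0 n = {1..n - 2} \<union> Nset (\<not> e)" by (simp add: sst_def)
  have um: "k \<in> sst e 0 n \<longleftrightarrow> k \<noteq> n - 1 \<and> k \<noteq> n" if "1 \<le> k" "k < n" for k
    using that Nset_mem(1)[of k "\<not> e"] unfolding upS by auto
  have un: "n \<in> sst e 0 n \<longleftrightarrow> \<not> e" unfolding upS using n4 by (auto simp: Nset_mem)
  have sd: "Pb b 1 (n - 1) (delta (top_sw e)) = u y"
  proof -
    show ?thesis unfolding eq y_def comp_def using Ug_dominant[of u' "top_sw e", OF u' top_sw_dominant] by simp
  qed
  have van: "y \<kappa> = 0" if "lev \<kappa> < lev low" for \<kappa>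
  proof (rule ccontr)
    assume "y \<kappa> \<noteq> 0"
    then obtain S where S: "\<kappa> = sw n S" "{1..n - 1} \<subseteq> S" using w0_top_sw unfolding y_def by blast
    have "lev \<kappa> = lev low" unfolding S(1) lev_low[OF S(2)] low_def lowS by (rule lev_low[symmetric]) simp
    then show False using that by simp
  qed
  have ui: "up i = 1" and uj: "\<And>j. j \<in> I \<Longrightarrow> up j = 1 \<Longrightarrow> j = i" and y_up: "y up = 0"
  proof -
    have pen: "up (n - 1) = of_bool (\<not> e)"
      unfolding up_def sw_at(1)[OF nn(3,4)] nn(2) un um[OF nn(3,4)] by simp
    have last: "up n = 1 - of_bool (\<not> e)"
      unfolding up_def sw_at(2) un um[OF nn(3,4)] by simp
    show "up i = 1" unfolding i_def using pen last by auto
    show "j = i" if j: "j \<in> I" "up j = 1" for j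
    proof (cases "j = n \<or> j = n - 1")
      case True
      then show ?thesis using j(2) pen last unfolding i_def by (auto simp: of_bool_def split: if_splits)
    next
      case False
      then have "1 \<le> j" "j < n" "j + 1 < n" "j \<noteq> n - 1" "j \<noteq> n" using j by auto
      then have "up j \<le> 0" unfolding up_def sw_at(1)[OF \<open>1 \<le> j\<close> \<open>j < n\<close>] using um[of j] um[of "j + 1"] by (simp add: of_bool_def)
      then show ?thesis using j(2) by simp
    qed
    show "y up = 0" unfolding y_def
    proof (rule w0_dominant)
      show "up \<in> mw" unfolding up_def by (rule sw_mw)
    qed (rule top_sw_dominant iI \<open>up i = 1\<close>; assumption?)+
  qed
  have refl: "reflect n i up = low"
    unfolding up_def low_def refl_sw[OF iI]
  proof (rule sw_cong)
    fix k assume k: "1 \<le> k" "k \<le> n"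
    show "k \<in> sact n i (sst e 0 n) \<longleftrightarrow> k \<in> sst e 0 (n - 1)"
      using k n4 unfolding lowS upS i_def sact_def Nset_def by (cases e) auto
  qed
  have lev_up: "lev low = lev up - 1" using lev_reflect[OF iI, of up] unfolding refl ui .
  have s0: "n - 1 - 0 = n - 1" "(0::nat) + 1 = 1" by simp_all
  have "sval b e 0 (n - 1) = 1" using sval_first[where b = b and e = e and j = 0, OF b] by simp
  then have "u y low = 1" unfolding sval_def s0 sd low_def .
  moreover have "u y low = y low" by (rule Ug_unipotent[of 1]) (use u van in auto)
  ultimately have ylow: "y low = 1" by simp
  have S: "{j \<in> I. up j = 1} = {i}" using iI ui uj by blast
  have "sval b e 0 n = u y up" unfolding sval_def s0 sd up_def ..
  also have "\<dots> = y up + (\<Sum>j\<in>{j\<in>I. up j = 1}. chiv 1 j u * y (reflect n j up))"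
    by (rule Ug_coeff) (use u van lev_up in \<open>auto simp: up_def intro: sw_mw\<close>)
  also have "\<dots> = chiv 1 i u" unfolding S y_up using refl ylow by simp
  finally show ?thesis unfolding i_def by simp
qed

end

section \<open>Path sums as sums over decreasing sequences\<close>

definition lterm :: "(nat \<Rightarrow> nat \<Rightarrow> complex) \<Rightarrow> bool \<Rightarrow> nat list \<Rightarrow> complex" where
  "lterm b e mu = (\<Prod>k\<in>{1..length mu}. Ysw b e (mu ! (k - 1) + k - 1) (n - mu ! (k - 1) - 1)
     / Ysw b e (mu ! (k - 1) + k - 1) (n - mu ! (k - 1)))"

definition Lseq :: "nat \<Rightarrow> nat \<Rightarrow> nat list set" where
  "Lseq k m = {mu. sorted_wrt (>) mu \<and> set mu \<subseteq> {m..<n} \<and> length mu = k}"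

definition sterm :: "(nat \<Rightarrow> nat \<Rightarrow> complex) \<Rightarrow> bool \<Rightarrow> nat list \<Rightarrow> complex" where
  "sterm b e mu = lterm b e mu * (if last mu = 1 then 1 else Ysw b e (length mu) n)"

lemma lterm_snoc: "lterm b e (mu @ [x]) = lterm b e mu * (Ysw b e (x + length mu) (n - x - 1) / Ysw b e (x + length mu) (n - x))"
proof -
  have "(\<Prod>k\<in>{1..length mu}. Ysw b e ((mu @ [x]) ! (k - 1) + k - 1) (n - (mu @ [x]) ! (k - 1) - 1)
     / Ysw b e ((mu @ [x]) ! (k - 1) + k - 1) (n - (mu @ [x]) ! (k - 1))) = lterm b e mu"
    unfolding lterm_def by (rule prod.cong) (auto simp: nth_append)
  then show ?thesis unfolding lterm_def[of b e "mu @ [x]"] by simp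
qed

lemma Lseq_finite: "finite (Lseq k m)"
  by (rule finite_subset[OF _ finite_lists_length_eq[of "{m..<n}" k]]) (auto simp: Lseq_def)

lemma Lseq_0: "Lseq 0 m = {[]}"
  by (auto simp: Lseq_def)

text \<open>Entries decrease, so a sequence with entries at least m either ends in m or has all
  entries at least m + 1. The recursions of the path model follow this splitting.\<close>

lemma Lseq_Suc:
  assumes m: "m < n"
  shows "Lseq (Suc k) m = Lseq (Suc k) (m + 1) \<union> (\<lambda>nu. nu @ [m]) ` Lseq k (m + 1)"
proof (intro Set.set_eqI iffI)
  fix mu assume mu: "mu \<in> Lseq (Suc k) m"
  then obtain nu x where nu: "mu = nu @ [x]" by (cases mu rule: rev_cases) (auto simp: Lseq_def)
  have nx: "sorted_wrt (>) nu" "set nu \<subseteq> {x + 1..<n}" "m \<le> x" "x < n" "length nu = k"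
    using mu by (auto simp: Lseq_def nu sorted_wrt_append Suc_le_eq subset_iff)
  show "mu \<in> Lseq (Suc k) (m + 1) \<union> (\<lambda>nu. nu @ [m]) ` Lseq k (m + 1)"
  proof (cases "x = m")
    case True
    then show ?thesis using nx by (auto simp: nu Lseq_def)
  next
    case False
    then have "mu \<in> Lseq (Suc k) (m + 1)" using nx by (auto simp: nu Lseq_def sorted_wrt_append)
    then show ?thesis by blast
  qed
next
  fix mu assume "mu \<in> Lseq (Suc k) (m + 1) \<union> (\<lambda>nu. nu @ [m]) ` Lseq k (m + 1)"
  then show "mu \<in> Lseq (Suc k) m" using m by (force simp: Lseq_def sorted_wrt_append)
qed

lemma Lseq_sum:
  assumes m: "m < n"
  shows "(\<Sum>mu\<in>Lseq (Suc k) m. f mu) = (\<Sum>mu\<in>Lseq (Suc k) (m + 1). f mu) + (\<Sum>nu\<in>Lseq k (m + 1). f (nu @ [m]) :: complex)"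
proof -
  have "Lseq (Suc k) (m + 1) \<inter> (\<lambda>nu. nu @ [m]) ` Lseq k (m + 1) = {}" by (auto simp: Lseq_def)
  then have "(\<Sum>mu\<in>Lseq (Suc k) m. f mu) = (\<Sum>mu\<in>Lseq (Suc k) (m + 1). f mu) + (\<Sum>mu\<in>(\<lambda>nu. nu @ [m]) ` Lseq k (m + 1). f mu)"
    unfolding Lseq_Suc[OF m] by (intro sum.union_disjoint finite_imageI Lseq_finite)
  also have "(\<Sum>mu\<in>(\<lambda>nu. nu @ [m]) ` Lseq k (m + 1). f mu) = (\<Sum>nu\<in>Lseq k (m + 1). f (nu @ [m]))"
    by (subst sum.reindex) (auto simp: inj_on_def)
  finally show ?thesis .
qed

lemma Lseq_empty: "n < m + k \<Longrightarrow> m \<le> n \<Longrightarrow> Lseq k m = {}"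
proof (rule ccontr)
  assume a: "n < m + k" "m \<le> n" "Lseq k m \<noteq> {}"
  then obtain mu where mu: "sorted_wrt (>) mu" "set mu \<subseteq> {m..<n}" "length mu = k" by (auto simp: Lseq_def)
  have "distinct mu" using mu(1) by (induction mu) auto
  then have "k = card (set mu)" using mu(3) by (simp add: distinct_card)
  also have "\<dots> \<le> card {m..<n}" by (rule card_mono) (use mu in auto)
  finally show False using a by simp
qed

text \<open>Both sides satisfy one recursion, descending in m: \<open>sval_rec\<close> separates the
  sequences whose last entry is m, and the ratio in block m + k - 1 is the factor which that entry
  contributes.\<close>

lemma sval_lists:
  assumes b: "\<And>j. good (b j)"
  shows "2 \<le> m \<Longrightarrow> m \<le> n \<Longrightarrow> m + k \<le> n + 1 \<Longrightarrow> sval b e (m + k - 2) (n - m + 1) = (\<Sum>mu\<in>Lseq k m. lterm b e mu)"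
proof (induction "n - m" arbitrary: m k)
  case 0
  then have m: "m = n" by simp
  show ?case
  proof (cases k)
    case 0
    have "sval b e (n - 2) (n - 1 - (n - 2)) = 1" by (rule sval_first[where b = b, OF b]) (use n4 in simp)
    moreover have "n - 1 - (n - 2) = 1" using n4 by simp
    ultimately show ?thesis using m 0 by (simp add: Lseq_0 lterm_def)
  next
    case (Suc k')
    then have k: "k = 1" using \<open>m + k \<le> n + 1\<close> m by simp
    have e: "n + 1 - 2 = n - 1" by simp
    have "Lseq 1 n = {}" by (rule Lseq_empty) auto
    moreover have "sval b e (n - 1) 1 = 0" using sval_last[of 1 b e] n4 by simp
    ultimately show ?thesis unfolding m k e by simp
  qed
next
  case (Suc d)
  then have m: "d = n - (m + 1)" "m < n" "2 \<le> m + 1" "m + 1 \<le> n" by auto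
  note ih = Suc.hyps(1)[OF m(1,3,4)]
  consider "k = 0" | "k \<noteq> 0" "m + k = n + 1" | k' where "k = Suc k'" "m + k \<le> n" using Suc.prems by (cases k) force+
  then show ?case
  proof cases
    case 1
    have "sval b e (m - 2) (n - 1 - (m - 2)) = 1" by (rule sval_first[where b = b, OF b]) (use m in simp)
    moreover have e: "n - 1 - (m - 2) = n - m + 1" using Suc.prems m by simp
    ultimately have "sval b e (m - 2) (n - m + 1) = 1" unfolding e by simp
    then show ?thesis using 1 by (simp add: Lseq_0 lterm_def)
  next
    case 2
    have e: "n + 1 - 2 = n - 1" by simp
    have "Lseq k m = {}" by (rule Lseq_empty) (use 2 m in auto)
    moreover have "sval b e (n - 1) (n - m + 1) = 0" using sval_last[of "n - m + 1" b e] m Suc.prems by auto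
    ultimately show ?thesis unfolding 2(2) e by simp
  next
    case 3
    have j: "m + k - 2 + 2 \<le> n" "n - 1 - (m + k - 2) \<le> n - m" "n - m + 1 \<le> n - 1" "m + k - 2 + 1 = m + k'"
      "m + k - 2 = m + 1 + k' - 2" "m + k' = m + 1 + k - 2" "n - m = n - (m + 1) + 1"
      "n - m \<noteq> n" "n - m \<noteq> n - 1" "n - m - 1 \<noteq> n" "n - m - 1 \<noteq> n - 1" "m + 1 + k' \<le> n + 1" "m + 1 + k \<le> n + 1"
      using 3 Suc.prems m by auto
    have Y: "Ysw b e (m + k') (n - m) = b (m + k') (n - m)" "Ysw b e (m + k') (n - m - 1) = b (m + k') (n - m - 1)"
      using j(8-11) by (simp_all add: Ysw_def)
    have a: "sval b e (m + k - 2) (n - m) = (\<Sum>mu\<in>Lseq k' (m + 1). lterm b e mu)"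
      using ih[OF j(12)] unfolding j(5) j(7)[symmetric] .
    have c: "sval b e (m + k') (n - m) = (\<Sum>mu\<in>Lseq k (m + 1). lterm b e mu)"
      using ih[OF j(13)] unfolding j(6)[symmetric] j(7)[symmetric] .
    have "sval b e (m + k - 2) (n - m + 1) =
      b (m + k') (n - m - 1) / b (m + k') (n - m) * sval b e (m + k - 2) (n - m) + sval b e (m + k') (n - m)"
      using sval_rec[where b = b and e = e, OF b j(1-3)] unfolding j(4) .
    also have "\<dots> = (\<Sum>mu\<in>Lseq k (m + 1). lterm b e mu) + (\<Sum>nu\<in>Lseq k' (m + 1). lterm b e (nu @ [m]))"
    proof -
      have "(\<Sum>nu\<in>Lseq k' (m + 1). lterm b e (nu @ [m])) =
        (\<Sum>nu\<in>Lseq k' (m + 1). lterm b e nu * (Ysw b e (m + k') (n - m - 1) / Ysw b e (m + k') (n - m)))"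
        by (rule sum.cong) (auto simp: lterm_snoc Lseq_def)
      then show ?thesis unfolding a c Y sum_distrib_right[symmetric] by (simp only: mult.commute add.commute)
    qed
    finally show ?thesis unfolding 3(1) Lseq_sum[OF m(2)] by simp
  qed
qed

text \<open>The value k is the block in which the extra sign of the state q = n settles. The two
  terms of \<open>sval_rec_n\<close> are the sequences of that length with last entry 1 and those
  with last entry at least 2; only the latter carry the extra factor, which is the case distinction
  for \<open>eps_mu\<close>.\<close>

lemma sval_total:
  assumes b: "\<And>j. good (b j)"
  shows "j \<le> n - 1 \<Longrightarrow> sval b e j n = (\<Sum>k\<in>{j + 1..n - 1}. \<Sum>mu\<in>Lseq k 1. sterm b e mu)"
proof (induction "n - 1 - j" arbitrary: j)
  case 0
  then have "j = n - 1" by simp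
  then show ?case using sval_last_n by simp
next
  case (Suc d)
  have j: "j + 2 \<le> n" "d = n - 1 - (j + 1)" "j + 1 \<le> n - 1" "1 < n" "j + 1 \<le> n - 1"
    "j = 2 + j - 2" "j + 1 = 2 + (j + 1) - 2" "n - 1 = n - 2 + 1" "1 + j = j + 1" "n - 2 = n - 1 - 1" "(1::nat) + 1 = 2" "Suc j = j + 1"
    using Suc.hyps(2) n4 by simp_all
  have ins: "{j + 1..n - 1} = insert (j + 1) {j + 1 + 1..n - 1}" using j(3) by auto
  have h: "(2::nat) \<le> 2" "2 \<le> n" "2 + j \<le> n + 1" "2 + (j + 1) \<le> n + 1" using j(1,3) n4 by simp_all
  have a: "sval b e j (n - 1) = (\<Sum>mu\<in>Lseq j 2. lterm b e mu)"
    using sval_lists[where b = b and e = e, OF b h(1-3)] unfolding j(6)[symmetric] j(8)[symmetric] .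
  have c: "sval b e (j + 1) (n - 1) = (\<Sum>mu\<in>Lseq (j + 1) 2. lterm b e mu)"
    using sval_lists[where b = b and e = e, OF b h(1,2,4)] unfolding j(7)[symmetric] j(8)[symmetric] .
  have 1: "(\<Sum>mu\<in>Lseq (Suc j) 1. sterm b e mu) = (\<Sum>mu\<in>Lseq (Suc j) (1 + 1). sterm b e mu) + (\<Sum>nu\<in>Lseq j (1 + 1). sterm b e (nu @ [1]))"
    by (rule Lseq_sum[OF j(4)])
  have 2: "sterm b e mu = Ysw b e (j + 1) n * lterm b e mu" if "mu \<in> Lseq (j + 1) 2" for mu
  proof -
    have "mu \<noteq> []" "set mu \<subseteq> {2..<n}" "length mu = j + 1" using that by (auto simp: Lseq_def)
    then have "last mu \<in> {2..<n}" using last_in_set by blast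
    then have "last mu \<noteq> 1" by simp
    then show ?thesis using \<open>length mu = j + 1\<close> by (simp add: sterm_def)
  qed
  have 3: "sterm b e (nu @ [1]) = Ysw b e (j + 1) (n - 2) / Ysw b e (j + 1) (n - 1) * lterm b e nu" if "nu \<in> Lseq j 2" for nu
  proof -
    have "length nu = j" using that by (simp add: Lseq_def)
    then show ?thesis unfolding sterm_def lterm_snoc by (simp add: numeral_2_eq_2)
  qed
  have 2: "(\<Sum>mu\<in>Lseq (j + 1) 2. sterm b e mu) = (\<Sum>mu\<in>Lseq (j + 1) 2. Ysw b e (j + 1) n * lterm b e mu)"
    by (rule sum.cong[OF refl 2])
  have 3: "(\<Sum>nu\<in>Lseq j 2. sterm b e (nu @ [1])) =
    (\<Sum>nu\<in>Lseq j 2. Ysw b e (j + 1) (n - 2) / Ysw b e (j + 1) (n - 1) * lterm b e nu)"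
    by (rule sum.cong[OF refl 3])
  have "(\<Sum>mu\<in>Lseq (j + 1) 1. sterm b e mu) = (\<Sum>mu\<in>Lseq (j + 1) 2. Ysw b e (j + 1) n * lterm b e mu)
     + (\<Sum>nu\<in>Lseq j 2. Ysw b e (j + 1) (n - 2) / Ysw b e (j + 1) (n - 1) * lterm b e nu)"
    using 1 unfolding j(11,12) 2 3 .
  then have "sval b e j n = (\<Sum>mu\<in>Lseq (j + 1) 1. sterm b e mu) + sval b e (j + 1) n"
    using sval_rec_n[where b = b and e = e, OF b j(1)] unfolding a c by (simp add: sum_distrib_left)
  also have "sval b e (j + 1) n = (\<Sum>k\<in>{j + 1 + 1..n - 1}. \<Sum>mu\<in>Lseq k 1. sterm b e mu)"
    by (rule Suc.hyps(1)[OF j(2,3)])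
  finally show ?case unfolding ins by simp
qed

lemma M_seqs_Lseq: "M_seqs n = (\<Union>k\<in>{1..n - 1}. Lseq k 1)"
proof (intro Set.set_eqI iffI)
  fix mu assume "mu \<in> M_seqs n"
  then have mu: "mu \<noteq> []" "sorted_wrt (>) mu" "set mu \<subseteq> {1..<n}" by (auto simp: M_seqs_def)
  then have l: "mu \<in> Lseq (length mu) 1" by (simp add: Lseq_def)
  then have "\<not> n < 1 + length mu" using Lseq_empty[of 1 "length mu"] n4 by auto
  moreover have "1 \<le> length mu" using mu(1) by (cases mu) auto
  ultimately show "mu \<in> (\<Union>k\<in>{1..n - 1}. Lseq k 1)" using l by (intro UN_I[of "length mu"]) auto
next
  fix mu assume "mu \<in> (\<Union>k\<in>{1..n - 1}. Lseq k 1)"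
  then show "mu \<in> M_seqs n" by (auto simp: M_seqs_def Lseq_def)
qed

lemma finite_M_seqs: "finite (M_seqs n)"
  unfolding M_seqs_Lseq using Lseq_finite by blast

lemma spin_total:
  assumes b: "\<And>j. good (b j)"
  shows "sval b e 0 n = (\<Sum>mu\<in>M_seqs n. sterm b e mu)"
proof -
  have "(\<Sum>mu\<in>M_seqs n. sterm b e mu) = (\<Sum>k\<in>{1..n - 1}. \<Sum>mu\<in>Lseq k 1. sterm b e mu)"
    unfolding M_seqs_Lseq by (rule sum.UNION_disjoint) (auto simp: Lseq_finite, auto simp: Lseq_def)
  then show ?thesis using sval_total[where b = b and e = e and j = 0, OF b] by simp
qed

section \<open>The positive chart and the action in coordinates\<close>

abbreviation "N \<equiv> len n"

abbreviation nz :: "(nat \<Rightarrow> complex) \<Rightarrow> bool" where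
  "nz c \<equiv> \<forall>k\<in>{1..N}. c k \<noteq> 0"

lemma letter_in: "letter n k \<in> I"
  using n4 by (auto simp: letter_def Suc_le_eq)

text \<open>\<open>e_i\<close> and \<open>f_j\<close> commute for i \<noteq> j. For neighbouring
  nodes both composites vanish, since all coordinates lie in {-1, 0, 1}.\<close>

lemma xy_commute:
  assumes "i \<in> I" "j \<in> I" "i \<noteq> j"
  shows "xs 1 i a \<circ> xs (-1) j b = xs (-1) j b \<circ> xs 1 i a"
proof (cases "cartan n i j = 0")
  case True
  then show ?thesis by (intro xs_xs_commute assms) auto
next
  case False
  then have c: "cartan n i j = -1" "cartan n j i = -1" using cartan_off[OF assms(3), of n] cartan_sym[of n i j] by auto
  show ?thesis
  proof (intro ext)
    fix v :: vec and \<mu>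
    show "(xs 1 i a \<circ> xs (-1) j b) v \<mu> = (xs (-1) j b \<circ> xs 1 i a) v \<mu>"
    proof (cases "\<mu> \<in> mw")
      case True
      have r: "reflect n i \<mu> \<in> mw" "reflect n j \<mu> \<in> mw" using refl_mw[OF True] assms by auto
      have v: "\<mu> i = 1 \<Longrightarrow> reflect n i \<mu> j \<noteq> -1" "\<mu> j = -1 \<Longrightarrow> reflect n j \<mu> i \<noteq> 1"
        using mw_values[OF True, of i] mw_values[OF True, of j] c by (auto simp: reflect_def)
      show ?thesis
        using True r v by (simp add: xs_def)
    next
      case False
      then show ?thesis by (simp add: outside_mw)
    qed
  qed
qed

lemma ybold_xs: "j \<in> I \<Longrightarrow> ybold n j c = xs (-1) j c \<circ> coroot n j (inverse c)"
  by (simp add: ybold_def yg_xs)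

lemma Tor_xs_left:
  assumes t: "t \<in> Tor n" and i: "i \<in> I"
  shows "xs 1 i a \<circ> t = t \<circ> xs 1 i (a / root_char n i t)"
  using Tor_xs[OF t i, of 1 "a / root_char n i t"] root_char_nonzero[OF t i] by simp

lemma pass_other:
  assumes "i \<in> I" "j \<in> I" "i \<noteq> j" "c \<noteq> 0"
  shows "xs 1 i p \<circ> ybold n j c = ybold n j c \<circ> xs 1 i (p * c powi cartan n j i)"
proof -
  have t: "coroot n j (inverse c) \<in> Tor n" using Tor_ops(5) assms by auto
  have r: "p / root_char n i (coroot n j (inverse c)) = p * c powi cartan n j i"
    using assms by (simp add: root_char_coroot power_int_inverse divide_inverse)
  have "xs 1 i p \<circ> ybold n j c = xs (-1) j c \<circ> (xs 1 i p \<circ> coroot n j (inverse c))"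
    unfolding ybold_xs[OF assms(2)] using xy_commute[OF assms(1-3)] by (simp only: comp_assoc[symmetric])
  also have "\<dots> = ybold n j c \<circ> xs 1 i (p * c powi cartan n j i)"
    unfolding Tor_xs_left[OF t assms(1)] r ybold_xs[OF assms(2)] by (simp only: comp_assoc)
  finally show ?thesis .
qed

text \<open>In the Bruhat form \<open>x_i(1/c) s_i x_i(c)\<close> the incoming parameter adds to
  1/c, which defines the new c; what is missing in the right-hand factor is passed on.\<close>

lemma pass_same:
  assumes i: "i \<in> I" "c \<noteq> 0" "1 + p * c \<noteq> 0"
  shows "xs 1 i p \<circ> ybold n i c = ybold n i (c / (1 + p * c)) \<circ> xs 1 i (p * c powi cartan n i i / (1 + p * c))"
proof -
  define c' where "c' = c / (1 + p * c)"
  have c': "c' \<noteq> 0" using i by (simp add: c'_def)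
  have inv: "p + inverse c = inverse c'" using i by (simp add: c'_def field_simps)
  have dif: "c = c' + p * c powi cartan n i i / (1 + p * c)"
  proof -
    have "c' + p * c powi cartan n i i / (1 + p * c) = c * (1 + p * c) / (1 + p * c)"
      using cartan_diag[OF i(1)] by (simp add: c'_def power2_eq_square add_divide_distrib[symmetric] algebra_simps)
    then show ?thesis using i(3) by simp
  qed
  have "xs 1 i p \<circ> ybold n i c = (xs 1 i p \<circ> xs 1 i (inverse c)) \<circ> sb i \<circ> xs 1 i c"
    unfolding ybold_Bruhat[OF i(1,2)] by (simp only: comp_assoc)
  also have "xs 1 i p \<circ> xs 1 i (inverse c) = xs 1 i (inverse c')" using xs_add[OF i(1), of 1 p "inverse c"] inv by simp
  also have "xs 1 i c = xs 1 i c' \<circ> xs 1 i (p * c powi cartan n i i / (1 + p * c))"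
    using xs_add[OF i(1), of 1 c' "p * c powi cartan n i i / (1 + p * c)"] dif by simp
  finally show ?thesis unfolding ybold_Bruhat[OF i(1) c'] c'_def[symmetric] by (simp only: comp_assoc)
qed

section \<open>Torus and unipotent parts of the chart, and the action on coordinates\<close>

definition Qw :: "nat \<Rightarrow> (nat \<Rightarrow> complex) \<Rightarrow> elt" where
  "Qw k c = foldr (\<circ>) (map (\<lambda>m. ybold n (letter n m) (c m)) [k..<N + 1]) id"

lemma Theta_Qw: "Theta n c = Qw 1 c"
  by (simp add: Theta_def word_prod_def Qw_def)

lemma Qw_end: "Qw (N + 1) c = id"
  by (simp add: Qw_def)

lemma Qw_step: "k \<le> N \<Longrightarrow> Qw k c = ybold n (letter n k) (c k) \<circ> Qw (k + 1) c"
proof -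
  assume "k \<le> N"
  then have "[k..<N + 1] = k # [k + 1..<N + 1]" using upt_conv_Cons[of k "N + 1"] by simp
  then show ?thesis by (simp only: Qw_def list.map foldr.simps comp_def)
qed

definition wprod :: "(nat \<Rightarrow> complex) \<Rightarrow> nat \<Rightarrow> nat \<Rightarrow> complex" where
  "wprod c i k = (\<Prod>m\<in>{k..N}. c m powi (- cartan n i (letter n m)))"

text \<open>The Laurent monomial with exponent -\<sigma>_m. These are the summands of the negative
  simple character of \<Theta>(c), so \<epsilon>_i, the reciprocal of their sum, tropicalizes to the
  maximum of the \<sigma>_m.\<close>

definition Tm :: "(nat \<Rightarrow> complex) \<Rightarrow> nat \<Rightarrow> complex" where
  "Tm c m = wprod c (letter n m) (m + 1) / c m"

abbreviation occ :: "nat \<Rightarrow> nat set" where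
  "occ i \<equiv> {m \<in> {1..N}. letter n m = i}"

lemma wprod_step: "k \<le> N \<Longrightarrow> wprod c i k = c k powi (- cartan n i (letter n k)) * wprod c i (k + 1)"
  unfolding wprod_def using prod.atLeast_Suc_atMost[of k N] by simp

lemma Qw_parts:
  assumes c: "nz c"
  shows "1 \<le> k \<Longrightarrow> k \<le> N + 1 \<Longrightarrow> \<exists>t\<in>Tor n. \<exists>u\<in>Ug (-1). Qw k c = t \<circ> u \<and>
    (\<forall>i\<in>I. root_char n i t = wprod c i k \<and> chiv (-1) i u = (\<Sum>m\<in>occ i \<inter> {k..N}. Tm c m))"
proof (induction "N + 1 - k" arbitrary: k)
  case 0
  then have k: "k = N + 1" by simp
  have "id = id \<circ> (id :: elt) \<and> (\<forall>i\<in>I. root_char n i id = wprod c i (N + 1) \<and> chiv (-1) i id = (\<Sum>m\<in>occ i \<inter> {N + 1..N}. Tm c m))"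
    using root_char_id chiv_id[of "-1"] by (simp add: wprod_def del: id_apply)
  moreover have "id \<in> Ug (-1)" using Ug_ops(1)[of "-1"] by simp
  ultimately show ?case unfolding k Qw_end using Tor_ops(1) by blast
next
  case (Suc d)
  define j where "j = letter n k"
  have k: "1 \<le> k + 1" "k + 1 \<le> N + 1" "k \<le> N" "d = N + 1 - (k + 1)" "k \<in> {1..N}" using Suc by auto
  have j: "j \<in> I" "c k \<noteq> 0" using letter_in c k by (auto simp: j_def)
  obtain t u where tu: "t \<in> Tor n" "u \<in> Ug (-1)" "Qw (k + 1) c = t \<circ> u"
    "\<And>i. i \<in> I \<Longrightarrow> root_char n i t = wprod c i (k + 1)"
    "\<And>i. i \<in> I \<Longrightarrow> chiv (-1) i u = (\<Sum>m\<in>occ i \<inter> {k + 1..N}. Tm c m)"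
    using Suc.hyps(1)[OF k(4,1,2)] by blast
  define t' where "t' = coroot n j (inverse (c k)) \<circ> t"
  have co: "coroot n j (inverse (c k)) \<in> Tor n" using Tor_ops(5) j by auto
  have t': "t' \<in> Tor n" unfolding t'_def by (rule Tor_ops(2)[OF co tu(1)])
  have rc: "root_char n i t' = wprod c i k" if "i \<in> I" for i
    unfolding t'_def wprod_step[OF k(3)] using root_char_comp[OF co tu(1) that] tu(4)[OF that] that j
    by (simp add: root_char_coroot power_int_inverse power_int_minus j_def cartan_sym)
  have rj: "root_char n j t' \<noteq> 0" by (rule root_char_nonzero[OF t' j(1)])
  have tmk: "root_char n j t' * c k = Tm c k"
    unfolding rc[OF j(1)] wprod_step[OF k(3)] Tm_def j_def[symmetric] using cartan_diag[OF j(1)] j(2)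
    by (simp add: power_int_minus field_simps power2_eq_square)
  have m: "xs (-1) j (c k) \<circ> t' = t' \<circ> xs (-1) j (Tm c k)"
  proof -
    have "root_char n j t' powi (-1) * Tm c k = c k" unfolding tmk[symmetric] using rj by (simp add: power_int_minus)
    then show ?thesis using Tor_xs[OF t' j(1), of "-1" "Tm c k"] by simp
  qed
  define u' where "u' = xs (-1) j (Tm c k) \<circ> u"
  have gx: "xs (-1) j (Tm c k) \<in> Ug (-1)" using Ug_ops(5)[of "-1" j] j(1) by simp
  have u': "u' \<in> Ug (-1)" unfolding u'_def using Ug_ops(2)[of "-1"] gx tu(2) by simp
  have "Qw k c = (xs (-1) j (c k) \<circ> t') \<circ> u"
    unfolding Qw_step[OF k(3)] tu(3) ybold_xs[OF j(1)] t'_def j_def[symmetric] by (simp only: comp_assoc)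
  then have 1: "Qw k c = t' \<circ> u'" unfolding m u'_def by (simp only: comp_assoc)
  have 2: "chiv (-1) i u' = (\<Sum>m\<in>occ i \<inter> {k..N}. Tm c m)" if i: "i \<in> I" for i
  proof -
    have a: "chiv (-1) i u' = chiv (-1) i (xs (-1) j (Tm c k)) + chiv (-1) i u"
      unfolding u'_def using chiv_comp[of "-1"] i gx tu(2) by simp
    have b: "chiv (-1) i (xs (-1) j (Tm c k)) = (if i = j then Tm c k else 0)"
      using chiv_gen[of "-1" i j] i j(1) by simp
    have o: "occ i \<inter> {k..N} = (if i = j then insert k (occ i \<inter> {k + 1..N}) else occ i \<inter> {k + 1..N})"
    proof (intro Set.set_eqI iffI)
      fix m assume "m \<in> occ i \<inter> {k..N}"
      then show "m \<in> (if i = j then insert k (occ i \<inter> {k + 1..N}) else occ i \<inter> {k + 1..N})"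
        by (cases "m = k") (auto simp: j_def)
    next
      fix m assume "m \<in> (if i = j then insert k (occ i \<inter> {k + 1..N}) else occ i \<inter> {k + 1..N})"
      then show "m \<in> occ i \<inter> {k..N}" using k by (auto simp: j_def split: if_splits)
    qed
    have "k \<notin> occ i \<inter> {k + 1..N}" by simp
    moreover have "finite (occ i \<inter> {k + 1..N})" by (rule finite_subset[of _ "{1..N}"]) auto
    ultimately show ?thesis unfolding a b o tu(5)[OF i] by simp
  qed
  show ?case using t' u' 1 rc 2 by blast
qed

lemma Theta_parts:
  assumes c: "nz c"
  shows "\<exists>t\<in>Tor n. \<exists>u\<in>Ug (-1). Theta n c = t \<circ> u \<and>
    (\<forall>i\<in>I. root_char n i t = wprod c i 1 \<and> chiv (-1) i u = (\<Sum>m\<in>occ i. Tm c m))"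
proof -
  have o: "occ i \<inter> {1..N} = occ i" for i by auto
  show ?thesis using Qw_parts[OF c, of 1] unfolding o Theta_Qw by simp
qed

lemma chart: "in_chart n t c \<longleftrightarrow> t \<in> Tor n \<and> nz c"
proof
  assume "t \<in> Tor n \<and> nz c"
  then have t: "t \<in> Tor n" and c: "nz c" by auto
  have "Theta n c \<in> Bneg n"
  proof -
    obtain s u where "s \<in> Tor n" "u \<in> Ug (-1)" "Theta n c = s \<circ> u" using Theta_parts[OF c] by blast
    then show ?thesis unfolding Bneg_def Uneg_Ug by blast
  qed
  moreover have "Theta n c \<in> cell w0" by (rule Theta_cell) (use c in auto)
  ultimately have "Theta n c \<in> Bw0 n" by (auto simp: Bw0_def cell_def Upos_Ug)
  then show "in_chart n t c" using t c by (auto simp: in_chart_def TBw0_def)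
qed (auto simp: in_chart_def)

lemma gamma_eps_chart:
  assumes t: "t \<in> Tor n" and c: "nz c" and i: "i \<in> I"
  shows "gc_gamma n i (t \<circ> Theta n c) = root_char n i t * wprod c i 1"
    "chi_neg n i (neg_part n (t \<circ> Theta n c)) = (\<Sum>m\<in>occ i. Tm c m)"
    "gc_eps n i (t \<circ> Theta n c) = 1 / (\<Sum>m\<in>occ i. Tm c m)"
proof -
  obtain s u where su: "s \<in> Tor n" "u \<in> Ug (-1)" "Theta n c = s \<circ> u"
    "\<And>i. i \<in> I \<Longrightarrow> root_char n i s = wprod c i 1" "\<And>i. i \<in> I \<Longrightarrow> chiv (-1) i u = (\<Sum>m\<in>occ i. Tm c m)"
    using Theta_parts[OF c] by blast
  have ts: "t \<circ> s \<in> Tor n" by (rule Tor_ops(2)[OF t su(1)])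
  have e: "t \<circ> Theta n c = (t \<circ> s) \<circ> u" unfolding su(3) by (simp only: comp_assoc)
  show "gc_gamma n i (t \<circ> Theta n c) = root_char n i t * wprod c i 1"
    unfolding gc_gamma_def e parts[OF ts su(2)] root_char_comp[OF t su(1) i] su(4)[OF i] ..
  show 1: "chi_neg n i (neg_part n (t \<circ> Theta n c)) = (\<Sum>m\<in>occ i. Tm c m)"
    unfolding e parts[OF ts su(2)] chi_neg_chiv[OF i su(2)] su(5)[OF i] ..
  then show "gc_eps n i (t \<circ> Theta n c) = 1 / (\<Sum>m\<in>occ i. Tm c m)"
    unfolding gc_eps_def by simp
qed

text \<open>The factor by which \<open>e\<^sub>i\<^sup>d\<close> changes \<open>c\<^sub>k\<close> is \<open>Sd c d i k / Sd c d i (k + 1)\<close>.\<close>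

definition Sd :: "(nat \<Rightarrow> complex) \<Rightarrow> complex \<Rightarrow> nat \<Rightarrow> nat \<Rightarrow> complex" where
  "Sd c d i k = (\<Sum>m\<in>occ i. if m < k then d * Tm c m else Tm c m)"

definition cact :: "(nat \<Rightarrow> complex) \<Rightarrow> complex \<Rightarrow> nat \<Rightarrow> nat \<Rightarrow> complex" where
  "cact c d i k = (if letter n k = i then c k * (Sd c d i k / Sd c d i (k + 1)) else c k)"

lemma Sd_step: "k \<in> {1..N} \<Longrightarrow> Sd c d i (k + 1) = (if letter n k = i then Sd c d i k + (d - 1) * Tm c k else Sd c d i k)"
proof -
  assume k: "k \<in> {1..N}"
  have f: "finite (occ i)" by simp
  show ?thesis
  proof (cases "letter n k = i")
    case True
    then have o: "occ i = insert k (occ i - {k})" "k \<notin> occ i - {k}" using k by auto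
    have "Sd c d i (k + 1) = d * Tm c k + (\<Sum>m\<in>occ i - {k}. if m < k + 1 then d * Tm c m else Tm c m)"
      unfolding Sd_def by (subst o(1), subst sum.insert) (use f in auto)
    also have "(\<Sum>m\<in>occ i - {k}. if m < k + 1 then d * Tm c m else Tm c m) = (\<Sum>m\<in>occ i - {k}. if m < k then d * Tm c m else Tm c m)"
      by (rule sum.cong) auto
    moreover have "Sd c d i k = Tm c k + (\<Sum>m\<in>occ i - {k}. if m < k then d * Tm c m else Tm c m)"
      unfolding Sd_def by (subst o(1), subst sum.insert) (use f in auto)
    ultimately show ?thesis using True by (simp add: algebra_simps)
  next
    case False
    then have "Sd c d i (k + 1) = Sd c d i k" unfolding Sd_def by (intro sum.cong) (auto simp: less_Suc_eq)
    then show ?thesis using False by simp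
  qed
qed

text \<open>The invariant is the parameter of the travelling \<open>x_i\<close> to the left of
  letter k. Passing another letter rescales it like \<open>wprod\<close>; passing a letter i divides
  it and the coordinate by 1 + p c_k, which equals the quotient of consecutive
  \<open>Sd\<close>.\<close>

lemma act_pass:
  assumes i: "i \<in> I" and c: "nz c" and s: "\<And>k. 1 \<le> k \<Longrightarrow> k \<le> N + 1 \<Longrightarrow> Sd c d i k \<noteq> 0"
  shows "1 \<le> k \<Longrightarrow> k \<le> N + 1 \<Longrightarrow>
    xs 1 i ((d - 1) * wprod c i k / Sd c d i k) \<circ> Qw k c = Qw k (cact c d i) \<circ> xs 1 i ((d - 1) / Sd c d i (N + 1))"
proof (induction "N + 1 - k" arbitrary: k)
  case 0
  then have k: "k = N + 1" by simp
  show ?case unfolding k Qw_end by (simp add: wprod_def)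
next
  case (Suc r)
  define j where "j = letter n k"
  define p where "p = (d - 1) * wprod c i k / Sd c d i k"
  have k: "1 \<le> k + 1" "k + 1 \<le> N + 1" "k \<le> N" "r = N + 1 - (k + 1)" "k \<in> {1..N}" using Suc by auto
  have j: "j \<in> I" "c k \<noteq> 0" using letter_in c k by (auto simp: j_def)
  have nzs: "Sd c d i k \<noteq> 0" "Sd c d i (k + 1) \<noteq> 0" using s k by auto
  have ih: "xs 1 i ((d - 1) * wprod c i (k + 1) / Sd c d i (k + 1)) \<circ> Qw (k + 1) c =
    Qw (k + 1) (cact c d i) \<circ> xs 1 i ((d - 1) / Sd c d i (N + 1))" by (rule Suc.hyps(1)[OF k(4,1,2)])
  have "xs 1 i p \<circ> ybold n j (c k) = ybold n j (cact c d i k) \<circ> xs 1 i ((d - 1) * wprod c i (k + 1) / Sd c d i (k + 1))"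
  proof (cases "j = i")
    case True
    have ck: "c k powi cartan n i i * c k powi (- cartan n i i) = 1" using j(2) by (simp add: power_int_minus)
    have tk: "c k * wprod c i k = Tm c k"
      unfolding wprod_step[OF k(3)] Tm_def j_def[symmetric] True using cartan_diag[OF i] j(2)
      by (simp add: power_int_minus field_simps power2_eq_square)
    have S: "Sd c d i (k + 1) = Sd c d i k + (d - 1) * Tm c k"
      using Sd_step[OF k(5), of c d i] True unfolding j_def by simp
    have 1: "1 + p * c k = Sd c d i (k + 1) / Sd c d i k"
      unfolding p_def S tk[symmetric] using nzs(1) by (simp add: field_simps)
    have nn: "1 + p * c k \<noteq> 0" unfolding 1 using nzs by simp
    have 2: "c k / (1 + p * c k) = cact c d i k" unfolding 1 cact_def using True by (simp add: j_def)
    have 3: "p * c k powi cartan n i i / (1 + p * c k) = (d - 1) * wprod c i (k + 1) / Sd c d i (k + 1)"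
    proof -
      have "p * c k powi cartan n i i = (d - 1) * wprod c i (k + 1) / Sd c d i k"
        unfolding p_def wprod_step[OF k(3)] j_def[symmetric] True using ck by (simp add: field_simps)
      then show ?thesis unfolding 1 using nzs by simp
    qed
    show ?thesis using pass_same[OF i j(2) nn] unfolding 2 3 True .
  next
    case False
    have ck: "c k powi cartan n j i * c k powi (- cartan n i j) = 1" using j(2) by (simp add: power_int_minus cartan_sym)
    have S: "Sd c d i (k + 1) = Sd c d i k" using Sd_step[OF k(5), of c d i] False unfolding j_def by simp
    have "p * c k powi cartan n j i = (d - 1) * wprod c i (k + 1) / Sd c d i (k + 1)"
      unfolding p_def S wprod_step[OF k(3)] j_def[symmetric] using ck by (simp add: field_simps)
    moreover have "cact c d i k = c k" unfolding cact_def using False by (simp add: j_def)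
    ultimately show ?thesis using pass_other[OF i j(1) _ j(2), of p] False by simp
  qed
  then have "xs 1 i p \<circ> (ybold n j (c k) \<circ> Qw (k + 1) c) =
      ybold n j (cact c d i k) \<circ> (xs 1 i ((d - 1) * wprod c i (k + 1) / Sd c d i (k + 1)) \<circ> Qw (k + 1) c)"
    by (simp only: comp_assoc[symmetric])
  then show ?case
    unfolding ih Qw_step[OF k(3)] p_def[symmetric] j_def[symmetric] by (simp only: comp_assoc)
qed

text \<open>The values of \<open>Sd\<close> at the two ends are X and d X with X the negative
  character. Thus the incoming parameter is (d - 1) \<phi>_i after the torus has been passed, and
  the outgoing one cancels the right-hand factor of the action.\<close>

lemma act_chart:
  assumes i: "i \<in> I" and t: "t \<in> Tor n" and c: "nz c" and d: "d \<noteq> 0" and chi: "(\<Sum>m\<in>occ i. Tm c m) \<noteq> 0"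
    and s: "\<And>k. k \<in> occ i \<Longrightarrow> Sd c d i k \<noteq> 0 \<and> Sd c d i (k + 1) \<noteq> 0"
  shows "gc_act n i d (t \<circ> Theta n c) = t \<circ> Theta n (cact c d i)"
proof -
  define X where "X = (\<Sum>m\<in>occ i. Tm c m)"
  have S1: "Sd c d i 1 = X" unfolding Sd_def X_def by (rule sum.cong) auto
  have SN: "Sd c d i (N + 1) = d * X" unfolding Sd_def X_def sum_distrib_left by (rule sum.cong) auto
  have X: "X \<noteq> 0" using chi by (simp add: X_def)
  have s': "Sd c d i k \<noteq> 0" if "1 \<le> k" "k \<le> N + 1" for k
    using that
  proof (induction k rule: dec_induct)
    case base
    then show ?case using S1 X by simp
  next
    case (step k)
    then have k: "k \<in> {1..N}" by auto
    show ?case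
    proof (cases "letter n k = i")
      case True
      then have "k \<in> occ i" using k by simp
      then show ?thesis using s[of k] by simp
    next
      case False
      then show ?thesis using Sd_step[OF k, of c d i] step by simp
    qed
  qed
  have rc: "root_char n i t \<noteq> 0" by (rule root_char_nonzero[OF t i])
  have g: "gc_eps n i (t \<circ> Theta n c) = 1 / X" "gc_phi n i (t \<circ> Theta n c) = root_char n i t * wprod c i 1 / X"
    unfolding gc_phi_def gamma_eps_chart[OF t c i] X_def by simp_all
  have q: "xs 1 i ((d - 1) / (d * X)) \<circ> xs 1 i ((inverse d - 1) * (1 / X)) = id"
  proof -
    have "(d - 1) / (d * X) + (inverse d - 1) * (1 / X) = 0" using d X by (simp add: field_simps)
    then show ?thesis using xs_add[OF i, of 1] xs_zero by simp
  qed
  have p: "(d - 1) * (root_char n i t * wprod c i 1 / X) / root_char n i t = (d - 1) * wprod c i 1 / X" using rc by simp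
  have "gc_act n i d (t \<circ> Theta n c) = (xs 1 i ((d - 1) * (root_char n i t * wprod c i 1 / X)) \<circ> t) \<circ> Theta n c \<circ> xs 1 i ((inverse d - 1) * (1 / X))"
    unfolding gc_act_def g xg_xs by (simp only: comp_assoc)
  also have "\<dots> = t \<circ> (xs 1 i ((d - 1) * wprod c i 1 / X) \<circ> Theta n c) \<circ> xs 1 i ((inverse d - 1) * (1 / X))"
    unfolding Tor_xs_left[OF t i] p by (simp only: comp_assoc)
  also have "xs 1 i ((d - 1) * wprod c i 1 / X) \<circ> Theta n c = Theta n (cact c d i) \<circ> xs 1 i ((d - 1) / (d * X))"
    using act_pass[OF i c s', of 1] unfolding S1 SN Theta_Qw by simp
  also have "t \<circ> (Theta n (cact c d i) \<circ> xs 1 i ((d - 1) / (d * X))) \<circ> xs 1 i ((inverse d - 1) * (1 / X)) =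
     t \<circ> Theta n (cact c d i) \<circ> (xs 1 i ((d - 1) / (d * X)) \<circ> xs 1 i ((inverse d - 1) * (1 / X)))"
    by (simp only: comp_assoc)
  finally show ?thesis unfolding q comp_id .
qed

end

section \<open>Growth along curves and subtraction-free expressions\<close>

text \<open>A positive real that is comparable to s to the power k up to the constant A. In the
  applications A is the same for all s in (0, 1], so letting s tend to 0 determines k.\<close>

definition near :: "real \<Rightarrow> real \<Rightarrow> complex \<Rightarrow> int \<Rightarrow> bool" where
  "near A s z k \<longleftrightarrow> (\<exists>r. z = complex_of_real r \<and> s powr k / A \<le> r \<and> r \<le> A * s powr k)"

lemma near_pos:
  assumes "near A s z k" "A \<ge> 1" "s > 0"
  shows "\<exists>r > 0. z = complex_of_real r" "z \<noteq> 0"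
proof -
  obtain r where r: "z = complex_of_real r" "s powr k / A \<le> r" using assms(1) by (auto simp: near_def)
  have "s powr k / A > 0" using assms by simp
  then have "r > 0" using r(2) by linarith
  then show "\<exists>r > 0. z = complex_of_real r" "z \<noteq> 0" using r by auto
qed

lemma near_mono:
  assumes "near A s z k" "A \<le> B" "A \<ge> 1" "s > 0"
  shows "near B s z k"
proof -
  obtain r where r: "z = complex_of_real r" "s powr k / A \<le> r" "r \<le> A * s powr k" using assms(1) by (auto simp: near_def)
  have "s powr k / B \<le> s powr k / A" using assms by (intro divide_left_mono) auto
  moreover have "A * s powr k \<le> B * s powr k" using assms by (intro mult_right_mono) auto
  ultimately show ?thesis using r unfolding near_def by (intro exI[of _ r]) auto
qed

text \<open>Both summands are positive reals, so nothing cancels and the smaller exponent dominates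
  for s \<le> 1.\<close>

lemma near_add:
  assumes z: "near A s z k" "A \<ge> 1" and w: "near B s w l" "B \<ge> 1" and s: "0 < s" "s \<le> 1"
  shows "near (A + B) s (z + w) (min k l)"
proof -
  obtain r where r: "z = complex_of_real r" "s powr k / A \<le> r" "r \<le> A * s powr k" using z by (auto simp: near_def)
  obtain q where q: "w = complex_of_real q" "s powr l / B \<le> q" "q \<le> B * s powr l" using w by (auto simp: near_def)
  have pos: "0 \<le> r" "0 \<le> q"
    using near_pos(1)[OF z s(1)] near_pos(1)[OF w s(1)] r(1) q(1) by auto
  have k: "s powr k \<le> s powr min k l" "s powr l \<le> s powr min k l" using s by (auto intro!: powr_mono')
  have "A * s powr k \<le> A * s powr min k l" "B * s powr l \<le> B * s powr min k l" using k z w by (auto intro!: mult_left_mono)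
  then have up: "r + q \<le> (A + B) * s powr min k l" using r q by (simp add: distrib_right)
  have "s powr k / (A + B) \<le> s powr k / A" "s powr l / (A + B) \<le> s powr l / B"
    using z w by (auto intro!: divide_left_mono)
  then have "s powr min k l / (A + B) \<le> r + q" using r q pos by (auto simp: min_def)
  then show ?thesis using up r q unfolding near_def by (intro exI[of _ "r + q"]) auto
qed

lemma near_mult:
  assumes z: "near A s z k" "A \<ge> 1" and w: "near B s w l" "B \<ge> 1" and s: "0 < s"
  shows "near (A * B) s (z * w) (k + l)"
proof -
  obtain r where r: "z = complex_of_real r" "s powr k / A \<le> r" "r \<le> A * s powr k" using z by (auto simp: near_def)
  obtain q where q: "w = complex_of_real q" "s powr l / B \<le> q" "q \<le> B * s powr l" using w by (auto simp: near_def)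
  have pos: "0 \<le> s powr k / A" "0 \<le> s powr l / B" "0 \<le> r" "0 \<le> q"
    using near_pos(1)[OF z s(1)] near_pos(1)[OF w s(1)] r(1) q(1) z w by auto
  have "s powr k / A * (s powr l / B) \<le> r * q" by (rule mult_mono) (use pos r q in auto)
  moreover have "r * q \<le> A * s powr k * (B * s powr l)" by (rule mult_mono) (use pos r q z in auto)
  ultimately show ?thesis using r(1) q(1) unfolding near_def
    by (intro exI[of _ "r * q"]) (auto simp: powr_add mult_ac)
qed

lemma near_inverse:
  assumes z: "near A s z k" "A \<ge> 1" and s: "0 < s"
  shows "near A s (inverse z) (- k)"
proof -
  obtain r where r: "z = complex_of_real r" "s powr k / A \<le> r" "r \<le> A * s powr k" using z by (auto simp: near_def)
  have r0: "r > 0" using near_pos(1)[OF z s] r(1) by auto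
  have "inverse (A * s powr k) \<le> inverse r" by (rule le_imp_inverse_le) (use r r0 in auto)
  moreover have "inverse r \<le> inverse (s powr k / A)" by (rule le_imp_inverse_le) (use r z s in auto)
  ultimately show ?thesis using r(1) unfolding near_def
    by (intro exI[of _ "inverse r"]) (auto simp: powr_minus field_simps)
qed

lemma near_divide:
  assumes "near A s z k" "A \<ge> 1" "near B s w l" "B \<ge> 1" "0 < s"
  shows "near (A * B) s (z / w) (k - l)"
  using near_mult[OF assms(1,2) near_inverse[OF assms(3,4,5)] assms(4,5)] by (simp add: divide_inverse)

lemma near_unique:
  assumes "A \<ge> 1" "B \<ge> 1" "\<And>s. 0 < s \<Longrightarrow> s \<le> 1 \<Longrightarrow> near A s (z s) k" "\<And>s. 0 < s \<Longrightarrow> s \<le> 1 \<Longrightarrow> near B s (z s) l"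
  shows "k = l"
proof -
  have *: False if AB: "A \<ge> 1" "B \<ge> 1" and n: "\<And>s. 0 < s \<Longrightarrow> s \<le> 1 \<Longrightarrow> near A s (z s) k"
      "\<And>s. 0 < s \<Longrightarrow> s \<le> 1 \<Longrightarrow> near B s (z s) l" and kl: "k < l" for A B k l
  proof -
    \<comment> \<open>At this s a gap of at least one in the exponents outweighs both constants: the
      two bounds give s powr k \<le> s powr k / 2.\<close>
    define s where "s = 1 / (2 * (A * B))"
    have ab: "A * B \<ge> 1" using AB mult_mono[of 1 A 1 B] by simp
    then have s: "0 < s" "s \<le> 1" by (auto simp: s_def field_simps)
    obtain r where r: "z s = complex_of_real r" "s powr k / A \<le> r" using n(1)[OF s] by (auto simp: near_def)
    have "r \<le> B * s powr l" using n(2)[OF s] r(1) by (auto simp: near_def)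
    then have "s powr k / A \<le> B * s powr l" using r by linarith
    then have 1: "s powr k \<le> A * B * s powr l" using AB by (simp add: field_simps)
    have "s powr l \<le> s powr (k + 1)" using s kl by (intro powr_mono') auto
    also have "\<dots> = s * s powr k" using s by (simp add: powr_add)
    finally have "A * B * s powr l \<le> A * B * (s * s powr k)" using ab by (intro mult_left_mono) auto
    also have "\<dots> = s powr k / 2" using ab AB by (simp add: s_def)
    finally have "s powr k \<le> s powr k / 2" using 1 by linarith
    then show False using s by simp
  qed
  show ?thesis using *[of A B k l] *[of B A l k] assms by (meson linorder_neqE)
qed

text \<open>The constant depends on the expression but not on s or on the values. Definedness comes
  for free, because every denominator is a positive real.\<close>

lemma trop_bounds:
  assumes "pos_consts E" "B \<ge> 1"
  shows "\<exists>A\<ge>1. \<forall>s \<rho>. 0 < s \<and> s \<le> 1 \<and> (\<forall>v\<in>set_sfexpr E. near B s (\<rho> v) (\<tau> v)) \<longrightarrow>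
    sf_defined \<rho> E \<and> near A s (sf_eval \<rho> E) (sf_trop \<tau> E)"
  using assms(1)
proof (induction E)
  case (Var v)
  then show ?case using assms(2) by (intro exI[of _ B]) auto
next
  case (Const r)
  then have r: "r > 0" by simp
  define A where "A = 1 + r + 1 / r"
  have A: "A \<ge> 1" "r \<le> A" using r by (auto simp: A_def)
  have "r * A = 1 + (r + r * r)" using r by (simp add: A_def algebra_simps)
  then have "1 \<le> r * A" using r by simp
  then have "1 / A \<le> r" using A(1) by (simp add: divide_le_eq)
  note A = A this
  then show ?case using r A by (intro exI[of _ A]) (auto simp: near_def)
next
  case (Add p q)
  obtain A where A: "A \<ge> 1" "\<And>s \<rho>. 0 < s \<Longrightarrow> s \<le> 1 \<Longrightarrow> (\<forall>v\<in>set_sfexpr p. near B s (\<rho> v) (\<tau> v)) \<Longrightarrow>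
      sf_defined \<rho> p \<and> near A s (sf_eval \<rho> p) (sf_trop \<tau> p)" using Add by auto
  obtain C where C: "C \<ge> 1" "\<And>s \<rho>. 0 < s \<Longrightarrow> s \<le> 1 \<Longrightarrow> (\<forall>v\<in>set_sfexpr q. near B s (\<rho> v) (\<tau> v)) \<Longrightarrow>
      sf_defined \<rho> q \<and> near C s (sf_eval \<rho> q) (sf_trop \<tau> q)" using Add by auto
  show ?case
    by (intro exI[of _ "A + C"]) (use A C near_add in auto)
next
  case (Mul p q)
  obtain A where A: "A \<ge> 1" "\<And>s \<rho>. 0 < s \<Longrightarrow> s \<le> 1 \<Longrightarrow> (\<forall>v\<in>set_sfexpr p. near B s (\<rho> v) (\<tau> v)) \<Longrightarrow>
      sf_defined \<rho> p \<and> near A s (sf_eval \<rho> p) (sf_trop \<tau> p)" using Mul by auto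
  obtain C where C: "C \<ge> 1" "\<And>s \<rho>. 0 < s \<Longrightarrow> s \<le> 1 \<Longrightarrow> (\<forall>v\<in>set_sfexpr q. near B s (\<rho> v) (\<tau> v)) \<Longrightarrow>
      sf_defined \<rho> q \<and> near C s (sf_eval \<rho> q) (sf_trop \<tau> q)" using Mul by auto
  have "A * C \<ge> 1" using A(1) C(1) mult_mono[of 1 A 1 C] by simp
  then show ?case
    by (intro exI[of _ "A * C"]) (use A C near_mult in auto)
next
  case (Quot p q)
  obtain A where A: "A \<ge> 1" "\<And>s \<rho>. 0 < s \<Longrightarrow> s \<le> 1 \<Longrightarrow> (\<forall>v\<in>set_sfexpr p. near B s (\<rho> v) (\<tau> v)) \<Longrightarrow>
      sf_defined \<rho> p \<and> near A s (sf_eval \<rho> p) (sf_trop \<tau> p)" using Quot by auto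
  obtain C where C: "C \<ge> 1" "\<And>s \<rho>. 0 < s \<Longrightarrow> s \<le> 1 \<Longrightarrow> (\<forall>v\<in>set_sfexpr q. near B s (\<rho> v) (\<tau> v)) \<Longrightarrow>
      sf_defined \<rho> q \<and> near C s (sf_eval \<rho> q) (sf_trop \<tau> q)" using Quot by auto
  have "A * C \<ge> 1" using A(1) C(1) mult_mono[of 1 A 1 C] by simp
  moreover have "sf_defined \<rho> (Quot p q) \<and> near (A * C) s (sf_eval \<rho> (Quot p q)) (sf_trop \<tau> (Quot p q))"
    if s: "0 < s" "s \<le> 1" and v: "\<forall>v\<in>set_sfexpr (Quot p q). near B s (\<rho> v) (\<tau> v)" for s \<rho>
  proof -
    have p: "sf_defined \<rho> p" "near A s (sf_eval \<rho> p) (sf_trop \<tau> p)" using A(2)[OF s] v by auto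
    have q: "sf_defined \<rho> q" "near C s (sf_eval \<rho> q) (sf_trop \<tau> q)" using C(2)[OF s] v by auto
    show ?thesis using p q near_divide[OF p(2) A(1) q(2) C(1) s(1)] near_pos(2)[OF q(2) C(1) s(1)] by simp
  qed
  ultimately show ?case by blast
qed

text \<open>A rational function f together with its tropical form g, witnessed by one expression.
  This calculus allows both to be built in parallel without writing expressions down.\<close>

definition sfr :: "'v set \<Rightarrow> (('v \<Rightarrow> complex) \<Rightarrow> complex) \<Rightarrow> (('v \<Rightarrow> int) \<Rightarrow> int) \<Rightarrow> bool" where
  "sfr V f g \<longleftrightarrow> (\<exists>E. pos_consts E \<and> set_sfexpr E \<subseteq> V \<and> (\<forall>\<rho>. sf_eval \<rho> E = f \<rho>) \<and> (\<forall>\<tau>. sf_trop \<tau> E = g \<tau>))"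

lemma sfr_var: "v \<in> V \<Longrightarrow> sfr V (\<lambda>\<rho>. \<rho> v) (\<lambda>\<tau>. \<tau> v)"
  unfolding sfr_def by (rule exI[of _ "Var v"]) simp

lemma sfr_one: "sfr V (\<lambda>\<rho>. 1) (\<lambda>\<tau>. 0)"
  unfolding sfr_def by (rule exI[of _ "Const 1"]) simp

lemma sfr_add: "sfr V f g \<Longrightarrow> sfr V f' g' \<Longrightarrow> sfr V (\<lambda>\<rho>. f \<rho> + f' \<rho>) (\<lambda>\<tau>. min (g \<tau>) (g' \<tau>))"
  unfolding sfr_def by (elim exE, rename_tac p q, rule_tac x = "Add p q" in exI) simp

lemma sfr_mult: "sfr V f g \<Longrightarrow> sfr V f' g' \<Longrightarrow> sfr V (\<lambda>\<rho>. f \<rho> * f' \<rho>) (\<lambda>\<tau>. g \<tau> + g' \<tau>)"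
  unfolding sfr_def by (elim exE, rename_tac p q, rule_tac x = "Mul p q" in exI) simp

lemma sfr_divide: "sfr V f g \<Longrightarrow> sfr V f' g' \<Longrightarrow> sfr V (\<lambda>\<rho>. f \<rho> / f' \<rho>) (\<lambda>\<tau>. g \<tau> - g' \<tau>)"
  unfolding sfr_def by (elim exE, rename_tac p q, rule_tac x = "Quot p q" in exI) simp

lemma sfr_cong: "sfr V f g \<Longrightarrow> (\<And>\<rho>. f \<rho> = f' \<rho>) \<Longrightarrow> (\<And>\<tau>. g \<tau> = g' \<tau>) \<Longrightarrow> sfr V f' g'"
  unfolding sfr_def by metis

lemma sfr_power: "sfr V f g \<Longrightarrow> sfr V (\<lambda>\<rho>. f \<rho> ^ k) (\<lambda>\<tau>. int k * g \<tau>)"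
proof (induction k)
  case 0
  then show ?case using sfr_one by simp
next
  case (Suc k)
  show ?case by (rule sfr_cong[OF sfr_mult[OF Suc.prems Suc.IH[OF Suc.prems]]]) (auto simp: algebra_simps)
qed

lemma sfr_powi: "sfr V f g \<Longrightarrow> sfr V (\<lambda>\<rho>. f \<rho> powi k) (\<lambda>\<tau>. k * g \<tau>)"
proof (cases "k \<ge> 0")
  case True
  assume "sfr V f g"
  from sfr_power[OF this, of "nat k"] show ?thesis using True by (simp add: power_int_def)
next
  case False
  assume a: "sfr V f g"
  show ?thesis
    by (rule sfr_cong[OF sfr_divide[OF sfr_one sfr_power[OF a, of "nat (- k)"]]])
      (use False in \<open>auto simp: power_int_def divide_inverse power_inverse\<close>)
qed

lemma sfr_sum:
  assumes "finite A" "A \<noteq> {}" "\<And>a. a \<in> A \<Longrightarrow> sfr V (f a) (g a)"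
  shows "sfr V (\<lambda>\<rho>. \<Sum>a\<in>A. f a \<rho>) (\<lambda>\<tau>. Min ((\<lambda>a. g a \<tau>) ` A))"
  using assms
proof (induction A rule: finite_ne_induct)
  case (insert a A)
  then have "sfr V (\<lambda>\<rho>. f a \<rho> + (\<Sum>a\<in>A. f a \<rho>)) (\<lambda>\<tau>. min (g a \<tau>) (Min ((\<lambda>a. g a \<tau>) ` A)))"
    by (intro sfr_add) auto
  then show ?case using insert.hyps by simp
qed simp

lemma sfr_prod:
  assumes "finite A" "\<And>a. a \<in> A \<Longrightarrow> sfr V (f a) (g a)"
  shows "sfr V (\<lambda>\<rho>. \<Prod>a\<in>A. f a \<rho>) (\<lambda>\<tau>. \<Sum>a\<in>A. g a \<tau>)"
  using assms
proof (induction A rule: finite_induct)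
  case (insert a A)
  then have "sfr V (\<lambda>\<rho>. f a \<rho> * (\<Prod>a\<in>A. f a \<rho>)) (\<lambda>\<tau>. g a \<tau> + (\<Sum>a\<in>A. g a \<tau>))"
    by (intro sfr_mult) auto
  then show ?case using insert.hyps by simp
qed (simp add: sfr_one)

text \<open>For sums that may be empty only the nonnegativity of the tropical value is recorded.\<close>

definition sfz :: "'v set \<Rightarrow> (('v \<Rightarrow> complex) \<Rightarrow> complex) \<Rightarrow> (('v \<Rightarrow> int) \<Rightarrow> bool) \<Rightarrow> bool" where
  "sfz V f P \<longleftrightarrow> (\<forall>\<rho>. f \<rho> = 0) \<and> (\<forall>\<tau>. P \<tau>) \<or> (\<exists>g. sfr V f g \<and> (\<forall>\<tau>. 0 \<le> g \<tau> \<longleftrightarrow> P \<tau>))"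

lemma sfz_sfr: "sfr V f g \<Longrightarrow> sfz V f (\<lambda>\<tau>. 0 \<le> g \<tau>)"
  unfolding sfz_def by blast

lemma sfz_add:
  assumes "sfz V f P" "sfz V f' P'"
  shows "sfz V (\<lambda>\<rho>. f \<rho> + f' \<rho>) (\<lambda>\<tau>. P \<tau> \<and> P' \<tau>)"
proof (cases "((\<forall>\<rho>. f \<rho> = 0) \<and> (\<forall>\<tau>. P \<tau>)) \<or> ((\<forall>\<rho>. f' \<rho> = 0) \<and> (\<forall>\<tau>. P' \<tau>))")
  case True
  then show ?thesis using assms by (elim disjE) simp_all
next
  case False
  then obtain g g' where "sfr V f g" "\<And>\<tau>. 0 \<le> g \<tau> \<longleftrightarrow> P \<tau>" "sfr V f' g'" "\<And>\<tau>. 0 \<le> g' \<tau> \<longleftrightarrow> P' \<tau>"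
    using assms unfolding sfz_def by blast
  then show ?thesis unfolding sfz_def using sfr_add[of V f g f' g']
    by (intro disjI2 exI[of _ "\<lambda>\<tau>. min (g \<tau>) (g' \<tau>)"]) auto
qed

lemma sfz_zero: "sfz V (\<lambda>\<rho>. 0) (\<lambda>\<tau>. True)"
  by (simp add: sfz_def)

lemma sfz_sum:
  assumes "finite A" "\<And>a. a \<in> A \<Longrightarrow> sfz V (f a) (P a)"
  shows "sfz V (\<lambda>\<rho>. \<Sum>a\<in>A. f a \<rho>) (\<lambda>\<tau>. \<forall>a\<in>A. P a \<tau>)"
  using assms
proof (induction A rule: finite_induct)
  case (insert a A)
  then have "sfz V (\<lambda>\<rho>. f a \<rho> + (\<Sum>a\<in>A. f a \<rho>)) (\<lambda>\<tau>. P a \<tau> \<and> (\<forall>a\<in>A. P a \<tau>))"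
    by (intro sfz_add) auto
  then show ?case using insert.hyps by simp
qed (simp add: sfz_zero)

lemma sfz_cong: "sfz V f P \<Longrightarrow> (\<And>\<rho>. f \<rho> = f' \<rho>) \<Longrightarrow> (\<And>\<tau>. P \<tau> \<longleftrightarrow> P' \<tau>) \<Longrightarrow> sfz V f' P'"
proof -
  assume a: "sfz V f P" "\<And>\<rho>. f \<rho> = f' \<rho>" "\<And>\<tau>. P \<tau> \<longleftrightarrow> P' \<tau>"
  then have "f = f'" "P = P'" by (auto simp: fun_eq_iff)
  then show ?thesis using a by simp
qed

context type_D
begin

text \<open>Doubly indexed coordinates; the default 1 is the multiplicative counterpart of the
  default 0 in \<open>dbl\<close>, and it also supplies c 0 = 1.\<close>

definition bc :: "(nat \<Rightarrow> complex) \<Rightarrow> nat \<Rightarrow> nat \<Rightarrow> complex" where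
  "bc c j i = (if j \<in> {1..n - 1} \<and> i \<in> I then c ((j - 1) * n + i) else 1)"

lemma index_in: "j \<in> {1..n - 1} \<Longrightarrow> i \<in> I \<Longrightarrow> (j - 1) * n + i \<in> {1..N}"
proof -
  assume a: "j \<in> {1..n - 1}" "i \<in> I"
  have "(j - 1) * n + i \<le> (j - 1) * n + n" using a by simp
  also have "\<dots> = j * n" using a by (cases j) auto
  also have "\<dots> \<le> (n - 1) * n" using a by (intro mult_right_mono) auto
  finally show ?thesis using a by (simp add: mult.commute)
qed

lemma index_ex: "k \<in> {1..N} \<Longrightarrow> \<exists>j\<in>{1..n - 1}. \<exists>i\<in>I. k = (j - 1) * n + i"
proof -
  assume k: "k \<in> {1..N}"
  define j where "j = (k - 1) div n"
  have "k - 1 < n * (n - 1)" using k by auto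
  then have "j < n - 1" unfolding j_def by (simp add: less_mult_imp_div_less mult.commute)
  then have j: "j + 1 \<in> {1..n - 1}" by simp
  have "k = j * n + (k - 1) mod n + 1" using k unfolding j_def by simp
  then have e: "k = (j + 1 - 1) * n + ((k - 1) mod n + 1)" by (simp only: add_diff_cancel_right' add.assoc)
  have "(k - 1) mod n < n" using n4 by simp
  then have "(k - 1) mod n + 1 \<in> I" by simp
  with j e show ?thesis by blast
qed

lemma good_bc: "nz c \<Longrightarrow> good (bc c j)"
  using index_in by (auto simp: good_def bc_def)

lemma Theta_Pb: "Theta n c = Pb (bc c) 1 (n - 1)"
proof -
  have s: "[1..<1 + (n - 1)] = map Suc [0..<n - 1]" by (simp add: map_Suc_upt)
  have "yblock (\<lambda>i. c (j * n + i)) = yblock (bc c (Suc j))" if "j < n - 1" for j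
    by (rule yblock_cong) (use that in \<open>auto simp: bc_def\<close>)
  then have "map (\<lambda>j. yblock (\<lambda>i. c (j * n + i))) [0..<n - 1] = map (\<lambda>j. yblock (bc c j)) [1..<1 + (n - 1)]"
    unfolding s map_map by (intro map_cong) auto
  then show ?thesis unfolding Theta_blocks Pb_def by simp
qed

lemma Theta_factor:
  assumes "nz c"
  shows "\<exists>u\<in>Ug 1. \<exists>u'\<in>Ug 1. Theta n c = u \<circ> w0 \<circ> u'"
proof -
  have "Theta n c \<in> cell w0" by (rule Theta_cell) (use assms in auto)
  then show ?thesis unfolding cell_def by blast
qed

text \<open>Needed for the ultra-discretized action: a tuple of expressions is only known through
  the group element \<Theta> of its values.\<close>

lemma Theta_inj:
  assumes c: "nz c" "nz c'" and eq: "Theta n c = Theta n c'" and k: "k \<in> {1..N}"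
  shows "c k = c' k"
proof -
  obtain u u' where u: "u \<in> Ug 1" "u' \<in> Ug 1" "Theta n c = u \<circ> w0 \<circ> u'" using Theta_factor[OF c(1)] by blast
  have p: "Pb (bc c) 1 (n - 1) = u \<circ> w0 \<circ> u'" "Pb (bc c') 1 (n - 1) = u \<circ> w0 \<circ> u'"
    using u(3) unfolding eq by (simp_all only: eq[symmetric] Theta_Pb[symmetric] u(3))
  obtain j i where ji: "j \<in> {1..n - 1}" "i \<in> I" "k = (j - 1) * n + i" using index_ex[OF k] by blast
  have "\<forall>j\<in>{1..n - 1}. \<forall>i\<in>I. bc c j i = bc c' j i"
    by (rule Pb_inj[where b = "bc c" and b' = "bc c'" and u = u and u' = u'])
      (rule good_bc[OF c(1)] good_bc[OF c(2)] u(1) u(2) p)+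
  then show ?thesis using ji by (auto simp: bc_def)
qed

definition fval :: "(nat \<Rightarrow> complex) \<Rightarrow> (nat \<Rightarrow> complex) \<Rightarrow> complex" where
  "fval r c = (\<Sum>k\<in>{1..n - 2}. upper_coeff (bc c) k) + (bc c (n - 1) (n - 1) + bc c (n - 1) n)
    + ((\<Sum>k\<in>{1..n - 2}. r k * ratio_sum (bc c) 1 k)
    + (r (n - 1) * (\<Sum>mu\<in>M_seqs n. sterm (bc c) False mu) + r n * (\<Sum>mu\<in>M_seqs n. sterm (bc c) True mu)))"

lemma sum_I: "(\<Sum>i\<in>I. f i) = (\<Sum>k\<in>{1..n - 2}. f k) + (f (n - 1) + f n)" for f :: "nat \<Rightarrow> complex"
proof -
  have "I = {1..n - 2} \<union> {n - 1, n}" using n4 by auto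
  moreover have "n - 1 \<noteq> n" "{1..n - 2} \<inter> {n - 1, n} = {}" using n4 by auto
  ultimately show ?thesis by (simp add: sum.union_disjoint)
qed

lemma decoration_fval:
  assumes t: "t \<in> Tor n" and c: "nz c"
  shows "decoration n (t \<circ> Theta n c) = fval (\<lambda>k. root_char n k t) c"
proof -
  obtain u u' where u: "u \<in> Ug 1" "u' \<in> Ug 1" "Theta n c = u \<circ> w0 \<circ> u'" using Theta_factor[OF c] by blast
  have g: "\<And>j. good (bc c j)" by (rule good_bc[OF c])
  have p: "Pb (bc c) 1 (n - 1) = u \<circ> w0 \<circ> u'" using u(3) unfolding Theta_Pb .
  note L = chi_left[where b = "bc c", OF g u(1,2) p] and R = chi_right[where b = "bc c", OF g u(1,2) p]
    and E = chi_right_end[where b = "bc c", OF g u(1,2) p] and S = chi_left_sval[where b = "bc c", OF g u(1,2) p]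
  have S': "chiv 1 (n - 1) u = (\<Sum>mu\<in>M_seqs n. sterm (bc c) False mu)" "chiv 1 n u = (\<Sum>mu\<in>M_seqs n. sterm (bc c) True mu)"
    using S[of False] S[of True] spin_total[where b = "bc c", OF g] by simp_all
  show ?thesis
    unfolding u(3) decoration_cell[OF t u(1,2)] sum_I E S' fval_def
    by (intro arg_cong2[where f = "(+)"] sum.cong refl) (auto simp: L R)
qed

text \<open>The left factor is absorbed into u after passing t, and the right one into u'. Both
  enter additively through the characters, and the factor \<alpha>_i(t) undoes the rescaling by
  t.\<close>

lemma decoration_shift:
  assumes t: "t \<in> Tor n" and c: "nz c" and i: "i \<in> I"
  shows "decoration n (xs 1 i p \<circ> (t \<circ> Theta n c) \<circ> xs 1 i q) = decoration n (t \<circ> Theta n c) + p + q"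
proof -
  obtain u u' where u: "u \<in> Ug 1" "u' \<in> Ug 1" "Theta n c = u \<circ> w0 \<circ> u'" using Theta_factor[OF c] by blast
  define p' where "p' = p / root_char n i t"
  have x: "xs 1 i a \<in> Ug 1" for a using Ug_ops(5)[of 1 i a] i by simp
  have U: "xs 1 i p' \<circ> u \<in> Ug 1" "u' \<circ> xs 1 i q \<in> Ug 1" using Ug_ops(2)[of 1] x u by auto
  have rc: "root_char n i t * p' = p" using root_char_nonzero[OF t i] by (simp add: p'_def)
  have "xs 1 i p \<circ> (t \<circ> Theta n c) \<circ> xs 1 i q = (xs 1 i p \<circ> t) \<circ> (u \<circ> w0 \<circ> u') \<circ> xs 1 i q"
    unfolding u(3) by (simp only: comp_assoc)
  also have "\<dots> = t \<circ> ((xs 1 i p' \<circ> u) \<circ> w0 \<circ> (u' \<circ> xs 1 i q))"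
    unfolding Tor_xs_left[OF t i] p'_def by (simp only: comp_assoc)
  finally have e: "xs 1 i p \<circ> (t \<circ> Theta n c) \<circ> xs 1 i q = t \<circ> ((xs 1 i p' \<circ> u) \<circ> w0 \<circ> (u' \<circ> xs 1 i q))" .
  have s: "(\<Sum>j\<in>I. g j * (if j = i then a else 0)) = g i * a" for g and a :: complex
    using sum.delta[of I i "\<lambda>j. g j * a"] i by (simp add: if_distrib cong: if_cong)
  have s1: "(\<Sum>j\<in>I. (if j = i then q else 0)) = q" using s[of "\<lambda>_. 1" q] by simp
  have 1: "chiv 1 j (u' \<circ> xs 1 i q) = chiv 1 j u' + (if j = i then q else 0)" if "j \<in> I" for j
    using chiv_comp[of 1] chiv_gen[of 1 j i] x u(2) that i by simp
  have 2: "root_char n j t * chiv 1 j (xs 1 i p' \<circ> u) = root_char n j t * chiv 1 j u + root_char n j t * (if j = i then p' else 0)" if "j \<in> I" for j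
    using chiv_comp[of 1] chiv_gen[of 1 j i] x u(1) that i by (simp add: algebra_simps)
  have 1: "(\<Sum>j\<in>I. chiv 1 j (u' \<circ> xs 1 i q)) = (\<Sum>j\<in>I. chiv 1 j u' + (if j = i then q else 0))"
    by (rule sum.cong[OF refl 1])
  have 2: "(\<Sum>j\<in>I. root_char n j t * chiv 1 j (xs 1 i p' \<circ> u)) = (\<Sum>j\<in>I. root_char n j t * chiv 1 j u + root_char n j t * (if j = i then p' else 0))"
    by (rule sum.cong[OF refl 2])
  show ?thesis
    unfolding e decoration_cell[OF t U] unfolding u(3) decoration_cell[OF t u(1,2)] 1 2 sum.distrib s s1 rc by simp
qed

end

section \<open>Ultra-discretization of the decoration\<close>

lemma sfr_near:
  assumes "sfr V f g" "B \<ge> 1"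
  shows "\<exists>A\<ge>1. \<forall>s \<rho>. 0 < s \<and> s \<le> 1 \<and> (\<forall>v\<in>V. near B s (\<rho> v) (\<tau> v)) \<longrightarrow> near A s (f \<rho>) (g \<tau>)"
proof -
  obtain E where E: "pos_consts E" "set_sfexpr E \<subseteq> V" "\<And>\<rho>. sf_eval \<rho> E = f \<rho>" "\<And>\<tau>. sf_trop \<tau> E = g \<tau>"
    using assms(1) unfolding sfr_def by blast
  obtain A where A: "A \<ge> 1" "\<And>s \<rho>. 0 < s \<and> s \<le> 1 \<and> (\<forall>v\<in>set_sfexpr E. near B s (\<rho> v) (\<tau> v)) \<Longrightarrow>
      sf_defined \<rho> E \<and> near A s (sf_eval \<rho> E) (sf_trop \<tau> E)"
    using trop_bounds[OF E(1) assms(2)] by blast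
  show ?thesis
  proof (intro exI[of _ A] conjI allI impI)
    fix s \<rho> assume "0 < s \<and> s \<le> 1 \<and> (\<forall>v\<in>V. near B s (\<rho> v) (\<tau> v))"
    then show "near A s (f \<rho>) (g \<tau>)" using A(2)[of s \<rho>] E(2) unfolding E(3,4) by blast
  qed (rule A(1))
qed

lemma ball_setcompr: "(\<forall>f\<in>{F i | i. P i}. Q f) \<longleftrightarrow> (\<forall>i. P i \<longrightarrow> Q (F i))"
  by blast

lemma sfz_add_sfr:
  assumes "sfz V f P" "sfr V f' g'"
  shows "\<exists>g. sfr V (\<lambda>\<rho>. f \<rho> + f' \<rho>) g \<and> (\<forall>\<tau>. 0 \<le> g \<tau> \<longleftrightarrow> P \<tau> \<and> 0 \<le> g' \<tau>)"
  using assms(1) unfolding sfz_def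
proof
  assume "(\<forall>\<rho>. f \<rho> = 0) \<and> (\<forall>\<tau>. P \<tau>)"
  then show ?thesis using assms(2) by (intro exI[of _ g']) simp
next
  assume "\<exists>g. sfr V f g \<and> (\<forall>\<tau>. 0 \<le> g \<tau> \<longleftrightarrow> P \<tau>)"
  then obtain g where g: "sfr V f g" "\<And>\<tau>. 0 \<le> g \<tau> \<longleftrightarrow> P \<tau>" by blast
  show ?thesis by (rule exI[of _ "\<lambda>\<tau>. min (g \<tau>) (g' \<tau>)"]) (use sfr_add[OF g(1) assms(2)] g(2) in simp)
qed

context type_D
begin

abbreviation "Vchart \<equiv> RootVar ` {1..n} \<union> CoordVar ` {1..N}"

abbreviation "Vact \<equiv> {ParVar} \<union> CoordVar ` {1..N}"

definition curve :: "(nat \<Rightarrow> int) \<Rightarrow> real \<Rightarrow> nat \<Rightarrow> complex" where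
  "curve x s k = complex_of_real (s powr x k)"

lemma near_curve: "near 1 s (curve x s k) (x k)"
  by (simp add: near_def curve_def)

lemma nz_curve: "0 < s \<Longrightarrow> nz (curve x s)"
  by (simp add: curve_def)

text \<open>The exponents y must be real: the integer combinations of coroots do not give all
  integer values on the simple roots, but powers of a positive s allow any real exponent.\<close>

lemma torus_real:
  fixes y :: "nat \<Rightarrow> real"
  assumes s: "0 < s"
  shows "m \<le> n \<Longrightarrow> \<exists>t\<in>Tor n. \<forall>i\<in>I. root_char n i t = complex_of_real (s powr (\<Sum>j\<in>{1..m}. y j * cartan n j i))"
proof (induction m)
  case 0
  then show ?case using s by (intro bexI[OF _ Tor_ops(1)]) (simp add: root_char_id del: id_apply)
next
  case (Suc m)
  then obtain t where t: "t \<in> Tor n" "\<And>i. i \<in> I \<Longrightarrow> root_char n i t = complex_of_real (s powr (\<Sum>j\<in>{1..m}. y j * cartan n j i))" by auto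
  define a where "a = complex_of_real (s powr y (Suc m))"
  have m: "Suc m \<in> I" "a \<noteq> 0" using Suc s by (auto simp: a_def)
  have co: "coroot n (Suc m) a \<in> Tor n" by (rule Tor_ops(5)[OF m])
  have "root_char n i (t \<circ> coroot n (Suc m) a) = complex_of_real (s powr (\<Sum>j\<in>{1..Suc m}. y j * cartan n j i))" if i: "i \<in> I" for i
  proof -
    have "(s powr y (Suc m)) powi k = s powr (y (Suc m) * k)" for k :: int
      using s powr_real_of_int'[of "s powr y (Suc m)" k] by (simp add: powr_powr)
    then have "a powi cartan n (Suc m) i = complex_of_real (s powr (y (Suc m) * cartan n (Suc m) i))"
      unfolding a_def of_real_power_int[symmetric] by simp
    then show ?thesis unfolding root_char_comp[OF t(1) co i] root_char_coroot[OF i m] t(2)[OF i]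
      by (simp add: powr_add)
  qed
  then show ?case using Tor_ops(2)[OF t(1) co] by blast
qed

lemma torus_curve:
  assumes s: "0 < s"
  shows "\<exists>t\<in>Tor n. \<forall>i\<in>I. root_char n i t = curve l s i"
proof -
  obtain y :: "nat \<Rightarrow> real" where y: "\<And>i. i \<in> I \<Longrightarrow> (\<Sum>j\<in>I. y j * real_of_int (cartan n j i)) = real_of_int (l i)"
    using cartan_invertible[of "\<lambda>i. real_of_int (l i)"] by blast
  show ?thesis using torus_real[OF s, of n y] y by (simp add: curve_def)
qed

lemma near_chart:
  assumes "\<forall>i\<in>I. root_char n i t = curve l s i" "v \<in> Vchart"
  shows "near 1 s (assign (\<lambda>i. root_char n i t) (curve x s) 0 v) (assign l x 0 v)"
  using assms near_curve by auto

text \<open>A competing expression is constrained only where it is defined; along the curves it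
  always is, so it agrees with f there, and equal growth forces equal tropical values at every pair
  l, x.\<close>

lemma UD_eq:
  assumes f: "sfr Vchart f g"
    and F: "\<And>t c. t \<in> Tor n \<Longrightarrow> nz c \<Longrightarrow> F (t \<circ> Theta n c) = f (assign (\<lambda>i. root_char n i t) c 0)"
  shows "UD n F l x = g (assign l x 0)"
proof -
  obtain E where E: "pos_consts E" "set_sfexpr E \<subseteq> Vchart" "\<And>\<rho>. sf_eval \<rho> E = f \<rho>" "\<And>\<tau>. sf_trop \<tau> E = g \<tau>"
    using f unfolding sfr_def by blast
  have rep: "represents n F E" unfolding represents_def chart Let_def using E F by auto
  have "UD n F = (\<lambda>l x. g (assign l x 0))"
    unfolding UD_def
  proof (rule the_equality)
    show "\<exists>E. represents n F E \<and> (\<lambda>l x. g (assign l x 0)) = (\<lambda>l x. sf_trop (assign l x 0) E)"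
      using rep E(4) by auto
  next
    fix p assume "\<exists>E. represents n F E \<and> p = (\<lambda>l x. sf_trop (assign l x 0) E)"
    then obtain E' where E': "represents n F E'" "p = (\<lambda>l x. sf_trop (assign l x 0) E')" by blast
    have pE': "pos_consts E'" "set_sfexpr E' \<subseteq> Vchart" using E'(1) unfolding represents_def by auto
    have "sf_trop (assign l x 0) E' = g (assign l x 0)" for l x
    proof -
      define \<tau> where "\<tau> = assign l x (0::int)"
      obtain A where A: "A \<ge> 1" "\<And>s \<rho>. 0 < s \<and> s \<le> 1 \<and> (\<forall>v\<in>set_sfexpr E'. near 1 s (\<rho> v) (\<tau> v)) \<Longrightarrow>
          sf_defined \<rho> E' \<and> near A s (sf_eval \<rho> E') (sf_trop \<tau> E')"
        using trop_bounds[OF pE'(1) order_refl] by blast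
      obtain B where B: "B \<ge> 1" "\<And>s \<rho>. 0 < s \<and> s \<le> 1 \<and> (\<forall>v\<in>Vchart. near 1 s (\<rho> v) (\<tau> v)) \<Longrightarrow> near B s (f \<rho>) (g \<tau>)"
        using sfr_near[OF f order_refl] by blast
      define t where "t s = (SOME t. t \<in> Tor n \<and> (\<forall>i\<in>I. root_char n i t = curve l s i))" for s
      have t: "t s \<in> Tor n \<and> (\<forall>i\<in>I. root_char n i (t s) = curve l s i)" if "0 < s" for s
        unfolding t_def
        by (rule someI_ex[where P = "\<lambda>t. t \<in> Tor n \<and> (\<forall>i\<in>I. root_char n i t = curve l s i)"])
          (use torus_curve[OF that, of l] in blast)
      define z where "z s = F (t s \<circ> Theta n (curve x s))" for s
      show ?thesis
        unfolding \<tau>_def[symmetric]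
      proof (rule near_unique[OF A(1) B(1)])
        fix s :: real assume s: "0 < s" "s \<le> 1"
        define \<rho> where "\<rho> = assign (\<lambda>i. root_char n i (t s)) (curve x s) 0"
        have nv: "near 1 s (\<rho> v) (\<tau> v)" if "v \<in> Vchart" for v
          unfolding \<rho>_def \<tau>_def by (rule near_chart) (use t[OF s(1)] that in auto)
        have "F (t s \<circ> Theta n (curve x s)) = f \<rho>"
          unfolding \<rho>_def by (rule F) (use t[OF s(1)] nz_curve[OF s(1)] in auto)
        then show "near B s (z s) (g \<tau>)" unfolding z_def using B(2)[of s \<rho>] nv s by simp
        have d: "sf_defined \<rho> E' \<and> near A s (sf_eval \<rho> E') (sf_trop \<tau> E')"
          by (rule A(2)) (use nv s pE'(2) in blast)
        have "in_chart n (t s) (curve x s)" unfolding chart using t[OF s(1)] nz_curve[OF s(1)] by blast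
        then have "F (t s \<circ> Theta n (curve x s)) = sf_eval \<rho> E'"
          using E'(1) d unfolding represents_def Let_def \<rho>_def by blast
        then show "near A s (z s) (sf_trop \<tau> E')" unfolding z_def using d by simp
      qed
    qed
    then show "p = (\<lambda>l x. g (assign l x 0))" unfolding E'(2) by blast
  qed
  then show ?thesis by simp
qed

abbreviation crd :: "(coord \<Rightarrow> 'r) \<Rightarrow> nat \<Rightarrow> 'r" where
  "crd \<rho> \<equiv> (\<lambda>k. \<rho> (CoordVar k))"

lemma occ_finite: "finite (occ i)"
  by simp

lemma occ_ne: "i \<in> I \<Longrightarrow> occ i \<noteq> {}"
proof -
  assume i: "i \<in> I"
  have "letter n (0 * n + i) = i" by (rule letter_block) (use i in auto)
  moreover have "i \<in> {1..N}" using index_in[of 1 i] i n4 by simp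
  ultimately show "occ i \<noteq> {}" by auto
qed

context
  fixes V :: "coord set"
  assumes V: "CoordVar ` {1..N} \<subseteq> V"
begin

lemma sfr_crd: "k \<in> {1..N} \<Longrightarrow> sfr V (\<lambda>\<rho>. crd \<rho> k) (\<lambda>\<tau>. crd \<tau> k)"
  by (rule sfr_var) (use V in auto)

lemma sfr_wprod:
  assumes "1 \<le> k"
  shows "sfr V (\<lambda>\<rho>. wprod (crd \<rho>) i k) (\<lambda>\<tau>. - (\<Sum>m\<in>{k..N}. cartan n i (letter n m) * crd \<tau> m))"
proof -
  have "sfr V (\<lambda>\<rho>. \<Prod>m\<in>{k..N}. crd \<rho> m powi (- cartan n i (letter n m)))
      (\<lambda>\<tau>. \<Sum>m\<in>{k..N}. - cartan n i (letter n m) * crd \<tau> m)"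
    by (intro sfr_prod sfr_powi sfr_crd) (use assms in auto)
  then show ?thesis by (rule sfr_cong) (simp_all add: wprod_def sum_negf)
qed

lemma sfr_Tm: "m \<in> {1..N} \<Longrightarrow> sfr V (\<lambda>\<rho>. Tm (crd \<rho>) m) (\<lambda>\<tau>. - sig n m (crd \<tau>))"
proof -
  assume m: "m \<in> {1..N}"
  have "{m + 1..N} = {m<..N}" by auto
  then show ?thesis
    using sfr_divide[OF sfr_wprod[of "m + 1" "letter n m"] sfr_crd[OF m]]
    unfolding Tm_def by (auto elim!: sfr_cong simp: sig_def)
qed

lemma sfr_chi: "i \<in> I \<Longrightarrow> sfr V (\<lambda>\<rho>. \<Sum>m\<in>occ i. Tm (crd \<rho>) m) (\<lambda>\<tau>. - sig_max n i (crd \<tau>))"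
proof -
  assume i: "i \<in> I"
  have e: "{sig n m x | m. m \<in> {1..N} \<and> letter n m = i} = (\<lambda>m. sig n m x) ` occ i" for x by auto
  have mm: "Min ((\<lambda>m. - sig n m x) ` occ i) = - sig_max n i x" for x
  proof -
    have "- Max ((\<lambda>m. sig n m x) ` occ i) = Min (uminus ` ((\<lambda>m. sig n m x) ` occ i))"
      by (rule minus_Max_eq_Min) (use occ_ne[OF i] in simp_all)
    then show ?thesis unfolding sig_max_def e by (simp add: image_image)
  qed
  have "sfr V (\<lambda>\<rho>. \<Sum>m\<in>occ i. Tm (crd \<rho>) m) (\<lambda>\<tau>. Min ((\<lambda>m. - sig n m (crd \<tau>)) ` occ i))"
    by (rule sfr_sum[OF occ_finite occ_ne[OF i]]) (rule sfr_Tm, simp)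
  then show ?thesis unfolding mm .
qed

lemma sfr_Sd:
  assumes "i \<in> I" "ParVar \<in> V"
  shows "sfr V (\<lambda>\<rho>. Sd (crd \<rho>) (\<rho> ParVar) i k)
    (\<lambda>\<tau>. Min ((\<lambda>m. if m < k then \<tau> ParVar - sig n m (crd \<tau>) else - sig n m (crd \<tau>)) ` occ i))"
  unfolding Sd_def
proof (rule sfr_sum[OF occ_finite occ_ne[OF assms(1)]])
  fix m assume m: "m \<in> occ i"
  then have T: "sfr V (\<lambda>\<rho>. Tm (crd \<rho>) m) (\<lambda>\<tau>. - sig n m (crd \<tau>))" by (intro sfr_Tm) simp
  show "sfr V (\<lambda>\<rho>. if m < k then \<rho> ParVar * Tm (crd \<rho>) m else Tm (crd \<rho>) m)
      (\<lambda>\<tau>. if m < k then \<tau> ParVar - sig n m (crd \<tau>) else - sig n m (crd \<tau>))"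
    using sfr_mult[OF sfr_var[OF assms(2)] T] T by (cases "m < k") simp_all
qed

lemma sfr_bc: "sfr V (\<lambda>\<rho>. bc (crd \<rho>) j i) (\<lambda>\<tau>. dbl n (crd \<tau>) j i)"
proof (cases "j \<in> {1..n - 1} \<and> i \<in> I")
  case True
  then have "(j - 1) * n + i \<in> {1..N}" by (intro index_in) auto
  from sfr_crd[OF this] show ?thesis using True by (simp add: bc_def dbl_def)
next
  case False
  then show ?thesis using sfr_one by (auto simp: bc_def dbl_def)
qed

lemma sfr_Ysw:
  "sfr V (\<lambda>\<rho>. Ysw (bc (crd \<rho>)) False j i) (\<lambda>\<tau>. X1 n (crd \<tau>) j i)"
  "sfr V (\<lambda>\<rho>. Ysw (bc (crd \<rho>)) True j i) (\<lambda>\<tau>. X2 n (crd \<tau>) j i)"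
proof -
  have "n \<noteq> n - 1" using n4 by simp
  then show "sfr V (\<lambda>\<rho>. Ysw (bc (crd \<rho>)) False j i) (\<lambda>\<tau>. X1 n (crd \<tau>) j i)"
    "sfr V (\<lambda>\<rho>. Ysw (bc (crd \<rho>)) True j i) (\<lambda>\<tau>. X2 n (crd \<tau>) j i)"
    using sfr_bc[of j n] sfr_bc[of j "n - 1"] sfr_bc[of j i] unfolding Ysw_def X1_def X2_def
    by (cases "even j"; cases "i = n - 1"; cases "i = n"; simp)+
qed

lemma sfr_sterm:
  "sfr V (\<lambda>\<rho>. sterm (bc (crd \<rho>)) False mu) (\<lambda>\<tau>. phi1 n mu (crd \<tau>))"
  "sfr V (\<lambda>\<rho>. sterm (bc (crd \<rho>)) True mu) (\<lambda>\<tau>. phi2 n mu (crd \<tau>))"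
proof -
  have l1: "sfr V (\<lambda>\<rho>. lterm (bc (crd \<rho>)) False mu) (\<lambda>\<tau>. \<Sum>k = 1..length mu.
      X1 n (crd \<tau>) (mu ! (k - 1) + k - 1) (n - mu ! (k - 1) - 1) - X1 n (crd \<tau>) (mu ! (k - 1) + k - 1) (n - mu ! (k - 1)))"
    unfolding lterm_def by (intro sfr_prod sfr_divide sfr_Ysw) simp
  have l2: "sfr V (\<lambda>\<rho>. lterm (bc (crd \<rho>)) True mu) (\<lambda>\<tau>. \<Sum>k = 1..length mu.
      X2 n (crd \<tau>) (mu ! (k - 1) + k - 1) (n - mu ! (k - 1) - 1) - X2 n (crd \<tau>) (mu ! (k - 1) + k - 1) (n - mu ! (k - 1)))"
    unfolding lterm_def by (intro sfr_prod sfr_divide sfr_Ysw) simp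
  show "sfr V (\<lambda>\<rho>. sterm (bc (crd \<rho>)) False mu) (\<lambda>\<tau>. phi1 n mu (crd \<tau>))"
    using l1 sfr_mult[OF l1 sfr_Ysw(1)[of "length mu" n]] unfolding sterm_def phi1_def eps_mu_def
    by (cases "last mu = 1") simp_all
  show "sfr V (\<lambda>\<rho>. sterm (bc (crd \<rho>)) True mu) (\<lambda>\<tau>. phi2 n mu (crd \<tau>))"
    using l2 sfr_mult[OF l2 sfr_Ysw(2)[of "length mu" n]] unfolding sterm_def phi2_def eps_mu_def
    by (cases "last mu = 1") simp_all
qed

lemma sfz_upper:
  assumes k: "k \<in> {1..n - 2}"
  shows "sfz V (\<lambda>\<rho>. upper_coeff (bc (crd \<rho>)) k) (\<lambda>\<tau>. \<forall>f\<in>Xi n k. 0 \<le> f (crd \<tau>))"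
proof -
  define D where "D \<tau> = dbl n (crd \<tau>)" for \<tau> :: "coord \<Rightarrow> int"
  note s = sfr_bc[folded D_def]
  have P: "(\<forall>f\<in>Xi n k. 0 \<le> f (crd \<tau>)) \<longleftrightarrow>
     (((((\<forall>i\<in>{1..n - 2}. 0 \<le> D \<tau> k i - D \<tau> (k + 1) (i - 1)) \<and> 0 \<le> D \<tau> k (n - 1) + D \<tau> k n - D \<tau> (k + 1) (n - 2))
      \<and> 0 \<le> D \<tau> (k + 1) (n - 2) - (D \<tau> (k + 1) (n - 1) + D \<tau> (k + 1) n)) \<and> 0 \<le> D \<tau> k (n - 1) - D \<tau> (k + 1) n)
      \<and> 0 \<le> D \<tau> k n - D \<tau> (k + 1) (n - 1)) \<and> (\<forall>j\<in>{k + 2..<n}. 0 \<le> D \<tau> j (n + k - j - 1) - D \<tau> j (n + k - j))" for \<tau>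
  proof -
    have k': "1 \<le> k \<and> k \<le> n - 2" using k by simp
    have r1: "(\<forall>f\<in>{\<lambda>x. dbl n x k i - dbl n x (k + 1) (i - 1) | i. 1 \<le> i \<and> i \<le> n - 2}. 0 \<le> f (crd \<tau>)) \<longleftrightarrow>
        (\<forall>i\<in>{1..n - 2}. 0 \<le> D \<tau> k i - D \<tau> (k + 1) (i - 1))" unfolding D_def ball_setcompr by auto
    have r2: "(\<forall>f\<in>{\<lambda>x. dbl n x j (n + k - j - 1) - dbl n x j (n + k - j) | j. k + 2 \<le> j \<and> j \<le> n - 1}. 0 \<le> f (crd \<tau>)) \<longleftrightarrow>
        (\<forall>j\<in>{k + 2..<n}. 0 \<le> D \<tau> j (n + k - j - 1) - D \<tau> j (n + k - j))"
    proof -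
      have "{k + 2..<n} = {j. k + 2 \<le> j \<and> j \<le> n - 1}" using n4 by auto
      then show ?thesis unfolding D_def ball_setcompr by simp
    qed
    show ?thesis
      unfolding Xi_def if_P[OF k'] ball_Un r1 r2 by (auto simp: D_def)
  qed
  show ?thesis
    unfolding upper_coeff_def P by (intro sfz_add sfz_sum sfz_sfr sfr_divide sfr_mult s) auto
qed

end

definition Fexp :: "(coord \<Rightarrow> complex) \<Rightarrow> complex" where
  "Fexp \<rho> = fval (\<lambda>i. \<rho> (RootVar i)) (crd \<rho>)"

text \<open>The two summands from the last block are always present; they turn the possibly empty
  sums, known only up to the sign of their tropical value, into a genuine expression for the whole
  decoration.\<close>

lemma Fexp_sfr: "\<exists>g. sfr Vchart Fexp g \<and> (\<forall>\<tau>. 0 \<le> g \<tau> \<longleftrightarrow>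
   (\<forall>k\<in>I. \<forall>f\<in>Xi n k. 0 \<le> f (crd \<tau>)) \<and> (\<forall>k\<in>I. \<forall>f\<in>Xi' n k. 0 \<le> \<tau> (RootVar k) + f (crd \<tau>)))"
  (is "\<exists>g. _ \<and> (\<forall>\<tau>. _ \<longleftrightarrow> ?P \<tau> \<and> ?Q \<tau>)")
proof -
  have V: "CoordVar ` {1..N} \<subseteq> Vchart" by blast
  have nn: "n \<noteq> n - 1" "\<not> n - 1 \<le> n - 2" "\<not> n \<le> n - 2" using n4 by auto
  have r: "sfr Vchart (\<lambda>\<rho>. \<rho> (RootVar k)) (\<lambda>\<tau>. \<tau> (RootVar k))" if "k \<in> I" for k by (rule sfr_var) (use that in auto)
  have I: "I = {1..n - 2} \<union> {n - 1, n}" using n4 by auto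
  have 1: "sfz Vchart (\<lambda>\<rho>. \<Sum>k\<in>{1..n - 2}. upper_coeff (bc (crd \<rho>)) k) (\<lambda>\<tau>. \<forall>k\<in>{1..n - 2}. \<forall>f\<in>Xi n k. 0 \<le> f (crd \<tau>))"
    by (intro sfz_sum sfz_upper[OF V]) auto
  have ends: "sfr Vchart (\<lambda>\<rho>. bc (crd \<rho>) (n - 1) (n - 1) + bc (crd \<rho>) (n - 1) n)
      (\<lambda>\<tau>. min (dbl n (crd \<tau>) (n - 1) (n - 1)) (dbl n (crd \<tau>) (n - 1) n))"
    by (intro sfr_add sfr_bc[OF V])
  have P: "(\<forall>k\<in>{1..n - 2}. \<forall>f\<in>Xi n k. 0 \<le> f (crd \<tau>)) \<and> 0 \<le> min (dbl n (crd \<tau>) (n - 1) (n - 1)) (dbl n (crd \<tau>) (n - 1) n)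
        \<longleftrightarrow> ?P \<tau>" for \<tau>
  proof -
    have "Xi n (n - 1) = {\<lambda>x. dbl n x (n - 1) (n - 1)}" "Xi n n = {\<lambda>x. dbl n x (n - 1) n}"
      using nn unfolding Xi_def by simp_all
    then show ?thesis unfolding I ball_Un by simp
  qed
  have 2: "sfz Vchart (\<lambda>\<rho>. (\<Sum>k\<in>{1..n - 2}. \<Sum>j\<in>{1..k}. \<rho> (RootVar k) * (bc (crd \<rho>) (1 + j - 1) (k - j) / bc (crd \<rho>) (1 + j - 1) (k - j + 1)))
     + ((\<Sum>mu\<in>M_seqs n. \<rho> (RootVar (n - 1)) * sterm (bc (crd \<rho>)) False mu) + (\<Sum>mu\<in>M_seqs n. \<rho> (RootVar n) * sterm (bc (crd \<rho>)) True mu))) ?Q"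
  proof (rule sfz_cong[OF _ refl])
    show "sfz Vchart (\<lambda>\<rho>. (\<Sum>k\<in>{1..n - 2}. \<Sum>j\<in>{1..k}. \<rho> (RootVar k) * (bc (crd \<rho>) (1 + j - 1) (k - j) / bc (crd \<rho>) (1 + j - 1) (k - j + 1)))
     + ((\<Sum>mu\<in>M_seqs n. \<rho> (RootVar (n - 1)) * sterm (bc (crd \<rho>)) False mu) + (\<Sum>mu\<in>M_seqs n. \<rho> (RootVar n) * sterm (bc (crd \<rho>)) True mu)))
     (\<lambda>\<tau>. (\<forall>k\<in>{1..n - 2}. \<forall>j\<in>{1..k}. 0 \<le> \<tau> (RootVar k) + (dbl n (crd \<tau>) (1 + j - 1) (k - j) - dbl n (crd \<tau>) (1 + j - 1) (k - j + 1)))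
       \<and> ((\<forall>mu\<in>M_seqs n. 0 \<le> \<tau> (RootVar (n - 1)) + phi1 n mu (crd \<tau>)) \<and> (\<forall>mu\<in>M_seqs n. 0 \<le> \<tau> (RootVar n) + phi2 n mu (crd \<tau>))))"
      by (intro sfz_add sfz_sum sfz_sfr sfr_mult sfr_divide sfr_bc[OF V] sfr_sterm[OF V] r finite_M_seqs) (use n4 in auto)
    show "(\<forall>k\<in>{1..n - 2}. \<forall>j\<in>{1..k}. 0 \<le> \<tau> (RootVar k) + (dbl n (crd \<tau>) (1 + j - 1) (k - j) - dbl n (crd \<tau>) (1 + j - 1) (k - j + 1)))
       \<and> ((\<forall>mu\<in>M_seqs n. 0 \<le> \<tau> (RootVar (n - 1)) + phi1 n mu (crd \<tau>)) \<and> (\<forall>mu\<in>M_seqs n. 0 \<le> \<tau> (RootVar n) + phi2 n mu (crd \<tau>)))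
       \<longleftrightarrow> ?Q \<tau>" for \<tau>
    proof -
      have x: "Xi' n (n - 1) = {phi1 n mu | mu. mu \<in> M_seqs n}" "Xi' n n = {phi2 n mu | mu. mu \<in> M_seqs n}"
        using nn unfolding Xi'_def by simp_all
      have "Xi' n k = {\<lambda>x. dbl n x j (k - j) - dbl n x j (k - j + 1) | j. 1 \<le> j \<and> j \<le> k}" if "k \<in> {1..n - 2}" for k
        using that unfolding Xi'_def by simp
      note xk = this
      have "(\<forall>f\<in>Xi' n k. 0 \<le> \<tau> (RootVar k) + f (crd \<tau>)) \<longleftrightarrow>
        (\<forall>j\<in>{1..k}. 0 \<le> \<tau> (RootVar k) + (dbl n (crd \<tau>) (1 + j - 1) (k - j) - dbl n (crd \<tau>) (1 + j - 1) (k - j + 1)))" if k: "k \<in> {1..n - 2}" for k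
        unfolding xk[OF k] ball_setcompr by auto
      then have "(\<forall>k\<in>{1..n - 2}. \<forall>f\<in>Xi' n k. 0 \<le> \<tau> (RootVar k) + f (crd \<tau>)) \<longleftrightarrow>
        (\<forall>k\<in>{1..n - 2}. \<forall>j\<in>{1..k}. 0 \<le> \<tau> (RootVar k) + (dbl n (crd \<tau>) (1 + j - 1) (k - j) - dbl n (crd \<tau>) (1 + j - 1) (k - j + 1)))"
        by (rule ball_cong[OF refl])
      moreover have "(\<forall>f\<in>Xi' n (n - 1). 0 \<le> \<tau> (RootVar (n - 1)) + f (crd \<tau>)) \<longleftrightarrow> (\<forall>mu\<in>M_seqs n. 0 \<le> \<tau> (RootVar (n - 1)) + phi1 n mu (crd \<tau>))"
        "(\<forall>f\<in>Xi' n n. 0 \<le> \<tau> (RootVar n) + f (crd \<tau>)) \<longleftrightarrow> (\<forall>mu\<in>M_seqs n. 0 \<le> \<tau> (RootVar n) + phi2 n mu (crd \<tau>))"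
        unfolding x ball_setcompr by blast+
      ultimately show ?thesis unfolding I ball_Un by simp
    qed
  qed
  have e: "Fexp = (\<lambda>\<rho>. ((\<Sum>k\<in>{1..n - 2}. upper_coeff (bc (crd \<rho>)) k) + ((\<Sum>k\<in>{1..n - 2}. \<Sum>j\<in>{1..k}. \<rho> (RootVar k) * (bc (crd \<rho>) (1 + j - 1) (k - j) / bc (crd \<rho>) (1 + j - 1) (k - j + 1)))
     + ((\<Sum>mu\<in>M_seqs n. \<rho> (RootVar (n - 1)) * sterm (bc (crd \<rho>)) False mu) + (\<Sum>mu\<in>M_seqs n. \<rho> (RootVar n) * sterm (bc (crd \<rho>)) True mu))))
     + (bc (crd \<rho>) (n - 1) (n - 1) + bc (crd \<rho>) (n - 1) n))"
    by (rule ext) (simp add: Fexp_def fval_def ratio_sum_def sum_distrib_left add_ac)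
  show ?thesis using sfz_add_sfr[OF sfz_add[OF 1 2] ends] unfolding e P[symmetric] by (simp only: conj_ac)
qed

end

section \<open>Ultra-discretization of the action\<close>

lemma sfr_mono: "sfr V f g \<Longrightarrow> V \<subseteq> W \<Longrightarrow> sfr W f g"
  unfolding sfr_def by blast

lemma sfr_near_curve:
  assumes f: "sfr V f g" and B: "B \<ge> 1" and v: "\<And>s v. 0 < s \<Longrightarrow> s \<le> 1 \<Longrightarrow> v \<in> V \<Longrightarrow> near B s (\<rho> s v) (\<tau> v)"
  shows "\<exists>A\<ge>1. \<forall>s. 0 < s \<and> s \<le> 1 \<longrightarrow> near A s (f (\<rho> s)) (g \<tau>)"
proof -
  obtain A where A: "A \<ge> 1" "\<forall>s \<rho>. 0 < s \<and> s \<le> 1 \<and> (\<forall>v\<in>V. near B s (\<rho> v) (\<tau> v)) \<longrightarrow> near A s (f \<rho>) (g \<tau>)"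
    using sfr_near[OF f B, of \<tau>] by blast
  show ?thesis
  proof (intro exI[of _ A] conjI allI impI)
    fix s :: real assume "0 < s \<and> s \<le> 1"
    then show "near A s (f (\<rho> s)) (g \<tau>)" using A(2)[rule_format, of s "\<rho> s"] v[of s] by blast
  qed (rule A(1))
qed

context type_D
begin

lemma chart_vars: "CoordVar ` {1..N} \<subseteq> Vchart" "CoordVar ` {1..N} \<subseteq> Vact"
  by blast+

definition gam :: "nat \<Rightarrow> (coord \<Rightarrow> complex) \<Rightarrow> complex" where
  "gam i \<rho> = \<rho> (RootVar i) * wprod (crd \<rho>) i 1"

definition chs :: "nat \<Rightarrow> (coord \<Rightarrow> complex) \<Rightarrow> complex" where
  "chs i \<rho> = (\<Sum>m\<in>occ i. Tm (crd \<rho>) m)"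

lemma sfr_gam: "i \<in> I \<Longrightarrow> sfr Vchart (gam i) (\<lambda>\<tau>. - sig0 n (\<lambda>j. \<tau> (RootVar j)) i (crd \<tau>))"
  unfolding gam_def
  by (rule sfr_cong[OF sfr_mult[OF sfr_var sfr_wprod[OF chart_vars(1) order_refl]]]) (auto simp: sig0_def)

lemma sfr_eps: "i \<in> I \<Longrightarrow> sfr Vchart (\<lambda>\<rho>. 1 / chs i \<rho>) (\<lambda>\<tau>. sig_max n i (crd \<tau>))"
  unfolding chs_def
  by (rule sfr_cong[OF sfr_divide[OF sfr_one sfr_chi[OF chart_vars(1)]]]) auto

lemma UD_gamma: "i \<in> I \<Longrightarrow> UD n (gc_gamma n i) l x = - sig0 n l i x"
  using UD_eq[OF sfr_gam[of i], of "gc_gamma n i" l x] gamma_eps_chart(1) by (simp add: gam_def)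

lemma UD_eps: "i \<in> I \<Longrightarrow> UD n (gc_eps n i) l x = sig_max n i x"
  using UD_eq[OF sfr_eps[of i], of "gc_eps n i" l x] gamma_eps_chart(3) by (simp add: chs_def)

lemma UD_decoration: "sfr Vchart Fexp g \<Longrightarrow> UD n (decoration n) l x = g (assign l x 0)"
  by (rule UD_eq) (auto simp: decoration_fval Fexp_def)

lemma B_set_eq: "B_set n l = Sigma_set n l"
proof -
  obtain g where g: "sfr Vchart Fexp g" "\<And>\<tau>. 0 \<le> g \<tau> \<longleftrightarrow>
     (\<forall>k\<in>I. \<forall>f\<in>Xi n k. 0 \<le> f (crd \<tau>)) \<and> (\<forall>k\<in>I. \<forall>f\<in>Xi' n k. 0 \<le> \<tau> (RootVar k) + f (crd \<tau>))"
    using Fexp_sfr by blast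
  show ?thesis unfolding B_set_def Sigma_set_def UD_decoration[OF g(1)] g(2) by simp
qed

text \<open>The tropical form of \<open>Sd\<close>, as \<open>atr\<close> below is that of
  \<open>cact\<close>; the value 0 outside {1..N} keeps \<open>atr\<close> inside the
  lattice.\<close>

definition mS :: "nat \<Rightarrow> int \<Rightarrow> (nat \<Rightarrow> int) \<Rightarrow> nat \<Rightarrow> int" where
  "mS i d x k = Min ((\<lambda>m. if m < k then d - sig n m x else - sig n m x) ` occ i)"

definition atr :: "nat \<Rightarrow> int \<Rightarrow> (nat \<Rightarrow> int) \<Rightarrow> nat \<Rightarrow> int" where
  "atr i d x k = (if k \<in> {1..N} then if letter n k = i then x k + (mS i d x k - mS i d x (k + 1)) else x k else 0)"

lemma sfr_cact:
  assumes i: "i \<in> I" and k: "k \<in> {1..N}"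
  shows "sfr Vact (\<lambda>\<rho>. cact (crd \<rho>) (\<rho> ParVar) i k) (\<lambda>\<tau>. atr i (\<tau> ParVar) (crd \<tau>) k)"
proof -
  have S: "sfr Vact (\<lambda>\<rho>. Sd (crd \<rho>) (\<rho> ParVar) i j) (\<lambda>\<tau>. mS i (\<tau> ParVar) (crd \<tau>) j)" for j
    unfolding mS_def by (rule sfr_Sd[OF chart_vars(2) i]) simp
  have c: "sfr Vact (\<lambda>\<rho>. crd \<rho> k) (\<lambda>\<tau>. crd \<tau> k)" by (rule sfr_crd[OF chart_vars(2) k])
  show ?thesis
  proof (cases "letter n k = i")
    case True
    show ?thesis using sfr_mult[OF c sfr_divide[OF S[of k] S[of "k + 1"]]] True k by (simp add: cact_def atr_def)
  next
    case False
    then show ?thesis using c k by (simp add: cact_def atr_def)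
  qed
qed

lemma Theta_cong: "(\<And>k. k \<in> {1..N} \<Longrightarrow> c k = c' k) \<Longrightarrow> Theta n c = Theta n c'"
  unfolding Theta_def word_prod_def by (intro arg_cong[where f = "\<lambda>l. foldr (\<circ>) l id"] map_cong) auto

lemma act_chart':
  assumes i: "i \<in> I" and t: "t \<in> Tor n" and c: "nz c" and d: "d \<noteq> 0" and chi: "(\<Sum>m\<in>occ i. Tm c m) \<noteq> 0"
    and nz: "nz (cact c d i)"
  shows "gc_act n i d (t \<circ> Theta n c) = t \<circ> Theta n (cact c d i)"
proof (rule act_chart[OF i t c d chi])
  fix k assume "k \<in> occ i"
  then have "cact c d i k \<noteq> 0" "letter n k = i" using nz by auto
  then show "Sd c d i k \<noteq> 0 \<and> Sd c d i (k + 1) \<noteq> 0" unfolding cact_def by auto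
qed

text \<open>All subtraction-free quantities are compared along the curves \<open>c\<^sub>k = s\<^sup>x\<^sup>k\<close>, \<open>d = s\<^sup>m\<close>.\<close>

lemma cact_curve:
  assumes i: "i \<in> I"
  shows "\<exists>B\<ge>1. \<forall>s. 0 < s \<and> s \<le> 1 \<longrightarrow>
    (\<forall>k\<in>{1..N}. near B s (cact (curve x s) (complex_of_real (s powr real_of_int m)) i k) (atr i m x k)) \<and>
    (\<Sum>j\<in>occ i. Tm (curve x s) j) \<noteq> 0"
proof -
  define \<rho> where "\<rho> s = assign (\<lambda>_. 0) (curve x s) (complex_of_real (s powr real_of_int m))" for s
  define \<tau> where "\<tau> = assign (\<lambda>_. 0) x m"
  have cr: "crd (\<rho> s) = curve x s" "\<rho> s ParVar = complex_of_real (s powr real_of_int m)" "crd \<tau> = x" "\<tau> ParVar = m" for s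
    by (simp_all add: \<rho>_def \<tau>_def)
  have v: "near 1 s (\<rho> s v) (\<tau> v)" if "v \<in> Vact" for s v
    using near_curve that by (auto simp: \<rho>_def \<tau>_def near_def)
  have "\<forall>k\<in>{1..N}. \<exists>A. A \<ge> 1 \<and> (\<forall>s. 0 < s \<and> s \<le> 1 \<longrightarrow> near A s (cact (curve x s) (complex_of_real (s powr real_of_int m)) i k) (atr i m x k))"
    using sfr_near_curve[where \<rho> = \<rho> and \<tau> = \<tau>, OF sfr_cact[OF i] order_refl v] unfolding cr by blast
  from bchoice[OF this] obtain A where A': "\<forall>k\<in>{1..N}. A k \<ge> 1 \<and> (\<forall>s. 0 < s \<and> s \<le> 1 \<longrightarrow>
      near (A k) s (cact (curve x s) (complex_of_real (s powr real_of_int m)) i k) (atr i m x k))" ..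
  have A: "\<And>k. k \<in> {1..N} \<Longrightarrow> A k \<ge> 1" "\<And>k s. k \<in> {1..N} \<Longrightarrow> 0 < s \<Longrightarrow> s \<le> 1 \<Longrightarrow>
      near (A k) s (cact (curve x s) (complex_of_real (s powr real_of_int m)) i k) (atr i m x k)"
    using A' by blast+
  define B where "B = 1 + (\<Sum>k\<in>{1..N}. A k)"
  have Ak: "A k \<le> B" if k: "k \<in> {1..N}" for k
  proof -
    have "A k \<le> (\<Sum>k\<in>{1..N}. A k)" by (rule member_le_sum[OF k]) (use A(1) in force)+
    then show ?thesis by (simp add: B_def)
  qed
  have "0 \<le> (\<Sum>k\<in>{1..N}. A k)" by (rule sum_nonneg) (use A(1) in force)
  then have "B \<ge> 1" by (simp add: B_def)
  moreover have "near B s (cact (curve x s) (complex_of_real (s powr real_of_int m)) i k) (atr i m x k)"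
    if "0 < s" "s \<le> 1" "k \<in> {1..N}" for s k
    by (rule near_mono[OF A(2)[OF that(3,1,2)] Ak[OF that(3)] A(1)[OF that(3)] that(1)])
  moreover have "(\<Sum>j\<in>occ i. Tm (curve x s) j) \<noteq> 0" if s: "0 < s" "s \<le> 1" for s
  proof -
    obtain C where C: "C \<ge> 1" "\<forall>s. 0 < s \<and> s \<le> 1 \<longrightarrow> near C s (\<Sum>j\<in>occ i. Tm (crd (\<rho> s)) j) (- sig_max n i (crd \<tau>))"
      using sfr_near_curve[where \<rho> = \<rho> and \<tau> = \<tau>, OF sfr_chi[OF chart_vars(2) i] order_refl v] by blast
    have "near C s (\<Sum>j\<in>occ i. Tm (curve x s) j) (- sig_max n i x)" using C(2) s unfolding cr by blast
    then show ?thesis by (rule near_pos(2)) (use C(1) s(1) in auto)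
  qed
  ultimately show ?thesis by blast
qed

text \<open>For uniqueness the action is evaluated along the curves at the torus element
  \<open>id\<close>: both tuples of coordinates give the same \<Theta>, so by injectivity they agree
  and have the same growth.\<close>

lemma UD_act_eq:
  assumes i: "i \<in> I"
  shows "UD_act n i m x = atr i m x"
proof -
  have "\<forall>k\<in>{1..N}. \<exists>E. pos_consts E \<and> set_sfexpr E \<subseteq> Vact \<and> (\<forall>\<rho>. sf_eval \<rho> E = cact (crd \<rho>) (\<rho> ParVar) i k) \<and>
      (\<forall>\<tau>. sf_trop \<tau> E = atr i (\<tau> ParVar) (crd \<tau>) k)"
    using sfr_cact[OF i] unfolding sfr_def by blast
  from bchoice[OF this] obtain E where E': "\<forall>k\<in>{1..N}. pos_consts (E k) \<and> set_sfexpr (E k) \<subseteq> Vact \<and>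
      (\<forall>\<rho>. sf_eval \<rho> (E k) = cact (crd \<rho>) (\<rho> ParVar) i k) \<and> (\<forall>\<tau>. sf_trop \<tau> (E k) = atr i (\<tau> ParVar) (crd \<tau>) k)" ..
  have E: "\<And>k. k \<in> {1..N} \<Longrightarrow> pos_consts (E k) \<and> set_sfexpr (E k) \<subseteq> Vact \<and>
      (\<forall>\<rho>. sf_eval \<rho> (E k) = cact (crd \<rho>) (\<rho> ParVar) i k) \<and> (\<forall>\<tau>. sf_trop \<tau> (E k) = atr i (\<tau> ParVar) (crd \<tau>) k)"
    using E' by (rule bspec)
  have rep: "represents_act n i E"
    unfolding represents_act_def Let_def chart
  proof (intro conjI ballI allI impI)
    fix t c d
    assume a: "(t \<in> Tor n \<and> nz c) \<and> d \<noteq> 0 \<and> chi_neg n i (neg_part n (t \<circ> Theta n c)) \<noteq> 0"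
      and b: "\<forall>k\<in>{1..N}. sf_defined (assign (\<lambda>_. 0) c d) (E k) \<and> sf_eval (assign (\<lambda>_. 0) c d) (E k) \<noteq> 0"
    have e: "sf_eval (assign (\<lambda>_. 0) c d) (E k) = cact c d i k" if "k \<in> {1..N}" for k
      using E[OF that] by simp
    have t: "t \<in> Tor n" and c: "nz c" using a by blast+
    have "gc_act n i d (t \<circ> Theta n c) = t \<circ> Theta n (cact c d i)"
      by (rule act_chart'[OF i t c]) (use a b e gamma_eps_chart(2)[OF t c i] in auto)
    also have "Theta n (cact c d i) = Theta n (\<lambda>k. sf_eval (assign (\<lambda>_. 0) c d) (E k))"
      by (rule Theta_cong) (simp add: e)
    finally show "gc_act n i d (t \<circ> Theta n c) = t \<circ> Theta n (\<lambda>k. sf_eval (assign (\<lambda>_. 0) c d) (E k))" .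
  qed (use E in blast)+
  have "UD_act n i = atr i"
    unfolding UD_act_def
  proof (rule the_equality)
    show "\<exists>E. represents_act n i E \<and> atr i = (\<lambda>m x k. if k \<in> {1..N} then sf_trop (assign (\<lambda>_. 0) x m) (E k) else 0)"
    proof (rule exI[of _ E], rule conjI[OF rep], intro ext)
      fix m x k
      show "atr i m x k = (if k \<in> {1..N} then sf_trop (assign (\<lambda>_. 0) x m) (E k) else 0)"
      proof (cases "k \<in> {1..N}")
        case True
        then show ?thesis using E[OF True] by simp
      next
        case False
        show ?thesis unfolding atr_def if_not_P[OF False] ..
      qed
    qed
  next
    fix p assume "\<exists>E. represents_act n i E \<and> p = (\<lambda>m x k. if k \<in> {1..N} then sf_trop (assign (\<lambda>_. 0) x m) (E k) else 0)"
    then obtain E' where E': "represents_act n i E'" "p = (\<lambda>m x k. if k \<in> {1..N} then sf_trop (assign (\<lambda>_. 0) x m) (E' k) else 0)"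
      by blast
    have pE': "pos_consts (E' k)" "set_sfexpr (E' k) \<subseteq> Vact" if "k \<in> {1..N}" for k
      using E'(1) that unfolding represents_act_def by blast+
    have "sf_trop (assign (\<lambda>_. 0) x m) (E' k) = atr i m x k" if k: "k \<in> {1..N}" for m x k
    proof -
      define \<tau> where "\<tau> = assign (\<lambda>_. 0) x m"
      define dd where "dd s = complex_of_real (s powr real_of_int m)" for s
      define \<rho> where "\<rho> s = assign (\<lambda>_. 0) (curve x s) (dd s)" for s
      have v: "\<forall>v\<in>Vact. near 1 s (\<rho> s v) (\<tau> v)" for s
        using near_curve by (auto simp: \<rho>_def \<tau>_def dd_def near_def)
      have bd: "\<exists>A\<ge>1. \<forall>s. 0 < s \<and> s \<le> 1 \<longrightarrow> sf_defined (\<rho> s) (E' j) \<and> near A s (sf_eval (\<rho> s) (E' j)) (sf_trop \<tau> (E' j))"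
        if j: "j \<in> {1..N}" for j
      proof -
        obtain A where A: "A \<ge> 1" "\<And>s \<rho>. 0 < s \<and> s \<le> 1 \<and> (\<forall>v\<in>set_sfexpr (E' j). near 1 s (\<rho> v) (\<tau> v)) \<Longrightarrow>
            sf_defined \<rho> (E' j) \<and> near A s (sf_eval \<rho> (E' j)) (sf_trop \<tau> (E' j))"
          using trop_bounds[OF pE'(1)[OF j] order_refl, of \<tau>] by blast
        show ?thesis
        proof (intro exI[of _ A] conjI allI impI A(1))
          fix s :: real assume s: "0 < s \<and> s \<le> 1"
          have "\<forall>v\<in>set_sfexpr (E' j). near 1 s (\<rho> s v) (\<tau> v)" using v[of s] pE'(2)[OF j] by blast
          then show "sf_defined (\<rho> s) (E' j)" "near A s (sf_eval (\<rho> s) (E' j)) (sf_trop \<tau> (E' j))"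
            using A(2)[of s "\<rho> s"] s by blast+
        qed
      qed
      obtain A where A: "A \<ge> 1" "\<And>s. 0 < s \<Longrightarrow> s \<le> 1 \<Longrightarrow> near A s (sf_eval (\<rho> s) (E' k)) (sf_trop \<tau> (E' k))"
        using bd[OF k] by blast
      obtain B where B: "B \<ge> 1" "\<And>s j. 0 < s \<Longrightarrow> s \<le> 1 \<Longrightarrow> j \<in> {1..N} \<Longrightarrow> near B s (cact (curve x s) (dd s) i j) (atr i m x j)"
        "\<And>s. 0 < s \<Longrightarrow> s \<le> 1 \<Longrightarrow> (\<Sum>j\<in>occ i. Tm (curve x s) j) \<noteq> 0"
        using cact_curve[OF i, of x m] unfolding dd_def by blast
      show ?thesis unfolding \<tau>_def[symmetric]
      proof (rule near_unique[OF A(1) B(1)])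
        fix s :: real assume s: "0 < s" "s \<le> 1"
        show "near A s (sf_eval (\<rho> s) (E' k)) (sf_trop \<tau> (E' k))" by (rule A(2)[OF s])
        have nE: "sf_defined (\<rho> s) (E' j) \<and> sf_eval (\<rho> s) (E' j) \<noteq> 0" if j: "j \<in> {1..N}" for j
          using bd[OF j] s near_pos(2) by blast
        have c: "nz (curve x s)" by (rule nz_curve[OF s(1)])
        have nc: "nz (cact (curve x s) (dd s) i)" using B(2)[OF s] near_pos(2) B(1) s(1) by blast
        have d: "dd s \<noteq> 0" using s by (simp add: dd_def)
        have 1: "gc_act n i (dd s) (id \<circ> Theta n (curve x s)) = id \<circ> Theta n (cact (curve x s) (dd s) i)"
          by (rule act_chart'[OF i Tor_ops(1) c d B(3)[OF s] nc])
        have "in_chart n id (curve x s)" unfolding chart using Tor_ops(1) c by blast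
        moreover have "chi_neg n i (neg_part n (id \<circ> Theta n (curve x s))) \<noteq> 0"
          unfolding gamma_eps_chart(2)[OF Tor_ops(1) c i] by (rule B(3)[OF s])
        ultimately have 2: "gc_act n i (dd s) (id \<circ> Theta n (curve x s)) = id \<circ> Theta n (\<lambda>k. sf_eval (\<rho> s) (E' k))"
          using E'(1) d nE unfolding represents_act_def Let_def \<rho>_def by blast
        have "Theta n (cact (curve x s) (dd s) i) = Theta n (\<lambda>k. sf_eval (\<rho> s) (E' k))"
          using 1 2 by (simp only: id_comp)
        from Theta_inj[OF nc _ this k] have "cact (curve x s) (dd s) i k = sf_eval (\<rho> s) (E' k)" using nE by blast
        then show "near B s (sf_eval (\<rho> s) (E' k)) (atr i m x k)" using B(2)[OF s k] by simp
      qed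
    qed
    then show "p = atr i" unfolding E'(2) by (intro ext) (auto simp: atr_def)
  qed
  then show ?thesis by simp
qed

text \<open>The shift formula with the negative terms moved across: decoration of the image plus
  \<phi>_i + \<epsilon>_i equals the old decoration plus d \<phi>_i + \<epsilon>_i / d. All terms
  are now positive, so both sides can be tropicalized.\<close>

lemma act_decoration:
  fixes l :: weight and x :: "nat \<Rightarrow> int"
  assumes i: "i \<in> I" and g: "sfr Vchart Fexp g"
  defines "\<phi> \<equiv> sig_max n i x - sig0 n l i x" and "\<epsilon> \<equiv> sig_max n i x"
  shows "min (g (assign l (atr i m x) 0)) (min \<phi> \<epsilon>) = min (g (assign l x 0)) (min (m + \<phi>) (\<epsilon> - m))"
proof -
  define dd where "dd s = complex_of_real (s powr real_of_int m)" for s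
  define \<tau> where "\<tau> = assign l x m"
  define t where "t s = (SOME t. t \<in> Tor n \<and> (\<forall>i\<in>I. root_char n i t = curve l s i))" for s
  define rc where "rc s j = root_char n j (t s)" for s j
  define \<rho> where "\<rho> s = assign (rc s) (curve x s) (dd s)" for s
  define \<rho>' where "\<rho>' s = assign (rc s) (cact (curve x s) (dd s) i) 0" for s
  define W where "W = insert ParVar Vchart"
  have t: "t s \<in> Tor n \<and> (\<forall>i\<in>I. rc s i = curve l s i)" if "0 < s" for s
    unfolding t_def rc_def
    by (rule someI_ex[where P = "\<lambda>t. t \<in> Tor n \<and> (\<forall>i\<in>I. root_char n i t = curve l s i)"])
      (use torus_curve[OF that, of l] in blast)
  have pv: "sfr W (\<lambda>\<rho>. \<rho> ParVar) (\<lambda>\<tau>. \<tau> ParVar)" by (rule sfr_var) (simp add: W_def)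
  have sub: "Vchart \<subseteq> W" by (auto simp: W_def)
  have ph: "sfr W (\<lambda>\<rho>. gam i \<rho> * (1 / chs i \<rho>)) (\<lambda>\<tau>. - sig0 n (\<lambda>j. \<tau> (RootVar j)) i (crd \<tau>) + sig_max n i (crd \<tau>))"
    by (rule sfr_mono[OF sfr_mult[OF sfr_gam[OF i] sfr_eps[OF i]] sub])
  have ep: "sfr W (\<lambda>\<rho>. 1 / chs i \<rho>) (\<lambda>\<tau>. sig_max n i (crd \<tau>))" by (rule sfr_mono[OF sfr_eps[OF i] sub])
  define R where "R \<rho> = Fexp \<rho> + (\<rho> ParVar * (gam i \<rho> * (1 / chs i \<rho>)) + 1 / chs i \<rho> / \<rho> ParVar)" for \<rho>
  have R: "sfr W R (\<lambda>\<tau>. min (g \<tau>) (min (\<tau> ParVar + (- sig0 n (\<lambda>j. \<tau> (RootVar j)) i (crd \<tau>) + sig_max n i (crd \<tau>))) (sig_max n i (crd \<tau>) - \<tau> ParVar)))"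
    unfolding R_def by (intro sfr_add sfr_mult sfr_divide pv ph ep sfr_mono[OF g sub])
  have L: "sfr W (\<lambda>\<rho>. gam i \<rho> * (1 / chs i \<rho>) + 1 / chs i \<rho>)
      (\<lambda>\<tau>. min (- sig0 n (\<lambda>j. \<tau> (RootVar j)) i (crd \<tau>) + sig_max n i (crd \<tau>)) (sig_max n i (crd \<tau>)))"
    by (intro sfr_add ph ep)
  have v: "near 1 s (\<rho> s v) (\<tau> v)" if "0 < s" "v \<in> W" for s v
    using t[OF that(1)] that(2) near_curve unfolding W_def \<rho>_def \<tau>_def dd_def by (auto simp: near_def)
  have \<tau>: "crd \<tau> = x" "(\<lambda>j. \<tau> (RootVar j)) = l" "\<tau> ParVar = m" by (simp_all add: \<tau>_def)
  have pf: "- sig0 n l i x + sig_max n i x = \<phi>" "sig_max n i x = \<epsilon>" by (simp_all add: \<phi>_def \<epsilon>_def)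
  have "\<exists>A\<ge>1. \<forall>s. 0 < s \<and> s \<le> 1 \<longrightarrow> near A s (R (\<rho> s)) (min (g \<tau>) (min (m + \<phi>) (\<epsilon> - m)))"
    using sfr_near_curve[where \<rho> = \<rho> and \<tau> = \<tau>, OF R order_refl v] unfolding \<tau> unfolding pf(1) unfolding pf(2) .
  then obtain A where A: "A \<ge> 1" "\<And>s. 0 < s \<Longrightarrow> s \<le> 1 \<Longrightarrow> near A s (R (\<rho> s)) (min (g \<tau>) (min (m + \<phi>) (\<epsilon> - m)))"
    by blast
  have "\<exists>A\<ge>1. \<forall>s. 0 < s \<and> s \<le> 1 \<longrightarrow> near A s (gam i (\<rho> s) * (1 / chs i (\<rho> s)) + 1 / chs i (\<rho> s)) (min \<phi> \<epsilon>)"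
    using sfr_near_curve[where \<rho> = \<rho> and \<tau> = \<tau>, OF L order_refl v] unfolding \<tau> unfolding pf(1) unfolding pf(2) .
  then obtain B where B: "B \<ge> 1" "\<And>s. 0 < s \<Longrightarrow> s \<le> 1 \<Longrightarrow> near B s (gam i (\<rho> s) * (1 / chs i (\<rho> s)) + 1 / chs i (\<rho> s)) (min \<phi> \<epsilon>)"
    by blast
  obtain C where C: "C \<ge> 1" "\<And>s k. 0 < s \<Longrightarrow> s \<le> 1 \<Longrightarrow> k \<in> {1..N} \<Longrightarrow> near C s (cact (curve x s) (dd s) i k) (atr i m x k)"
    "\<And>s. 0 < s \<Longrightarrow> s \<le> 1 \<Longrightarrow> (\<Sum>j\<in>occ i. Tm (curve x s) j) \<noteq> 0"
    using cact_curve[OF i, of x m] unfolding dd_def by blast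
  have v': "near C s (\<rho>' s v) (assign l (atr i m x) 0 v)" if s: "0 < s" "s \<le> 1" "v \<in> Vchart" for s v
  proof (cases "v \<in> RootVar ` {1..n}")
    case True
    then obtain j where j: "v = RootVar j" "j \<in> I" by blast
    have "near C s (curve l s j) (l j)" by (rule near_mono[OF near_curve C(1) order_refl s(1)])
    then show ?thesis using t[OF s(1)] j by (simp add: \<rho>'_def)
  next
    case False
    then obtain k where k: "v = CoordVar k" "k \<in> {1..N}" using s(3) by blast
    then show ?thesis using C(2)[OF s(1,2) k(2)] by (simp add: \<rho>'_def)
  qed
  have "\<exists>D\<ge>1. \<forall>s. 0 < s \<and> s \<le> 1 \<longrightarrow> near D s (Fexp (\<rho>' s)) (g (assign l (atr i m x) 0))"
    by (rule sfr_near_curve[where \<rho> = \<rho>' and \<tau> = "assign l (atr i m x) 0", OF g C(1) v'])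
  then obtain D where D: "D \<ge> 1" "\<And>s. 0 < s \<Longrightarrow> s \<le> 1 \<Longrightarrow> near D s (Fexp (\<rho>' s)) (g (assign l (atr i m x) 0))"
    by blast
  have DB: "D + B \<ge> 1" using D(1) B(1) by simp
  have "min (g (assign l (atr i m x) 0)) (min \<phi> \<epsilon>) = min (g \<tau>) (min (m + \<phi>) (\<epsilon> - m))"
  proof (rule near_unique[OF DB A(1)])
    fix s :: real assume s: "0 < s" "s \<le> 1"
    show "near A s (R (\<rho> s)) (min (g \<tau>) (min (m + \<phi>) (\<epsilon> - m)))" by (rule A(2)[OF s])
    have T: "t s \<in> Tor n" using t[OF s(1)] by blast
    have c: "nz (curve x s)" by (rule nz_curve[OF s(1)])
    have nc: "nz (cact (curve x s) (dd s) i)" using C(2)[OF s] near_pos(2) C(1) s(1) by blast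
    have d: "dd s \<noteq> 0" using s by (simp add: dd_def)
    have cr: "crd (\<rho> s) = curve x s" "crd (\<rho>' s) = cact (curve x s) (dd s) i" "(\<lambda>j. \<rho> s (RootVar j)) = rc s"
      "(\<lambda>j. \<rho>' s (RootVar j)) = rc s" "\<rho> s ParVar = dd s" by (simp_all add: \<rho>_def \<rho>'_def)
    have F: "decoration n (t s \<circ> Theta n (curve x s)) = Fexp (\<rho> s)"
      unfolding decoration_fval[OF T c] Fexp_def cr rc_def ..
    have F': "decoration n (t s \<circ> Theta n (cact (curve x s) (dd s) i)) = Fexp (\<rho>' s)"
      unfolding decoration_fval[OF T nc] Fexp_def cr rc_def ..
    have e: "gc_eps n i (t s \<circ> Theta n (curve x s)) = 1 / chs i (\<rho> s)"
      unfolding gamma_eps_chart(3)[OF T c i] chs_def cr ..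
    have p: "gc_phi n i (t s \<circ> Theta n (curve x s)) = gam i (\<rho> s) * (1 / chs i (\<rho> s))"
      unfolding gc_phi_def e gamma_eps_chart(1)[OF T c i] gam_def cr using fun_cong[OF cr(3), of i]
      by (simp add: rc_def)
    have "decoration n (gc_act n i (dd s) (t s \<circ> Theta n (curve x s))) =
        Fexp (\<rho> s) + (dd s - 1) * (gam i (\<rho> s) * (1 / chs i (\<rho> s))) + (inverse (dd s) - 1) * (1 / chs i (\<rho> s))"
      unfolding gc_act_def xg_xs p e decoration_shift[OF T c i] F ..
    then have "Fexp (\<rho>' s) + (gam i (\<rho> s) * (1 / chs i (\<rho> s)) + 1 / chs i (\<rho> s)) = R (\<rho> s)"
      unfolding act_chart'[OF i T c d C(3)[OF s] nc] F' R_def cr(5) by (simp add: algebra_simps divide_inverse)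
    then show "near (D + B) s (R (\<rho> s)) (min (g (assign l (atr i m x) 0)) (min \<phi> \<epsilon>))"
      using near_add[OF D(2)[OF s] D(1) B(2)[OF s] B(1) s] by simp
  qed
  \<comment> \<open>The expression behind g contains no \<open>ParVar\<close>, so the value m stored
    there in \<tau> can be replaced by 0.\<close>
  moreover have "g \<tau> = g (assign l x 0)"
  proof -
    obtain E where E: "set_sfexpr E \<subseteq> Vchart" "\<And>\<tau>. sf_trop \<tau> E = g \<tau>" using g unfolding sfr_def by blast
    have cong: "(\<And>v. v \<in> set_sfexpr E \<Longrightarrow> \<tau> v = \<tau>' v) \<Longrightarrow> sf_trop \<tau> E = sf_trop \<tau>' E" for \<tau> \<tau>' :: "coord \<Rightarrow> int" and E
      by (induction E) auto
    have "sf_trop \<tau> E = sf_trop (assign l x 0) E" by (rule cong) (use E(1) in \<open>auto simp: \<tau>_def\<close>)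
    then show ?thesis unfolding E(2) .
  qed
  ultimately show ?thesis by simp
qed

end

section \<open>The crystals\<close>

lemma is_crystal_cong:
  assumes D: "is_crystal n D" and el: "elems C = elems D"
    and w: "\<And>b. b \<in> elems D \<Longrightarrow> wt C b = wt D b"
    and e: "\<And>i b. i \<in> {1..n} \<Longrightarrow> b \<in> elems D \<Longrightarrow> eps C i b = eps D i b"
    and p: "\<And>i b. i \<in> {1..n} \<Longrightarrow> b \<in> elems D \<Longrightarrow> phi C i b = phi D i b"
    and et: "\<And>i b. i \<in> {1..n} \<Longrightarrow> b \<in> elems D \<Longrightarrow> etil C i b = etil D i b"
    and ft: "\<And>i b. i \<in> {1..n} \<Longrightarrow> b \<in> elems D \<Longrightarrow> ftil C i b = ftil D i b"
  shows "is_crystal n C"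
  unfolding is_crystal_def el
proof (intro ballI)
  fix i b assume i: "i \<in> {1..n}" and b: "b \<in> elems D"
  show "phi C i b = eps C i b + wt C b i \<and>
       (\<forall>b'. etil C i b = Some b' \<longrightarrow>
          b' \<in> elems D \<and> wt C b' = (\<lambda>j. wt C b j + simple_root n i j) \<and>
          eps C i b' = eps C i b - 1 \<and> phi C i b' = phi C i b + 1) \<and>
       (\<forall>b'. ftil C i b = Some b' \<longrightarrow>
          b' \<in> elems D \<and> wt C b' = (\<lambda>j. wt C b j - simple_root n i j) \<and>
          eps C i b' = eps C i b + 1 \<and> phi C i b' = phi C i b - 1) \<and>
       (\<forall>b'\<in>elems D. etil C i b = Some b' \<longleftrightarrow> ftil C i b' = Some b)"
    using bspec[OF bspec[OF D[unfolded is_crystal_def] i] b]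
    by (simp add: w e[OF i] p[OF i] et[OF i] ft[OF i] b cong: conj_cong)
qed

context type_D
begin

section \<open>Single steps at the first and last maximal positions\<close>

lemma sig_max_eqI:
  assumes "\<And>j. j \<in> occ i \<Longrightarrow> sig n j x \<le> v" "p \<in> occ i" "sig n p x = v"
  shows "sig_max n i x = v"
  unfolding sig_max_def
proof (rule Max_eqI)
  have "{sig n m x | m. m \<in> {1..N} \<and> letter n m = i} = (\<lambda>m. sig n m x) ` occ i" by auto
  then show "finite {sig n m x | m. m \<in> {1..N} \<and> letter n m = i}" by simp
qed (use assms in auto)

lemma sig_le_max: "j \<in> occ i \<Longrightarrow> sig n j x \<le> sig_max n i x"
proof -
  assume j: "j \<in> occ i"
  have e: "{sig n m x | m. m \<in> {1..N} \<and> letter n m = i} = (\<lambda>m. sig n m x) ` occ i" by auto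
  show ?thesis unfolding sig_max_def e by (rule Max_ge) (use j in auto)
qed

lemma sig_argmax_occ: "j \<in> sig_argmax n i x \<longleftrightarrow> j \<in> occ i \<and> sig n j x = sig_max n i x"
  by (auto simp: sig_argmax_def)

lemma sig_argmax_finite: "finite (sig_argmax n i x)"
  by (rule finite_subset[OF _ occ_finite[of i]]) (auto simp: sig_argmax_def)

lemma sig_argmax_ne: "i \<in> I \<Longrightarrow> sig_argmax n i x \<noteq> {}"
proof -
  assume i: "i \<in> I"
  have e: "{sig n m x | m. m \<in> {1..N} \<and> letter n m = i} = (\<lambda>m. sig n m x) ` occ i" by auto
  have "sig_max n i x \<in> (\<lambda>m. sig n m x) ` occ i"
    unfolding sig_max_def e by (rule Max_in) (use occ_ne[OF i] in simp_all)
  then obtain m where "m \<in> occ i" "sig_max n i x = sig n m x" by (rule imageE)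
  then have "m \<in> sig_argmax n i x" unfolding sig_argmax_occ by simp
  then show ?thesis by blast
qed

abbreviation "ptop i x \<equiv> Max (sig_argmax n i x)"
abbreviation "pbot i x \<equiv> Min (sig_argmax n i x)"

lemma ptop: "i \<in> I \<Longrightarrow> ptop i x \<in> sig_argmax n i x" "j \<in> sig_argmax n i x \<Longrightarrow> j \<le> ptop i x"
  using sig_argmax_finite sig_argmax_ne by simp_all

lemma pbot: "i \<in> I \<Longrightarrow> pbot i x \<in> sig_argmax n i x" "j \<in> sig_argmax n i x \<Longrightarrow> pbot i x \<le> j"
  using sig_argmax_finite sig_argmax_ne by simp_all

lemma above_ptop: "j \<in> occ i \<Longrightarrow> ptop i x < j \<Longrightarrow> sig n j x \<le> sig_max n i x - 1"
  using ptop(2)[of j i x] sig_le_max[of j i x] sig_argmax_occ[of j i x] by force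

lemma below_pbot: "j \<in> occ i \<Longrightarrow> j < pbot i x \<Longrightarrow> sig n j x \<le> sig_max n i x - 1"
  using pbot(2)[of j i x] sig_le_max[of j i x] sig_argmax_occ[of j i x] by force

text \<open>Adding 1 to the terms before k changes the minimum only when every maximal position lies
  before k. Consecutive values therefore differ exactly at the last maximal position.\<close>

lemma mS_up:
  assumes i: "i \<in> I"
  shows "mS i 1 x k = - sig_max n i x + (if k \<le> ptop i x then 0 else 1)"
proof -
  define p where "p = ptop i x"
  have p: "p \<in> occ i" "sig n p x = sig_max n i x" using ptop(1)[OF i, of x] unfolding p_def sig_argmax_occ by auto
  show ?thesis unfolding mS_def p_def[symmetric]
  proof (rule Min_eqI)
    show "- sig_max n i x + (if k \<le> p then 0 else 1) \<in> (\<lambda>m. if m < k then 1 - sig n m x else - sig n m x) ` occ i"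
      by (rule image_eqI[OF _ p(1)]) (use p(2) in auto)
  next
    fix y assume "y \<in> (\<lambda>m. if m < k then 1 - sig n m x else - sig n m x) ` occ i"
    then obtain j where j: "j \<in> occ i" "y = (if j < k then 1 - sig n j x else - sig n j x)" by blast
    show "- sig_max n i x + (if k \<le> p then 0 else 1) \<le> y"
      using sig_le_max[OF j(1), of x] above_ptop[OF j(1), of x] unfolding j(2) p_def by auto
  qed simp
qed

lemma mS_down:
  assumes i: "i \<in> I"
  shows "mS i (-1) x k = - sig_max n i x + (if pbot i x < k then -1 else 0)"
proof -
  define p where "p = pbot i x"
  have p: "p \<in> occ i" "sig n p x = sig_max n i x" using pbot(1)[OF i, of x] unfolding p_def sig_argmax_occ by auto
  show ?thesis unfolding mS_def p_def[symmetric]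
  proof (rule Min_eqI)
    show "- sig_max n i x + (if p < k then -1 else 0) \<in> (\<lambda>m. if m < k then - 1 - sig n m x else - sig n m x) ` occ i"
      by (rule image_eqI[OF _ p(1)]) (use p(2) in auto)
  next
    fix y assume "y \<in> (\<lambda>m. if m < k then - 1 - sig n m x else - sig n m x) ` occ i"
    then obtain j where j: "j \<in> occ i" "y = (if j < k then - 1 - sig n j x else - sig n j x)" by blast
    show "- sig_max n i x + (if p < k then -1 else 0) \<le> y"
      using sig_le_max[OF j(1), of x] below_pbot[OF j(1), of x] unfolding j(2) p_def by auto
  qed simp
qed

lemma atr_up:
  assumes i: "i \<in> I" and x: "x \<in> lattice n"
  shows "atr i 1 x = x(ptop i x := x (ptop i x) - 1)"
proof
  fix k
  have p: "ptop i x \<in> occ i" using ptop(1)[OF i, of x] sig_argmax_occ by blast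
  have x0: "x k = 0" if "k \<notin> {1..N}" using x that by (simp add: lattice_def)
  show "atr i 1 x k = (x(ptop i x := x (ptop i x) - 1)) k"
    unfolding atr_def mS_up[OF i] using p x0 by auto
qed

lemma atr_down:
  assumes i: "i \<in> I" and x: "x \<in> lattice n"
  shows "atr i (-1) x = x(pbot i x := x (pbot i x) + 1)"
proof
  fix k
  have p: "pbot i x \<in> occ i" using pbot(1)[OF i, of x] sig_argmax_occ by blast
  have x0: "x k = 0" if "k \<notin> {1..N}" using x that by (simp add: lattice_def)
  show "atr i (-1) x k = (x(pbot i x := x (pbot i x) + 1)) k"
    unfolding atr_def mS_down[OF i] using p x0 by auto
qed

lemma sum_upd:
  fixes x f :: "nat \<Rightarrow> int"
  assumes "finite A"
  shows "(\<Sum>k\<in>A. f k * (x(p := x p + d)) k) = (\<Sum>k\<in>A. f k * x k) + (if p \<in> A then f p * d else 0)"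
proof -
  have "(\<Sum>k\<in>A. f k * (x(p := x p + d)) k) = (\<Sum>k\<in>A. f k * x k + (if k = p then f k * d else 0))"
    by (rule sum.cong) (auto simp: algebra_simps)
  then show ?thesis using assms by (simp add: sum.distrib)
qed

lemma sig_upd:
  assumes "p \<in> {1..N}"
  shows "sig n j (x(p := x p + d)) = sig n j x + (if j = p then d else if j < p then cartan n (letter n j) (letter n p) * d else 0)"
proof -
  have "(x(p := x p + d)) j = x j + (if j = p then d else 0)" by simp
  then show ?thesis
    unfolding sig_def sum_upd[of "{j<..N}" "\<lambda>k. cartan n (letter n j) (letter n k)" x p d, OF finite_greaterThanAtMost]
    using assms by auto
qed

lemma sig0_upd: "p \<in> {1..N} \<Longrightarrow> sig0 n l i (x(p := x p + d)) = sig0 n l i x + cartan n i (letter n p) * d"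
  unfolding sig0_def sum_upd[of "{1..N}" "\<lambda>k. cartan n i (letter n k)" x p d, OF finite_atLeastAtMost] by simp

lemma wt_upd:
  assumes "p \<in> {1..N}"
  shows "Sigma_wt n l (x(p := x p + d)) = (\<lambda>j. Sigma_wt n l x j - d * simple_root n (letter n p) j)"
proof
  fix j
  have "(\<Sum>k\<in>{1..N}. (x(p := x p + d)) k * simple_root n (letter n k) j) =
      (\<Sum>k\<in>{1..N}. x k * simple_root n (letter n k) j) + simple_root n (letter n p) j * d"
    using sum_upd[of "{1..N}" "\<lambda>k. simple_root n (letter n k) j" x p d, OF finite_atLeastAtMost] assms
    by (simp only: mult.commute if_True)
  then show "Sigma_wt n l (x(p := x p + d)) j = Sigma_wt n l x j - d * simple_root n (letter n p) j"
    unfolding Sigma_wt_def by (simp only: diff_diff_add mult.commute)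
qed

text \<open>Lowering coordinate p reduces \<sigma> by 1 at p and by 2 at earlier occurrences; later
  ones were already smaller. So the new maximum drops by 1 and p becomes its first position, which
  makes the opposite step undo this one.\<close>

lemma step_up:
  fixes x :: "nat \<Rightarrow> int"
  assumes i: "i \<in> I"
  defines "p \<equiv> ptop i x" and "y \<equiv> x(ptop i x := x (ptop i x) - 1)"
  shows "p \<in> {1..N}" "letter n p = i" "sig_max n i y = sig_max n i x - 1" "pbot i y = p"
    "sig0 n l i y = sig0 n l i x - 2" "Sigma_wt n l y = (\<lambda>j. Sigma_wt n l x j + simple_root n i j)"
proof -
  have y: "y = x(p := x p + (-1))" by (simp add: y_def p_def)
  have po: "p \<in> occ i" "sig n p x = sig_max n i x" using ptop(1)[OF i, of x] unfolding p_def sig_argmax_occ by auto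
  then show p: "p \<in> {1..N}" "letter n p = i" by auto
  have s: "sig n j y = sig n j x + (if j = p then -1 else if j < p then -2 else 0)" if "j \<in> occ i" for j
    unfolding y sig_upd[OF p(1)] using that p(2) cartan_diag[OF i] by auto
  show m: "sig_max n i y = sig_max n i x - 1"
  proof (rule sig_max_eqI[OF _ po(1)])
    show "sig n j y \<le> sig_max n i x - 1" if "j \<in> occ i" for j
      using sig_le_max[OF that, of x] above_ptop[OF that, of x] unfolding s[OF that] p_def by auto
    show "sig n p y = sig_max n i x - 1" unfolding s[OF po(1)] using po(2) by simp
  qed
  show "pbot i y = p"
  proof (rule Min_eqI[OF sig_argmax_finite])
    show "p \<in> sig_argmax n i y" unfolding sig_argmax_occ m s[OF po(1)] using po by simp
    show "p \<le> j" if "j \<in> sig_argmax n i y" for j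
    proof (rule ccontr)
      have j: "j \<in> occ i" "sig n j y = sig_max n i x - 1" using that unfolding sig_argmax_occ m by auto
      assume "\<not> p \<le> j"
      then show False using s[OF j(1)] j(2) sig_le_max[OF j(1), of x] by auto
    qed
  qed
  show "sig0 n l i y = sig0 n l i x - 2" unfolding y sig0_upd[OF p(1)] p(2) using cartan_diag[OF i] by simp
  show "Sigma_wt n l y = (\<lambda>j. Sigma_wt n l x j + simple_root n i j)" unfolding y wt_upd[OF p(1)] p(2) by simp
qed

lemma step_down:
  fixes x :: "nat \<Rightarrow> int"
  assumes i: "i \<in> I"
  defines "p \<equiv> pbot i x" and "y \<equiv> x(pbot i x := x (pbot i x) + 1)"
  shows "p \<in> {1..N}" "letter n p = i" "sig_max n i y = sig_max n i x + 1" "ptop i y = p"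
    "sig0 n l i y = sig0 n l i x + 2" "Sigma_wt n l y = (\<lambda>j. Sigma_wt n l x j - simple_root n i j)"
proof -
  have y: "y = x(p := x p + 1)" by (simp add: y_def p_def)
  have po: "p \<in> occ i" "sig n p x = sig_max n i x" using pbot(1)[OF i, of x] unfolding p_def sig_argmax_occ by auto
  then show p: "p \<in> {1..N}" "letter n p = i" by auto
  have s: "sig n j y = sig n j x + (if j = p then 1 else if j < p then 2 else 0)" if "j \<in> occ i" for j
    unfolding y sig_upd[OF p(1)] using that p(2) cartan_diag[OF i] by auto
  show m: "sig_max n i y = sig_max n i x + 1"
  proof (rule sig_max_eqI[OF _ po(1)])
    show "sig n j y \<le> sig_max n i x + 1" if "j \<in> occ i" for j
      using sig_le_max[OF that, of x] below_pbot[OF that, of x] unfolding s[OF that] p_def by auto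
    show "sig n p y = sig_max n i x + 1" unfolding s[OF po(1)] using po(2) by simp
  qed
  show "ptop i y = p"
  proof (rule Max_eqI[OF sig_argmax_finite])
    show "p \<in> sig_argmax n i y" unfolding sig_argmax_occ m s[OF po(1)] using po by simp
    show "j \<le> p" if "j \<in> sig_argmax n i y" for j
    proof (rule ccontr)
      have j: "j \<in> occ i" "sig n j y = sig_max n i x + 1" using that unfolding sig_argmax_occ m by auto
      assume "\<not> j \<le> p"
      then show False using s[OF j(1)] j(2) sig_le_max[OF j(1), of x] by auto
    qed
  qed
  show "sig0 n l i y = sig0 n l i x + 2" unfolding y sig0_upd[OF p(1)] p(2) using cartan_diag[OF i] by simp
  show "Sigma_wt n l y = (\<lambda>j. Sigma_wt n l x j - simple_root n i j)" unfolding y wt_upd[OF p(1)] p(2) by simp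
qed

lemma wt_sig0: "Sigma_wt n l x i = - sig0 n l i x"
  unfolding Sigma_wt_def sig0_def simple_root_def by (simp add: mult.commute)

text \<open>After the last occurrence of the letter i only the rest of the final block contributes
  to \<sigma>, so the value is a single form in the coordinates of that block.\<close>

lemma last_occ:
  assumes i: "i \<in> I"
  shows "(n - 2) * n + i \<in> occ i"
    "sig n ((n - 2) * n + i) x = dbl n x (n - 1) i + (\<Sum>j\<in>{i<..n}. cartan n i j * dbl n x (n - 1) j)"
proof -
  have in1: "n - 1 \<in> {1..n - 1}" "n - 1 - 1 = n - 2" using n4 by auto
  have ii: "(n - 2) * n + j \<in> {1..N}" if "j \<in> I" for j using index_in[OF in1(1) that] unfolding in1(2) .
  have lt: "letter n ((n - 2) * n + j) = j" if "j \<in> I" for j by (rule letter_block) (use that in auto)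
  show "(n - 2) * n + i \<in> occ i" using ii[OF i] lt[OF i] by simp
  have d: "dbl n x (n - 1) j = x ((n - 2) * n + j)" if "j \<in> I" for j
    using that in1 unfolding dbl_def by (simp del: One_nat_def)
  have NN: "N = (n - 2) * n + n"
  proof -
    have "n - 1 = Suc (n - 2)" using n4 by simp
    then show ?thesis by (simp add: algebra_simps)
  qed
  have im: "{(n - 2) * n + i<..N} = (\<lambda>j. (n - 2) * n + j) ` {i<..n}"
    unfolding NN by (simp add: image_add_greaterThanAtMost)
  have "(\<Sum>k\<in>{(n - 2) * n + i<..N}. cartan n (letter n ((n - 2) * n + i)) (letter n k) * x k) =
     (\<Sum>j\<in>{i<..n}. cartan n i (letter n ((n - 2) * n + j)) * x ((n - 2) * n + j))"
    unfolding im lt[OF i] by (subst sum.reindex) (auto simp: inj_on_def)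
  also have "\<dots> = (\<Sum>j\<in>{i<..n}. cartan n i j * dbl n x (n - 1) j)"
  proof (rule sum.cong[OF refl])
    fix j assume "j \<in> {i<..n}"
    then have j: "j \<in> I" using i by auto
    show "cartan n i (letter n ((n - 2) * n + j)) * x ((n - 2) * n + j) = cartan n i j * dbl n x (n - 1) j"
      unfolding lt[OF j] d[OF j] ..
  qed
  finally show "sig n ((n - 2) * n + i) x = dbl n x (n - 1) i + (\<Sum>j\<in>{i<..n}. cartan n i j * dbl n x (n - 1) j)"
    unfolding sig_def d[OF i] by simp
qed

text \<open>In \<sigma> - \<sigma>_0 at the first occurrence all later letters cancel, which leaves
  a form in the beginning of the first block.\<close>

lemma first_occ:
  assumes i: "i \<in> I"
  shows "i \<in> occ i" "sig n i x - sig0 n l i x = l i - dbl n x 1 i - (\<Sum>j\<in>{1..<i}. cartan n i j * dbl n x 1 j)"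
proof -
  have in1: "1 \<in> {1..n - 1}" using n4 by auto
  have ii: "j \<in> {1..N}" if "j \<in> I" for j using index_in[OF in1 that] by simp
  have lt: "letter n j = j" if "j \<in> I" for j using letter_block[of j n 0] that by simp
  show "i \<in> occ i" using ii[OF i] lt[OF i] by simp
  have d: "dbl n x 1 j = x j" if "j \<in> I" for j using that in1 unfolding dbl_def by simp
  have iN: "1 \<le> i" "i \<le> N" using ii[OF i] by auto
  have "{1..N} = {1..<i} \<union> insert i {i<..N}" "{1..<i} \<inter> insert i {i<..N} = {}" using iN by auto
  then have "(\<Sum>k\<in>{1..N}. cartan n i (letter n k) * x k) =
     (\<Sum>k\<in>{1..<i}. cartan n i (letter n k) * x k) + (cartan n i (letter n i) * x i + (\<Sum>k\<in>{i<..N}. cartan n i (letter n k) * x k))"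
    by (simp add: sum.union_disjoint)
  moreover have "(\<Sum>k\<in>{1..<i}. cartan n i (letter n k) * x k) = (\<Sum>j\<in>{1..<i}. cartan n i j * dbl n x 1 j)"
  proof (rule sum.cong[OF refl])
    fix j assume "j \<in> {1..<i}"
    then have j: "j \<in> I" using i by auto
    show "cartan n i (letter n j) * x j = cartan n i j * dbl n x 1 j" unfolding lt[OF j] d[OF j] ..
  qed
  ultimately show "sig n i x - sig0 n l i x = l i - dbl n x 1 i - (\<Sum>j\<in>{1..<i}. cartan n i j * dbl n x 1 j)"
    unfolding sig_def sig0_def lt[OF i] cartan_diag[OF i] d[OF i] by simp
qed

text \<open>The form at the last occurrence belongs to \<open>Xi\<close>, the one at the first
  occurrence, up to the constant l i, to \<open>Xi'\<close>. Each maximum is at least the value at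
  the occurrence in question.\<close>

lemma Sigma_nonneg:
  assumes x: "x \<in> Sigma_set n l" and i: "i \<in> I"
  shows "0 \<le> sig_max n i x" "sig0 n l i x \<le> sig_max n i x"
proof -
  have X: "\<And>k f. k \<in> I \<Longrightarrow> f \<in> Xi n k \<Longrightarrow> 0 \<le> f x" and X': "\<And>k f. k \<in> I \<Longrightarrow> f \<in> Xi' n k \<Longrightarrow> 0 \<le> l k + f x"
    using x unfolding Sigma_set_def by blast+
  have nn: "n - 1 \<noteq> n" "n \<noteq> n - 1" "\<not> n - 1 \<le> n - 2" "\<not> n \<le> n - 2" "n - 2 + 1 = n - 1" "n - 2 \<noteq> n - 1" "n - 2 \<noteq> n" using n4 by auto
  consider "i \<le> n - 3" | "i = n - 2" | "i = n - 1" | "i = n" using i by fastforce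
  then have "0 \<le> dbl n x (n - 1) i + (\<Sum>j\<in>{i<..n}. cartan n i j * dbl n x (n - 1) j)"
  proof cases
    case 1
    then have k: "1 \<le> i \<and> i \<le> n - 2" "i + 2 \<le> n - 1" "n + i - (n - 1) - 1 = i" "n + i - (n - 1) = i + 1" "i + 1 \<le> n" using i n4 by auto
    have "(\<Sum>j\<in>{i<..n}. cartan n i j * dbl n x (n - 1) j) = (\<Sum>j\<in>{i + 1}. cartan n i j * dbl n x (n - 1) j)"
      by (rule sum.mono_neutral_right) (use k i in \<open>auto simp: cartan_def doubleton_eq_iff\<close>)
    moreover have "cartan n i (i + 1) = -1" using k i by (auto simp: cartan_def doubleton_eq_iff)
    moreover have "(\<lambda>x. dbl n x (n - 1) (n + i - (n - 1) - 1) - dbl n x (n - 1) (n + i - (n - 1))) \<in> Xi n i"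
      unfolding Xi_def if_P[OF k(1)] using k(2) by blast
    from X[OF i this] have "0 \<le> dbl n x (n - 1) i - dbl n x (n - 1) (i + 1)" unfolding k(3) unfolding k(4) .
    ultimately show ?thesis by simp
  next
    case 2
    have k: "1 \<le> i \<and> i \<le> n - 2" "{i<..n} = {n - 1, n}" using 2 i n4 by auto
    have "(\<lambda>x. dbl n x (i + 1) (n - 2) - dbl n x (i + 1) (n - 1) - dbl n x (i + 1) n) \<in> Xi n i"
      unfolding Xi_def if_P[OF k(1)] by blast
    from X[OF i this] have "0 \<le> dbl n x (n - 1) i - dbl n x (n - 1) (n - 1) - dbl n x (n - 1) n" unfolding 2 nn(5) .
    moreover have "cartan n i (n - 1) = -1" "cartan n i n = -1" using 2 n4 by (auto simp: cartan_def doubleton_eq_iff)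
    ultimately show ?thesis unfolding k(2) using nn(1) by simp
  next
    case 3
    have k: "{i<..n} = {n}" using 3 n4 by auto
    have "cartan n (n - 1) n = 0" using nn by (auto simp: cartan_def doubleton_eq_iff)
    moreover have "(\<lambda>x. dbl n x (n - 1) (n - 1)) \<in> Xi n (n - 1)" using nn unfolding Xi_def by simp
    from X[OF _ this] have "0 \<le> dbl n x (n - 1) (n - 1)" using n4 by simp
    ultimately show ?thesis unfolding k unfolding 3 by simp
  next
    case 4
    have "(\<lambda>x. dbl n x (n - 1) n) \<in> Xi n n" using nn unfolding Xi_def by simp
    from X[OF _ this] have "0 \<le> dbl n x (n - 1) n" using n4 by simp
    then show ?thesis unfolding 4 by simp
  qed
  then show "0 \<le> sig_max n i x" using sig_le_max[OF last_occ(1)[OF i], of x] unfolding last_occ(2)[OF i] by linarith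
  have c0: "cartan n i j = 0" if "j < i" "j + 1 \<noteq> i" "\<not> (i = n \<and> j = n - 2)" for j
    using that nn by (auto simp: cartan_def doubleton_eq_iff)
  \<comment> \<open>The sequence [1] yields the inequalities of the first block for the letters n -
    1 and n.\<close>
  have mem: "[1] \<in> M_seqs n" using n4 by (auto simp: M_seqs_def)
  consider "i = 1" | "2 \<le> i" "i \<le> n - 2" | "i = n - 1" | "i = n" using i by fastforce
  then have "0 \<le> l i - dbl n x 1 i - (\<Sum>j\<in>{1..<i}. cartan n i j * dbl n x 1 j)"
  proof cases
    case 1
    have k: "1 \<le> i \<and> i \<le> n - 2" using 1 n4 by auto
    have "(\<lambda>x. dbl n x 1 (i - 1) - dbl n x 1 (i - 1 + 1)) \<in> Xi' n i"
      unfolding Xi'_def if_P[OF k] using k by blast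
    from X'[OF i this] show ?thesis using 1 by (simp add: dbl_def)
  next
    case 2
    have k: "1 \<le> i \<and> i \<le> n - 2" "i - 1 + 1 = i" using 2 by auto
    have "(\<Sum>j\<in>{1..<i}. cartan n i j * dbl n x 1 j) = (\<Sum>j\<in>{i - 1}. cartan n i j * dbl n x 1 j)"
      by (rule sum.mono_neutral_right) (use 2 c0 nn in auto)
    moreover have "cartan n i (i - 1) = -1" using 2 i by (auto simp: cartan_def doubleton_eq_iff)
    moreover have "(\<lambda>x. dbl n x 1 (i - 1) - dbl n x 1 (i - 1 + 1)) \<in> Xi' n i"
      unfolding Xi'_def if_P[OF k(1)] using k(1) by blast
    from X'[OF i this] have "0 \<le> l i + (dbl n x 1 (i - 1) - dbl n x 1 i)" unfolding k(2) .
    ultimately show ?thesis by simp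
  next
    case 3
    have "(\<Sum>j\<in>{1..<i}. cartan n i j * dbl n x 1 j) = (\<Sum>j\<in>{n - 2}. cartan n i j * dbl n x 1 j)"
      by (rule sum.mono_neutral_right) (use 3 c0 nn n4 in auto)
    moreover have "cartan n i (n - 2) = -1" using 3 n4 by (auto simp: cartan_def doubleton_eq_iff)
    moreover have "phi1 n [1] \<in> Xi' n (n - 1)" using nn mem unfolding Xi'_def by auto
    from X'[OF _ this] have "0 \<le> l (n - 1) + phi1 n [1] x" using n4 by simp
    moreover have "phi1 n [1] x = dbl n x 1 (n - 2) - dbl n x 1 (n - 1)"
      using nn n4 by (simp add: phi1_def eps_mu_def X1_def numeral_2_eq_2)
    ultimately show ?thesis unfolding 3 by simp
  next
    case 4
    have "(\<Sum>j\<in>{1..<i}. cartan n i j * dbl n x 1 j) = (\<Sum>j\<in>{n - 2, n - 1}. cartan n i j * dbl n x 1 j)"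
      by (rule sum.mono_neutral_right) (use 4 c0 nn n4 in auto)
    moreover have "cartan n n (n - 2) = -1" "cartan n n (n - 1) = 0" using n4 by (auto simp: cartan_def doubleton_eq_iff)
    moreover have "phi2 n [1] \<in> Xi' n n" using nn mem unfolding Xi'_def by auto
    from X'[OF _ this] have "0 \<le> l n + phi2 n [1] x" using n4 by simp
    moreover have "phi2 n [1] x = dbl n x 1 (n - 2) - dbl n x 1 n"
      using nn n4 by (simp add: phi2_def eps_mu_def X2_def numeral_2_eq_2)
    ultimately show ?thesis unfolding 4 using nn(6) by simp
  qed
  then show "sig0 n l i x \<le> sig_max n i x"
    using sig_le_max[OF first_occ(1)[OF i], of x] first_occ(2)[OF i, of x l] by linarith
qed

text \<open>If the image lies in the set, nonnegativity of \<epsilon>_i or \<phi>_i there gives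
  positivity before the step. Conversely, positivity makes the right-hand side of
  \<open>act_decoration\<close> nonnegative, hence also the decoration of the image.\<close>

lemma closure:
  assumes x: "x \<in> Sigma_set n l" and i: "i \<in> I"
  shows "x(ptop i x := x (ptop i x) - 1) \<in> Sigma_set n l \<longleftrightarrow> sig_max n i x > 0"
    "x(pbot i x := x (pbot i x) + 1) \<in> Sigma_set n l \<longleftrightarrow> sig_max n i x > sig0 n l i x"
proof -
  obtain g where g: "sfr Vchart Fexp g" using Fexp_sfr by blast
  have mem: "y \<in> Sigma_set n l \<longleftrightarrow> y \<in> lattice n \<and> 0 \<le> g (assign l y 0)" for y
    unfolding B_set_eq[symmetric] B_set_def UD_decoration[OF g] by simp
  have lat: "x \<in> lattice n" and gx: "0 \<le> g (assign l x 0)" using x mem by auto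
  note nonneg = Sigma_nonneg[OF x i]
  define y where "y = x(ptop i x := x (ptop i x) - 1)"
  define z where "z = x(pbot i x := x (pbot i x) + 1)"
  have y: "y = atr i 1 x" and z: "z = atr i (-1) x" unfolding y_def z_def using atr_up[OF i lat] atr_down[OF i lat] by simp_all
  have yl: "y \<in> lattice n" "z \<in> lattice n" unfolding y z by (auto simp: lattice_def atr_def)
  note A = act_decoration[where x = x and l = l, OF i g]
  show "x(ptop i x := x (ptop i x) - 1) \<in> Sigma_set n l \<longleftrightarrow> sig_max n i x > 0"
    unfolding y_def[symmetric]
  proof
    assume "y \<in> Sigma_set n l"
    then have "0 \<le> sig_max n i y" using Sigma_nonneg(1) i by blast
    then show "sig_max n i x > 0" using step_up(3)[where x = x, OF i] unfolding y_def by linarith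
  next
    assume "sig_max n i x > 0"
    then have "0 \<le> min (g (assign l x 0)) (min (1 + (sig_max n i x - sig0 n l i x)) (sig_max n i x - 1))"
      using gx nonneg by simp
    then have "0 \<le> g (assign l y 0)" unfolding A[where m = 1, symmetric] y by simp
    then show "y \<in> Sigma_set n l" using mem yl by blast
  qed
  show "x(pbot i x := x (pbot i x) + 1) \<in> Sigma_set n l \<longleftrightarrow> sig_max n i x > sig0 n l i x"
    unfolding z_def[symmetric]
  proof
    assume "z \<in> Sigma_set n l"
    then have "sig0 n l i z \<le> sig_max n i z" using Sigma_nonneg(2) i by blast
    then show "sig_max n i x > sig0 n l i x" using step_down(3)[where x = x, OF i] step_down(5)[where x = x and l = l, OF i] unfolding z_def by simp
  next
    assume "sig_max n i x > sig0 n l i x"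
    then have "0 \<le> min (g (assign l x 0)) (min (-1 + (sig_max n i x - sig0 n l i x)) (sig_max n i x - (-1)))"
      using gx nonneg by simp
    then have "0 \<le> g (assign l z 0)" unfolding A[where m = "-1", symmetric] z by simp
    then show "z \<in> Sigma_set n l" using mem yl by blast
  qed
qed

abbreviation "SC l \<equiv> Sigma_crystal n l"

lemma Sigma_maps:
  assumes x: "x \<in> Sigma_set n l" and i: "i \<in> I"
  shows "etil (SC l) i x = (if sig_max n i x > 0 then Some (x(ptop i x := x (ptop i x) - 1)) else None)"
    "ftil (SC l) i x = (if sig_max n i x > sig0 n l i x then Some (x(pbot i x := x (pbot i x) + 1)) else None)"
  using Sigma_nonneg(2)[OF x i] by (simp_all add: Sigma_crystal_def Let_def)

lemma Sigma_is_crystal: "is_crystal n (SC l)"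
  unfolding is_crystal_def
proof (intro ballI conjI allI impI)
  fix i b assume i: "i \<in> I" and "b \<in> elems (SC l)"
  then have b: "b \<in> Sigma_set n l" by (simp add: Sigma_crystal_def)
  show "phi (SC l) i b = eps (SC l) i b + wt (SC l) b i" by (simp add: Sigma_crystal_def)
  have d: "simple_root n i i = 2" unfolding simple_root_def by (rule cartan_diag[OF i])
  {
    fix b' assume "etil (SC l) i b = Some b'"
    then have b': "sig_max n i b > 0" "b' = b(ptop i b := b (ptop i b) - 1)"
      unfolding Sigma_maps[OF b i] by (auto split: if_splits)
    have "b' \<in> Sigma_set n l" using closure(1)[OF b i] b' by simp
    then show "b' \<in> elems (SC l)" by (simp add: Sigma_crystal_def)
    show w: "wt (SC l) b' = (\<lambda>j. wt (SC l) b j + simple_root n i j)"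
      unfolding b'(2) using step_up(6)[where l = l and x = b, OF i] by (simp add: Sigma_crystal_def)
    show e: "eps (SC l) i b' = eps (SC l) i b - 1"
      unfolding b'(2) using step_up(3)[where x = b, OF i] by (simp add: Sigma_crystal_def)
    show "phi (SC l) i b' = phi (SC l) i b + 1"
      using w e fun_cong[OF w, of i] d by (simp add: Sigma_crystal_def)
  }
  {
    fix b' assume "ftil (SC l) i b = Some b'"
    then have b': "sig_max n i b > sig0 n l i b" "b' = b(pbot i b := b (pbot i b) + 1)"
      unfolding Sigma_maps[OF b i] by (auto split: if_splits)
    have "b' \<in> Sigma_set n l" using closure(2)[OF b i] b' by simp
    then show "b' \<in> elems (SC l)" by (simp add: Sigma_crystal_def)
    show w: "wt (SC l) b' = (\<lambda>j. wt (SC l) b j - simple_root n i j)"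
      unfolding b'(2) using step_down(6)[where l = l and x = b, OF i] by (simp add: Sigma_crystal_def)
    show e: "eps (SC l) i b' = eps (SC l) i b + 1"
      unfolding b'(2) using step_down(3)[where x = b, OF i] by (simp add: Sigma_crystal_def)
    show "phi (SC l) i b' = phi (SC l) i b - 1"
      using w e fun_cong[OF w, of i] d by (simp add: Sigma_crystal_def)
  }
  {
    fix b' assume "b' \<in> elems (SC l)"
    then have c: "b' \<in> Sigma_set n l" by (simp add: Sigma_crystal_def)
    show "etil (SC l) i b = Some b' \<longleftrightarrow> ftil (SC l) i b' = Some b"
    proof
      assume "etil (SC l) i b = Some b'"
      then have b': "sig_max n i b > 0" "b' = b(ptop i b := b (ptop i b) - 1)"
        unfolding Sigma_maps[OF b i] by (auto split: if_splits)
      note S = step_up[where x = b, OF i, folded b'(2)]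
      have "sig_max n i b' > sig0 n l i b'" using S(3) S(5)[where l = l] Sigma_nonneg(2)[OF b i] by simp
      moreover have "b'(pbot i b' := b' (pbot i b') + 1) = b" unfolding S(4) by (simp add: b'(2))
      ultimately show "ftil (SC l) i b' = Some b" unfolding Sigma_maps[OF c i] by simp
    next
      assume "ftil (SC l) i b' = Some b"
      then have b': "sig_max n i b' > sig0 n l i b'" "b = b'(pbot i b' := b' (pbot i b') + 1)"
        unfolding Sigma_maps[OF c i] by (auto split: if_splits)
      note S = step_down[where x = b', OF i, folded b'(2)]
      have "sig_max n i b > 0" using S(3) Sigma_nonneg(1)[OF c i] by simp
      moreover have "b(ptop i b := b (ptop i b) - 1) = b'" unfolding S(4) by (simp add: b'(2))
      ultimately show "etil (SC l) i b = Some b'" unfolding Sigma_maps[OF b i] by simp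
    qed
  }
qed

lemma B_maps:
  assumes x: "x \<in> Sigma_set n l" and i: "i \<in> I"
  shows "eps (B_crystal n l) i x = eps (SC l) i x" "phi (B_crystal n l) i x = phi (SC l) i x"
    "etil (B_crystal n l) i x = etil (SC l) i x" "ftil (B_crystal n l) i x = ftil (SC l) i x"
proof -
  have lat: "x \<in> lattice n" using x by (simp add: Sigma_set_def)
  show "eps (B_crystal n l) i x = eps (SC l) i x"
    by (simp add: B_crystal_def Sigma_crystal_def UD_eps[OF i])
  show "phi (B_crystal n l) i x = phi (SC l) i x"
    by (simp add: B_crystal_def Sigma_crystal_def UD_eps[OF i] UD_gamma[OF i] wt_sig0)
  show "etil (B_crystal n l) i x = etil (SC l) i x" "ftil (B_crystal n l) i x = ftil (SC l) i x"
    unfolding Sigma_maps[OF x i]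
    by (simp_all add: B_crystal_def UD_act_eq[OF i] B_set_eq atr_up[OF i lat] atr_down[OF i lat] closure[OF x i])
qed

text \<open>Outside {1..n} both weights are 0: dominance includes l = 0 there, and the simple roots
  have no such coordinates.\<close>

lemma B_wt:
  assumes "l \<in> dominant_weights n"
  shows "wt (B_crystal n l) x = wt (SC l) x"
proof
  fix i
  show "wt (B_crystal n l) x i = wt (SC l) x i"
  proof (cases "i \<in> I")
    case True
    then show ?thesis by (simp add: B_crystal_def Sigma_crystal_def UD_gamma[OF True] wt_sig0)
  next
    case False
    have "l i = 0" using assms False by (simp add: dominant_weights_def)
    moreover have "simple_root n j i = 0" for j using False by (simp add: simple_root_def cartan_def)
    ultimately show ?thesis using False by (auto simp: B_crystal_def Sigma_crystal_def Sigma_wt_def)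
  qed
qed

lemma B_iso:
  assumes l: "l \<in> dominant_weights n"
  shows "crystal_iso n (B_crystal n l) (SC l) id"
proof -
  have el: "elems (B_crystal n l) = Sigma_set n l" "elems (SC l) = Sigma_set n l"
    by (simp_all add: B_crystal_def Sigma_crystal_def B_set_eq)
  have "is_crystal n (B_crystal n l)"
    by (rule is_crystal_cong[OF Sigma_is_crystal[of l]]) (simp_all only: el B_maps B_wt[OF l])
  then show ?thesis
    unfolding crystal_iso_def el using Sigma_is_crystal[of l] B_maps[of _ l] B_wt[OF l]
    by (simp only: option.map_id id_apply bij_betw_id simp_thms) simp
qed

end

theorem theorem5p7:
  fixes n :: nat and l :: weight
  assumes "n \<ge> 4" and "l \<in> dominant_weights n"
  shows "\<exists>\<psi>. crystal_iso n (B_crystal n l) (Sigma_crystal n l) \<psi>"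
proof -
  interpret type_D n by standard (rule assms(1))
  show ?thesis using B_iso[OF assms(2)] by blast
qed

end
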